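(* Let $B_0$ be the unit hypercube in $\mathbb{R}^d$ centered at the origin and $B_n:=nB_0$, $n\in\mathbb{N}_+$. Let $\mathcal{P}(\lambda)$ be a homogeneous Poisson process on $\mathbb{R}^d$ with intensity $\lambda>0$, and let $$F_{B_n}^{\mathrm{MST}}(\mathcal{P}(\lambda)):=M(\mathcal{P}(\lambda)|_{B_n}).$$ Then there exist constants $C_0>0$, $1>D_1>0$ and $D_2>0$ not depending on $n$ such that $$d_K\left(\frac{F_{B_n}^{\mathrm{MST}}(\mathcal{P}(\lambda))-\mathbb{E}F_{B_n}^{\mathrm{MST}}(\mathcal{P}(\lambda))}{\sqrt{\mathrm{Var}F_{B_n}^{\mathrm{MST}}(\mathcal{P}(\lambda))}},N\right)\le\begin{cases}C_0n^{-D_1},&\text{if }d=2,\\ C_0(\log n)^{-D_2},&\text{if }d\ge3.\end{cases}$$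
   Context: For a finite set $V\subset\mathbb{R}^d$, $M(V):=\min_T\sum_{e\text{ an edge of }T}|e|$ is the total edge length of a minimal spanning tree of $V$: the minimum is over all connected graphs $T$ with vertex set $V$ (equivalently, spanning trees of the complete graph on $V$), and $|e|$ is the Euclidean length of the edge $e$. $\mathcal{P}(\lambda)|_{B_n}$ is the restriction of the process to $B_n$. $d_K(Y,Z):=\sup_{t\in\mathbb{R}}|\mathbb{P}(Y\le t)-\mathbb{P}(Z\le t)|$ and $N$ is standard normal. *)

theory Defs
  imports "HOL-Probability.Probability"
begin

section \<open>Minimal spanning trees\<close>

text \<open>
  A simple graph with vertex set \<open>V\<close> is given by its set \<open>E\<close> of edges, which are two-element
  subsets of \<open>V\<close>.  The empty graph counts as connected.
\<close>

definition connected_graph :: "'a set \<Rightarrow> 'a set set \<Rightarrow> bool" where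
  "connected_graph V E \<longleftrightarrow>
     E \<subseteq> {{u, v} | u v. u \<in> V \<and> v \<in> V \<and> u \<noteq> v} \<and>
     (\<forall>u\<in>V. \<forall>v\<in>V. (u, v) \<in> {(x, y). {x, y} \<in> E}\<^sup>*)"

text \<open>
  The diameter of an edge \<open>{u, v}\<close> is its length \<open>dist u v\<close>; see \<open>diameter_edge\<close> below.
  The definition is meaningful only for finite \<open>V\<close>, where the minimum is over a finite nonempty
  set (\<open>mst_length_attained\<close>).
\<close>

definition mst_length :: "'a::metric_space set \<Rightarrow> real" where
  "mst_length V = Min {(\<Sum>e\<in>E. diameter e) | E. connected_graph V E}"

lemma diameter_edge: "diameter {u, v} = dist u v"
proof (rule antisym)
  show "diameter {u, v} \<le> dist u v"
    unfolding diameter_def by (auto intro!: cSup_least simp: dist_commute)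
  show "dist u v \<le> diameter {u, v}"
    by (rule diameter_bounded_bound) auto
qed

lemma mst_length_attained:
  assumes "finite V"
  shows "\<exists>E. connected_graph V E \<and> mst_length V = (\<Sum>e\<in>E. diameter e)"
    and "connected_graph V E' \<Longrightarrow> mst_length V \<le> (\<Sum>e\<in>E'. diameter e)"
proof -
  let ?S = "{(\<Sum>e\<in>E. diameter e) | E. connected_graph V E}"
  have "{E. connected_graph V E} \<subseteq> Pow (Pow V)"
    by (auto simp: connected_graph_def)
  then have "finite {E. connected_graph V E}"
    by (rule finite_subset) (use assms in simp)
  then have fin: "finite ?S"
    by simp
  let ?K = "{{u, v} | u v. u \<in> V \<and> v \<in> V \<and> u \<noteq> v}"
  have "(u, v) \<in> {(x, y). {x, y} \<in> ?K}\<^sup>*" if "u \<in> V" "v \<in> V" for u v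
    using that by (cases "u = v") blast+
  then have "connected_graph V ?K"
    by (simp add: connected_graph_def)
  then have ne: "?S \<noteq> {}"
    by blast
  show "\<exists>E. connected_graph V E \<and> mst_length V = (\<Sum>e\<in>E. diameter e)"
    using Min_in[OF fin ne] unfolding mst_length_def by blast
  show "mst_length V \<le> (\<Sum>e\<in>E'. diameter e)" if "connected_graph V E'"
    unfolding mst_length_def by (rule Min_le[OF fin]) (use that in blast)
qed


section \<open>Homogeneous Poisson processes\<close>

text \<open>
  A homogeneous Poisson process is almost surely simple, so it is represented by the random
  locally finite set \<open>P\<close> of its points rather than by a random counting measure.

  The Poisson probabilities are written out because \<open>poisson_pmf\<close> is specified only for positive
  rates, whereas \<open>A\<close> may be a null set here (\<open>0 ^ 0 = 1\<close> then makes the count zero almost surely).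
\<close>

locale homogeneous_poisson_process = prob_space M
  for M :: "'w measure" and lam :: real and P :: "'w \<Rightarrow> 'a::euclidean_space set" +
  assumes locally_finite:
      "\<omega> \<in> space M \<Longrightarrow> bounded A \<Longrightarrow> finite (P \<omega> \<inter> A)"
    and count_measurable:
      "A \<in> sets borel \<Longrightarrow> bounded A \<Longrightarrow>
        (\<lambda>\<omega>. card (P \<omega> \<inter> A)) \<in> measurable M (count_space UNIV)"
    and count_poisson:
      "A \<in> sets borel \<Longrightarrow> bounded A \<Longrightarrow>
        prob {\<omega> \<in> space M. card (P \<omega> \<inter> A) = k} =
          (lam * measure lborel A) ^ k / fact k * exp (- (lam * measure lborel A))"
    and counts_indep:
      "(\<And>i. i < m \<Longrightarrow> B i \<in> sets borel \<and> bounded (B i)) \<Longrightarrow> disjoint_family_on B {..<m} \<Longrightarrow>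
        indep_vars (\<lambda>_. count_space UNIV) (\<lambda>i \<omega>. card (P \<omega> \<inter> B i)) {..<m::nat}"


section \<open>The observation windows and the Kolmogorov distance\<close>

definition unit_hypercube :: "(real ^ 'd) set" where
  "unit_hypercube = cbox (\<chi> i. - 1 / 2) (\<chi> i. 1 / 2)"

definition window :: "nat \<Rightarrow> (real ^ 'd) set" where
  "window n = (\<lambda>x. real n *\<^sub>R x) ` unit_hypercube"

text \<open>The Kolmogorov distance of two random variables depends only on their laws.\<close>

definition kolmogorov_distance :: "real measure \<Rightarrow> real measure \<Rightarrow> real" where
  "kolmogorov_distance \<mu> \<nu> = (SUP t. \<bar>cdf \<mu> t - cdf \<nu> t\<bar>)"

end

(*
  Replace the Poisson process by a Bernoulli(p) random subset S of a fine cubic lattice. By Kruskal's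
  algorithm the length of a minimal spanning tree is the integral over r of kappa_r - 1, where kappa_r
  is the number of components of the graph joining points at distance at most r; up to an error of
  bounded second moment the integral may be truncated at a scale R that is a small power of n. Adding a
  point x changes kappa_r by 1 - N_r(x), where N_r(x), the number of components that x meets, is bounded
  by a packing argument.

  Cut the window into blocks of side l much larger than R, and let G be the truncated functional minus
  its sum over the blocks. Away from the block boundaries the add-one cost of G is nonnegative, because
  with fewer points to connect them the neighbours of x fall into at least as many components within
  the block as in the whole window. So the Efron-Stein inequality bounds Var G by the sum of the expected add-one costs,
  which by Russo's formula is the derivative in p of E G; and E G itself is small, of the order of the
  number of points near the block boundaries. The mean value theorem, applied between two intensities of
  bounded ratio, gives a p at which this derivative is small and at which the derivative of the expected
  block sum is large. The latter bounds the block variances from below through the first chaos. The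
  freedom in p costs nothing, since the mesh of the lattice can be rescaled to reach the given intensity.

  Thus the functional is close in mean square to a sum of independent block functionals, and
  Lindeberg's method with l and R small powers of n gives a rate n^(-1/128) in every dimension d >= 2,
  uniformly in the mesh. Letting the mesh tend to 0 gives the theorem, the logarithmic rate for d >= 3
  being weaker.
*)
theory Submission
  imports Defs
begin


section \<open>Random subsets of a finite set\<close>

text \<open>The gap between the truncated functional and its block sum is caused by points whose
  neighbours are joined in the whole window but not within their block. At one fixed density,
  bounding their number is a question of percolation theory; summed over an interval of densities,
  it is only the increment of a function already known to be small. The price is that the density is
  found instead of given. It is found on a fixed cube \<open>V\<close>, and the mesh that turns it
  into the given intensity, hence the number of cells in the window, is known only afterwards. So
  the window is a subcube \<open>A\<close> of \<open>V\<close> whose side is left open, and its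
  add-one costs away from the block boundaries are dominated pointwise by those of \<open>V\<close>.
  The other requirement, that the block sum grows between the two densities, rests on
  \<open>D \<ge> 2\<close>: the length per unit volume scales like the density to the power
  \<open>1 - 1/D\<close>. The densities lie a large constant factor apart, so that crude bounds on
  the mean decide the sign. All scales are powers of one parameter \<open>x\<close>, the cube having
  side \<open>x ^ 128\<close>; hence the exponent 1/128.\<close>

definition Bexp :: "'a set \<Rightarrow> real \<Rightarrow> ('a set \<Rightarrow> real) \<Rightarrow> real" where
  "Bexp V p f = (\<Sum>S\<in>Pow V. p ^ card S * (1 - p) ^ card (V - S) * f S)"

definition Bvar :: "'a set \<Rightarrow> real \<Rightarrow> ('a set \<Rightarrow> real) \<Rightarrow> real" where
  "Bvar V p f = Bexp V p (\<lambda>S. (f S - Bexp V p f)\<^sup>2)"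

text \<open>The point is added on one side and removed on the other, so \<open>DD x f S\<close> does
  not depend on whether \<open>x\<close> belongs to \<open>S\<close>.\<close>

definition DD :: "'a \<Rightarrow> ('a set \<Rightarrow> real) \<Rightarrow> 'a set \<Rightarrow> real" where
  "DD x f S = f (insert x S) - f (S - {x})"

lemma Bexp_empty [simp]: "Bexp {} p f = f {}"
  by (simp add: Bexp_def)

lemma Bexp_insert:
  assumes "finite V" "x \<notin> V"
  shows "Bexp (insert x V) p f = p * Bexp V p (\<lambda>S. f (insert x S)) + (1 - p) * Bexp V p f"
proof -
  have disj: "Pow V \<inter> insert x ` Pow V = {}"
    using assms by auto
  have inj: "inj_on (insert x) (Pow V)"
    using assms by (auto simp: inj_on_def)
  have card1: "card (insert x S) = Suc (card S)" "insert x V - insert x S = V - S"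
    "V - insert x S = V - S" if "S \<in> Pow V" for S
    using that assms finite_subset[of S V] by (auto simp: card_insert_if)
  have card2: "card (insert x V - S) = Suc (card (V - S))" if "S \<in> Pow V" for S
  proof -
    have "insert x V - S = insert x (V - S)"
      using that assms by auto
    then show ?thesis
      using assms by (simp add: card_insert_if)
  qed
  have "Bexp (insert x V) p f =
      (\<Sum>S\<in>Pow V. p ^ card S * (1 - p) ^ card (insert x V - S) * f S) +
      (\<Sum>S\<in>insert x ` Pow V. p ^ card S * (1 - p) ^ card (insert x V - S) * f S)"
    unfolding Bexp_def Pow_insert
    by (rule sum.union_disjoint) (use assms disj in auto)
  also have "(\<Sum>S\<in>Pow V. p ^ card S * (1 - p) ^ card (insert x V - S) * f S) = (1 - p) * Bexp V p f"
    unfolding Bexp_def sum_distrib_left by (rule sum.cong) (auto simp: card2)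
  also have "(\<Sum>S\<in>insert x ` Pow V. p ^ card S * (1 - p) ^ card (insert x V - S) * f S) =
      p * Bexp V p (\<lambda>S. f (insert x S))"
    unfolding Bexp_def sum_distrib_left sum.reindex[OF inj]
    by (rule sum.cong) (auto simp: card1)
  finally show ?thesis
    by simp
qed

lemma Bexp_cong: "(\<And>S. S \<subseteq> V \<Longrightarrow> f S = g S) \<Longrightarrow> Bexp V p f = Bexp V p g"
  unfolding Bexp_def by (rule sum.cong) auto

lemma Bexp_add: "Bexp V p (\<lambda>S. f S + g S) = Bexp V p f + Bexp V p g"
  by (simp add: Bexp_def sum.distrib algebra_simps)

lemma Bexp_diff: "Bexp V p (\<lambda>S. f S - g S) = Bexp V p f - Bexp V p g"
  by (simp add: Bexp_def sum_subtractf algebra_simps)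

lemma Bexp_cmult: "Bexp V p (\<lambda>S. c * f S) = c * Bexp V p f"
  by (simp add: Bexp_def sum_distrib_left algebra_simps)

lemma Bexp_sum: "Bexp V p (\<lambda>S. \<Sum>i\<in>I. f i S) = (\<Sum>i\<in>I. Bexp V p (f i))"
  unfolding Bexp_def by (subst sum.swap) (simp add: sum_distrib_left)

lemma Bexp_const:
  assumes "finite V"
  shows "Bexp V p (\<lambda>_. c) = c"
  using assms by induction (simp_all add: Bexp_insert algebra_simps)

lemma Bexp_mono:
  assumes "\<And>S. S \<subseteq> V \<Longrightarrow> f S \<le> g S" "0 \<le> p" "p \<le> 1"
  shows "Bexp V p f \<le> Bexp V p g"
  unfolding Bexp_def by (intro sum_mono mult_left_mono) (use assms in auto)

lemma Bexp_nonneg: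
  assumes "\<And>S. S \<subseteq> V \<Longrightarrow> 0 \<le> f S" "0 \<le> p" "p \<le> 1"
  shows "0 \<le> Bexp V p f"
  unfolding Bexp_def by (intro sum_nonneg mult_nonneg_nonneg) (use assms in auto)

lemma Bexp_abs_le:
  assumes "0 \<le> p" "p \<le> 1"
  shows "\<bar>Bexp V p f\<bar> \<le> Bexp V p (\<lambda>S. \<bar>f S\<bar>)"
proof -
  have "- Bexp V p (\<lambda>S. \<bar>f S\<bar>) = Bexp V p (\<lambda>S. - \<bar>f S\<bar>)"
    using Bexp_cmult[of V p "-1" "\<lambda>S. \<bar>f S\<bar>"] by simp
  also have "\<dots> \<le> Bexp V p f"
    by (rule Bexp_mono) (use assms in auto)
  finally have 1: "- Bexp V p (\<lambda>S. \<bar>f S\<bar>) \<le> Bexp V p f" .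
  have "Bexp V p f \<le> Bexp V p (\<lambda>S. \<bar>f S\<bar>)"
    by (rule Bexp_mono) (use assms in auto)
  with 1 show ?thesis by linarith
qed

lemma Bexp_Un:
  assumes "finite A" "finite B" "A \<inter> B = {}"
  shows "Bexp (A \<union> B) p f = Bexp A p (\<lambda>S. Bexp B p (\<lambda>T. f (S \<union> T)))"
  using assms
proof (induction A arbitrary: f rule: finite_induct)
  case empty
  then show ?case by simp
next
  case (insert x A)
  have "Bexp (insert x A \<union> B) p f = p * Bexp (A \<union> B) p (\<lambda>S. f (insert x S))
    + (1 - p) * Bexp (A \<union> B) p f"
    using insert.prems insert.hyps by (simp add: Bexp_insert)
  also have "\<dots> = Bexp (insert x A) p (\<lambda>S. Bexp B p (\<lambda>T. f (S \<union> T)))"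
    using insert by (simp add: Bexp_insert)
  finally show ?case .
qed

lemma Bexp_restrict:
  assumes "finite V" "A \<subseteq> V"
  shows "Bexp V p (\<lambda>S. f (S \<inter> A)) = Bexp A p f"
proof -
  have fin: "finite A" "finite (V - A)"
    using assms finite_subset by auto
  have "Bexp V p (\<lambda>S. f (S \<inter> A)) = Bexp (A \<union> (V - A)) p (\<lambda>S. f (S \<inter> A))"
    using assms by (simp add: Un_absorb1)
  also have "\<dots> = Bexp A p (\<lambda>S. Bexp (V - A) p (\<lambda>T. f ((S \<union> T) \<inter> A)))"
    by (rule Bexp_Un) (use fin in auto)
  also have "\<dots> = Bexp A p (\<lambda>S. Bexp (V - A) p (\<lambda>T. f S))"
  proof (intro Bexp_cong)
    fix S T assume "S \<subseteq> A" "T \<subseteq> V - A"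
    then have "(S \<union> T) \<inter> A = S" by auto
    then show "f ((S \<union> T) \<inter> A) = f S" by simp
  qed
  finally show ?thesis
    using fin by (simp add: Bexp_const)
qed

lemma Bexp_image:
  assumes "inj_on g V"
  shows "Bexp (g ` V) p f = Bexp V p (\<lambda>S. f (g ` S))"
proof -
  have inj: "inj_on (image g) (Pow V)"
    using assms by (rule inj_on_image_Pow)
  have *: "card (g ` S) = card S" "card (g ` V - g ` S) = card (V - S)" if "S \<in> Pow V" for S
  proof -
    show "card (g ` S) = card S"
      using that by (intro card_image inj_on_subset[OF assms]) auto
    have "g ` V - g ` S = g ` (V - S)"
      using that assms by (simp add: inj_on_image_set_diff)
    then show "card (g ` V - g ` S) = card (V - S)"
      by (simp add: card_image inj_on_subset[OF assms])
  qed
  have "Pow (g ` V) = image g ` Pow V"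
    by (simp add: image_Pow_surj)
  then show ?thesis
    unfolding Bexp_def by (simp add: sum.reindex[OF inj] *)
qed

lemma Bexp_square_le:
  assumes "finite V" "0 \<le> p" "p \<le> 1"
  shows "(Bexp V p f)\<^sup>2 \<le> Bexp V p (\<lambda>S. (f S)\<^sup>2)"
proof -
  have "0 \<le> Bexp V p (\<lambda>S. (f S - Bexp V p f)\<^sup>2)"
    by (rule Bexp_nonneg) (use assms in auto)
  also have "(\<lambda>S. (f S - Bexp V p f)\<^sup>2) = (\<lambda>S. (f S)\<^sup>2 - 2 * Bexp V p f * f S + (Bexp V p f)\<^sup>2)"
    by (auto simp: power2_diff)
  finally show ?thesis
    using assms by (simp add: Bexp_add Bexp_diff Bexp_cmult Bexp_const power2_eq_square)
qed

section \<open>Variance inequalities by conditioning on single points\<close>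

lemma Bvar_eq:
  assumes "finite V"
  shows "Bvar V p f = Bexp V p (\<lambda>S. (f S)\<^sup>2) - (Bexp V p f)\<^sup>2"
proof -
  have "(\<lambda>S. (f S - Bexp V p f)\<^sup>2) = (\<lambda>S. (f S)\<^sup>2 - 2 * Bexp V p f * f S + (Bexp V p f)\<^sup>2)"
    by (auto simp: power2_diff)
  then show ?thesis
    using assms by (simp add: Bvar_def Bexp_add Bexp_diff Bexp_cmult Bexp_const power2_eq_square)
qed

lemma Bvar_nonneg: "0 \<le> p \<Longrightarrow> p \<le> 1 \<Longrightarrow> 0 \<le> Bvar V p f"
  unfolding Bvar_def by (rule Bexp_nonneg) auto

text \<open>Law of total variance for the event that \<open>x\<close> is present: the mean
  conditional variance, plus the variance \<open>p * (1 - p)\<close> of the indicator times the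
  squared difference of the conditional means.\<close>

lemma Bvar_insert:
  assumes "finite V" "x \<notin> V"
  shows "Bvar (insert x V) p f = p * Bvar V p (\<lambda>S. f (insert x S)) + (1 - p) * Bvar V p f
    + p * (1 - p) * (Bexp V p (\<lambda>S. f (insert x S)) - Bexp V p f)\<^sup>2"
proof -
  have "finite (insert x V)"
    using assms by simp
  from Bvar_eq[OF this] Bvar_eq[OF assms(1)] show ?thesis
    by (simp add: Bexp_insert[OF assms]) (simp add: power2_eq_square algebra_simps)
qed

lemma DD_insert_ne:
  assumes "x \<noteq> y"
  shows "DD x f (insert y S) = DD x (\<lambda>S. f (insert y S)) S"
proof -
  have "insert x (insert y S) = insert y (insert x S)" "insert y S - {x} = insert y (S - {x})"
    using assms by auto
  then show ?thesis
    by (simp add: DD_def)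
qed

text \<open>The transform \<open>h\<close> stays arbitrary because the same induction step is needed
  for squared costs (Efron-Stein) and for plain costs (first chaos, Russo).\<close>

lemma Bexp_DD_insert:
  assumes "finite V" "y \<notin> V" "x \<in> V"
  shows "Bexp (insert y V) p (\<lambda>S. h (DD x f S)) =
    p * Bexp V p (\<lambda>S. h (DD x (\<lambda>S. f (insert y S)) S)) + (1 - p) * Bexp V p (\<lambda>S. h (DD x f S))"
proof -
  have "x \<noteq> y" using assms by auto
  then show ?thesis
    using assms by (simp add: Bexp_insert DD_insert_ne)
qed

lemma sum_Bexp_DD_insert:
  assumes "finite V" "y \<notin> V"
  shows "(\<Sum>x\<in>V. Bexp (insert y V) p (\<lambda>S. h (DD x f S))) =
    p * (\<Sum>x\<in>V. Bexp V p (\<lambda>S. h (DD x (\<lambda>S. f (insert y S)) S))) +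
    (1 - p) * (\<Sum>x\<in>V. Bexp V p (\<lambda>S. h (DD x f S)))"
  using Bexp_DD_insert[OF assms] by (simp add: sum.distrib sum_distrib_left)

lemma Bexp_DD_new:
  assumes "finite V" "y \<notin> V"
  shows "Bexp (insert y V) p (\<lambda>S. h (DD y f S)) = Bexp V p (\<lambda>S. h (f (insert y S) - f S))"
proof -
  have "Bexp V p (\<lambda>S. h (DD y f (insert y S))) = Bexp V p (\<lambda>S. h (f (insert y S) - f S))"
    "Bexp V p (\<lambda>S. h (DD y f S)) = Bexp V p (\<lambda>S. h (f (insert y S) - f S))"
    using assms by (auto intro!: Bexp_cong simp: DD_def) (metis Diff_empty Diff_insert0 subset_iff)+
  then show ?thesis
    using assms by (simp add: Bexp_insert algebra_simps)
qed

text \<open>Induction over the points: in \<open>Bvar_insert\<close> the conditional variances fall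
  to the induction hypothesis, and Jensen's inequality bounds the squared mean difference by the
  mean square of the cost of \<open>y\<close>.\<close>

lemma efron_stein:
  assumes "finite V" "0 \<le> p" "p \<le> 1"
  shows "Bvar V p f \<le> p * (1 - p) * (\<Sum>x\<in>V. Bexp V p (\<lambda>S. (DD x f S)\<^sup>2))"
  using assms
proof (induction V arbitrary: f rule: finite_induct)
  case empty
  then show ?case by (simp add: Bvar_eq)
next
  case (insert y V)
  let ?f1 = "\<lambda>S. f (insert y S)"
  have "Bvar (insert y V) p f = p * Bvar V p ?f1 + (1 - p) * Bvar V p f
      + p * (1 - p) * (Bexp V p (\<lambda>S. ?f1 S - f S))\<^sup>2"
    using insert by (simp add: Bvar_insert Bexp_diff)
  also have "\<dots> \<le> p * (p * (1 - p) * (\<Sum>x\<in>V. Bexp V p (\<lambda>S. (DD x ?f1 S)\<^sup>2)))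
      + (1 - p) * (p * (1 - p) * (\<Sum>x\<in>V. Bexp V p (\<lambda>S. (DD x f S)\<^sup>2)))
      + p * (1 - p) * Bexp V p (\<lambda>S. (?f1 S - f S)\<^sup>2)"
    using insert by (intro add_mono mult_left_mono insert.IH Bexp_square_le) auto
  also have "\<dots> = p * (1 - p) * ((\<Sum>x\<in>V. Bexp (insert y V) p (\<lambda>S. (DD x f S)\<^sup>2))
      + Bexp (insert y V) p (\<lambda>S. (DD y f S)\<^sup>2))"
    unfolding Bexp_DD_new[OF insert.hyps, of p "\<lambda>z. z\<^sup>2" f]
      sum_Bexp_DD_insert[OF insert.hyps, of p "\<lambda>z. z\<^sup>2" f]
    by (simp add: algebra_simps)
  finally show ?case
    using insert.hyps by (simp add: add.commute)
qed

lemma Bvar_convex: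
  assumes "0 \<le> p" "p \<le> 1" "0 \<le> t" "t \<le> 1"
  shows "Bvar V p (\<lambda>S. t * f S + (1 - t) * g S) \<le> t * Bvar V p f + (1 - t) * Bvar V p g"
proof -
  let ?f = "\<lambda>S. f S - Bexp V p f" and ?g = "\<lambda>S. g S - Bexp V p g"
  have "Bvar V p (\<lambda>S. t * f S + (1 - t) * g S) = Bexp V p (\<lambda>S. (t * ?f S + (1 - t) * ?g S)\<^sup>2)"
    unfolding Bvar_def Bexp_add Bexp_cmult by (simp add: algebra_simps)
  also have "\<dots> \<le> Bexp V p (\<lambda>S. t * (?f S)\<^sup>2 + (1 - t) * (?g S)\<^sup>2)"
  proof (rule Bexp_mono)
    fix S
    have "t * (?f S)\<^sup>2 + (1 - t) * (?g S)\<^sup>2 - (t * ?f S + (1 - t) * ?g S)\<^sup>2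
        = t * (1 - t) * (?f S - ?g S)\<^sup>2"
      by (simp add: power2_eq_square algebra_simps)
    moreover have "t * (1 - t) * (?f S - ?g S)\<^sup>2 \<ge> 0"
      using assms by simp
    ultimately show "(t * ?f S + (1 - t) * ?g S)\<^sup>2 \<le> t * (?f S)\<^sup>2 + (1 - t) * (?g S)\<^sup>2"
      by linarith
  qed (use assms in auto)
  finally show ?thesis
    by (simp add: Bexp_add Bexp_cmult Bvar_def)
qed

text \<open>The left-hand side is the variance of the projection of \<open>f\<close> onto linear
  functions of the indicators. In the induction \<open>?g\<close> averages out the state of
  \<open>y\<close>: this preserves the coefficients at the points of \<open>V\<close>, does not
  increase the mean conditional variance (convexity), and the remaining term of
  \<open>Bvar_insert\<close> is exactly the contribution of \<open>y\<close>.\<close>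

lemma Bvar_ge_first_chaos:
  assumes "finite V" "0 \<le> p" "p \<le> 1"
  shows "p * (1 - p) * (\<Sum>x\<in>V. (Bexp V p (DD x f))\<^sup>2) \<le> Bvar V p f"
  using assms
proof (induction V arbitrary: f rule: finite_induct)
  case empty
  then show ?case by (simp add: Bvar_eq)
next
  case (insert y V)
  let ?f1 = "\<lambda>S. f (insert y S)"
  let ?g = "\<lambda>S. p * ?f1 S + (1 - p) * f S"
  have DD_g: "DD x ?g = (\<lambda>S. p * DD x ?f1 S + (1 - p) * DD x f S)" for x
    by (simp add: DD_def algebra_simps fun_eq_iff)
  have *: "Bexp (insert y V) p (DD x f) = Bexp V p (DD x ?g)" if "x \<in> V" for x
    using Bexp_DD_insert[OF insert.hyps that, of p "\<lambda>z. z" f]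
    by (simp add: DD_g Bexp_add Bexp_cmult)
  have "p * (1 - p) * (\<Sum>x\<in>insert y V. (Bexp (insert y V) p (DD x f))\<^sup>2)
      = p * (1 - p) * (\<Sum>x\<in>V. (Bexp V p (DD x ?g))\<^sup>2)
        + p * (1 - p) * (Bexp V p (\<lambda>S. ?f1 S - f S))\<^sup>2"
    using insert.hyps * Bexp_DD_new[OF insert.hyps, of p "\<lambda>z. z" f]
    by (simp add: algebra_simps)
  also have "\<dots> \<le> Bvar V p ?g + p * (1 - p) * (Bexp V p (\<lambda>S. ?f1 S - f S))\<^sup>2"
    using insert.IH[of ?g] insert.prems by simp
  also have "\<dots> \<le> p * Bvar V p ?f1 + (1 - p) * Bvar V p f
      + p * (1 - p) * (Bexp V p (\<lambda>S. ?f1 S - f S))\<^sup>2"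
    using insert by (intro add_right_mono Bvar_convex) auto
  also have "\<dots> = Bvar (insert y V) p f"
    using insert by (simp add: Bvar_insert Bexp_diff)
  finally show ?case .
qed

text \<open>Russo's formula, for functions that need not be monotone. \<open>Bexp V p f\<close> is a
  polynomial in \<open>p\<close>, which gives the derivative at every real \<open>p\<close>.\<close>

lemma Bexp_has_derivative:
  assumes "finite V"
  shows "((\<lambda>p. Bexp V p f) has_real_derivative (\<Sum>x\<in>V. Bexp V p (DD x f))) (at p)"
  using assms
proof (induction V arbitrary: f rule: finite_induct)
  case empty
  then show ?case by simp
next
  case (insert y V)
  let ?f1 = "\<lambda>S. f (insert y S)"
  have "((\<lambda>p. p * Bexp V p ?f1 + (1 - p) * Bexp V p f) has_real_derivative
      (\<Sum>x\<in>V. Bexp (insert y V) p (DD x f)) + (Bexp V p ?f1 - Bexp V p f)) (at p)"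
    unfolding sum_Bexp_DD_insert[OF insert.hyps, of p "\<lambda>z. z" f]
    by (auto intro!: derivative_eq_intros insert.IH simp: algebra_simps)
  moreover have "(\<Sum>x\<in>V. Bexp (insert y V) p (DD x f)) + (Bexp V p ?f1 - Bexp V p f)
      = (\<Sum>x\<in>insert y V. Bexp (insert y V) p (DD x f))"
    using insert.hyps Bexp_DD_new[OF insert.hyps, of p "\<lambda>z. z" f] by (simp add: Bexp_diff)
  ultimately show ?case
    by (simp add: Bexp_insert[OF insert.hyps])
qed

lemma Bvar_add_const:
  assumes "finite V"
  shows "Bvar V p (\<lambda>S. f S + c) = Bvar V p f"
  using assms by (simp add: Bvar_def Bexp_add Bexp_const)

lemma Bvar_add_le:
  assumes "finite V" "0 \<le> p" "p \<le> 1"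
  shows "Bvar V p (\<lambda>S. f S + g S) \<le> 2 * Bvar V p f + 2 * Bvar V p g"
proof -
  let ?f = "\<lambda>S. f S - Bexp V p f" and ?g = "\<lambda>S. g S - Bexp V p g"
  have "Bvar V p (\<lambda>S. f S + g S) = Bexp V p (\<lambda>S. (?f S + ?g S)\<^sup>2)"
    unfolding Bvar_def by (simp add: Bexp_add algebra_simps)
  also have "\<dots> \<le> Bexp V p (\<lambda>S. 2 * (?f S)\<^sup>2 + 2 * (?g S)\<^sup>2)"
  proof (rule Bexp_mono)
    fix S
    have "0 \<le> (?f S - ?g S)\<^sup>2" by simp
    moreover have "2 * (?f S)\<^sup>2 + 2 * (?g S)\<^sup>2 - (?f S + ?g S)\<^sup>2 = (?f S - ?g S)\<^sup>2"
      by (simp add: power2_eq_square algebra_simps)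
    ultimately show "(?f S + ?g S)\<^sup>2 \<le> 2 * (?f S)\<^sup>2 + 2 * (?g S)\<^sup>2"
      by linarith
  qed (use assms in auto)
  finally show ?thesis
    by (simp add: Bexp_add Bexp_cmult Bvar_def)
qed

lemma Bvar_le_square:
  assumes "finite V" "0 \<le> p" "p \<le> 1"
  shows "Bvar V p f \<le> Bexp V p (\<lambda>S. (f S)\<^sup>2)"
  using assms by (simp add: Bvar_eq)

lemma Bexp_cauchy_schwarz:
  assumes "0 \<le> p" "p \<le> 1"
  shows "(Bexp V p (\<lambda>S. f S * g S))\<^sup>2 \<le> Bexp V p (\<lambda>S. (f S)\<^sup>2) * Bexp V p (\<lambda>S. (g S)\<^sup>2)"
proof -
  let ?w = "\<lambda>S. p ^ card S * (1 - p) ^ card (V - S)"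
  have w: "?w S \<ge> 0" for S
    using assms by simp
  have "(\<Sum>S\<in>Pow V. (sqrt (?w S) * f S) * (sqrt (?w S) * g S))\<^sup>2 \<le>
      (\<Sum>S\<in>Pow V. (sqrt (?w S) * f S)\<^sup>2) * (\<Sum>S\<in>Pow V. (sqrt (?w S) * g S)\<^sup>2)"
    by (rule Cauchy_Schwarz_ineq_sum)
  moreover have "(\<Sum>S\<in>Pow V. (sqrt (?w S) * f S) * (sqrt (?w S) * g S)) = Bexp V p (\<lambda>S. f S * g S)"
  proof -
    have "(sqrt (?w S) * f S) * (sqrt (?w S) * g S) = ?w S * (f S * g S)" for S
    proof -
      have "(sqrt (?w S) * f S) * (sqrt (?w S) * g S) = (sqrt (?w S) * sqrt (?w S)) * (f S * g S)"
        by (simp only: ac_simps)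
      then show ?thesis
        using w[of S] by (simp only: real_sqrt_mult_self abs_of_nonneg)
    qed
    then show ?thesis by (simp only: Bexp_def)
  qed
  moreover have "(\<Sum>S\<in>Pow V. (sqrt (?w S) * f S)\<^sup>2) = Bexp V p (\<lambda>S. (f S)\<^sup>2)" for f
    using w unfolding Bexp_def power_mult_distrib by (intro sum.cong refl)
      (simp only: real_sqrt_pow2)
  ultimately show ?thesis by simp
qed

lemma sd_triangle:
  assumes "0 \<le> p" "p \<le> 1"
  shows "sqrt (Bvar V p (\<lambda>S. f S + g S)) \<le> sqrt (Bvar V p f) + sqrt (Bvar V p g)"
proof -
  let ?f = "\<lambda>S. f S - Bexp V p f" and ?g = "\<lambda>S. g S - Bexp V p g"
  have nn: "0 \<le> Bvar V p f" "0 \<le> Bvar V p g"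
    using assms by (auto intro: Bvar_nonneg)
  have "Bexp V p (\<lambda>S. ?f S * ?g S) \<le> sqrt ((Bexp V p (\<lambda>S. ?f S * ?g S))\<^sup>2)"
    by simp
  also have "\<dots> \<le> sqrt (Bvar V p f * Bvar V p g)"
    unfolding Bvar_def by (intro real_sqrt_le_mono Bexp_cauchy_schwarz assms)
  finally have cs: "Bexp V p (\<lambda>S. ?f S * ?g S) \<le> sqrt (Bvar V p f) * sqrt (Bvar V p g)"
    by (simp add: real_sqrt_mult)
  have "Bvar V p (\<lambda>S. f S + g S) = Bexp V p (\<lambda>S. (?f S)\<^sup>2 + 2 * (?f S * ?g S) + (?g S)\<^sup>2)"
    unfolding Bvar_def by (simp add: Bexp_add power2_eq_square algebra_simps)
  also have "\<dots> = Bvar V p f + 2 * Bexp V p (\<lambda>S. ?f S * ?g S) + Bvar V p g"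
    by (simp only: Bexp_add Bexp_cmult Bvar_def)
  also have "\<dots> \<le> (sqrt (Bvar V p f) + sqrt (Bvar V p g))\<^sup>2"
    using cs nn by (simp add: power2_sum)
  finally show ?thesis
    using nn by (simp add: real_le_lsqrt real_le_rsqrt sqrt_le_D)
qed

lemma Bvar_cmult: "Bvar V p (\<lambda>S. c * f S) = c\<^sup>2 * Bvar V p f"
proof -
  have "(\<lambda>S. (c * f S - c * Bexp V p f)\<^sup>2) = (\<lambda>S. c\<^sup>2 * (f S - Bexp V p f)\<^sup>2)"
    by (simp add: power_mult_distrib flip: right_diff_distrib)
  then show ?thesis
    by (simp add: Bvar_def Bexp_cmult)
qed

section \<open>Moments of the size of the random subset\<close>

lemma Bexp_card:
  assumes "finite V"
  shows "Bexp V p (\<lambda>S. real (card S)) = p * real (card V)"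
  using assms
proof induction
  case (insert x V)
  have "Bexp V p (\<lambda>S. real (card (insert x S))) = Bexp V p (\<lambda>S. real (card S) + 1)"
  proof (rule Bexp_cong)
    fix S assume "S \<subseteq> V"
    then have "finite S" "x \<notin> S" using insert finite_subset by auto
    then show "real (card (insert x S)) = real (card S) + 1" by simp
  qed
  then show ?case
    using insert by (simp add: Bexp_insert Bexp_add Bexp_const algebra_simps)
qed simp

lemma Bexp_card_Int:
  assumes "finite V" "A \<subseteq> V"
  shows "Bexp V p (\<lambda>S. real (card (S \<inter> A))) = p * real (card A)"
  using assms Bexp_restrict[OF assms, of p "\<lambda>S. real (card S)"] finite_subset[OF assms(2,1)]
  by (simp add: Bexp_card)

text \<open>The bounds are the moments of the Poisson law of mean \<open>\<mu>\<close>. They see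
  \<open>V\<close> and \<open>p\<close> only through \<open>\<mu>\<close>, which keeps later
  estimates uniform in the mesh.\<close>

lemma Bexp_card_moments:
  assumes "finite V" "0 \<le> p" "p \<le> 1"
  defines "\<mu> \<equiv> p * real (card V)"
  shows "Bexp V p (\<lambda>S. real (card S) ^ 2) \<le> \<mu>\<^sup>2 + \<mu>"
    and "Bexp V p (\<lambda>S. real (card S) ^ 3) \<le> \<mu> ^ 3 + 3 * \<mu>\<^sup>2 + \<mu>"
proof -
  have "Bexp V p (\<lambda>S. real (card S) ^ 2) \<le> (p * real (card V))\<^sup>2 + p * real (card V) \<and>
    Bexp V p (\<lambda>S. real (card S) ^ 3) \<le> (p * real (card V)) ^ 3 + 3 * (p * real (card V))\<^sup>2 + p *
      real (card V)"
    using assms(1)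
  proof (induction V rule: finite_induct)
    case (insert x V)
    let ?m = "p * real (card V)"
    have c: "Bexp V p (\<lambda>S. h (real (card (insert x S)))) = Bexp V p (\<lambda>S. h (real (card S) + 1))"
      for h :: "real \<Rightarrow> real"
    proof (rule Bexp_cong)
      fix S assume "S \<subseteq> V"
      then have "finite S" "x \<notin> S" using insert finite_subset by auto
      then show "h (real (card (insert x S))) = h (real (card S) + 1)" by (simp add: add.commute)
    qed
    let ?m2 = "Bexp V p (\<lambda>S. real (card S) ^ 2)" and ?m3 = "Bexp V p (\<lambda>S. real (card S) ^ 3)"
    have 2: "Bexp (insert x V) p (\<lambda>S. real (card S) ^ 2) = ?m2 + p * (2 * ?m + 1)"
    proof -
      have "(\<lambda>S. (real (card S) + 1) ^ 2) = (\<lambda>S::'a set. real (card S) ^ 2 + 2 * real (card S) + 1)"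
        by (simp add: power2_eq_square algebra_simps)
      then have "Bexp V p (\<lambda>S. real (card (insert x S)) ^ 2) = ?m2 + 2 * ?m + 1"
        unfolding c[of "\<lambda>z. z ^ 2"]
        by (simp only: Bexp_add Bexp_const[OF insert.hyps(1)] Bexp_cmult
          Bexp_card[OF insert.hyps(1)])
      then show ?thesis
        unfolding Bexp_insert[OF insert.hyps] by (simp add: algebra_simps)
    qed
    have 3: "Bexp (insert x V) p (\<lambda>S. real (card S) ^ 3) = ?m3 + p * (3 * ?m2 + 3 * ?m + 1)"
    proof -
      have "(\<lambda>S. (real (card S) + 1) ^ 3) =
          (\<lambda>S::'a set. real (card S) ^ 3 + 3 * real (card S) ^ 2 + 3 * real (card S) + 1)"
        by (simp add: power2_eq_square power3_eq_cube algebra_simps)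
      then have "Bexp V p (\<lambda>S. real (card (insert x S)) ^ 3) = ?m3 + 3 * ?m2 + 3 * ?m + 1"
        unfolding c[of "\<lambda>z. z ^ 3"]
        by (simp only: Bexp_add Bexp_const[OF insert.hyps(1)] Bexp_cmult
          Bexp_card[OF insert.hyps(1)])
      then show ?thesis
        unfolding Bexp_insert[OF insert.hyps] by (simp add: algebra_simps)
    qed
    have eq: "p * real (card (insert x V)) = ?m + p"
      using insert by (simp add: algebra_simps)
    have m0: "?m \<ge> 0" using assms by simp
    have "?m2 + p * (2 * ?m + 1) \<le> (?m\<^sup>2 + ?m) + p * (2 * ?m + 1)"
      using insert.IH by simp
    also have "\<dots> \<le> (?m + p)\<^sup>2 + (?m + p)"
      by (simp add: power2_eq_square algebra_simps)
    finally have r2: "?m2 + p * (2 * ?m + 1) \<le> (?m + p)\<^sup>2 + (?m + p)" .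
    have "?m3 + p * (3 * ?m2 + 3 * ?m + 1) \<le>
        (?m ^ 3 + 3 * ?m\<^sup>2 + ?m) + p * (3 * (?m\<^sup>2 + ?m) + 3 * ?m + 1)"
      using insert.IH assms by (intro add_mono mult_left_mono) auto
    also have "\<dots> \<le> (?m + p) ^ 3 + 3 * (?m + p)\<^sup>2 + (?m + p)"
    proof -
      have "(?m + p) ^ 3 + 3 * (?m + p)\<^sup>2 + (?m + p) -
        ((?m ^ 3 + 3 * ?m\<^sup>2 + ?m) + p * (3 * (?m\<^sup>2 + ?m) + 3 * ?m + 1)) = 3 * ?m * p\<^sup>2 + p ^ 3 + 3 *
          p\<^sup>2"
        by (simp add: power2_eq_square power3_eq_cube algebra_simps)
      moreover have "3 * ?m * p\<^sup>2 + p ^ 3 + 3 * p\<^sup>2 \<ge> 0"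
        using m0 assms by simp
      ultimately show ?thesis by linarith
    qed
    finally have r3: "?m3 + p * (3 * ?m2 + 3 * ?m + 1) \<le> (?m + p) ^ 3 + 3 * (?m + p)\<^sup>2 + (?m + p)" .
    show ?case
      unfolding 2 3 eq using r2 r3 by blast
  qed simp
  then show "Bexp V p (\<lambda>S. real (card S) ^ 2) \<le> \<mu>\<^sup>2 + \<mu>"
    and "Bexp V p (\<lambda>S. real (card S) ^ 3) \<le> \<mu> ^ 3 + 3 * \<mu>\<^sup>2 + \<mu>"
    unfolding \<mu>_def by auto
qed

lemma Bexp_markov:
  assumes "0 \<le> p" "p \<le> 1" "c > 0" "\<And>S. S \<subseteq> V \<Longrightarrow> 0 \<le> f S"
  shows "Bexp V p (\<lambda>S. of_bool (f S \<ge> c)) \<le> Bexp V p f / c"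
proof -
  have "Bexp V p (\<lambda>S. c * of_bool (f S \<ge> c)) \<le> Bexp V p f"
    by (rule Bexp_mono) (use assms in auto)
  then show ?thesis
    using assms by (simp add: Bexp_cmult field_simps)
qed

section \<open>Components of geometric graphs and minimal spanning trees\<close>

definition adj :: "'a set set \<Rightarrow> ('a \<times> 'a) set" where
  "adj E = {(x, y). {x, y} \<in> E}"

definition component :: "'a set \<Rightarrow> 'a set set \<Rightarrow> 'a \<Rightarrow> 'a set" where
  "component V E x = {y \<in> V. (x, y) \<in> (adj E)\<^sup>*}"

definition ncomp :: "'a set \<Rightarrow> 'a set set \<Rightarrow> nat" where
  "ncomp V E = card (component V E ` V)"

definition pairs :: "'a set \<Rightarrow> 'a set set" where
  "pairs V = {{u, v} | u v. u \<in> V \<and> v \<in> V \<and> u \<noteq> v}"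

definition geo :: "real \<Rightarrow> 'a::metric_space set \<Rightarrow> 'a set set" where
  "geo r V = {{u, v} | u v. u \<in> V \<and> v \<in> V \<and> u \<noteq> v \<and> dist u v \<le> r}"

definition kap :: "real \<Rightarrow> 'a::metric_space set \<Rightarrow> nat" where
  "kap r V = ncomp V (geo r V)"

text \<open>The number of components of the graph at scale \<open>r\<close> that a new vertex at \<open>x\<close> would join.\<close>

definition nbc :: "real \<Rightarrow> 'a::metric_space \<Rightarrow> 'a set \<Rightarrow> nat" where
  "nbc r x V = card (component V (geo r V) ` (V \<inter> cball x r))"

lemma sym_adj: "sym (adj E)"
  by (auto simp: adj_def sym_def insert_commute)

lemma adj_rtrancl_sym: "(x, y) \<in> (adj E)\<^sup>* \<Longrightarrow> (y, x) \<in> (adj E)\<^sup>*"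
  using sym_rtrancl[OF sym_adj] by (rule symD)

lemma adj_mono: "E \<subseteq> F \<Longrightarrow> (adj E)\<^sup>* \<subseteq> (adj F)\<^sup>*"
  by (rule rtrancl_mono) (auto simp: adj_def)

lemma component_eq_iff:
  assumes "x \<in> V" "y \<in> V"
  shows "component V E x = component V E y \<longleftrightarrow> (x, y) \<in> (adj E)\<^sup>*"
proof
  assume "component V E x = component V E y"
  moreover have "y \<in> component V E y"
    using assms by (simp add: component_def)
  ultimately show "(x, y) \<in> (adj E)\<^sup>*"
    by (auto simp: component_def)
next
  assume *: "(x, y) \<in> (adj E)\<^sup>*"
  then show "component V E x = component V E y"
    unfolding component_def using adj_rtrancl_sym[OF *] by (auto intro: rtrancl_trans)
qed

text \<open>On \<open>X\<close> the map \<open>g\<close> factors through \<open>f\<close>, the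
  choice operator supplying the factor map. With component maps for \<open>f\<close> and
  \<open>g\<close> this compares numbers of components.\<close>

lemma card_image_coarser:
  assumes "finite X" "\<And>y y'. y \<in> X \<Longrightarrow> y' \<in> X \<Longrightarrow> f y = f y' \<Longrightarrow> g y = g y'"
  shows "card (g ` X) \<le> card (f ` X)"
proof -
  have "g ` X \<subseteq> (\<lambda>c. g (SOME y. y \<in> X \<and> f y = c)) ` f ` X"
  proof
    fix z assume "z \<in> g ` X"
    then obtain y where y: "y \<in> X" "z = g y" by auto
    let ?y = "SOME y'. y' \<in> X \<and> f y' = f y"
    have "?y \<in> X \<and> f ?y = f y"
      by (rule someI[of _ y]) (use y in auto)
    then have "g ?y = g y"
      using assms(2) y by blast
    then show "z \<in> (\<lambda>c. g (SOME y. y \<in> X \<and> f y = c)) ` f ` X"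
      using y by (intro image_eqI[of _ _ "f y"]) auto
  qed
  then have "card (g ` X) \<le> card ((\<lambda>c. g (SOME y. y \<in> X \<and> f y = c)) ` f ` X)"
    using assms(1) by (intro card_mono) auto
  also have "\<dots> \<le> card (f ` X)"
    using assms(1) by (intro card_image_le) auto
  finally show ?thesis .
qed

lemma ncomp_coarser:
  assumes "finite V" "(adj E)\<^sup>* \<subseteq> (adj F)\<^sup>*"
  shows "ncomp V F \<le> ncomp V E"
  unfolding ncomp_def
proof (rule card_image_coarser[OF assms(1)])
  fix y y' assume "y \<in> V" "y' \<in> V" "component V E y = component V E y'"
  then show "component V F y = component V F y'"
    using component_eq_iff[of y V y' E] component_eq_iff[of y V y' F] assms(2) by auto
qed

lemma ncomp_eq_1_iff:
  assumes "finite V" "V \<noteq> {}"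
  shows "ncomp V E = 1 \<longleftrightarrow> (\<forall>u\<in>V. \<forall>v\<in>V. (u, v) \<in> (adj E)\<^sup>*)"
proof -
  have "ncomp V E = 1 \<longleftrightarrow> (\<forall>u\<in>V. \<forall>v\<in>V. component V E u = component V E v)"
  proof
    assume "ncomp V E = 1"
    then obtain c where "component V E ` V = {c}"
      unfolding ncomp_def by (auto simp: card_1_singleton_iff)
    then show "\<forall>u\<in>V. \<forall>v\<in>V. component V E u = component V E v" by blast
  next
    assume *: "\<forall>u\<in>V. \<forall>v\<in>V. component V E u = component V E v"
    obtain u where "u \<in> V" using assms by auto
    with * have "component V E ` V = {component V E u}" by blast
    then show "ncomp V E = 1" by (simp add: ncomp_def)
  qed
  then show ?thesis
    by (simp add: component_eq_iff)
qed

lemma ncomp_pos: "finite V \<Longrightarrow> V \<noteq> {} \<Longrightarrow> ncomp V E \<ge> 1"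
  by (simp add: ncomp_def Suc_le_eq card_gt_0_iff)

text \<open>\<open>E'\<close> unites all classes that meet \<open>T\<close> and leaves the others
  alone. Adding an edge (\<open>T\<close> its ends) and adding a vertex (\<open>T\<close> the vertex
  and its neighbours) are both of this form.\<close>

lemma ncomp_merge:
  assumes "finite V" "T \<subseteq> V" "T \<noteq> {}"
    and "(adj E')\<^sup>* = (adj E)\<^sup>* \<union> {(x, y). (\<exists>a\<in>T. (x, a) \<in> (adj E)\<^sup>*) \<and> (\<exists>b\<in>T. (b, y) \<in> (adj E)\<^sup>*)}"
  shows "ncomp V E' + card (component V E ` T) = ncomp V E + 1"
proof -
  let ?c = "component V E"
  define M where "M = {y \<in> V. \<exists>t\<in>T. (t, y) \<in> (adj E)\<^sup>*}"
  have c': "component V E' x = (if \<exists>a\<in>T. (x, a) \<in> (adj E)\<^sup>* then M else ?c x)" for x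
    unfolding component_def assms(4) M_def
    using adj_rtrancl_sym[of x _ E] by (auto intro: rtrancl_trans)
  have inT: "(\<exists>a\<in>T. (x, a) \<in> (adj E)\<^sup>*) \<longleftrightarrow> ?c x \<in> ?c ` T" if "x \<in> V" for x
    using that assms(2) component_eq_iff[of x V _ E] by (auto simp: image_iff subset_iff)
  have "component V E' ` V = insert M (?c ` V - ?c ` T)"
  proof (intro equalityI subsetI)
    fix z assume "z \<in> component V E' ` V"
    then obtain x where x: "x \<in> V" "z = component V E' x" by auto
    then show "z \<in> insert M (?c ` V - ?c ` T)"
      using inT[OF x(1)] c'[of x] by auto
  next
    fix z assume "z \<in> insert M (?c ` V - ?c ` T)"
    then consider "z = M" | x where "x \<in> V" "z = ?c x" "?c x \<notin> ?c ` T" by auto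
    then show "z \<in> component V E' ` V"
    proof cases
      case 1
      obtain t where "t \<in> T" using assms by auto
      then have "component V E' t = M" using c'[of t] by auto
      then show ?thesis using 1 \<open>t \<in> T\<close> assms(2) by blast
    next
      case 2
      then have "component V E' x = z" using c'[of x] inT[of x] by auto
      then show ?thesis using 2 by blast
    qed
  qed
  moreover have "M \<notin> ?c ` V - ?c ` T"
  proof
    assume "M \<in> ?c ` V - ?c ` T"
    then obtain x where x: "x \<in> V" "M = ?c x" "?c x \<notin> ?c ` T" by auto
    obtain t where t: "t \<in> T" using assms by auto
    then have "t \<in> M" using assms(2) by (auto simp: M_def)
    then have "(x, t) \<in> (adj E)\<^sup>*" using x by (simp add: component_def)
    then show False using inT[OF x(1)] x t by blast
  qed
  ultimately have "ncomp V E' = card (?c ` V - ?c ` T) + 1"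
    using assms(1) by (simp add: ncomp_def)
  moreover have "card (?c ` V - ?c ` T) + card (?c ` T) = card (?c ` V)"
  proof -
    have "?c ` T \<subseteq> ?c ` V" using assms(2) by auto
    moreover have "finite (?c ` T)" "finite (?c ` V)"
      using assms(1) finite_subset[OF assms(2,1)] by auto
    ultimately show ?thesis
      by (metis card_Diff_subset card_mono le_add_diff_inverse2)
  qed
  ultimately show ?thesis by (simp add: ncomp_def)
qed

lemma rtrancl_adj_insert:
  "(adj (insert {a, b} E))\<^sup>* =
    (adj E)\<^sup>* \<union> {(x, y). (\<exists>c\<in>{a, b}. (x, c) \<in> (adj E)\<^sup>*) \<and> (\<exists>c\<in>{a, b}. (c, y) \<in> (adj E)\<^sup>*)}"
  (is "?L = ?R")
proof (intro equalityI subrelI)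
  fix x y assume "(x, y) \<in> ?L"
  then show "(x, y) \<in> ?R"
  proof (induction rule: rtrancl_induct)
    case base
    then show ?case by simp
  next
    case (step y z)
    then have "(y, z) \<in> adj E \<or> y \<in> {a, b} \<and> z \<in> {a, b}"
      by (auto simp: adj_def doubleton_eq_iff)
    with step.IH show ?case
      by (auto intro: rtrancl_into_rtrancl)
  qed
next
  fix x y assume xy: "(x, y) \<in> ?R"
  have ab: "(c, d) \<in> ?L" if "c \<in> {a, b}" "d \<in> {a, b}" for c d
  proof (cases "c = d")
    case False
    then have "{c, d} = {a, b}" using that by auto
    then have "(c, d) \<in> adj (insert {a, b} E)" by (simp add: adj_def)
    then show ?thesis by blast
  qed simp
  have sub: "(adj E)\<^sup>* \<subseteq> ?L" by (rule adj_mono) auto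
  from xy consider "(x, y) \<in> (adj E)\<^sup>*"
    | c d where "c \<in> {a, b}" "d \<in> {a, b}" "(x, c) \<in> (adj E)\<^sup>*" "(d, y) \<in> (adj E)\<^sup>*" by blast
  then show "(x, y) \<in> ?L"
  proof cases
    case 2
    then show ?thesis
      using sub ab[of c d] by (meson rtrancl_trans subsetD)
  qed (use sub in blast)
qed

lemma ncomp_insert_edge:
  assumes "finite V" "a \<in> V" "b \<in> V"
  shows "ncomp V (insert {a, b} E) + (if (a, b) \<in> (adj E)\<^sup>* then 0 else 1) = ncomp V E"
proof -
  have "ncomp V (insert {a, b} E) + card (component V E ` {a, b}) = ncomp V E + 1"
    by (rule ncomp_merge) (use assms in
      \<open>auto simp only: rtrancl_adj_insert insert_subset empty_subsetI insert_not_empty\<close>)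
  moreover have "card (component V E ` {a, b}) = (if (a, b) \<in> (adj E)\<^sup>* then 1 else 2)"
    using component_eq_iff[OF assms(2,3), of E] by auto
  ultimately show ?thesis by (auto split: if_splits)
qed

lemma ncomp_Un_edges:
  assumes "finite V" "finite F" "F \<subseteq> pairs V"
  shows "ncomp V E \<le> ncomp V (E \<union> F) + card F"
  using assms(2,3)
proof (induction F rule: finite_induct)
  case empty
  then show ?case by simp
next
  case (insert e F)
  then obtain a b where ab: "e = {a, b}" "a \<in> V" "b \<in> V"
    by (auto simp: pairs_def)
  have "ncomp V (E \<union> F) \<le> ncomp V (insert e (E \<union> F)) + 1"
    using ncomp_insert_edge[OF assms(1) ab(2,3), of "E \<union> F"] ab(1) by (auto split: if_splits)
  then show ?case
    using insert by simp
qed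

lemma component_no_edges: "component V {} (x::'a) = V \<inter> {x}"
proof -
  have "(adj {} :: ('a \<times> 'a) set) = {}" by (simp add: adj_def)
  then have "(adj {} :: ('a \<times> 'a) set)\<^sup>* = Id" by (simp only: rtrancl_empty)
  then show ?thesis by (auto simp: component_def)
qed

lemma ncomp_no_edges: "finite V \<Longrightarrow> ncomp V {} = card V"
  unfolding ncomp_def by (rule card_image) (auto simp: inj_on_def component_no_edges)

section \<open>Kruskal's algorithm and the integral formula for the length\<close>

lemma finite_imp_Max_attained:
  fixes f :: "'a \<Rightarrow> real"
  assumes "finite D" "D \<noteq> {}"
  shows "\<exists>e\<in>D. \<forall>x\<in>D. f x \<le> f e"
  using Max_in[of "f ` D"] Max_ge[of "f ` D"] assms by fastforce

text \<open>One forest \<open>K\<close> serves all thresholds at once. After removal of a longest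
  edge \<open>e\<close>, a threshold below its length does not see \<open>e\<close>, and any other
  threshold sees all of \<open>D\<close>; so only the full graph has to be reconsidered, and
  \<open>e\<close> enters \<open>K\<close> exactly if its ends are not yet joined.\<close>

lemma kruskal:
  assumes "finite V" "finite D" "D \<subseteq> pairs V"
  shows "\<exists>K\<subseteq>D. (adj K)\<^sup>* = (adj D)\<^sup>* \<and>
    (\<forall>r. ncomp V {e \<in> D. diameter e \<le> r} + card {e \<in> K. diameter e \<le> r} = card V)"
  using assms(2,3)
proof (induction "card D" arbitrary: D)
  case 0
  then have "D = {}" by simp
  then show ?case using assms(1) by (simp add: ncomp_no_edges)
next
  case (Suc n)
  then have "D \<noteq> {}" by auto
  then obtain e where e: "e \<in> D" "\<And>f. f \<in> D \<Longrightarrow> diameter f \<le> diameter e"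
    using finite_imp_Max_attained[OF Suc.prems(1), of diameter] by auto
  define D' where "D' = D - {e}"
  have D: "D = insert e D'" "e \<notin> D'" using e by (auto simp: D'_def)
  have "card D' = n" "finite D'" "D' \<subseteq> pairs V"
    using Suc e by (auto simp: D'_def)
  with Suc.hyps(1)[of D'] obtain K where K: "K \<subseteq> D'" "(adj K)\<^sup>* = (adj D')\<^sup>*"
    "\<And>r. ncomp V {e \<in> D'. diameter e \<le> r} + card {e \<in> K. diameter e \<le> r} = card V"
    by blast
  obtain a b where ab: "e = {a, b}" "a \<in> V" "b \<in> V"
    using e Suc.prems by (auto simp: pairs_def)
  have big: "{f \<in> D'. diameter f \<le> r} = D'" "{f \<in> D. diameter f \<le> r} = D"
    "{f \<in> K. diameter f \<le> r} = K"
    if "diameter e \<le> r" for r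
    using e that K(1) D by force+
  have small: "{f \<in> D. diameter f \<le> r} = {f \<in> D'. diameter f \<le> r}" if "\<not> diameter e \<le> r" for r
    using that D by auto
  note step = ncomp_insert_edge[OF assms(1) ab(2,3), of D', folded ab(1), folded D(1)]
  show ?case
  proof (cases "(a, b) \<in> (adj D')\<^sup>*")
    case True
    have "(adj D)\<^sup>* = (adj D')\<^sup>*"
    proof
      show "(adj D)\<^sup>* \<subseteq> (adj D')\<^sup>*"
        unfolding D ab(1) rtrancl_adj_insert
        using True adj_rtrancl_sym[OF True] by (auto intro: rtrancl_trans)
    qed (rule adj_mono, use D in auto)
    moreover have "ncomp V {f \<in> D. diameter f \<le> r} + card {f \<in> K. diameter f \<le> r} = card V" for r
      using K(3)[of r] step True big[of r] small[of r] by (cases "diameter e \<le> r") auto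
    ultimately show ?thesis
      using K D by (intro exI[of _ K]) auto
  next
    case False
    have "e \<notin> K" "finite K" using K D \<open>finite D'\<close> finite_subset by auto
    have "(adj (insert e K))\<^sup>* = (adj D)\<^sup>*"
      unfolding D ab(1) rtrancl_adj_insert K(2) ..
    moreover have "ncomp V {f \<in> D. diameter f \<le> r} + card {f \<in> insert e K. diameter f \<le> r} = card V"
      for r
    proof (cases "diameter e \<le> r")
      case True
      then have "{f \<in> insert e K. diameter f \<le> r} = insert e K"
        using big(3)[OF True] by auto
      then show ?thesis
        using K(3)[of r] step False big[OF True] \<open>e \<notin> K\<close> \<open>finite K\<close> by simp
    next
      case False
      then have "{f \<in> insert e K. diameter f \<le> r} = {f \<in> K. diameter f \<le> r}" by auto
      then show ?thesis
        using K(3)[of r] small[OF False] by simp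
    qed
    ultimately show ?thesis
      using K D by (intro exI[of _ "insert e K"]) auto
  qed
qed

lemma mem_geo: "e \<in> geo r V \<longleftrightarrow> e \<in> pairs V \<and> diameter e \<le> r"
  unfolding geo_def pairs_def mem_Collect_eq by (metis diameter_edge)

lemma geo_subset_pairs: "geo r V \<subseteq> pairs V"
  by (auto simp: mem_geo)

lemma pairs_mono: "W \<subseteq> V \<Longrightarrow> pairs W \<subseteq> pairs V"
  unfolding pairs_def by blast

lemma geo_mono: "W \<subseteq> V \<Longrightarrow> r \<le> s \<Longrightarrow> geo r W \<subseteq> geo s V"
  using pairs_mono[of W V] by (auto simp: mem_geo)

lemma finite_pairs: "finite V \<Longrightarrow> finite (pairs V)"
  by (rule finite_subset[of _ "Pow V"]) (auto simp: pairs_def)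

lemma geo_filter: "r \<le> R \<Longrightarrow> {e \<in> geo R V. diameter e \<le> r} = geo r V"
  by (auto simp: mem_geo)

lemma geo_pairs: "{e \<in> pairs V. diameter e \<le> r} = geo r V"
  by (auto simp: mem_geo)

lemma adj_geo: "(x, y) \<in> adj (geo r V) \<longleftrightarrow> x \<in> V \<and> y \<in> V \<and> x \<noteq> y \<and> dist x y \<le> r"
  by (auto simp: adj_def geo_def doubleton_eq_iff dist_commute)

lemma kap_antimono: "finite V \<Longrightarrow> r \<le> s \<Longrightarrow> kap s V \<le> kap r V"
  unfolding kap_def by (intro ncomp_coarser adj_mono) (auto intro: geo_mono[THEN subsetD])

lemma kap_le_card: "finite V \<Longrightarrow> kap r V \<le> card V"
  unfolding kap_def ncomp_def by (rule card_image_le)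

lemma kap_empty [simp]: "kap r {} = 0"
  by (simp add: kap_def ncomp_def)

lemma kap_integrable:
  assumes "finite V"
  shows "(\<lambda>r. real (kap r V)) integrable_on {a..b}"
proof -
  have "(\<lambda>r. - real (kap r V)) integrable_on {a..b}"
    by (rule integrable_on_mono_on) (use kap_antimono[OF assms] in \<open>auto simp: mono_on_def\<close>)
  then show ?thesis
    using integrable_neg by fastforce
qed

lemma integral_indicator_less:
  assumes "0 \<le> a" "0 \<le> R"
  shows "((\<lambda>r. of_bool (r < a)) has_integral min a R) {0..R::real}"
proof -
  have "((\<lambda>r. 1::real) has_integral min a R) {0..min a R}"
    using has_integral_const_real[of "1::real" 0 "min a R"] assms by simp
  then have "((\<lambda>r. if r \<in> {0..min a R} then 1 else 0 :: real) has_integral min a R) {0..R}"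
    by (subst has_integral_restrict) auto
  moreover have "of_bool (r < a) = (if r \<in> {0..min a R} then 1 else 0 :: real)"
    if "r \<in> {0..R} - {a}" for r
    using that by auto
  ultimately show ?thesis
    using has_integral_spike_finite[of "{a}" "{0..R}" "\<lambda>r. of_bool (r < a)"
        "\<lambda>r. if r \<in> {0..min a R} then 1 else 0 :: real"] by blast
qed

text \<open>Layer-cake formula: a length cut off at \<open>R\<close> is the measure of the scales in
  \<open>{0..R}\<close> that lie below it.\<close>

lemma integral_card_longer:
  assumes "finite E" "0 \<le> R" "\<And>e. e \<in> E \<Longrightarrow> 0 \<le> l e"
  shows "((\<lambda>r. real (card {e \<in> E. r < l e})) has_integral (\<Sum>e\<in>E. min (l e) R)) {0..R}"
proof -
  have "((\<lambda>r. \<Sum>e\<in>E. of_bool (r < l e)) has_integral (\<Sum>e\<in>E. min (l e) R)) {0..R}"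
    by (intro has_integral_sum integral_indicator_less) (use assms in auto)
  moreover have "(\<Sum>e\<in>E. of_bool (r < l e)) = real (card {e \<in> E. r < l e})" for r
    using assms(1) by (simp add: sum.If_cases of_bool_def Int_def)
  ultimately show ?thesis by simp
qed

lemma connected_graph_iff:
  "connected_graph V E \<longleftrightarrow> E \<subseteq> pairs V \<and> (\<forall>u\<in>V. \<forall>v\<in>V. (u, v) \<in> (adj E)\<^sup>*)"
  by (simp add: connected_graph_def pairs_def adj_def)

lemma diameter_pair_nonneg: "e \<in> pairs V \<Longrightarrow> 0 \<le> diameter (e :: 'a::metric_space set)"
  by (auto simp: pairs_def diameter_edge)

text \<open>Upper bound: the Kruskal forest at scale \<open>R\<close> is a spanning tree with
  \<open>kap r V - 1\<close> edges longer than \<open>r\<close>. Lower bound: deleting the edges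
  longer than \<open>r\<close> from any connected graph leaves at least \<open>kap r V\<close>
  components, and each deletion creates at most one.\<close>

theorem mst_length_eq_integral:
  assumes "finite V" "V \<noteq> {}" "0 \<le> R" "kap R V = 1"
  shows "mst_length V = integral {0..R} (\<lambda>r. real (kap r V)) - R"
proof -
  have kint: "((\<lambda>r. real (kap r V) - 1) has_integral integral {0..R} (\<lambda>r. real (kap r V))
    - R) {0..R}"
    using has_integral_diff[OF integrable_integral[OF kap_integrable[OF assms(1)]]
        has_integral_const_real[of "1::real" 0 R]] assms(3) by simp
  have fin: "finite (geo R V)" "geo R V \<subseteq> pairs V"
    using assms(1) finite_pairs geo_subset_pairs finite_subset by metis+
  obtain K where K: "K \<subseteq> geo R V" "(adj K)\<^sup>* = (adj (geo R V))\<^sup>*"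
    "\<And>r. ncomp V {e \<in> geo R V. diameter e \<le> r} + card {e \<in> K. diameter e \<le> r} = card V"
    using kruskal[OF assms(1) fin] by blast
  have finK: "finite K" using finite_subset[OF K(1) fin(1)] .
  have "connected_graph V K"
    unfolding connected_graph_iff K(2)
    using K(1) fin ncomp_eq_1_iff[OF assms(1,2)] assms(4) by (auto simp: kap_def)
  then have "mst_length V \<le> (\<Sum>e\<in>K. diameter e)"
    by (rule mst_length_attained(2)[OF assms(1)])
  also have "\<dots> = (\<Sum>e\<in>K. min (diameter e) R)"
    using K(1) by (intro sum.cong) (auto simp: mem_geo)
  also have "\<dots> = integral {0..R} (\<lambda>r. real (kap r V)) - R"
  proof (rule has_integral_unique)
    show "((\<lambda>r. real (card {e \<in> K. r < diameter e})) has_integral (\<Sum>e\<in>K. min (diameter e) R))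
      {0..R}"
      using finK assms(3) K(1) fin(2) diameter_pair_nonneg by (intro integral_card_longer) blast+
    have "{e \<in> geo R V. diameter e \<le> R} = geo R V" "{e \<in> K. diameter e \<le> R} = K"
      using K(1) by (auto simp: mem_geo)
    then have top: "1 + card K = card V"
      using K(3)[of R] assms(4) by (simp add: kap_def)
    have "real (kap r V) - 1 = real (card {e \<in> K. r < diameter e})" if "r \<in> {0..R}" for r
    proof -
      have "K = {e \<in> K. diameter e \<le> r} \<union> {e \<in> K. r < diameter e}" by auto
      then have "card K = card {e \<in> K. diameter e \<le> r} + card {e \<in> K. r < diameter e}"
        using finK by (subst card_Un_disjoint[symmetric]) auto
      moreover have "kap r V + card {e \<in> K. diameter e \<le> r} = card V"
        using K(3)[of r] that by (simp add: geo_filter kap_def)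
      ultimately show ?thesis using top by linarith
    qed
    with kint show "((\<lambda>r. real (card {e \<in> K. r < diameter e})) has_integral
        integral {0..R} (\<lambda>r. real (kap r V)) - R) {0..R}"
      by (rule has_integral_eq[rotated])
  qed
  finally have le: "mst_length V \<le> integral {0..R} (\<lambda>r. real (kap r V)) - R" .
  obtain E where E: "connected_graph V E" "mst_length V = (\<Sum>e\<in>E. diameter e)"
    using mst_length_attained(1)[OF assms(1)] by blast
  have Esub: "E \<subseteq> pairs V" using E(1) by (simp add: connected_graph_iff)
  have finE: "finite E" using Esub finite_pairs[OF assms(1)] finite_subset by blast
  have "integral {0..R} (\<lambda>r. real (kap r V)) - R \<le> (\<Sum>e\<in>E. min (diameter e) R)"
  proof (rule has_integral_le[OF kint])
    show "((\<lambda>r. real (card {e \<in> E. r < diameter e})) has_integral (\<Sum>e\<in>E. min (diameter e) R))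
      {0..R}"
      using finE assms(3) Esub diameter_pair_nonneg by (intro integral_card_longer) blast+
    fix r assume "r \<in> {0..R}"
    have "ncomp V {e \<in> E. diameter e \<le> r} \<le>
        ncomp V ({e \<in> E. diameter e \<le> r} \<union> {e \<in> E. r < diameter e}) + card {e \<in> E. r < diameter e}"
      by (rule ncomp_Un_edges) (use assms finE Esub in auto)
    also have "{e \<in> E. diameter e \<le> r} \<union> {e \<in> E. r < diameter e} = E" by auto
    also have "ncomp V E = 1"
      using E(1) ncomp_eq_1_iff[OF assms(1,2)] by (simp add: connected_graph_iff)
    finally have "ncomp V {e \<in> E. diameter e \<le> r} \<le> 1 + card {e \<in> E. r < diameter e}" .
    moreover have "kap r V \<le> ncomp V {e \<in> E. diameter e \<le> r}"
      unfolding kap_def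
      by (intro ncomp_coarser adj_mono) (use assms(1) Esub geo_pairs[of V r] in auto)
    ultimately show "real (kap r V) - 1 \<le> real (card {e \<in> E. r < diameter e})"
      by linarith
  qed
  also have "\<dots> \<le> (\<Sum>e\<in>E. diameter e)"
    by (intro sum_mono) auto
  finally show ?thesis
    using le E(2) by linarith
qed

section \<open>Effect of an added point on the components\<close>

lemma kap_insert:
  assumes "finite V" "x \<notin> V" "0 \<le> r"
  shows "kap r (insert x V) + nbc r x V = kap r V + 1"
proof -
  let ?T = "insert x (V \<inter> cball x r)" and ?E = "geo r V" and ?E' = "geo r (insert x V)"
  \<comment> \<open>Before its edges are added, \<open>x\<close> is an isolated vertex, so
    \<open>insert x V\<close> starts with one component more than \<open>V\<close>, and
    \<open>x\<close> itself is one of the merged classes.\<close>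
  have iso: "(x, y) \<in> (adj ?E)\<^sup>* \<longleftrightarrow> y = x" "(y, x) \<in> (adj ?E)\<^sup>* \<longleftrightarrow> y = x" for y
    using assms(2) by (auto simp: adj_geo elim: converse_rtranclE rtranclE)
  have ins: "(adj ?E')\<^sup>* = (adj ?E)\<^sup>* \<union>
      {(y, z). (\<exists>a\<in>?T. (y, a) \<in> (adj ?E)\<^sup>*) \<and> (\<exists>b\<in>?T. (b, z) \<in> (adj ?E)\<^sup>*)}" (is "?L = ?R")
  proof (intro equalityI subrelI)
    fix y z assume "(y, z) \<in> ?L"
    then show "(y, z) \<in> ?R"
    proof (induction rule: rtrancl_induct)
      case base
      then show ?case by simp
    next
      case (step z w)
      then have "(z, w) \<in> adj ?E \<or> z \<in> ?T \<and> w \<in> ?T"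
        by (auto simp: adj_geo dist_commute)
      with step.IH show ?case
        by (auto intro: rtrancl_into_rtrancl)
    qed
  next
    fix y z assume yz: "(y, z) \<in> ?R"
    have sub: "(adj ?E)\<^sup>* \<subseteq> ?L" by (intro adj_mono geo_mono) auto
    have "(a, x) \<in> ?L" "(x, a) \<in> ?L" if "a \<in> ?T" for a
    proof -
      have "a = x \<or> (x, a) \<in> adj ?E'"
        using that assms(2) by (auto simp: adj_geo)
      then show "(x, a) \<in> ?L" by auto
      then show "(a, x) \<in> ?L" by (rule adj_rtrancl_sym)
    qed
    then have ab: "(a, b) \<in> ?L" if "a \<in> ?T" "b \<in> ?T" for a b
      using that by (meson rtrancl_trans)
    from yz consider "(y, z) \<in> (adj ?E)\<^sup>*"
      | a b where "a \<in> ?T" "b \<in> ?T" "(y, a) \<in> (adj ?E)\<^sup>*" "(b, z) \<in> (adj ?E)\<^sup>*" by blast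
    then show "(y, z) \<in> ?L"
    proof cases
      case 2
      then show ?thesis
        using sub ab[of a b] by (meson rtrancl_trans subsetD)
    qed (use sub in blast)
  qed
  have m: "ncomp (insert x V) ?E' + card (component (insert x V) ?E ` ?T) = ncomp (insert x V) ?E
    + 1"
    by (rule ncomp_merge) (use assms ins in auto)
  have cx: "component (insert x V) ?E x = {x}"
    using iso by (auto simp: component_def)
  have cy: "component (insert x V) ?E y = component V ?E y" if "y \<in> V" for y
    using that assms(2) iso by (auto simp: component_def)
  have nin: "{x} \<notin> component V ?E ` A" for A
    using assms(2) by (auto simp: component_def)
  have "component (insert x V) ?E ` insert x A = insert {x} (component V ?E ` A)" if "A \<subseteq> V" for A
  proof -
    have "component (insert x V) ?E ` A = component V ?E ` A"
      by (rule image_cong) (use that cy in auto)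
    then show ?thesis by (simp only: image_insert cx)
  qed
  then have "card (component (insert x V) ?E ` insert x A) = Suc (card (component V ?E ` A))"
    if "A \<subseteq> V" for A
    using that nin assms(1) finite_subset by (simp add: finite_subset[of A V])
  from this[of V] this[of "V \<inter> cball x r"] m show ?thesis
    by (simp add: kap_def nbc_def ncomp_def)
qed

lemma card_image_coarser_le:
  assumes "finite X" "\<And>y y'. y \<in> X \<Longrightarrow> y' \<in> X \<Longrightarrow> f y = f y' \<Longrightarrow> dist y y' \<le> r" "X \<subseteq> V"
  shows "card (component V (geo r V) ` X) \<le> card (f ` X)"
proof (rule card_image_coarser[OF assms(1)])
  fix y y' assume *: "y \<in> X" "y' \<in> X" "f y = f y'"
  then have "y = y' \<or> (y, y') \<in> adj (geo r V)"
    using assms(2,3) by (auto simp: adj_geo)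
  then show "component V (geo r V) y = component V (geo r V) y'"
    using * assms(3) by (subst component_eq_iff) auto
qed

lemma kap_le_card_image:
  assumes "finite V" "\<And>y y'. y \<in> V \<Longrightarrow> y' \<in> V \<Longrightarrow> f y = f y' \<Longrightarrow> dist y y' \<le> r"
  shows "kap r V \<le> card (f ` V)"
  unfolding kap_def ncomp_def by (rule card_image_coarser_le) (use assms in auto)

lemma nbc_le_card_image:
  assumes "finite V" "\<And>y y'. y \<in> V \<inter> cball x r \<Longrightarrow> y' \<in> V \<inter> cball x r \<Longrightarrow> f y = f y' \<Longrightarrow> dist y y' \<le> r"
  shows "nbc r x V \<le> card (f ` (V \<inter> cball x r))"
  unfolding nbc_def by (rule card_image_coarser_le) (use assms in auto)

text \<open>This monotonicity yields both the sign of the add-one cost of the gap and the comparison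
  of that cost between a window and a larger cube.\<close>

lemma nbc_antimono:
  assumes "finite V" "W \<subseteq> V" "V \<inter> cball x r \<subseteq> W"
  shows "nbc r x V \<le> nbc r x W"
proof -
  have eq: "W \<inter> cball x r = V \<inter> cball x r" using assms by auto
  have sub: "(adj (geo r W))\<^sup>* \<subseteq> (adj (geo r V))\<^sup>*"
    by (intro adj_mono geo_mono) (use assms in auto)
  show ?thesis
    unfolding nbc_def eq
  proof (rule card_image_coarser)
    fix y y' assume "y \<in> V \<inter> cball x r" "y' \<in> V \<inter> cball x r"
      "component W (geo r W) y = component W (geo r W) y'"
    then show "component V (geo r V) y = component V (geo r V) y'"
      using component_eq_iff[of y W y' "geo r W"] component_eq_iff[of y V y' "geo r V"] sub assms
      by blast
  qed (use assms in auto)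
qed

text \<open>No path from \<open>Q\<close> can leave \<open>Q\<close>, so the points outside cannot
  help to join neighbours of \<open>x\<close>. This is the case of configurations without points
  near block boundaries.\<close>

lemma nbc_closed:
  assumes "finite V" "V \<inter> cball x r \<subseteq> Q"
    and closed: "\<And>y z. y \<in> V \<inter> Q \<Longrightarrow> z \<in> V \<Longrightarrow> dist y z \<le> r \<Longrightarrow> z \<in> Q"
  shows "nbc r x (V \<inter> Q) = nbc r x V"
proof (rule antisym)
  have eq: "V \<inter> Q \<inter> cball x r = V \<inter> cball x r" using assms by auto
  have stay: "(y, z) \<in> (adj (geo r (V \<inter> Q)))\<^sup>* \<and> (z = y \<or> z \<in> V \<inter> Q)"
    if "(y, z) \<in> (adj (geo r V))\<^sup>*" "y \<in> V \<inter> Q" for y z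
    using that
  proof (induction rule: rtrancl_induct)
    case (step z w)
    then have "(z, w) \<in> adj (geo r (V \<inter> Q))"
      using closed[of z w] by (auto simp: adj_geo)
    with step show ?case
      by (auto intro: rtrancl_into_rtrancl simp: adj_geo)
  qed simp
  show "nbc r x (V \<inter> Q) \<le> nbc r x V"
    unfolding nbc_def eq
  proof (rule card_image_coarser)
    fix y y' assume *: "y \<in> V \<inter> cball x r" "y' \<in> V \<inter> cball x r"
      "component V (geo r V) y = component V (geo r V) y'"
    then have "(y, y') \<in> (adj (geo r V))\<^sup>*" "y \<in> V \<inter> Q" "y' \<in> V \<inter> Q"
      using assms by (auto simp: component_eq_iff)
    then show "component (V \<inter> Q) (geo r (V \<inter> Q)) y = component (V \<inter> Q) (geo r (V \<inter> Q)) y'"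
      using stay[of y y'] by (subst component_eq_iff) auto
  qed (use assms in auto)
  show "nbc r x V \<le> nbc r x (V \<inter> Q)"
    by (rule nbc_antimono) (use assms in auto)
qed

lemma kap_ge_isolated:
  assumes "finite V"
  shows "card {x \<in> V. V \<inter> cball x r \<subseteq> {x}} \<le> kap r V"
proof -
  let ?I = "{x \<in> V. V \<inter> cball x r \<subseteq> {x}}"
  have "inj_on (component V (geo r V)) ?I"
  proof (rule inj_onI)
    fix x y assume xy: "x \<in> ?I" "y \<in> ?I" "component V (geo r V) x = component V (geo r V) y"
    then have "(x, y) \<in> (adj (geo r V))\<^sup>*" by (simp add: component_eq_iff)
    then show "x = y"
    proof (cases rule: converse_rtranclE)
      case (step z)
      then show ?thesis using xy by (auto simp: adj_geo)
    qed
  qed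
  then have "card ?I = card (component V (geo r V) ` ?I)"
    by (simp add: card_image)
  also have "\<dots> \<le> kap r V"
    unfolding kap_def ncomp_def by (rule card_mono) (use assms in auto)
  finally show ?thesis .
qed

text \<open>Walk along the segment between two points of \<open>V\<close>, which stays in
  \<open>W\<close>, in steps shorter than \<open>r / 3\<close>. Points of \<open>V\<close> within
  \<open>r / 3\<close> of consecutive positions are then at distance at most
  \<open>r\<close>.\<close>

lemma kap_eq_1_of_dense:
  fixes V W :: "'a::real_normed_vector set"
  assumes "finite V" "V \<noteq> {}" "V \<subseteq> W" "convex W" "0 < r"
    and dense: "\<And>w. w \<in> W \<Longrightarrow> \<exists>v\<in>V. dist w v \<le> r / 3"
  shows "kap r V = 1"
proof -
  have "(u, v) \<in> (adj (geo r V))\<^sup>*" if u: "u \<in> V" and v: "v \<in> V" for u v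
  proof -
    obtain m :: nat where m: "m > 0" "dist u v / real m < r / 3"
    proof -
      obtain m :: nat where "3 * dist u v / r < real m"
        using reals_Archimedean2 by blast
      then have "3 * dist u v < real (Suc m) * r"
        using assms(5) by (simp add: field_simps)
      then show ?thesis
        using that[of "Suc m"] by (simp add: field_simps)
    qed
    define w where "w i = u + (real i / real m) *\<^sub>R (v - u)" for i
    have wW: "w i \<in> W" if "i \<le> m" for i
    proof -
      have "w i = (1 - real i / real m) *\<^sub>R u + (real i / real m) *\<^sub>R v"
        by (simp add: w_def algebra_simps)
      then show ?thesis
        using that m u v assms(3,4) by (auto intro!: convexD)
    qed
    have "\<exists>s\<in>V. dist (w i) s \<le> r / 3 \<and> (u, s) \<in> (adj (geo r V))\<^sup>*" if "i \<le> m" for i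
      using that
    proof (induction i)
      case 0
      show ?case using u assms(5) by (intro bexI[of _ u]) (auto simp: w_def)
    next
      case (Suc i)
      then obtain s where s: "s \<in> V" "dist (w i) s \<le> r / 3" "(u, s) \<in> (adj (geo r V))\<^sup>*" by auto
      obtain s' where s': "s' \<in> V" "dist (w (Suc i)) s' \<le> r / 3"
        using dense[OF wW[OF Suc.prems]] by auto
      have "w (Suc i) - w i = (1 / real m) *\<^sub>R (v - u)"
        by (simp add: w_def algebra_simps add_divide_distrib)
      then have "dist (w (Suc i)) (w i) = dist u v / real m"
        by (simp add: dist_norm norm_minus_commute)
      then have "dist (w (Suc i)) (w i) < r / 3"
        using m(2) by simp
      then have "dist s s' \<le> r"
        using s(2) s'(2) dist_triangle[of s s' "w i"] dist_triangle[of "w i" s' "w (Suc i)"]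
        unfolding dist_commute[of s] dist_commute[of _ "w i"] by linarith
      then have "s = s' \<or> (s, s') \<in> adj (geo r V)"
        using s s' by (auto simp: adj_geo)
      then show ?case
        using s s' by (auto intro: rtrancl_into_rtrancl)
    qed
    from this[of m] obtain s where s: "s \<in> V" "dist (w m) s \<le> r / 3" "(u, s) \<in> (adj (geo r V))\<^sup>*"
      by auto
    have "w m = v" using m by (simp add: w_def)
    then have "s = v \<or> (s, v) \<in> adj (geo r V)"
      using s v assms(5) by (auto simp: adj_geo dist_commute)
    then show ?thesis
      using s by (auto intro: rtrancl_into_rtrancl)
  qed
  then show ?thesis
    unfolding kap_def using ncomp_eq_1_iff[OF assms(1,2)] by blast
qed

lemma kap_isometry:
  assumes "finite V" "\<And>u v. u \<in> V \<Longrightarrow> v \<in> V \<Longrightarrow> dist (g u) (g v) = dist u v"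
  shows "kap r (g ` V) = kap r V"
proof -
  have inj: "inj_on g V"
    by (rule inj_onI) (metis assms(2) dist_eq_0_iff)
  have fw: "(g u, g v) \<in> (adj (geo r (g ` V)))\<^sup>*" if "(u, v) \<in> (adj (geo r V))\<^sup>*" for u v
    using that
  proof (induction rule: rtrancl_induct)
    case (step y z)
    then have "(g y, g z) \<in> adj (geo r (g ` V))"
      using assms(2) inj by (auto simp: adj_geo inj_on_eq_iff)
    with step.IH show ?case by (auto intro: rtrancl_into_rtrancl)
  qed simp
  have bw: "\<exists>v\<in>V. z = g v \<and> (u, v) \<in> (adj (geo r V))\<^sup>*"
    if "(g u, z) \<in> (adj (geo r (g ` V)))\<^sup>*" "u \<in> V" for u z
    using that
  proof (induction rule: rtrancl_induct)
    case base
    then show ?case by auto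
  next
    case (step y z)
    then obtain v where v: "v \<in> V" "y = g v" "(u, v) \<in> (adj (geo r V))\<^sup>*" by auto
    obtain w where w: "w \<in> V" "z = g w" using step.hyps by (auto simp: adj_geo)
    have "(v, w) \<in> adj (geo r V)"
      using step.hyps v w assms(2) by (auto simp: adj_geo)
    then show ?case using v w by (auto intro: rtrancl_into_rtrancl)
  qed
  have "component (g ` V) (geo r (g ` V)) (g u) = g ` component V (geo r V) u" if "u \<in> V" for u
    using fw bw[OF _ that] unfolding component_def by blast
  then have "component (g ` V) (geo r (g ` V)) ` g ` V = image g ` (component V (geo r V) ` V)"
    unfolding image_image by (intro image_cong refl)
  moreover have "inj_on (image g) (component V (geo r V) ` V)"
    by (rule inj_on_subset[OF inj_on_image_Pow[OF inj]]) (auto simp: component_def)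
  ultimately show ?thesis
    by (simp add: kap_def ncomp_def card_image)
qed

lemma mst_length_empty [simp]: "mst_length ({} :: 'a::metric_space set) = 0"
proof -
  obtain E :: "'a set set" where E: "connected_graph {} E"
    "mst_length ({}::'a set) = (\<Sum>e\<in>E. diameter e)"
    using mst_length_attained(1)[OF finite.emptyI] by blast
  have "E \<subseteq> {}"
    using E(1) unfolding connected_graph_def by blast
  with E(2) show ?thesis by simp
qed

section \<open>The truncated functional and its add-one cost\<close>

text \<open>For nonempty \<open>V\<close> this is \<open>R\<close> plus the sum of the edge lengths
  of a minimal spanning tree, each cut off at \<open>R\<close>. Integrating \<open>kap r V\<close>
  rather than \<open>kap r V - 1\<close> makes the value at the empty set 0, so the formula for the
  add-one cost also holds for the first point.\<close>

definition HH :: "real \<Rightarrow> 'a::metric_space set \<Rightarrow> real" where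
  "HH R V = integral {0..R} (\<lambda>r. real (kap r V))"

text \<open>Cells of side \<open>r / CARD('d)\<close> have diameter at most \<open>r\<close> by the
  1-norm, so points of one cell lie in one component. If \<open>x\<close> is a corner of the cells,
  the ball of radius \<open>r\<close> about \<open>x\<close> involves at most
  \<open>2 * CARD('d) + 1\<close> cell indices per coordinate, whatever \<open>r\<close> is.\<close>

definition pack :: "'d::finite itself \<Rightarrow> real" where
  "pack _ = (2 * real CARD('d) + 1) ^ CARD('d)"

lemma pack_ge_1: "pack TYPE('d::finite) \<ge> 1"
  by (simp add: pack_def)

lemma floor_bound:
  fixes a :: real
  assumes "\<bar>a\<bar> \<le> real D"
  shows "\<lfloor>a\<rfloor> \<in> {- int D..int D}"
proof -
  have "of_int (- int D) \<le> a" "a \<le> of_int (int D)" using assms by auto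
  from this[THEN floor_mono] have "- int D \<le> \<lfloor>a\<rfloor>" "\<lfloor>a\<rfloor> \<le> int D"
    unfolding floor_of_int .
  then show ?thesis by simp
qed

lemma dist_le_of_same_floor:
  fixes u v :: "real ^ 'd"
  assumes "0 < r" "\<And>i. \<lfloor>(u $ i - x $ i) * CARD('d) / r\<rfloor> = \<lfloor>(v $ i - x $ i) * CARD('d) / r\<rfloor>"
  shows "dist u v \<le> r"
proof -
  have "\<bar>(u - v) $ i\<bar> \<le> r / CARD('d)" for i
  proof -
    have "\<bar>(u $ i - x $ i) * CARD('d) / r - (v $ i - x $ i) * CARD('d) / r\<bar> \<le> 1"
      using assms(2)[of i] by linarith
    moreover have "(u $ i - x $ i) * CARD('d) / r - (v $ i - x $ i) * CARD('d) / r
        = (u $ i - v $ i) * (CARD('d) / r)"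
      using assms(1) by (simp add: field_simps)
    ultimately have "\<bar>u $ i - v $ i\<bar> * (CARD('d) / r) \<le> 1"
      using assms(1) by (simp add: abs_mult)
    then show ?thesis
      using assms(1) by (simp add: field_simps)
  qed
  then have "(\<Sum>i\<in>UNIV. \<bar>(u - v) $ i\<bar>) \<le> (\<Sum>i\<in>(UNIV :: 'd set). r / CARD('d))"
    by (intro sum_mono)
  then have "(\<Sum>i\<in>UNIV. \<bar>(u - v) $ i\<bar>) \<le> r"
    by simp
  then show ?thesis
    using norm_le_l1_cart[of "u - v"] by (simp add: dist_norm)
qed

lemma nbc_le_pack:
  fixes V :: "(real ^ 'd) set"
  assumes "finite V" "0 \<le> r" "x \<notin> V"
  shows "real (nbc r x V) \<le> pack TYPE('d)"
proof (cases "r = 0")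
  case True
  then have "V \<inter> cball x r = {}" using assms by auto
  then show ?thesis using pack_ge_1[where 'd='d] by (simp add: nbc_def)
next
  case False
  with assms have r: "0 < r" by simp
  define f where "f u = (\<lambda>i. \<lfloor>(u $ i - x $ i) * CARD('d) / r\<rfloor>)" for u :: "real ^ 'd"
  have "nbc r x V \<le> card (f ` (V \<inter> cball x r))"
    by (rule nbc_le_card_image[OF assms(1)])
      (auto simp: f_def fun_eq_iff intro!: dist_le_of_same_floor[OF r])
  also have "\<dots> \<le> card (PiE UNIV (\<lambda>_::'d. {- int CARD('d)..int CARD('d)}))"
  proof (rule card_mono)
    show "f ` (V \<inter> cball x r) \<subseteq> PiE UNIV (\<lambda>_::'d. {- int CARD('d)..int CARD('d)})"
    proof
      fix z assume "z \<in> f ` (V \<inter> cball x r)"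
      then obtain u where u: "u \<in> cball x r" "z = f u" by auto
      have "z i \<in> {- int CARD('d)..int CARD('d)}" for i
      proof -
        have "\<bar>u $ i - x $ i\<bar> \<le> r"
          using u(1) component_le_norm_cart[of "u - x" i] by (simp add: dist_norm
            norm_minus_commute)
        then have "\<bar>(u $ i - x $ i) * CARD('d) / r\<bar> \<le> real CARD('d)"
          using r by (simp add: abs_mult pos_divide_le_eq mult.commute mult_left_mono)
        then show ?thesis
          unfolding u(2) f_def by (rule floor_bound)
      qed
      then show "z \<in> PiE UNIV (\<lambda>_. {- int CARD('d)..int CARD('d)})" by (simp add: PiE_def)
    qed
  qed (simp add: finite_PiE)
  also have "card (PiE UNIV (\<lambda>_::'d. {- int CARD('d)..int CARD('d)}))
    = (2 * CARD('d) + 1) ^ CARD('d)"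
  proof -
    have "nat (1 + int CARD('d) + int CARD('d)) = 2 * CARD('d) + 1" by linarith
    then show ?thesis by (simp add: card_PiE algebra_simps)
  qed
  finally have "nbc r x V \<le> (2 * CARD('d) + 1) ^ CARD('d)" .
  then have "real (nbc r x V) \<le> real ((2 * CARD('d) + 1) ^ CARD('d))"
    by (rule of_nat_mono)
  then show ?thesis by (simp add: pack_def add.commute)
qed

lemma nbc_integrable:
  assumes "finite V" "x \<notin> V" "0 \<le> a"
  shows "(\<lambda>r. real (nbc r x V)) integrable_on {a..b}"
proof -
  have "(\<lambda>r. real (kap r V) + 1 - real (kap r (insert x V))) integrable_on {a..b}"
    using assms by (intro integrable_diff integrable_add kap_integrable) auto
  then show ?thesis
  proof (rule integrable_eq)
    fix r assume "r \<in> {a..b}"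
    then show "real (kap r V) + 1 - real (kap r (insert x V)) = real (nbc r x V)"
      using kap_insert[OF assms(1,2), of r] assms(3) by simp
  qed
qed

lemma HH_insert:
  assumes "finite V" "x \<notin> V"
  shows "HH R (insert x V) - HH R V = integral {0..R} (\<lambda>r. 1 - real (nbc r x V))"
proof -
  have "HH R (insert x V) - HH R V
    = integral {0..R} (\<lambda>r. real (kap r (insert x V)) - real (kap r V))"
    unfolding HH_def by (intro integral_diff[symmetric] kap_integrable) (use assms in auto)
  also have "\<dots> = integral {0..R} (\<lambda>r. 1 - real (nbc r x V))"
  proof (rule integral_cong)
    fix r assume "r \<in> {0..R}"
    then show "real (kap r (insert x V)) - real (kap r V) = 1 - real (nbc r x V)"
      using kap_insert[OF assms, of r] by simp
  qed
  finally show ?thesis .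
qed

lemma HH_empty [simp]: "HH R {} = 0"
  by (simp add: HH_def)

lemma integral_between:
  fixes f :: "real \<Rightarrow> real"
  assumes "f integrable_on {0..R}" "0 \<le> R" "\<And>r. r \<in> {0..R} \<Longrightarrow> a \<le> f r" "\<And>r. r \<in> {0..R} \<Longrightarrow> f r \<le> b"
  shows "a * R \<le> integral {0..R} f" "integral {0..R} f \<le> b * R"
proof -
  have "integral {0..R} (\<lambda>_. a) \<le> integral {0..R} f"
    by (rule integral_le[OF integrable_const_ivl assms(1,3)])
  then show "a * R \<le> integral {0..R} f"
    using assms(2) by (simp add: mult.commute)
  have "integral {0..R} f \<le> integral {0..R} (\<lambda>_. b)"
    by (rule integral_le[OF assms(1) integrable_const_ivl assms(4)])
  then show "integral {0..R} f \<le> b * R"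
    using assms(2) by (simp add: mult.commute)
qed

lemma HH_insert_abs_le:
  fixes V :: "(real ^ 'd) set"
  assumes "finite V" "0 \<le> R"
  shows "\<bar>HH R (insert x V) - HH R V\<bar> \<le> pack TYPE('d) * R"
proof (cases "x \<in> V")
  case True
  then show ?thesis using assms pack_ge_1[where 'd='d] by (simp add: insert_absorb)
next
  case False
  have i: "(\<lambda>r. 1 - real (nbc r x V)) integrable_on {0..R}"
    using nbc_integrable[OF assms(1) False] by (intro integrable_diff) auto
  have b: "- pack TYPE('d) \<le> 1 - real (nbc r x V)" "1 - real (nbc r x V) \<le> pack TYPE('d)"
    if "r \<in> {0..R}" for r
    using nbc_le_pack[OF assms(1) _ False, of r] pack_ge_1[where 'd='d] that by auto
  show ?thesis
    using integral_between[OF i assms(2) b] HH_insert[OF assms(1) False, of R]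
      by (simp add: abs_le_iff)
qed

lemma DD_HH_Int:
  assumes "x \<in> B"
  shows "DD x (\<lambda>S. HH R (S \<inter> B)) S = HH R (insert x ((S - {x}) \<inter> B)) - HH R ((S - {x}) \<inter> B)"
proof -
  have "insert x S \<inter> B = insert x ((S - {x}) \<inter> B)" using assms by auto
  then show ?thesis by (simp add: DD_def)
qed

lemma DD_HH_Int_notin:
  assumes "x \<notin> B"
  shows "DD x (\<lambda>S. HH R (S \<inter> B)) S = 0"
proof -
  have "insert x S \<inter> B = S \<inter> B" "(S - {x}) \<inter> B = S \<inter> B" using assms by auto
  then show ?thesis by (simp add: DD_def)
qed

lemma DD_HH_Int_abs_le:
  fixes S :: "(real ^ 'd) set"
  assumes "finite S" "0 \<le> R"
  shows "\<bar>DD x (\<lambda>S. HH R (S \<inter> B)) S\<bar> \<le> pack TYPE('d) * R"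
proof (cases "x \<in> B")
  case True
  show ?thesis
    unfolding DD_HH_Int[OF True] by (rule HH_insert_abs_le) (use assms in auto)
next
  case False
  then show ?thesis
    using assms pack_ge_1[where 'd='d] by (simp add: DD_HH_Int_notin)
qed

lemma DD_diff: "DD x (\<lambda>S. f S - g S) S = DD x f S - DD x g S"
  by (simp add: DD_def)

lemma DD_sum: "DD x (\<lambda>S. \<Sum>i\<in>I. f i S) S = (\<Sum>i\<in>I. DD x (f i) S)"
  by (simp add: DD_def sum_subtractf)

section \<open>Block systems\<close>

text \<open>All geometry is condensed in \<open>closed\<close>: off \<open>bd\<close>, a point has
  its neighbours up to scale \<open>R\<close> in its own block. The estimates pay for the
  cardinality of \<open>bd\<close>.\<close>

locale block_system =
  fixes V :: "(real ^ 'd) set" and J :: "'j set" and Q :: "'j \<Rightarrow> (real ^ 'd) set"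
    and bd :: "(real ^ 'd) set" and R C1 :: real
  assumes finV: "finite V" and finJ: "finite J" and V_eq: "V = (\<Union>j\<in>J. Q j)"
    and disj: "disjoint_family_on Q J" and bd: "bd \<subseteq> V" and R: "0 \<le> R"
    and closed: "\<And>j x y. j \<in> J \<Longrightarrow> x \<in> Q j \<Longrightarrow> x \<notin> bd \<Longrightarrow> y \<in> V \<Longrightarrow> dist x y \<le> R \<Longrightarrow> y \<in> Q j"
    and C1: "C1 = pack TYPE('d) * R"
begin

text \<open>\<open>A\<close> and \<open>I\<close> vary because two gaps are compared: that of the
  cube \<open>V\<close> with all blocks, where the density is selected, and that of a smaller window
  with the blocks inside it.\<close>

definition GA :: "(real ^ 'd) set \<Rightarrow> 'j set \<Rightarrow> (real ^ 'd) set \<Rightarrow> real" where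
  "GA A I S = HH R (S \<inter> A) - (\<Sum>j\<in>I. HH R (S \<inter> Q j))"

definition BB :: "(real ^ 'd) set \<Rightarrow> real" where
  "BB S = (\<Sum>j\<in>J. HH R (S \<inter> Q j))"

abbreviation "G \<equiv> GA V J"

lemma C1_nonneg: "0 \<le> C1"
  using R pack_ge_1[where 'd='d] by (simp add: C1)

lemma DD_Int_abs_le:
  fixes S :: "(real ^ 'd) set"
  shows "finite S \<Longrightarrow> \<bar>DD x (\<lambda>S. HH R (S \<inter> B)) S\<bar> \<le> C1"
  using DD_HH_Int_abs_le[of S R x B] R by (simp add: C1)

lemma in_block: "x \<in> V \<Longrightarrow> \<exists>j\<in>J. x \<in> Q j"
  using V_eq by blast

lemma Q_subset: "j \<in> J \<Longrightarrow> Q j \<subseteq> V"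
  using V_eq by auto

lemma Q_unique: "i \<in> J \<Longrightarrow> j \<in> J \<Longrightarrow> x \<in> Q i \<Longrightarrow> x \<in> Q j \<Longrightarrow> i = j"
  using disj by (auto simp: disjoint_family_on_def)

lemma DD_block_sum:
  assumes "I \<subseteq> J" "j \<in> J" "x \<in> Q j"
  shows "DD x (\<lambda>S. \<Sum>i\<in>I. HH R (S \<inter> Q i)) S =
    (if j \<in> I then DD x (\<lambda>S. HH R (S \<inter> Q j)) S else 0)"
proof -
  have "DD x (\<lambda>S. HH R (S \<inter> Q i)) S = (if i = j then DD x (\<lambda>S. HH R (S \<inter> Q j)) S else 0)"
    if "i \<in> I" for i
  proof (cases "i = j")
    case False
    then have "x \<notin> Q i" using that assms Q_unique[of i j x] by blast
    then show ?thesis using False by (simp add: DD_HH_Int_notin)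
  qed simp
  then have "(\<Sum>i\<in>I. DD x (\<lambda>S. HH R (S \<inter> Q i)) S) =
      (\<Sum>i\<in>I. if i = j then DD x (\<lambda>S. HH R (S \<inter> Q j)) S else 0)"
    by (intro sum.cong) auto
  then show ?thesis
    using finite_subset[OF assms(1) finJ] by (simp add: DD_sum)
qed

lemma DD_GA_abs_le:
  assumes "I \<subseteq> J" "x \<in> V" "finite S"
  shows "\<bar>DD x (GA A I) S\<bar> \<le> 2 * C1"
proof -
  obtain j where j: "j \<in> J" "x \<in> Q j" using in_block assms(2) by blast
  have "DD x (GA A I) S = DD x (\<lambda>S. HH R (S \<inter> A)) S
    - (if j \<in> I then DD x (\<lambda>S. HH R (S \<inter> Q j)) S else 0)"
    unfolding GA_def DD_diff DD_block_sum[OF assms(1) j] ..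
  then show ?thesis
    using DD_Int_abs_le[OF assms(3), of x A] DD_Int_abs_le[OF assms(3), of x "Q j"] C1_nonneg
    by (auto split: if_splits)
qed

lemma DD_GA_eq:
  assumes "I \<subseteq> J" "A \<subseteq> V" "j \<in> I" "Q j \<subseteq> A" "x \<in> Q j" "S \<subseteq> V"
  shows "DD x (GA A I) S = integral {0..R} (\<lambda>r. real (nbc r x ((S - {x}) \<inter> Q j))
    - real (nbc r x ((S - {x}) \<inter> A)))"
proof -
  have fin: "finite S" using assms(6) finV finite_subset by auto
  let ?T = "S - {x}"
  have j: "j \<in> J" using assms by auto
  have xA: "x \<in> A" using assms by auto
  have int: "(\<lambda>r. 1 - real (nbc r x (?T \<inter> B))) integrable_on {0..R}" for B
    using fin by (intro integrable_diff nbc_integrable) auto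
  have "DD x (GA A I) S = DD x (\<lambda>S. HH R (S \<inter> A)) S - DD x (\<lambda>S. HH R (S \<inter> Q j)) S"
    unfolding GA_def DD_diff DD_block_sum[OF assms(1) j assms(5)] using assms(3) by simp
  also have "\<dots> = integral {0..R} (\<lambda>r. 1 - real (nbc r x (?T \<inter> A))) -
      integral {0..R} (\<lambda>r. 1 - real (nbc r x (?T \<inter> Q j)))"
    unfolding DD_HH_Int[OF xA] DD_HH_Int[OF assms(5)] using fin by (simp add: HH_insert)
  also have "\<dots> = integral {0..R} (\<lambda>r. (1 - real (nbc r x (?T \<inter> A)))
    - (1 - real (nbc r x (?T \<inter> Q j))))"
    by (rule integral_diff[symmetric]) (rule int)+
  finally show ?thesis by (simp add: algebra_simps)
qed

text \<open>The neighbours of \<open>x\<close> lie in \<open>Q j\<close>, and passing from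
  \<open>Q j\<close> to \<open>A\<close> and on to \<open>V\<close> only adds connections between
  them; the upper bound \<open>C1\<close> is the packing bound. The last inequality lets a density
  selected on \<open>V\<close> control every smaller window.\<close>

lemma DD_GA_bounds:
  assumes "I \<subseteq> J" "A \<subseteq> V" "j \<in> I" "Q j \<subseteq> A" "x \<in> Q j" "x \<notin> bd" "S \<subseteq> V"
  shows "0 \<le> DD x (GA A I) S" "DD x (GA A I) S \<le> C1" "DD x (GA A I) S \<le> DD x G S"
proof -
  have fin: "finite S" using assms(7) finV finite_subset by auto
  let ?T = "S - {x}"
  let ?f = "\<lambda>A r. real (nbc r x (?T \<inter> Q j)) - real (nbc r x (?T \<inter> A))"
  have j: "j \<in> J" using assms by auto
  have ball: "?T \<inter> cball x r \<subseteq> Q j" if "r \<in> {0..R}" for r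
    using closed[OF j assms(5,6)] that assms(7) by auto
  have int: "?f B integrable_on {0..R}" for B
    using fin by (intro integrable_diff nbc_integrable) auto
  have b1: "0 \<le> ?f A r" if r: "r \<in> {0..R}" for r
    using nbc_antimono[of "?T \<inter> A" "?T \<inter> Q j" x r] fin ball[OF r] assms(4) by auto
  have b2: "?f A r \<le> pack TYPE('d)" if r: "r \<in> {0..R}" for r
    using nbc_le_pack[of "?T \<inter> Q j" r x] fin r by auto
  have b3: "?f A r \<le> ?f V r" if r: "r \<in> {0..R}" for r
    using nbc_antimono[of "?T \<inter> V" "?T \<inter> A" x r] fin ball[OF r] assms(2,4) by auto
  have *: "DD x (GA A I) S = integral {0..R} (?f A)"
    by (rule DD_GA_eq) (use assms in auto)
  have **: "DD x G S = integral {0..R} (?f V)"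
    by (rule DD_GA_eq) (use assms j Q_subset in auto)
  show "0 \<le> DD x (GA A I) S" "DD x (GA A I) S \<le> C1"
    using integral_between[OF int R b1 b2] * by (auto simp: C1)
  show "DD x (GA A I) S \<le> DD x G S"
    unfolding * ** by (rule integral_le[OF int int b3])
qed

text \<open>Without points in \<open>bd\<close> no edge of length at most \<open>R\<close> joins two
  blocks, so inserting points one at a time never changes the gap. Each point of \<open>bd\<close>
  then changes it by at most \<open>2 * C1\<close>.\<close>

lemma G_abs_le:
  assumes "S \<subseteq> V"
  shows "\<bar>G S\<bar> \<le> 2 * C1 * real (card (S \<inter> bd))"
proof -
  have zero: "G T = 0" if "finite T" "T \<subseteq> V" "T \<inter> bd = {}" for T
    using that
  proof (induction T rule: finite_induct)
    case empty
    then show ?case by (simp add: GA_def)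
  next
    case (insert x T)
    then obtain j where j: "j \<in> J" "x \<in> Q j" using in_block by blast
    have eq: "nbc r x (T \<inter> Q j) = nbc r x (T \<inter> V)" if "r \<in> {0..R}" for r
    proof -
      have "nbc r x (T \<inter> Q j) = nbc r x T"
      proof (rule nbc_closed)
        show "T \<inter> cball x r \<subseteq> Q j"
          using closed[OF j] insert.prems that by auto
        show "z \<in> Q j" if "y \<in> T \<inter> Q j" "z \<in> T" "dist y z \<le> r" for y z
          using closed[OF j(1), of y z] insert.prems that \<open>r \<in> {0..R}\<close> by auto
      qed (use insert in auto)
      then show ?thesis using insert.prems by (simp add: Int_absorb2)
    qed
    have "DD x G (insert x T)
      = integral {0..R} (\<lambda>r. real (nbc r x (T \<inter> Q j)) - real (nbc r x (T \<inter> V)))"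
      using DD_GA_eq[of J V j x "insert x T"] insert j Q_subset by auto
    also have "\<dots> = integral {0..R} (\<lambda>r. 0)"
      by (rule integral_cong) (simp add: eq)
    finally have "G (insert x T) = G T"
      using insert.hyps by (simp add: DD_def)
    then show ?case using insert by simp
  qed
  have fin: "finite S" using assms finV finite_subset by auto
  have "\<bar>G ((S - bd) \<union> T)\<bar> \<le> 2 * C1 * real (card T)" if "finite T" "T \<subseteq> S \<inter> bd" for T
    using that
  proof (induction T rule: finite_induct)
    case empty
    have "G (S - bd) = 0"
      by (rule zero) (use fin assms in auto)
    then show ?case by simp
  next
    case (insert x T)
    let ?U = "(S - bd) \<union> T"
    have "\<bar>DD x G ?U\<bar> \<le> 2 * C1"
      by (rule DD_GA_abs_le) (use insert fin assms in auto)
    moreover have "?U - {x} = ?U" using insert by auto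
    ultimately have "\<bar>G (insert x ?U) - G ?U\<bar> \<le> 2 * C1"
      by (simp add: DD_def)
    moreover have "\<bar>G ?U\<bar> \<le> 2 * C1 * real (card T)"
      using insert by auto
    moreover have "2 * C1 * real (card (insert x T)) = 2 * C1 * real (card T) + 2 * C1"
      using insert by (simp add: algebra_simps)
    ultimately show ?case by simp
  qed
  from this[of "S \<inter> bd"] fin have "\<bar>G ((S - bd) \<union> (S \<inter> bd))\<bar> \<le> 2 * C1 * real (card (S \<inter> bd))"
    by auto
  moreover have "(S - bd) \<union> (S \<inter> bd) = S" by auto
  ultimately show ?thesis by simp
qed

lemma Bexp_G_abs_le:
  assumes "0 \<le> p" "p \<le> 1"
  shows "\<bar>Bexp V p G\<bar> \<le> 2 * C1 * p * real (card bd)"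
proof -
  have "\<bar>Bexp V p G\<bar> \<le> Bexp V p (\<lambda>S. \<bar>G S\<bar>)"
    by (rule Bexp_abs_le) (use assms in auto)
  also have "\<dots> \<le> Bexp V p (\<lambda>S. 2 * C1 * real (card (S \<inter> bd)))"
    by (rule Bexp_mono) (use assms G_abs_le in auto)
  also have "\<dots> = 2 * C1 * p * real (card bd)"
    by (simp only: Bexp_cmult Bexp_card_Int[OF finV bd] mult.assoc)
  finally show ?thesis .
qed

text \<open>Costs at points of \<open>bd\<close> have no sign but are bounded. Taking them out of
  the derivative leaves the nonnegative sum that controls the variance.\<close>

lemma sum_interior_le:
  assumes "0 \<le> p" "p \<le> 1"
  shows "(\<Sum>x\<in>V - bd. Bexp V p (DD x G)) \<le> (\<Sum>x\<in>V. Bexp V p (DD x G)) + 2 * C1 * real (card bd)"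
    and "0 \<le> (\<Sum>x\<in>V - bd. Bexp V p (DD x G))"
proof -
  have "\<bar>Bexp V p (DD x G)\<bar> \<le> 2 * C1" if "x \<in> bd" for x
  proof -
    have "\<bar>Bexp V p (DD x G)\<bar> \<le> Bexp V p (\<lambda>S. \<bar>DD x G S\<bar>)"
      by (rule Bexp_abs_le) (use assms in auto)
    also have "\<dots> \<le> Bexp V p (\<lambda>S. 2 * C1)"
      by (intro Bexp_mono DD_GA_abs_le) (use assms that bd finV finite_subset in auto)
    finally show ?thesis by (simp add: Bexp_const finV)
  qed
  then have "(\<Sum>x\<in>bd. - (2 * C1)) \<le> (\<Sum>x\<in>bd. Bexp V p (DD x G))"
    by (intro sum_mono) (metis abs_le_D2 minus_le_iff)
  then have "- (2 * C1 * real (card bd)) \<le> (\<Sum>x\<in>bd. Bexp V p (DD x G))"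
    by (simp add: mult.commute)
  moreover have "(\<Sum>x\<in>V. Bexp V p (DD x G)) = (\<Sum>x\<in>V - bd. Bexp V p (DD x G))
    + (\<Sum>x\<in>bd. Bexp V p (DD x G))"
    by (rule sum.subset_diff[OF bd finV])
  ultimately show "(\<Sum>x\<in>V - bd. Bexp V p (DD x G)) \<le> (\<Sum>x\<in>V. Bexp V p (DD x G))
    + 2 * C1 * real (card bd)"
    by linarith
  show "0 \<le> (\<Sum>x\<in>V - bd. Bexp V p (DD x G))"
  proof (intro sum_nonneg Bexp_nonneg)
    fix x S assume "x \<in> V - bd" "S \<subseteq> V"
    moreover from this obtain j where "j \<in> J" "x \<in> Q j" using in_block by blast
    ultimately show "0 \<le> DD x G S"
      using DD_GA_bounds(1)[of J V j x S] Q_subset by auto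
  qed (use assms in auto)
qed

text \<open>Efron-Stein with linearised squares: at an interior point of a block in \<open>I\<close>
  the cost lies between 0 and \<open>C1\<close>, so its square is at most \<open>C1\<close> times
  the cost, hence at most \<open>C1\<close> times the cost for \<open>V\<close>. Points of
  \<open>bd\<close> and points of \<open>A\<close> outside the blocks are charged the square of
  \<open>2 * C1\<close>.\<close>

lemma Bvar_GA_le:
  assumes p: "0 \<le> p" "p \<le> 1" and I: "I \<subseteq> J" and A: "A \<subseteq> V" and QA: "\<And>j. j \<in> I \<Longrightarrow> Q j \<subseteq> A"
  shows "Bvar V p (GA A I) \<le> p * (C1 * (\<Sum>x\<in>V - bd. Bexp V p (DD x G))
    + (2 * C1)\<^sup>2 * (real (card bd) + real (card (A - (\<Union>j\<in>I. Q j)))))"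
proof -
  let ?L = "A - (\<Union>j\<in>I. Q j)"
  \<comment> \<open>The charges are nonnegative and simply added, so overlaps of the three sets are
    harmless.\<close>
  define w where "w x = (if x \<in> V - bd then C1 * Bexp V p (DD x G) else 0)
      + (if x \<in> bd then (2 * C1)\<^sup>2 else 0) + (if x \<in> ?L then (2 * C1)\<^sup>2 else 0)" for x
  have DG0: "0 \<le> Bexp V p (DD x G)" if x: "x \<in> V - bd" for x
  proof (rule Bexp_nonneg)
    fix S assume "S \<subseteq> V"
    obtain j where "j \<in> J" "x \<in> Q j" using in_block x by blast
    then show "0 \<le> DD x G S"
      using DD_GA_bounds(1)[of J V j x S] Q_subset \<open>S \<subseteq> V\<close> x by auto
  qed (use p in auto)
  have pt: "Bexp V p (\<lambda>S. (DD x (GA A I) S)\<^sup>2) \<le> w x" if x: "x \<in> V" for x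
  proof -
    have w0: "0 \<le> w x"
      using DG0 C1_nonneg by (auto simp: w_def)
    have wbig: "(2 * C1)\<^sup>2 \<le> w x" if "x \<in> bd \<or> x \<in> ?L"
      using that DG0[of x] C1_nonneg x by (auto simp: w_def)
    consider "x \<in> bd \<or> x \<in> ?L" | "x \<notin> bd" "x \<notin> A" | j where "x \<notin> bd" "j \<in> I" "x \<in> Q j" by blast
    then show ?thesis
    proof cases
      case 1
      have "Bexp V p (\<lambda>S. (DD x (GA A I) S)\<^sup>2) \<le> Bexp V p (\<lambda>S. (2 * C1)\<^sup>2)"
      proof (rule Bexp_mono)
        fix S assume "S \<subseteq> V"
        then have "\<bar>DD x (GA A I) S\<bar> \<le> 2 * C1"
          by (intro DD_GA_abs_le) (use I x finV finite_subset in auto)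
        then show "(DD x (GA A I) S)\<^sup>2 \<le> (2 * C1)\<^sup>2"
          by (metis abs_ge_zero power2_abs power_mono)
      qed (use p in auto)
      then show ?thesis using wbig[OF 1] by (simp add: Bexp_const finV)
    next
      case 2
      have "DD x (GA A I) S = 0" for S
      proof -
        have "x \<notin> Q j" if "j \<in> I" for j using QA[OF that] 2 by auto
        then show ?thesis
          unfolding GA_def DD_diff DD_sum using 2 by (simp add: DD_HH_Int_notin)
      qed
      then show ?thesis using w0 by (simp add: Bexp_const finV)
    next
      case 3
      have "Bexp V p (\<lambda>S. (DD x (GA A I) S)\<^sup>2) \<le> Bexp V p (\<lambda>S. C1 * DD x G S)"
      proof (rule Bexp_mono)
        fix S assume S: "S \<subseteq> V"
        note b = DD_GA_bounds[OF I A 3(2) QA[OF 3(2)] 3(3,1) S]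
        show "(DD x (GA A I) S)\<^sup>2 \<le> C1 * DD x G S"
          unfolding power2_eq_square using b C1_nonneg by (intro mult_mono) auto
      qed (use p in auto)
      also have "\<dots> = C1 * Bexp V p (DD x G)" by (rule Bexp_cmult)
      also have "\<dots> \<le> w x" using 3 x by (simp add: w_def)
      finally show ?thesis .
    qed
  qed
  have "Bvar V p (GA A I) \<le> p * (1 - p) * (\<Sum>x\<in>V. Bexp V p (\<lambda>S. (DD x (GA A I) S)\<^sup>2))"
    by (rule efron_stein[OF finV p])
  also have "\<dots> \<le> p * (\<Sum>x\<in>V. Bexp V p (\<lambda>S. (DD x (GA A I) S)\<^sup>2))"
  proof (rule mult_right_mono)
    show "p * (1 - p) \<le> p" using p mult_left_le[of "1 - p" p] by simp
    show "0 \<le> (\<Sum>x\<in>V. Bexp V p (\<lambda>S. (DD x (GA A I) S)\<^sup>2))"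
      by (intro sum_nonneg Bexp_nonneg) (use p in auto)
  qed
  also have "\<dots> \<le> p * (\<Sum>x\<in>V. w x)"
    by (intro mult_left_mono sum_mono pt) (use p in auto)
  also have "(\<Sum>x\<in>V. w x) = C1 * (\<Sum>x\<in>V - bd. Bexp V p (DD x G)) +
      (2 * C1)\<^sup>2 * (real (card bd) + real (card ?L))"
  proof -
    have "V \<inter> (V - bd) = V - bd" "V \<inter> bd = bd" "V \<inter> ?L = ?L" using bd A by auto
    then show ?thesis
      unfolding w_def sum.distrib using finV
      by (simp only: sum.inter_restrict[OF finV, symmetric])
        (simp add: sum_distrib_left distrib_left)
  qed
  finally show ?thesis .
qed

lemma Bexp_BB_derivative_le:
  assumes "0 \<le> p" "p \<le> 1"
  shows "(\<Sum>x\<in>V. Bexp V p (DD x BB)) \<le> C1 * real (card V)"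
proof -
  have "Bexp V p (DD x BB) \<le> C1" if x: "x \<in> V" for x
  proof -
    obtain j where j: "j \<in> J" "x \<in> Q j" using in_block x by blast
    have "Bexp V p (DD x BB) \<le> Bexp V p (\<lambda>_. C1)"
    proof (rule Bexp_mono)
      fix S assume "S \<subseteq> V"
      then have "finite S" using finV finite_subset by auto
      then show "DD x BB S \<le> C1"
        unfolding BB_def DD_block_sum[OF subset_refl j]
        using DD_Int_abs_le[of S x "Q j"] j by (simp add: abs_le_iff)
    qed (use assms in auto)
    then show ?thesis by (simp add: Bexp_const finV)
  qed
  then have "(\<Sum>x\<in>V. Bexp V p (DD x BB)) \<le> (\<Sum>x\<in>V. C1)"
    by (rule sum_mono)
  then show ?thesis by (simp add: mult.commute)
qed

text \<open>Both bounds come from one application of the mean value theorem, to \<open>BB - \<theta> * G\<close>.\<close>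

lemma good_parameter:
  assumes p0: "0 < p0" and B: "2 \<le> B" and Bp: "B * p0 \<le> 1" and c: "0 < c" and e: "0 < e"
    and e_bd: "8 * C1 * real (card bd) \<le> e" and V: "V \<noteq> {}"
    and incr: "Bexp V (B * p0) BB - Bexp V p0 BB \<ge> 2 * c * (B - 1) * p0 * real (card V)"
  shows "\<exists>p. p0 \<le> p \<and> p \<le> B * p0 \<and> (\<Sum>x\<in>V. Bexp V p (DD x BB)) \<ge> c * real (card V)
    \<and> (\<Sum>x\<in>V. Bexp V p (DD x G)) \<le> 2 * C1 * e / c"
proof -
  define v where "v = real (card V)"
  have v: "v > 0" using V finV by (simp add: v_def card_gt_0_iff)
  \<comment> \<open>This weight balances the two conclusions: the increment of
    \<open>\<theta> * G\<close> can consume at most a quarter of that of \<open>BB\<close>, and the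
    bound \<open>C1 * v\<close> on the derivative of \<open>BB\<close> turns into
    \<open>C1 * v / \<theta> = 2 * C1 * e / c\<close> for that of \<open>G\<close>.\<close>
  define \<theta> where "\<theta> = c * v / (2 * e)"
  have \<theta>: "\<theta> > 0" "\<theta> * e = c * v / 2" using c v e by (auto simp: \<theta>_def)
  let ?b = "\<lambda>p. Bexp V p BB" and ?g = "\<lambda>p. Bexp V p G"
  let ?b' = "\<lambda>p. \<Sum>x\<in>V. Bexp V p (DD x BB)" and ?g' = "\<lambda>p. \<Sum>x\<in>V. Bexp V p (DD x G)"
  have lt: "p0 < B * p0" using p0 B by simp
  have "\<exists>p>p0. p < B * p0 \<and> (?b (B * p0) - \<theta> * ?g (B * p0)) - (?b p0 - \<theta> * ?g p0)
      = (B * p0 - p0) * (?b' p - \<theta> * ?g' p)"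
    by (rule MVT2[OF lt])
      (auto intro!: derivative_eq_intros Bexp_has_derivative finV)
  then obtain p where p: "p0 < p" "p < B * p0" and
    mvt: "(?b (B * p0) - \<theta> * ?g (B * p0)) - (?b p0 - \<theta> * ?g p0)
      = (B * p0 - p0) * (?b' p - \<theta> * ?g' p)"
    by blast
  have p01: "0 \<le> p" "p \<le> 1" using p p0 Bp by auto
  let ?D = "(B - 1) * p0"
  have D: "?D > 0" using p0 B by simp
  define z where "z = C1 * real (card bd)"
  have z: "0 \<le> z" "8 * z \<le> e" using C1_nonneg e_bd by (auto simp: z_def)
  have "\<bar>?g p0\<bar> \<le> 2 * z * p0" "\<bar>?g (B * p0)\<bar> \<le> 2 * z * (B * p0)"
    using Bexp_G_abs_le[of p0] Bexp_G_abs_le[of "B * p0"] p0 Bp B lt by (simp_all add: z_def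
      mult_ac)
  then have "?g (B * p0) - ?g p0 \<le> 2 * z * (B + 1) * p0"
    by (simp add: abs_le_iff algebra_simps)
  \<comment> \<open>Here \<open>2 \<le> B\<close> enters: \<open>B + 1 \<le> 3 * (B - 1)\<close>
    compares the two endpoint values of \<open>G\<close> with the length of the interval.\<close>
  also have "\<dots> \<le> 2 * z * (3 * (B - 1)) * p0"
    using z p0 B by (intro mult_right_mono mult_left_mono) auto
  also have "\<dots> = 6 * z * ?D" by simp
  also have "\<dots> \<le> e * ?D"
    using z D by (intro mult_right_mono) auto
  finally have dg: "?g (B * p0) - ?g p0 \<le> e * ?D" .
  then have "\<theta> * (?g (B * p0) - ?g p0) \<le> \<theta> * (e * ?D)"
    using \<theta> by (intro mult_left_mono) auto
  also have "\<dots> = c * v / 2 * ?D"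
    using \<theta> by (metis mult.assoc)
  finally have 1: "\<theta> * (?g (B * p0) - ?g p0) \<le> c * v / 2 * ?D" .
  have "?D * (?b' p - \<theta> * ?g' p) = (?b (B * p0) - ?b p0) - \<theta> * (?g (B * p0) - ?g p0)"
    using mvt by (simp only: left_diff_distrib right_diff_distrib mult_1)
  also have "\<dots> \<ge> 2 * c * v * ?D - c * v / 2 * ?D"
  proof -
    have "2 * c * (B - 1) * p0 * real (card V) = 2 * c * v * ?D" by (simp add: v_def)
    then show ?thesis using 1 incr by linarith
  qed
  finally have "?D * (?b' p - \<theta> * ?g' p) \<ge> (2 * c * v - c * v / 2) * ?D"
    by (simp only: left_diff_distrib)
  then have slope: "?b' p - \<theta> * ?g' p \<ge> 2 * c * v - c * v / 2"
    unfolding mult.commute[of _ ?D] using D by (rule mult_left_le_imp_le)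
  \<comment> \<open>Interior costs are nonnegative, so the derivative of \<open>G\<close> cannot be
    very negative, and the lower bound for the combined slope passes to \<open>BB\<close>.\<close>
  have "- (2 * z) \<le> ?g' p"
    using sum_interior_le[OF p01] by (simp add: z_def)
  then have "- e \<le> ?g' p" using z e by linarith
  then have "\<theta> * (- e) \<le> \<theta> * ?g' p"
    using \<theta> by (intro mult_left_mono) auto
  then have low: "- (c * v / 2) \<le> \<theta> * ?g' p" using \<theta> by simp
  have bl: "?b' p \<ge> c * v" using slope low by (simp add: algebra_simps)
  have "\<theta> * ?g' p \<le> C1 * v"
    using Bexp_BB_derivative_le[OF p01] slope c v mult_pos_pos[OF c v] unfolding v_def by linarith
  then have "?g' p \<le> C1 * v / \<theta>"
    using \<theta> by (simp add: field_simps)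
  also have "\<dots> = 2 * C1 * e / c"
    using v c e by (simp add: \<theta>_def field_simps)
  finally show ?thesis
    using p bl unfolding v_def by (intro exI[of _ p]) auto
qed

end

section \<open>Lindeberg's method\<close>

definition Phi :: "real \<Rightarrow> real" where
  "Phi = cdf std_normal_distribution"

interpretation std_normal: real_distribution std_normal_distribution
  by (rule real_dist_normal_dist)

lemma Phi_mono: "x \<le> y \<Longrightarrow> Phi x \<le> Phi y"
  unfolding Phi_def by (rule std_normal.cdf_nondecreasing)

lemma Phi_nonneg: "0 \<le> Phi x"
  unfolding Phi_def by (rule std_normal.cdf_nonneg)

lemma Phi_le_1: "Phi x \<le> 1"
  unfolding Phi_def by (rule std_normal.cdf_bounded_prob)

lemma continuous_std_normal_density: "continuous_on A std_normal_density"
  unfolding std_normal_density_def by (intro continuous_intros) auto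

lemma Phi_has_derivative: "(Phi has_real_derivative std_normal_density t) (at t)"
proof -
  \<comment> \<open>Integrating from \<open>t - 1\<close> instead of minus infinity keeps the
    density on a compact interval.\<close>
  define a where "a = t - 1"
  define b where "b = t + 1"
  have diff: "Phi x = Phi a + integral {a..x} std_normal_density" if "a < x" for x
  proof -
    have "Phi x - Phi a = measure std_normal_distribution {a<..x}"
      unfolding Phi_def by (rule std_normal.cdf_diff_eq[OF that])
    also have "\<dots> = (\<integral>y. indicator {a<..x} y \<partial>std_normal_distribution)"
      by simp
    also have "\<dots> = (\<integral>y. std_normal_density y * indicator {a<..x} y \<partial>lborel)"
      by (subst integral_density) auto
    also have "\<dots> = (\<integral>y. indicator {a..x} y *\<^sub>R std_normal_density y \<partial>lborel)"
    proof (rule integral_cong_AE)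
      have "AE y in lborel. y \<noteq> a" by (rule AE_lborel_singleton)
      then show "AE y in lborel. std_normal_density y * indicator {a<..x} y
        = indicator {a..x} y *\<^sub>R std_normal_density y"
        by eventually_elim (auto simp: indicator_def)
    qed auto
    also have "\<dots> = integral {a..x} std_normal_density"
      using set_borel_integral_eq_integral(2)[of "{a..x}" std_normal_density]
        borel_integrable_atLeastAtMost'[OF continuous_std_normal_density, of a x]
      by (simp add: set_lebesgue_integral_def)
    finally show ?thesis by simp
  qed
  have "((\<lambda>x. integral {a..x} std_normal_density) has_real_derivative std_normal_density t)
    (at t within {a..b})"
    by (rule integral_has_real_derivative[OF continuous_std_normal_density])
      (auto simp: a_def b_def)
  then have "((\<lambda>x. integral {a..x} std_normal_density) has_real_derivative std_normal_density t)
    (at t)"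
    by (subst (asm) at_within_interior) (auto simp: a_def b_def)
  then have "((\<lambda>x. Phi a + integral {a..x} std_normal_density) has_real_derivative
    std_normal_density t) (at t)"
    by (auto intro!: derivative_eq_intros)
  then show ?thesis
  proof (rule has_field_derivative_transform_within_open[where S = "{a<..}"])
    show "t \<in> {a<..}" by (simp add: a_def)
  qed (use diff in auto)
qed

lemma std_normal_density_has_derivative:
  "(std_normal_density has_real_derivative - t * std_normal_density t) (at t)"
  unfolding std_normal_density_def
  by (auto intro!: derivative_eq_intros simp: field_simps power2_eq_square)

lemma std_normal_density_le: "std_normal_density z \<le> 1 / 2"
proof -
  have "2 \<le> sqrt (2 * pi)"
    using pi_gt3 by (intro real_le_rsqrt) auto
  then have "1 / sqrt (2 * pi) \<le> 1 / 2"
    by (intro divide_left_mono) (auto intro: mult_pos_pos)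
  moreover have "exp (- z\<^sup>2 / 2) \<le> 1" by simp
  ultimately have "1 / sqrt (2 * pi) * exp (- z\<^sup>2 / 2) \<le> 1 / 2 * 1"
    by (intro mult_mono) auto
  then show ?thesis by (simp add: std_normal_density_def)
qed

lemma std_normal_density_sq_le: "z\<^sup>2 * std_normal_density z \<le> 1"
  and std_normal_density_4_le: "z ^ 4 * std_normal_density z \<le> 4"
proof -
  let ?w = "z\<^sup>2 / 2" and ?c = "1 / sqrt (2 * pi)"
  have c: "0 \<le> ?c" "?c \<le> 1 / 2"
    using std_normal_density_le[of 0] by (auto simp: std_normal_density_def)
  have e: "exp (- ?w) * exp ?w = 1" by (simp flip: exp_add)
  have "?w \<le> exp ?w"
    using exp_ge_add_one_self[of ?w] by linarith
  then have "exp (- ?w) * ?w \<le> exp (- ?w) * exp ?w" by (intro mult_left_mono) auto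
  then have 1: "z\<^sup>2 * exp (- ?w) \<le> 2" unfolding e by (simp add: mult.commute)
  have "?w\<^sup>2 / 2 \<le> exp ?w"
    using exp_lower_Taylor_quadratic[of ?w] zero_le_power2[of z] by linarith
  then have "exp (- ?w) * (?w\<^sup>2 / 2) \<le> exp (- ?w) * exp ?w" by (intro mult_left_mono) auto
  moreover have "exp (- ?w) * (?w\<^sup>2 / 2) = z ^ 4 * exp (- ?w) / 8"
    by (simp add: power_divide)
  ultimately have 2: "z ^ 4 * exp (- ?w) \<le> 8" unfolding e by linarith
  have "?c * (z\<^sup>2 * exp (- ?w)) \<le> 1 / 2 * 2" using c 1 by (intro mult_mono) auto
  then show "z\<^sup>2 * std_normal_density z \<le> 1" by (simp add: std_normal_density_def mult_ac)
  have "?c * (z ^ 4 * exp (- ?w)) \<le> 1 / 2 * 8" using c 2 by (intro mult_mono) auto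
  then show "z ^ 4 * std_normal_density z \<le> 4" by (simp add: std_normal_density_def mult_ac)
qed

lemma std_normal_density_abs_le: "\<bar>z\<bar> * std_normal_density z \<le> 1"
  and std_normal_density_cube_le: "\<bar>z\<bar> ^ 3 * std_normal_density z \<le> 4"
proof -
  have "\<bar>z\<bar> * std_normal_density z \<le> max 1 (z\<^sup>2) * std_normal_density z"
  proof (rule mult_right_mono)
    have "\<bar>z\<bar> \<le> \<bar>z\<bar>\<^sup>2" if "1 \<le> \<bar>z\<bar>"
      using self_le_power[OF that, of 2] by simp
    then show "\<bar>z\<bar> \<le> max 1 (z\<^sup>2)" by (cases "1 \<le> \<bar>z\<bar>") (auto simp: max_def)
  qed simp
  also have "\<dots> \<le> 1"
    using std_normal_density_le[of z] std_normal_density_sq_le[of z] by (auto simp: max_def)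
  finally show "\<bar>z\<bar> * std_normal_density z \<le> 1" .
  have "\<bar>z\<bar> ^ 3 * std_normal_density z \<le> max 1 (z ^ 4) * std_normal_density z"
  proof (rule mult_right_mono)
    have "\<bar>z\<bar> ^ 3 \<le> \<bar>z\<bar> ^ 4" if "1 \<le> \<bar>z\<bar>"
      using that by (intro power_increasing) auto
    moreover have "\<bar>z\<bar> ^ 3 \<le> 1" if "\<not> 1 \<le> \<bar>z\<bar>"
      using that by (intro power_le_one) auto
    ultimately show "\<bar>z\<bar> ^ 3 \<le> max 1 (z ^ 4)" by (cases "1 \<le> \<bar>z\<bar>") (auto simp: max_def)
  qed simp
  also have "\<dots> \<le> 4"
    using std_normal_density_le[of z] std_normal_density_4_le[of z] by (auto simp: max_def)
  finally show "\<bar>z\<bar> ^ 3 * std_normal_density z \<le> 4" .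
qed

text \<open>Taylor's formula with third derivative
  \<open>(z\<^sup>2 - 1) * std_normal_density z\<close>, which is at most 1 in absolute
  value.\<close>

lemma Phi_taylor:
  "\<bar>Phi (s + w) - Phi s - w * std_normal_density s + w\<^sup>2 / 2 * (s * std_normal_density s)\<bar>
    \<le> \<bar>w\<bar> ^ 3"
proof (cases "w = 0")
  case False
  define diff where "diff m = (if m = 0 then Phi else if m = 1 then std_normal_density else
     if m = 2 then (\<lambda>z. - z * std_normal_density z) else (\<lambda>z. (z\<^sup>2 - 1) * std_normal_density z))"
    for m :: nat
  have d: "(diff m has_real_derivative diff (Suc m) z) (at z)" if "m < 3" for m z
  proof -
    have "m = 0 \<or> m = 1 \<or> m = 2" using that by auto
    moreover have "((\<lambda>z. - z * std_normal_density z) has_real_derivative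
        (z\<^sup>2 - 1) * std_normal_density z) (at z)"
      by (auto intro!: derivative_eq_intros std_normal_density_has_derivative
        simp: power2_eq_square algebra_simps)
    ultimately show ?thesis
      using Phi_has_derivative[of z] std_normal_density_has_derivative[of z]
        by (auto simp: diff_def)
  qed
  obtain t where t: "Phi (s + w) = (\<Sum>m<3. diff m s / fact m * (s + w - s) ^ m)
    + diff 3 t / fact 3 * (s + w - s) ^ 3"
    using Taylor[of 3 diff Phi "min s (s + w)" "max s (s + w)" s "s + w"] d False
    by (auto simp: diff_def split: if_splits)
  have eq: "Phi (s + w) - Phi s - w * std_normal_density s + w\<^sup>2 / 2 * (s * std_normal_density s)
      = diff 3 t / 6 * w ^ 3"
    unfolding t by (simp add: diff_def eval_nat_numeral field_simps)
  have "\<bar>diff 3 t\<bar> \<le> 1"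
  proof -
    have "diff 3 t = t\<^sup>2 * std_normal_density t - std_normal_density t"
      by (simp add: diff_def algebra_simps)
    then show ?thesis
      using std_normal_density_sq_le[of t] std_normal_density_le[of t]
        normal_density_nonneg[of 0 1 t]
          mult_nonneg_nonneg[OF zero_le_power2[of t] normal_density_nonneg[of 0 1 t]]
      by linarith
  qed
  then have "\<bar>diff 3 t / 6\<bar> * \<bar>w\<bar> ^ 3 \<le> 1 * \<bar>w\<bar> ^ 3"
    by (intro mult_right_mono) auto
  then show ?thesis
    unfolding eq abs_mult power_abs by simp
qed simp

text \<open>Expansion in the variance. The function \<open>Phi (a / sqrt v)\<close> solves the heat
  equation: its derivative in \<open>v\<close> is half its second derivative in \<open>a\<close>.
  Hence the linear term in \<open>q\<close> equals the quadratic term of \<open>Phi_taylor\<close>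
  for a perturbation of variance \<open>q\<close>.\<close>

lemma Phi_heat:
  fixes a v q :: real
  assumes "0 < v" "0 \<le> q"
  defines "z \<equiv> a / sqrt v"
  shows "\<bar>Phi (a / sqrt (v + q)) - Phi z + q / (2 * v) * (z * std_normal_density z)\<bar> \<le> q\<^sup>2 / v\<^sup>2"
proof (cases "q = 0")
  case True
  then show ?thesis by (simp add: z_def)
next
  case False
  with assms have q: "0 < q" by simp
  define Z where "Z x = a / sqrt x" for x
  define diff where "diff m = (if m = 0 then (\<lambda>x. Phi (Z x)) else
      if m = 1 then (\<lambda>x. - (Z x * std_normal_density (Z x)) / (2 * x))
      else (\<lambda>x. Z x * std_normal_density (Z x) * (3 - (Z x)\<^sup>2) / (4 * x\<^sup>2)))" for m :: nat
  have dZ: "(Z has_real_derivative - Z x / (2 * x)) (at x)" if "x > 0" for x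
    unfolding Z_def using that
    by (auto intro!: derivative_eq_intros simp: field_simps)
  have dP: "((\<lambda>x. Phi (Z x)) has_real_derivative std_normal_density (Z x) * (- Z x / (2 * x)))
    (at x)"
    if "x > 0" for x
    by (rule DERIV_chain2[OF Phi_has_derivative dZ[OF that]])
  have dD: "((\<lambda>x. std_normal_density (Z x)) has_real_derivative
      (- Z x * std_normal_density (Z x)) * (- Z x / (2 * x))) (at x)" if "x > 0" for x
    by (rule DERIV_chain2[OF std_normal_density_has_derivative dZ[OF that]])
  have d: "(diff m has_real_derivative diff (Suc m) x) (at x)" if "m < 2" "x > 0" for m x
  proof -
    have "m = 0 \<or> m = 1" using that by auto
    then show ?thesis
    proof
      assume m: "m = 0"
      show ?thesis using dP[OF that(2)] by (simp add: m diff_def mult.commute)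
    next
      assume m: "m = 1"
      let ?p = "std_normal_density (Z x)"
      have "((\<lambda>x. - (Z x * std_normal_density (Z x)) / (2 * x)) has_real_derivative
          (- ((- Z x / (2 * x)) * ?p + Z x * ((- Z x * ?p) * (- Z x / (2 * x)))) * (2 * x)
            - (- (Z x * ?p)) * 2) / (2 * x)\<^sup>2) (at x)"
        using that(2) dZ[OF that(2)] dD[OF that(2)]
        by (auto intro!: derivative_eq_intros simp: power2_eq_square) (simp add: field_simps)
      moreover have "(- ((- Z x / (2 * x)) * ?p + Z x * ((- Z x * ?p) * (- Z x / (2 * x))))
        * (2 * x)
            - (- (Z x * ?p)) * 2) / (2 * x)\<^sup>2 = Z x * ?p * (3 - (Z x)\<^sup>2) / (4 * x\<^sup>2)"
        using that(2) by (simp add: field_simps power2_eq_square)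
      ultimately have "((\<lambda>x. - (Z x * std_normal_density (Z x)) / (2 * x)) has_real_derivative
          Z x * ?p * (3 - (Z x)\<^sup>2) / (4 * x\<^sup>2)) (at x)"
        by (rule DERIV_cong)
      then show ?thesis by (simp add: m diff_def)
    qed
  qed
  obtain t where t: "v < t" "Phi (Z (v + q)) = (\<Sum>m<2. diff m v / fact m * (v + q - v) ^ m)
    + diff 2 t / fact 2 * (v + q - v) ^ 2"
  proof -
    have "\<exists>t. (if v + q < v then v + q < t \<and> t < v else v < t \<and> t < v + q) \<and>
        Phi (Z (v + q)) = (\<Sum>m<2. diff m v / fact m * (v + q - v) ^ m) + diff 2 t / fact 2 *
          (v + q - v) ^ 2"
      by (rule Taylor[where a = v and b = "v + q"]) (use d q assms(1) in \<open>auto simp: diff_def\<close>)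
    then show ?thesis using q that by auto
  qed
  have eq: "Phi (a / sqrt (v + q)) - Phi z + q / (2 * v) * (z * std_normal_density z)
    = diff 2 t / 2 * q\<^sup>2"
    using t(2) unfolding Z_def[symmetric] z_def
    by (simp add: diff_def eval_nat_numeral field_simps Z_def)
  have "\<bar>diff 2 t\<bar> \<le> 2 / v\<^sup>2"
  proof -
    let ?p = "std_normal_density (Z t)"
    have p0: "0 \<le> ?p" by simp
    have "\<bar>Z t * ?p * (3 - (Z t)\<^sup>2)\<bar> = \<bar>3 * (Z t * ?p) - Z t ^ 3 * ?p\<bar>"
      by (simp add: algebra_simps power2_eq_square power3_eq_cube)
    also have "\<dots> \<le> 3 * (\<bar>Z t\<bar> * ?p) + \<bar>Z t\<bar> ^ 3 * ?p"
      using abs_triangle_ineq4[of "3 * (Z t * ?p)" "Z t ^ 3 * ?p"] p0 by (simp add: abs_mult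
        power_abs)
    also have "\<dots> \<le> 7"
      using std_normal_density_abs_le[of "Z t"] std_normal_density_cube_le[of "Z t"] by linarith
    finally have "\<bar>diff 2 t\<bar> \<le> 7 / (4 * t\<^sup>2)"
      using t(1) assms(1) by (simp add: diff_def divide_right_mono)
    also have "\<dots> \<le> 7 / (4 * v\<^sup>2)"
      using t(1) assms(1) by (intro divide_left_mono mult_left_mono power_mono) auto
    also have "\<dots> \<le> 2 / v\<^sup>2" using assms(1) by (simp add: field_simps)
    finally show ?thesis .
  qed
  then have "\<bar>diff 2 t / 2\<bar> * q\<^sup>2 \<le> (1 / v\<^sup>2) * q\<^sup>2"
    by (intro mult_right_mono) auto
  then show ?thesis
    unfolding eq abs_mult by simp
qed

lemma Phi_variance_le:
  assumes "1 / 2 \<le> v"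
  shows "\<bar>Phi (a / sqrt v) - Phi a\<bar> \<le> \<bar>v - 1\<bar>"
proof -
  define Z where "Z x = a / sqrt x" for x
  have der: "((\<lambda>x. Phi (Z x)) has_real_derivative std_normal_density (Z x) * (- Z x / (2 * x)))
    (at x)"
    if "x > 0" for x
  proof (rule DERIV_chain2[OF Phi_has_derivative])
    show "(Z has_real_derivative - Z x / (2 * x)) (at x)"
      unfolding Z_def using that by (auto intro!: derivative_eq_intros simp: field_simps)
  qed
  have "norm (Phi (Z v) - Phi (Z 1)) \<le> 1 * norm (v - 1)"
  proof (rule field_differentiable_bound[where S = "{1/2..}"])
    fix x :: real assume x: "x \<in> {1/2..}"
    show "((\<lambda>x. Phi (Z x)) has_field_derivative std_normal_density (Z x) * (- Z x / (2 * x)))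
      (at x within {1/2..})"
      by (rule has_field_derivative_at_within[OF der]) (use x in simp)
    have "\<bar>std_normal_density (Z x) * (- Z x / (2 * x))\<bar>
      = (\<bar>Z x\<bar> * std_normal_density (Z x)) / (2 * x)"
      using x by (simp add: abs_mult)
    also have "\<dots> \<le> 1 / (2 * x)"
      using x std_normal_density_abs_le by (intro divide_right_mono) auto
    also have "\<dots> \<le> 1" using x by simp
    finally show "norm (std_normal_density (Z x) * (- Z x / (2 * x))) \<le> 1" by simp
  qed (use assms in auto)
  then show ?thesis by (simp add: Z_def)
qed

lemma Phi_lipschitz:
  assumes "a \<le> b"
  shows "Phi b - Phi a \<le> b - a"
proof -
  have "norm (Phi b - Phi a) \<le> 1 * norm (b - a)"
  proof (rule field_differentiable_bound[where S = UNIV and f' = std_normal_density])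
    fix x show "norm (std_normal_density x) \<le> 1"
      using std_normal_density_le[of x] by simp
  qed (simp_all add: Phi_has_derivative)
  then show ?thesis using assms by simp
qed

text \<open>Quadratic tails from Chebyshev's inequality suffice, since the smoothing will be much
  narrower than the shift of the threshold.\<close>

lemma Phi_tails:
  assumes "0 < x"
  shows "Phi (- x) \<le> 1 / x\<^sup>2" "1 - Phi x \<le> 1 / x\<^sup>2"
proof -
  let ?N = "std_normal_distribution"
  have e0: "std_normal.expectation (\<lambda>y. y) = 0"
    using integral_std_normal_distribution_moment_odd[of 1] by simp
  have v1: "std_normal.variance (\<lambda>y. y) = 1"
    using std_normal_distribution_even_moments(1)[of 1] e0 by simp
  have "measure ?N {y \<in> space ?N. \<bar>y - std_normal.expectation (\<lambda>y. y)\<bar> \<ge> x}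
    \<le> std_normal.variance (\<lambda>y. y) / x\<^sup>2"
    by (rule std_normal.Chebyshev_inequality)
      (use assms integrable_std_normal_distribution_moment[of 2] in auto)
  then have ch: "measure ?N {y. \<bar>y\<bar> \<ge> x} \<le> 1 / x\<^sup>2"
    using v1 unfolding e0 by simp
  have "Phi (- x) \<le> measure ?N {y. \<bar>y\<bar> \<ge> x}"
    unfolding Phi_def cdf_def by (rule std_normal.finite_measure_mono) auto
  then show "Phi (- x) \<le> 1 / x\<^sup>2" using ch by simp
  have "1 - Phi x = measure ?N (space ?N - {..x})"
    unfolding Phi_def cdf_def by (subst std_normal.prob_compl) auto
  also have "\<dots> \<le> measure ?N {y. \<bar>y\<bar> \<ge> x}"
    by (rule std_normal.finite_measure_mono) auto
  finally show "1 - Phi x \<le> 1 / x\<^sup>2" using ch by simp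
qed

text \<open>Replacing \<open>Y\<close> by an independent normal variable of the same variance means
  replacing \<open>v\<close> by \<open>v + q\<close>. The second-order terms of the two expansions
  cancel by the heat equation, and \<open>\<delta>\<^sup>2 \<le> v\<close> keeps the remainders,
  cubic in \<open>Y\<close> and quadratic in \<open>q\<close>, under control.\<close>

lemma lindeberg_step:
  assumes V: "finite V" "0 \<le> p" "p \<le> 1" and v: "\<delta>\<^sup>2 \<le> v" "0 < \<delta>"
    and Y: "Bexp V p Y = 0" "Bexp V p (\<lambda>S. (Y S)\<^sup>2) = q"
  shows "\<bar>Bexp V p (\<lambda>S. Phi ((a - Y S) / sqrt v)) - Phi (a / sqrt (v + q))\<bar>
    \<le> Bexp V p (\<lambda>S. \<bar>Y S\<bar> ^ 3) / \<delta> ^ 3 + q\<^sup>2 / \<delta> ^ 4"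
proof -
  have v0: "0 < v" using v by (meson less_le_trans zero_less_power)
  have q0: "0 \<le> q" unfolding Y(2)[symmetric] by (rule Bexp_nonneg) (use V in auto)
  have sd: "\<delta> \<le> sqrt v" using v by (simp add: real_le_rsqrt)
  have s0: "sqrt v > 0" using v0 by simp
  define z where "z = a / sqrt v"
  let ?d = "std_normal_density z"
  let ?P = "\<lambda>S. Phi z - ?d / sqrt v * Y S - z * ?d / (2 * v) * (Y S)\<^sup>2"
  have pt: "\<bar>Phi ((a - Y S) / sqrt v) - ?P S\<bar> \<le> \<bar>Y S\<bar> ^ 3 / \<delta> ^ 3" for S
  proof -
    let ?w = "- Y S / sqrt v"
    have zw: "z + ?w = (a - Y S) / sqrt v" by (simp add: z_def diff_divide_distrib)
    have "?w\<^sup>2 = (Y S)\<^sup>2 / v" using v0 by (simp add: power_divide)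
    then have P: "?P S = Phi z + ?w * ?d - ?w\<^sup>2 / 2 * (z * ?d)" by (simp add: mult_ac)
    have "\<bar>Phi ((a - Y S) / sqrt v) - ?P S\<bar> = \<bar>Phi (z + ?w) - Phi z - ?w * ?d
      + ?w\<^sup>2 / 2 * (z * ?d)\<bar>"
      unfolding zw P by (rule arg_cong[where f = abs]) linarith
    also have "\<dots> \<le> \<bar>?w\<bar> ^ 3"
      by (rule Phi_taylor)
    also have "\<dots> \<le> \<bar>Y S\<bar> ^ 3 / \<delta> ^ 3"
      using v(2) sd s0 by (simp add: power_divide frac_le power_mono)
    finally show ?thesis .
  qed
  have EP: "Bexp V p ?P = Phi z - z * ?d / (2 * v) * q"
    unfolding Bexp_diff Bexp_cmult Y Bexp_const[OF V(1)] by simp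
  have "\<bar>Bexp V p (\<lambda>S. Phi ((a - Y S) / sqrt v)) - Bexp V p ?P\<bar>
      = \<bar>Bexp V p (\<lambda>S. Phi ((a - Y S) / sqrt v) - ?P S)\<bar>"
    by (simp only: Bexp_diff)
  also have "\<dots> \<le> Bexp V p (\<lambda>S. \<bar>Phi ((a - Y S) / sqrt v) - ?P S\<bar>)"
    by (rule Bexp_abs_le) (use V in auto)
  also have "\<dots> \<le> Bexp V p (\<lambda>S. (1 / \<delta> ^ 3) * \<bar>Y S\<bar> ^ 3)"
    by (rule Bexp_mono) (use V pt in auto)
  also have "\<dots> = Bexp V p (\<lambda>S. \<bar>Y S\<bar> ^ 3) / \<delta> ^ 3"
    by (simp only: Bexp_cmult) simp
  finally have 1: "\<bar>Bexp V p (\<lambda>S. Phi ((a - Y S) / sqrt v)) - (Phi z - z * ?d / (2 * v) * q)\<bar>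
      \<le> Bexp V p (\<lambda>S. \<bar>Y S\<bar> ^ 3) / \<delta> ^ 3"
    by (simp only: EP)
  have "\<bar>Phi (a / sqrt (v + q)) - Phi z + q / (2 * v) * (z * ?d)\<bar> \<le> q\<^sup>2 / v\<^sup>2"
    unfolding z_def by (rule Phi_heat[OF v0 q0])
  also have "\<dots> \<le> q\<^sup>2 / \<delta> ^ 4"
  proof (rule divide_left_mono)
    have "(\<delta>\<^sup>2)\<^sup>2 \<le> v\<^sup>2" using v by (intro power_mono) auto
    then show "\<delta> ^ 4 \<le> v\<^sup>2" by simp
  qed (use v v0 in auto)
  finally have 2: "\<bar>Phi (a / sqrt (v + q)) - (Phi z - z * ?d / (2 * v) * q)\<bar> \<le> q\<^sup>2 / \<delta> ^ 4"
    by (simp add: mult_ac)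
  from 1 2 show ?thesis by linarith
qed

text \<open>The blocks are replaced one by one. Each replacement adds its variance to the smoothing
  variance, which thus stays above \<open>\<delta>\<^sup>2\<close>; this is why \<open>v\<close> is
  generalised in the induction.\<close>

lemma lindeberg:
  assumes "finite I" "\<And>i. i \<in> I \<Longrightarrow> finite (Q i)" "disjoint_family_on Q I" "0 \<le> p" "p \<le> 1"
    and \<delta>: "\<delta>\<^sup>2 \<le> v" "0 < \<delta>"
    and Y: "\<And>i. i \<in> I \<Longrightarrow> Bexp (Q i) p (Y i) = 0" "\<And>i. i \<in> I \<Longrightarrow> Bexp (Q i) p (\<lambda>S. (Y i S)\<^sup>2) = q i"
  shows "\<bar>Bexp (\<Union>i\<in>I. Q i) p (\<lambda>S. Phi ((a - (\<Sum>i\<in>I. Y i (S \<inter> Q i))) / sqrt v))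
    - Phi (a / sqrt (v + (\<Sum>i\<in>I. q i)))\<bar>
    \<le> (\<Sum>i\<in>I. Bexp (Q i) p (\<lambda>S. \<bar>Y i S\<bar> ^ 3) / \<delta> ^ 3 + (q i)\<^sup>2 / \<delta> ^ 4)"
  using assms
proof (induction I arbitrary: v rule: finite_induct)
  case empty
  then show ?case by simp
next
  case (insert j I)
  let ?U = "\<Union>i\<in>I. Q i"
  have disj: "Q i \<inter> Q j = {}" if "i \<in> I" for i
    using insert.prems(2) insert.hyps(2) that by (auto simp: disjoint_family_on_def)
  have fin: "finite ?U" "finite (Q j)" "?U \<inter> Q j = {}"
    using insert.prems(1) insert.hyps disj by auto
  have q0: "0 \<le> q j"
    using insert.prems(8)[of j] insert.prems by (metis Bexp_nonneg insertI1 zero_le_power2)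
  let ?e = "\<lambda>i. Bexp (Q i) p (\<lambda>S. \<bar>Y i S\<bar> ^ 3) / \<delta> ^ 3 + (q i)\<^sup>2 / \<delta> ^ 4"
  let ?X = "\<lambda>S. \<Sum>i\<in>I. Y i (S \<inter> Q i)"
  have eq: "(\<Sum>i\<in>insert j I. Y i ((S \<union> T) \<inter> Q i)) = ?X S + Y j T" if "S \<subseteq> ?U" "T \<subseteq> Q j" for S T
  proof -
    have "(S \<union> T) \<inter> Q i = S \<inter> Q i" if "i \<in> I" for i
      using disj[OF that] \<open>T \<subseteq> Q j\<close> by auto
    moreover have "(S \<union> T) \<inter> Q j = T" using that fin by auto
    ultimately show ?thesis using insert.hyps by (simp add: add.commute)
  qed
  have un: "(\<Union>i\<in>insert j I. Q i) = ?U \<union> Q j" by auto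
  have "Bexp (\<Union>i\<in>insert j I. Q i) p (\<lambda>S. Phi ((a - (\<Sum>i\<in>insert j I. Y i (S \<inter> Q i))) / sqrt v))
    = Bexp ?U p (\<lambda>S. Bexp (Q j) p (\<lambda>T. Phi ((a - (\<Sum>i\<in>insert j I. Y i ((S \<union> T) \<inter> Q i))) / sqrt v)))"
    unfolding un by (rule Bexp_Un) (use fin in auto)
  also have "\<dots> = Bexp ?U p (\<lambda>S. Bexp (Q j) p (\<lambda>T. Phi (((a - ?X S) - Y j T) / sqrt v)))"
    by (intro Bexp_cong) (simp add: eq algebra_simps)
  finally have 1: "Bexp (\<Union>i\<in>insert j I. Q i) p
    (\<lambda>S. Phi ((a - (\<Sum>i\<in>insert j I. Y i (S \<inter> Q i))) / sqrt v))
    = Bexp ?U p (\<lambda>S. Bexp (Q j) p (\<lambda>T. Phi (((a - ?X S) - Y j T) / sqrt v)))" .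
  let ?v = "v + q j"
  have "\<bar>Bexp ?U p (\<lambda>S. Bexp (Q j) p (\<lambda>T. Phi (((a - ?X S) - Y j T) / sqrt v)))
    - Bexp ?U p (\<lambda>S. Phi ((a - ?X S) / sqrt ?v))\<bar>
    = \<bar>Bexp ?U p (\<lambda>S. Bexp (Q j) p (\<lambda>T. Phi (((a - ?X S) - Y j T) / sqrt v)) - Phi
      ((a - ?X S) / sqrt ?v))\<bar>"
    by (simp only: Bexp_diff)
  also have "\<dots> \<le> Bexp ?U p (\<lambda>S. \<bar>Bexp (Q j) p (\<lambda>T. Phi (((a - ?X S) - Y j T) / sqrt v))
    - Phi ((a - ?X S) / sqrt ?v)\<bar>)"
    by (rule Bexp_abs_le) (use insert.prems in auto)
  also have "\<dots> \<le> Bexp ?U p (\<lambda>S. ?e j)"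
    by (intro Bexp_mono lindeberg_step) (use insert.prems fin in auto)
  also have "\<dots> = ?e j" by (rule Bexp_const[OF fin(1)])
  finally have 2: "\<bar>Bexp ?U p (\<lambda>S. Bexp (Q j) p (\<lambda>T. Phi (((a - ?X S) - Y j T) / sqrt v)))
    - Bexp ?U p (\<lambda>S. Phi ((a - ?X S) / sqrt ?v))\<bar> \<le> ?e j" .
  have 3: "\<bar>Bexp ?U p (\<lambda>S. Phi ((a - ?X S) / sqrt ?v)) - Phi (a / sqrt (?v + (\<Sum>i\<in>I. q i)))\<bar>
    \<le> (\<Sum>i\<in>I. ?e i)"
  proof (rule insert.IH)
    show "disjoint_family_on Q I"
      using insert.prems(2) by (rule disjoint_family_on_mono[rotated]) auto
  qed (use insert.prems q0 in auto)
  have 4: "?v + (\<Sum>i\<in>I. q i) = v + (\<Sum>i\<in>insert j I. q i)"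
    "(\<Sum>i\<in>insert j I. ?e i) = ?e j + (\<Sum>i\<in>I. ?e i)"
    using insert.hyps by auto
  show ?case
    unfolding 1 4(2) using 2 3 unfolding 4(1) by linarith
qed

section \<open>Block sums and the passage to distribution functions\<close>

lemma Bexp_block_sum:
  assumes "finite I" "\<And>i. i \<in> I \<Longrightarrow> finite (Q i)" "disjoint_family_on Q I" "0 \<le> p" "p \<le> 1"
    and Y: "\<And>i. i \<in> I \<Longrightarrow> Bexp (Q i) p (Y i) = 0" "\<And>i. i \<in> I \<Longrightarrow> Bexp (Q i) p (\<lambda>S. (Y i S)\<^sup>2) = q i"
  defines "U \<equiv> \<Union>i\<in>I. Q i"
  shows "Bexp U p (\<lambda>S. \<Sum>i\<in>I. Y i (S \<inter> Q i)) = 0"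
    and "Bexp U p (\<lambda>S. (\<Sum>i\<in>I. Y i (S \<inter> Q i))\<^sup>2) = (\<Sum>i\<in>I. q i)"
proof -
  have "Bexp (\<Union>i\<in>I. Q i) p (\<lambda>S. \<Sum>i\<in>I. Y i (S \<inter> Q i)) = 0 \<and>
    Bexp (\<Union>i\<in>I. Q i) p (\<lambda>S. (\<Sum>i\<in>I. Y i (S \<inter> Q i))\<^sup>2) = (\<Sum>i\<in>I. q i)"
    using assms(1-7)
  proof (induction I rule: finite_induct)
    case (insert j I)
    let ?U = "\<Union>i\<in>I. Q i"
    have disj: "Q i \<inter> Q j = {}" if "i \<in> I" for i
      using insert.prems(2) insert.hyps(2) that by (auto simp: disjoint_family_on_def)
    have fin: "finite ?U" "finite (Q j)" "?U \<inter> Q j = {}"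
      using insert.prems(1) insert.hyps disj by auto
    let ?X = "\<lambda>S. \<Sum>i\<in>I. Y i (S \<inter> Q i)"
    have eq: "(\<Sum>i\<in>insert j I. Y i ((S \<union> T) \<inter> Q i)) = ?X S + Y j T" if "S \<subseteq> ?U" "T \<subseteq> Q j" for S T
    proof -
      have "(S \<union> T) \<inter> Q i = S \<inter> Q i" if "i \<in> I" for i
        using disj[OF that] \<open>T \<subseteq> Q j\<close> by auto
      moreover have "(S \<union> T) \<inter> Q j = T" using that fin by auto
      ultimately show ?thesis using insert.hyps by (simp add: add.commute)
    qed
    have un: "(\<Union>i\<in>insert j I. Q i) = ?U \<union> Q j" by auto
    have IH: "Bexp ?U p ?X = 0" "Bexp ?U p (\<lambda>S. (?X S)\<^sup>2) = (\<Sum>i\<in>I. q i)"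
      using insert.IH insert.prems disjoint_family_on_mono[of I "insert j I" Q] by auto
    have Yj: "Bexp (Q j) p (Y j) = 0" "Bexp (Q j) p (\<lambda>S. (Y j S)\<^sup>2) = q j"
      using insert.prems by auto
    have "Bexp (\<Union>i\<in>insert j I. Q i) p (\<lambda>S. \<Sum>i\<in>insert j I. Y i (S \<inter> Q i))
      = Bexp ?U p (\<lambda>S. Bexp (Q j) p (\<lambda>T. ?X S + Y j T))"
      unfolding un by (subst Bexp_Un[OF fin]) (intro Bexp_cong eq)
    also have "\<dots> = 0"
      unfolding Bexp_add Bexp_const[OF fin(2)] Yj IH Bexp_const[OF fin(1)] by simp
    finally have 1: "Bexp (\<Union>i\<in>insert j I. Q i) p (\<lambda>S. \<Sum>i\<in>insert j I. Y i (S \<inter> Q i)) = 0" .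
    have "Bexp (\<Union>i\<in>insert j I. Q i) p (\<lambda>S. (\<Sum>i\<in>insert j I. Y i (S \<inter> Q i))\<^sup>2)
      = Bexp ?U p (\<lambda>S. Bexp (Q j) p (\<lambda>T. (?X S)\<^sup>2 + (2 * ?X S) * Y j T + (Y j T)\<^sup>2))"
      unfolding un Bexp_Un[OF fin]
    proof (intro Bexp_cong)
      fix S T assume "S \<subseteq> ?U" "T \<subseteq> Q j"
      then show "(\<Sum>i\<in>insert j I. Y i ((S \<union> T) \<inter> Q i))\<^sup>2 = (?X S)\<^sup>2 + (2 * ?X S) * Y j T + (Y j T)\<^sup>2"
        by (simp only: eq power2_sum)
    qed
    also have "\<dots> = (\<Sum>i\<in>I. q i) + q j"
      by (simp only: Bexp_add Bexp_cmult Bexp_const[OF fin(2)] Yj IH Bexp_const[OF fin(1)]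
        mult_zero_right add_0_right)
    finally show ?case using 1 insert.hyps by (simp add: add.commute)
  qed simp
  then show "Bexp U p (\<lambda>S. \<Sum>i\<in>I. Y i (S \<inter> Q i)) = 0"
    and "Bexp U p (\<lambda>S. (\<Sum>i\<in>I. Y i (S \<inter> Q i))\<^sup>2) = (\<Sum>i\<in>I. q i)"
    unfolding U_def by auto
qed

lemma Bexp_block_sum_restrict:
  fixes h :: "real \<Rightarrow> real"
  assumes "finite V" "\<And>i. i \<in> I \<Longrightarrow> Q i \<subseteq> V"
  shows "Bexp V p (\<lambda>S. h (\<Sum>i\<in>I. Y i (S \<inter> Q i))) = Bexp (\<Union>i\<in>I. Q i) p (\<lambda>S. h (\<Sum>i\<in>I. Y i (S \<inter> Q i)))"
proof -
  let ?U = "\<lambda>S. \<Sum>i\<in>I. Y i (S \<inter> Q i)"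
  have sub: "(\<Union>i\<in>I. Q i) \<subseteq> V" using assms by auto
  have "?U S = ?U (S \<inter> (\<Union>i\<in>I. Q i))" for S
  proof (rule sum.cong)
    fix i assume "i \<in> I"
    then have "S \<inter> Q i = S \<inter> (\<Union>i\<in>I. Q i) \<inter> Q i" by auto
    then show "Y i (S \<inter> Q i) = Y i (S \<inter> (\<Union>i\<in>I. Q i) \<inter> Q i)" by simp
  qed simp
  then have "Bexp V p (\<lambda>S. h (?U S)) = Bexp V p (\<lambda>S. (\<lambda>S. h (?U S)) (S \<inter> (\<Union>i\<in>I. Q i)))"
    by (intro Bexp_cong) metis
  also have "\<dots> = Bexp (\<Union>i\<in>I. Q i) p (\<lambda>S. h (?U S))"
    by (rule Bexp_restrict[OF assms(1) sub])
  finally show ?thesis .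
qed

text \<open>\<open>Phi ((t - x) / \<delta>)\<close> is the indicator smoothed by a normal variable
  of standard deviation \<open>\<delta>\<close>. A shift of the threshold by \<open>\<eta>\<close>
  makes the comparison one-sided, up to the normal tail beyond
  \<open>\<eta> / \<delta>\<close>.\<close>

lemma smoothed_indicator:
  assumes "0 < \<delta>" "0 < \<eta>"
  shows "of_bool (x \<le> t) \<le> Phi ((t + \<eta> - x) / \<delta>) + \<delta>\<^sup>2 / \<eta>\<^sup>2"
    and "Phi ((t - \<eta> - x) / \<delta>) - \<delta>\<^sup>2 / \<eta>\<^sup>2 \<le> of_bool (x \<le> t)"
proof -
  have tl: "Phi (- (\<eta> / \<delta>)) \<le> \<delta>\<^sup>2 / \<eta>\<^sup>2" "1 - Phi (\<eta> / \<delta>) \<le> \<delta>\<^sup>2 / \<eta>\<^sup>2"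
    using Phi_tails[of "\<eta> / \<delta>"] assms by (auto simp: power_divide)
  have pos: "0 \<le> \<delta>\<^sup>2 / \<eta>\<^sup>2" by simp
  show "of_bool (x \<le> t) \<le> Phi ((t + \<eta> - x) / \<delta>) + \<delta>\<^sup>2 / \<eta>\<^sup>2"
  proof (cases "x \<le> t")
    case True
    then have "Phi (\<eta> / \<delta>) \<le> Phi ((t + \<eta> - x) / \<delta>)"
      using assms by (intro Phi_mono divide_right_mono) auto
    then show ?thesis using tl True by simp
  next
    case False
    then show ?thesis using Phi_nonneg[of "(t + \<eta> - x) / \<delta>"] pos by simp
  qed
  show "Phi ((t - \<eta> - x) / \<delta>) - \<delta>\<^sup>2 / \<eta>\<^sup>2 \<le> of_bool (x \<le> t)"
  proof (cases "x \<le> t")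
    case True
    have "Phi ((t - \<eta> - x) / \<delta>) - \<delta>\<^sup>2 / \<eta>\<^sup>2 \<le> 1"
      using Phi_le_1[of "(t - \<eta> - x) / \<delta>"] pos by linarith
    then show ?thesis using True by simp
  next
    case False
    then have "Phi ((t - \<eta> - x) / \<delta>) \<le> Phi (- (\<eta> / \<delta>))"
      using assms by (intro Phi_mono) (auto simp: field_simps)
    then show ?thesis using tl False by simp
  qed
qed

text \<open>Smoothing at scale \<open>\<epsilon>\<^sup>2\<close>, shifts of size
  \<open>\<epsilon>\<close>. The bound \<open>\<epsilon> ^ 4\<close> makes block sum and
  \<open>W\<close> differ by less than \<open>\<epsilon>\<close> outside an event of probability
  \<open>\<epsilon>\<^sup>2\<close>. The ninth powers are divided by \<open>\<epsilon> ^ 6\<close>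
  and \<open>\<epsilon> ^ 8\<close> in \<open>lindeberg\<close>, leaving at most
  \<open>2 * \<epsilon>\<close>.\<close>

lemma clt_perturbed_block_sum:
  assumes V: "finite V" "0 \<le> p" "p \<le> 1"
    and I: "finite I" "\<And>i. i \<in> I \<Longrightarrow> Q i \<subseteq> V" "disjoint_family_on Q I"
    and Y: "\<And>i. i \<in> I \<Longrightarrow> Bexp (Q i) p (Y i) = 0" "\<And>i. i \<in> I \<Longrightarrow> Bexp (Q i) p (\<lambda>S. (Y i S)\<^sup>2) = q i"
    and W: "Bexp V p W = 0" "Bexp V p (\<lambda>S. (W S)\<^sup>2) = 1"
    and \<epsilon>: "0 < \<epsilon>" "\<epsilon> \<le> 1 / 4"
    and close: "Bexp V p (\<lambda>S. ((\<Sum>i\<in>I. Y i (S \<inter> Q i)) - W S)\<^sup>2) \<le> \<epsilon> ^ 4"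
    and third: "(\<Sum>i\<in>I. Bexp (Q i) p (\<lambda>S. \<bar>Y i S\<bar> ^ 3)) \<le> \<epsilon> ^ 9"
    and second: "(\<Sum>i\<in>I. (q i)\<^sup>2) \<le> \<epsilon> ^ 9"
  shows "\<bar>Bexp V p (\<lambda>S. of_bool (W S \<le> t)) - Phi t\<bar> \<le> 10 * \<epsilon>"
proof -
  let ?U = "\<lambda>S. \<Sum>i\<in>I. Y i (S \<inter> Q i)"
  define q2 where "q2 = (\<Sum>i\<in>I. q i)"
  have finQ: "finite (Q i)" if "i \<in> I" for i using I(2)[OF that] V(1) finite_subset by auto
  have red: "Bexp V p (\<lambda>S. h (?U S)) = Bexp (\<Union>i\<in>I. Q i) p (\<lambda>S. h (?U S))" for h :: "real \<Rightarrow> real"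
    by (rule Bexp_block_sum_restrict[OF V(1) I(2)])
  have EU: "Bexp V p ?U = 0" "Bexp V p (\<lambda>S. (?U S)\<^sup>2) = q2"
    using Bexp_block_sum[OF I(1) finQ I(3) V(2,3) Y] red[of "\<lambda>z. z"] red[of "\<lambda>z. z\<^sup>2"]
    by (auto simp: q2_def)
  \<comment> \<open>By the triangle inequality for standard deviations, those of the block sum and
    of \<open>W\<close> differ by at most \<open>\<epsilon>\<^sup>2\<close>; so the variance
    \<open>v\<close> reached by \<open>lindeberg\<close> is close to 1.\<close>
  have q2: "\<bar>q2 - 1\<bar> \<le> 3 * \<epsilon>\<^sup>2"
  proof -
    have q20: "0 \<le> q2" unfolding EU(2)[symmetric] by (rule Bexp_nonneg) (use V in auto)
    have BU: "Bvar V p ?U = q2" "Bvar V p W = 1"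
      using EU W by (simp_all add: Bvar_eq[OF V(1)])
    have BD: "Bvar V p (\<lambda>S. ?U S - W S) \<le> \<epsilon> ^ 4"
      using Bvar_le_square[OF V, of "\<lambda>S. ?U S - W S"] close by linarith
    have "sqrt (Bvar V p (\<lambda>S. ?U S - W S)) \<le> sqrt (\<epsilon> ^ 4)"
      by (rule real_sqrt_le_mono[OF BD])
    also have "sqrt (\<epsilon> ^ 4) = \<epsilon>\<^sup>2"
      by (rule real_sqrt_unique) auto
    finally have sD: "sqrt (Bvar V p (\<lambda>S. ?U S - W S)) \<le> \<epsilon>\<^sup>2" .
    have "Bvar V p (\<lambda>S. W S - ?U S) = Bvar V p (\<lambda>S. (- 1) * (?U S - W S))" by simp
    then have sD': "sqrt (Bvar V p (\<lambda>S. W S - ?U S)) \<le> \<epsilon>\<^sup>2"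
      using sD unfolding Bvar_cmult by simp
    have a: "sqrt q2 \<le> 1 + \<epsilon>\<^sup>2"
      using sd_triangle[OF V(2,3), of V W "\<lambda>S. ?U S - W S"] sD BU by simp
    have b: "1 \<le> sqrt q2 + \<epsilon>\<^sup>2"
      using sd_triangle[OF V(2,3), of V ?U "\<lambda>S. W S - ?U S"] sD' BU by simp
    have e1: "\<epsilon>\<^sup>2 \<le> 1" using \<epsilon> by (simp add: power_le_one)
    have "\<bar>sqrt q2 - 1\<bar> \<le> \<epsilon>\<^sup>2" using a b by linarith
    moreover have "\<bar>sqrt q2 + 1\<bar> \<le> 3" using a e1 q20 by simp
    ultimately have "\<bar>sqrt q2 - 1\<bar> * \<bar>sqrt q2 + 1\<bar> \<le> \<epsilon>\<^sup>2 * 3" by (intro mult_mono) auto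
    moreover have "(sqrt q2 - 1) * (sqrt q2 + 1) = q2 - 1"
      using q20 by (simp add: algebra_simps)
    ultimately show ?thesis by (simp flip: abs_mult)
  qed
  define v where "v = (\<epsilon>\<^sup>2)\<^sup>2 + q2"
  have e2: "\<epsilon>\<^sup>2 \<le> \<epsilon> / 4" using \<epsilon> by (simp add: power2_eq_square)
  have e4: "(\<epsilon>\<^sup>2)\<^sup>2 \<le> \<epsilon>\<^sup>2"
    using \<epsilon> by (intro power_le_one_iff[THEN iffD2] order_trans[OF power_decreasing[of 1 2 "\<epsilon>\<^sup>2"]])
      (auto simp: power_le_one)
  have v: "\<bar>v - 1\<bar> \<le> \<epsilon>" "1 / 2 \<le> v"
    using q2 e2 e4 \<epsilon> zero_le_power2[of "\<epsilon>\<^sup>2"] unfolding v_def abs_le_iff by linarith+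
  have lind: "\<bar>Bexp V p (\<lambda>S. Phi ((a - ?U S) / \<epsilon>\<^sup>2)) - Phi (a / sqrt v)\<bar> \<le> 2 * \<epsilon>" for a
  proof -
    have "\<bar>Bexp (\<Union>i\<in>I. Q i) p (\<lambda>S. Phi ((a - ?U S) / sqrt ((\<epsilon>\<^sup>2)\<^sup>2)))
      - Phi (a / sqrt ((\<epsilon>\<^sup>2)\<^sup>2 + (\<Sum>i\<in>I. q i)))\<bar>
      \<le> (\<Sum>i\<in>I. Bexp (Q i) p (\<lambda>S. \<bar>Y i S\<bar> ^ 3) / (\<epsilon>\<^sup>2) ^ 3 + (q i)\<^sup>2 / (\<epsilon>\<^sup>2) ^ 4)"
      by (rule lindeberg[OF I(1) finQ I(3) V(2,3) _ _ Y]) (use \<epsilon> in auto)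
    also have "\<dots> = (\<Sum>i\<in>I. Bexp (Q i) p (\<lambda>S. \<bar>Y i S\<bar> ^ 3)) / \<epsilon> ^ 6 + (\<Sum>i\<in>I. (q i)\<^sup>2) / \<epsilon> ^ 8"
      by (simp add: sum.distrib sum_divide_distrib flip: power_mult)
    also have "\<dots> \<le> \<epsilon> ^ 9 / \<epsilon> ^ 6 + \<epsilon> ^ 9 / \<epsilon> ^ 8"
      using third second \<epsilon> by (intro add_mono divide_right_mono) auto
    also have "\<dots> = \<epsilon> ^ 3 + \<epsilon>"
      using \<epsilon> by (simp add: eval_nat_numeral)
    also have "\<dots> \<le> 2 * \<epsilon>"
      using \<epsilon> power_decreasing[of 1 3 \<epsilon>] by simp
    finally show ?thesis
      unfolding red[of "\<lambda>x. Phi ((a - x) / \<epsilon>\<^sup>2)"] v_def q2_def real_sqrt_abs abs_power2 .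
  qed
  have far: "Bexp V p (\<lambda>S. of_bool ((?U S - W S)\<^sup>2 \<ge> \<epsilon>\<^sup>2)) \<le> \<epsilon>\<^sup>2"
  proof -
    have "Bexp V p (\<lambda>S. of_bool ((?U S - W S)\<^sup>2 \<ge> \<epsilon>\<^sup>2)) \<le> Bexp V p (\<lambda>S. (?U S - W S)\<^sup>2) / \<epsilon>\<^sup>2"
      by (rule Bexp_markov) (use V \<epsilon> in auto)
    also have "\<dots> \<le> \<epsilon> ^ 4 / \<epsilon>\<^sup>2"
      using close by (rule divide_right_mono) simp
    also have "\<dots> = \<epsilon>\<^sup>2" using \<epsilon> by (simp add: eval_nat_numeral)
    finally show ?thesis .
  qed
  have near: "\<bar>?U S - W S\<bar> < \<epsilon>" if "\<not> (?U S - W S)\<^sup>2 \<ge> \<epsilon>\<^sup>2" for S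
    using that \<epsilon> abs_le_square_iff[of \<epsilon> "?U S - W S"] by auto
  have ratio: "(\<epsilon>\<^sup>2)\<^sup>2 / \<epsilon>\<^sup>2 = \<epsilon>\<^sup>2" using \<epsilon> by (simp add: power2_eq_square)
  have Phi_cmp: "\<bar>Phi (a / sqrt v) - Phi a\<bar> \<le> \<epsilon>" for a
    using Phi_variance_le[OF v(2), of a] v(1) by linarith
  have "Bexp V p (\<lambda>S. of_bool (W S \<le> t)) \<le>
      Bexp V p (\<lambda>S. Phi ((t + 2 * \<epsilon> - ?U S) / \<epsilon>\<^sup>2) + \<epsilon>\<^sup>2 + of_bool ((?U S - W S)\<^sup>2 \<ge> \<epsilon>\<^sup>2))"
  proof (rule Bexp_mono)
    fix S
    have "of_bool (W S \<le> t) \<le> of_bool (?U S \<le> t + \<epsilon>) + (of_bool ((?U S - W S)\<^sup>2 \<ge> \<epsilon>\<^sup>2) :: real)"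
      using near[of S] by (cases "(?U S - W S)\<^sup>2 \<ge> \<epsilon>\<^sup>2") auto
    moreover have "of_bool (?U S \<le> t + \<epsilon>) \<le> Phi ((t + \<epsilon> + \<epsilon> - ?U S) / \<epsilon>\<^sup>2) + (\<epsilon>\<^sup>2)\<^sup>2 / \<epsilon>\<^sup>2"
      by (rule smoothed_indicator(1)) (use \<epsilon> in auto)
    ultimately show "of_bool (W S \<le> t) \<le> Phi ((t + 2 * \<epsilon> - ?U S) / \<epsilon>\<^sup>2) + \<epsilon>\<^sup>2
      + of_bool ((?U S - W S)\<^sup>2 \<ge> \<epsilon>\<^sup>2)"
      unfolding ratio by (simp add: algebra_simps)
  qed (use V in auto)
  also have "\<dots> \<le> (Phi ((t + 2 * \<epsilon>) / sqrt v) + 2 * \<epsilon>) + \<epsilon>\<^sup>2 + \<epsilon>\<^sup>2"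
    unfolding Bexp_add Bexp_const[OF V(1)] using lind[of "t + 2 * \<epsilon>"] far by linarith
  also have "\<dots> \<le> Phi t + 10 * \<epsilon>"
    using Phi_cmp[of "t + 2 * \<epsilon>"] Phi_lipschitz[of t "t + 2 * \<epsilon>"] \<epsilon>(1) e2 by linarith
  finally have up: "Bexp V p (\<lambda>S. of_bool (W S \<le> t)) \<le> Phi t + 10 * \<epsilon>" .
  have "Phi t - 10 * \<epsilon> \<le> (Phi ((t - 2 * \<epsilon>) / sqrt v) - 2 * \<epsilon>) - \<epsilon>\<^sup>2 - \<epsilon>\<^sup>2"
    using Phi_cmp[of "t - 2 * \<epsilon>"] Phi_lipschitz[of "t - 2 * \<epsilon>" t] \<epsilon>(1) e2 by linarith
  also have "\<dots> \<le> Bexp V p (\<lambda>S. Phi ((t - 2 * \<epsilon> - ?U S) / \<epsilon>\<^sup>2) - \<epsilon>\<^sup>2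
    - of_bool ((?U S - W S)\<^sup>2 \<ge> \<epsilon>\<^sup>2))"
    unfolding Bexp_diff Bexp_const[OF V(1)] using lind[of "t - 2 * \<epsilon>"] far by linarith
  also have "\<dots> \<le> Bexp V p (\<lambda>S. of_bool (W S \<le> t))"
  proof (rule Bexp_mono)
    fix S
    have "of_bool (?U S \<le> t - \<epsilon>) - (of_bool ((?U S - W S)\<^sup>2 \<ge> \<epsilon>\<^sup>2) :: real) \<le> of_bool (W S \<le> t)"
      using near[of S] by (cases "(?U S - W S)\<^sup>2 \<ge> \<epsilon>\<^sup>2") auto
    moreover have "Phi ((t - \<epsilon> - \<epsilon> - ?U S) / \<epsilon>\<^sup>2) - (\<epsilon>\<^sup>2)\<^sup>2 / \<epsilon>\<^sup>2 \<le> of_bool (?U S \<le> t - \<epsilon>)"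
      by (rule smoothed_indicator(2)) (use \<epsilon> in auto)
    ultimately show "Phi ((t - 2 * \<epsilon> - ?U S) / \<epsilon>\<^sup>2) - \<epsilon>\<^sup>2 - of_bool ((?U S - W S)\<^sup>2 \<ge> \<epsilon>\<^sup>2)
      \<le> of_bool (W S \<le> t)"
      unfolding ratio by (simp add: algebra_simps)
  qed (use V in auto)
  finally show ?thesis using up by (simp add: abs_le_iff)
qed

section \<open>Cubic lattices\<close>

definition pt :: "real \<Rightarrow> ('d::finite \<Rightarrow> nat) \<Rightarrow> real ^ 'd" where
  "pt h j = (\<chi> i. h * real (j i))"

definition grid :: "nat \<Rightarrow> ('d::finite \<Rightarrow> nat) set" where
  "grid N = {j. \<forall>i. j i < N}"

definition block :: "nat \<Rightarrow> ('d::finite \<Rightarrow> nat) \<Rightarrow> ('d \<Rightarrow> nat) set" where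
  "block L b = {j. \<forall>i. j i div L = b i}"

lemma PiE_UNIV_conv: "PiE UNIV X = {j. \<forall>i. j i \<in> X i}"
  by (auto simp: PiE_def extensional_def)

lemma finite_Collect_grid:
  "(\<And>i. finite (X i)) \<Longrightarrow> finite {j :: 'd::finite \<Rightarrow> 'a. \<forall>i. j i \<in> X i}"
  unfolding PiE_UNIV_conv[symmetric] by (intro finite_PiE) auto

lemma card_Collect_grid:
  "card {j :: 'd::finite \<Rightarrow> 'a. \<forall>i. j i \<in> X i} = (\<Prod>i\<in>UNIV. card (X i))"
  unfolding PiE_UNIV_conv[symmetric] by (simp add: card_PiE)

lemma grid_eq: "grid N = {j. \<forall>i. j i \<in> {..<N}}"
  by (auto simp: grid_def)

lemma finite_grid: "finite (grid N :: ('d::finite \<Rightarrow> nat) set)"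
  unfolding grid_eq by (rule finite_Collect_grid) simp

lemma card_grid: "card (grid N :: ('d::finite \<Rightarrow> nat) set) = N ^ CARD('d)"
  unfolding grid_eq card_Collect_grid by simp

lemma inj_pt: "h \<noteq> 0 \<Longrightarrow> inj (pt h)"
  by (auto simp: inj_def pt_def vec_eq_iff)

lemma inj_on_pt: "0 < h \<Longrightarrow> inj_on (pt h) A"
  using inj_pt[of h] by (auto intro: inj_on_subset)

lemma card_pt: "0 < h \<Longrightarrow> card (pt h ` A) = card A"
  by (intro card_image inj_on_pt)

lemma pt_component: "pt h j $ i = h * real (j i)"
  by (simp add: pt_def)

lemma component_dist_le: "\<bar>x $ i - y $ i\<bar> \<le> dist x (y :: real ^ 'd)"
  using component_le_norm_cart[of "x - y" i] by (simp add: dist_norm)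

lemma dist_le_l1:
  fixes x y :: "real ^ 'd" and c :: real
  assumes "\<And>i. \<bar>x $ i - y $ i\<bar> \<le> c"
  shows "dist x y \<le> CARD('d) * c"
proof -
  have "dist x y \<le> (\<Sum>i\<in>UNIV. \<bar>x $ i - y $ i\<bar>)"
    using norm_le_l1_cart[of "x - y"] by (simp add: dist_norm)
  also have "\<dots> \<le> (\<Sum>i\<in>(UNIV :: 'd set). c)"
    by (intro sum_mono assms)
  finally show ?thesis by simp
qed

lemma card_grid_slab:
  fixes X :: "nat set"
  assumes "X \<subseteq> {..<N}" "1 \<le> CARD('d::finite)"
  shows "card {j \<in> (grid N :: ('d \<Rightarrow> nat) set). \<exists>i. j i \<in> X}
    \<le> CARD('d) * (card X * N ^ (CARD('d) - 1))"
proof -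
  have fX: "finite X" using assms(1) finite_subset by auto
  have "{j \<in> grid N. \<exists>i. j i \<in> X}
    = (\<Union>i. {j :: 'd \<Rightarrow> nat. \<forall>i'. j i' \<in> (if i' = i then X else {..<N})})"
  proof (intro equalityI subsetI)
    fix j :: "'d \<Rightarrow> nat" assume "j \<in> {j \<in> grid N. \<exists>i. j i \<in> X}"
    then obtain i where i: "j i \<in> X" "j \<in> grid N" by auto
    then have "\<forall>i'. j i' \<in> (if i' = i then X else {..<N})" by (auto simp: grid_def)
    then show "j \<in> (\<Union>i. {j. \<forall>i'. j i' \<in> (if i' = i then X else {..<N})})" by blast
  next
    fix j :: "'d \<Rightarrow> nat" assume "j \<in> (\<Union>i. {j. \<forall>i'. j i' \<in> (if i' = i then X else {..<N})})"
    then obtain i where i: "\<And>i'. j i' \<in> (if i' = i then X else {..<N})" by auto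
    have "j i' < N" for i' using i[of i'] assms(1) by (auto split: if_splits)
    moreover have "j i \<in> X" using i[of i] by simp
    ultimately show "j \<in> {j \<in> grid N. \<exists>i. j i \<in> X}" by (auto simp: grid_def)
  qed
  then have "card {j \<in> (grid N :: ('d \<Rightarrow> nat) set). \<exists>i. j i \<in> X} \<le>
      (\<Sum>i\<in>(UNIV :: 'd set). card {j :: 'd \<Rightarrow> nat. \<forall>i'. j i' \<in> (if i' = i then X else {..<N})})"
    by (simp only: card_UN_le[OF finite])
  also have "\<dots> = (\<Sum>i\<in>(UNIV :: 'd set). card X * N ^ (CARD('d) - 1))"
  proof (rule sum.cong)
    fix i :: 'd
    have "(\<Prod>i'\<in>UNIV. card (if i' = i then X else {..<N})) =
        card X * (\<Prod>i'\<in>UNIV - {i}. card (if i' = i then X else {..<N}))"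
      by (subst prod.remove[of UNIV i]) auto
    also have "(\<Prod>i'\<in>UNIV - {i}. card (if i' = i then X else {..<N})) = (\<Prod>i'\<in>UNIV - {i}. N)"
      by (rule prod.cong) auto
    also have "\<dots> = N ^ (CARD('d) - 1)" by (simp add: card_Diff_singleton)
    finally show "card {j :: 'd \<Rightarrow> nat. \<forall>i'. j i' \<in> (if i' = i then X else {..<N})}
      = card X * N ^ (CARD('d) - 1)"
      unfolding card_Collect_grid .
  qed simp
  finally show ?thesis by simp
qed

lemma card_residues_le: "card {m. m < k * L \<and> P (m mod L)} \<le> k * card {r. r < L \<and> P r}"
proof (cases "L = 0")
  case False
  have "{m. m < k * L \<and> P (m mod L)} \<subseteq> (\<lambda>(a, r). a * L + r) ` ({..<k} \<times> {r. r < L \<and> P r})"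
  proof
    fix m assume "m \<in> {m. m < k * L \<and> P (m mod L)}"
    then show "m \<in> (\<lambda>(a, r). a * L + r) ` ({..<k} \<times> {r. r < L \<and> P r})"
      using False by (intro image_eqI[of _ _ "(m div L, m mod L)"])
        (auto simp: less_mult_imp_div_less)
  qed
  then have "card {m. m < k * L \<and> P (m mod L)}
    \<le> card ((\<lambda>(a, r). a * L + r) ` ({..<k} \<times> {r. r < L \<and> P r}))"
    by (intro card_mono) auto
  also have "\<dots> \<le> card ({..<k} \<times> {r. r < L \<and> P r})"
    by (rule card_image_le) auto
  finally show ?thesis by (simp add: card_cartesian_product)
qed simp

lemma block_subset_grid:
  assumes "b \<in> grid k" "0 < L"
  shows "block L b \<subseteq> grid (k * L)"
  using assms by (auto simp: block_def grid_def) (metis div_less_iff_less_mult)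

lemma grid_blocks:
  assumes "0 < L"
  shows "grid (k * L) = (\<Union>b\<in>grid k. block L b)"
proof (intro equalityI subsetI)
  fix j :: "'a::finite \<Rightarrow> nat" assume "j \<in> grid (k * L)"
  then have "(\<lambda>i. j i div L) \<in> grid k"
    using assms by (auto simp: grid_def less_mult_imp_div_less)
  then show "j \<in> (\<Union>b\<in>grid k. block L b)"
    by (auto simp: block_def)
next
  fix j :: "'a \<Rightarrow> nat" assume "j \<in> (\<Union>b\<in>grid k. block L b)"
  then show "j \<in> grid (k * L)"
    using block_subset_grid[OF _ assms] by blast
qed

lemma block_eq_translate:
  assumes "0 < L"
  shows "block L b = (\<lambda>j i. b i * L + j i) ` grid L"
proof (intro equalityI subsetI)
  fix j assume "j \<in> block L b"
  then have "j = (\<lambda>i. b i * L + j i mod L)" "(\<lambda>i. j i mod L) \<in> grid L"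
    using assms by (auto simp: block_def grid_def fun_eq_iff) (metis div_mult_mod_eq)
  then show "j \<in> (\<lambda>j i. b i * L + j i) ` grid L" by (rule image_eqI)
next
  fix j assume "j \<in> (\<lambda>j i. b i * L + j i) ` grid L"
  then show "j \<in> block L b"
    using assms by (auto simp: block_def grid_def)
qed

lemma pt_block:
  assumes "0 < L"
  shows "pt h ` block L b = (\<lambda>x. pt (h * real L) b + x) ` pt h ` grid L"
proof -
  have "pt h (\<lambda>i. b i * L + j i) = pt (h * real L) b + pt h j" for j :: "'a \<Rightarrow> nat"
    by (simp add: pt_def vec_eq_iff algebra_simps)
  then show ?thesis
    unfolding block_eq_translate[OF assms] image_image by simp
qed

lemma disjoint_blocks: "0 < h \<Longrightarrow> disjoint_family_on (\<lambda>b. pt h ` block L b) J"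
proof -
  assume h: "0 < h"
  have "pt h ` block L b \<inter> pt h ` block L b' = {}" if "b \<noteq> b'" for b b'
  proof -
    have "block L b \<inter> block L b' = {}" using that by (auto simp: block_def fun_eq_iff)
    then show ?thesis
      using image_Int[OF inj_pt[of h], of "block L b" "block L b'"] h by simp
  qed
  then show ?thesis by (auto simp: disjoint_family_on_def)
qed

section \<open>Translation invariance of the block functionals\<close>

lemma HH_isometry:
  assumes "finite V" "\<And>u v. u \<in> V \<Longrightarrow> v \<in> V \<Longrightarrow> dist (g u) (g v) = dist u v"
  shows "HH R (g ` V) = HH R V"
  unfolding HH_def using kap_isometry[OF assms] by simp

text \<open>Every block is a translate of the block at the origin. The function
  \<open>\<phi>\<close> is free so that means, variances and third absolute moments all
  transfer.\<close>

lemma Bexp_HH_block: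
  assumes "0 < L"
  shows "Bexp (pt h ` block L b :: (real ^ 'd) set) p (\<lambda>S. \<phi> (HH R S)) =
    Bexp (pt h ` grid L :: (real ^ 'd) set) p (\<lambda>S. \<phi> (HH R S))"
proof -
  let ?g = "\<lambda>x :: real ^ 'd. pt (h * real L) b + x"
  have "Bexp (?g ` pt h ` grid L) p (\<lambda>S. \<phi> (HH R S))
    = Bexp (pt h ` grid L :: (real ^ 'd) set) p (\<lambda>S. \<phi> (HH R (?g ` S)))"
    by (rule Bexp_image) (auto simp: inj_on_def)
  also have "\<dots> = Bexp (pt h ` grid L :: (real ^ 'd) set) p (\<lambda>S. \<phi> (HH R S))"
  proof (rule Bexp_cong)
    fix S :: "(real ^ 'd) set" assume "S \<subseteq> pt h ` grid L"
    then have "finite S" using finite_grid finite_subset by blast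
    then have "HH R (?g ` S) = HH R S"
      by (rule HH_isometry) (simp add: dist_norm)
    then show "\<phi> (HH R (?g ` S)) = \<phi> (HH R S)" by simp
  qed
  finally show ?thesis by (simp only: pt_block[OF assms])
qed

section \<open>Points near block faces and outside the complete blocks\<close>

definition margin :: "real \<Rightarrow> real \<Rightarrow> nat" where
  "margin h R = nat \<lceil>R / h\<rceil>"

text \<open>\<open>margin h R\<close> layers along every face of every block. The condition looks at
  residues modulo \<open>L\<close>, so the outer faces of the cube are included, which makes the
  count the same for all blocks.\<close>

definition rim :: "real \<Rightarrow> nat \<Rightarrow> nat \<Rightarrow> real \<Rightarrow> (real ^ 'd) set" where
  "rim h k L R = pt h ` {j \<in> grid (k * L).
     \<exists>i. j i \<in> {m. m < k * L \<and> (m mod L < margin h R \<or> L \<le> m mod L + margin h R)}}"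

lemma same_block_nat:
  fixes m m' L w :: nat
  assumes "w \<le> m mod L" "m mod L + w < L" "m \<le> m' + w" "m' \<le> m + w"
  shows "m' div L = m div L"
proof -
  let ?q = "m div L"
  have "m = ?q * L + m mod L" by simp
  then have "?q * L \<le> m'" "m' < ?q * L + L"
    using assms by linarith+
  then show ?thesis
    by (metis add.commute div_nat_eqI mult.commute mult_Suc_right)
qed

text \<open>Lattice points within distance \<open>R\<close> differ by at most
  \<open>margin h R\<close> in every index, so a neighbour of a point off the rim has the same
  quotients by \<open>L\<close>.\<close>

lemma lattice_block_system:
  fixes h R :: real
  assumes "0 < h" "0 < L" "0 \<le> R"
  shows "block_system (pt h ` grid (k * L) :: (real ^ 'd) set) (grid k) (\<lambda>b. pt h ` block L b)
    (rim h k L R) R (pack TYPE('d) * R)"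
proof
  show "finite (pt h ` grid (k * L) :: (real ^ 'd) set)" "finite (grid k :: ('d \<Rightarrow> nat) set)"
    using finite_grid by auto
  show "(pt h ` grid (k * L) :: (real ^ 'd) set) = (\<Union>b\<in>grid k. pt h ` block L b)"
    unfolding grid_blocks[OF assms(2)] by auto
  show "disjoint_family_on (\<lambda>b. pt h ` block L b :: (real ^ 'd) set) (grid k)"
    by (rule disjoint_blocks[OF assms(1)])
  show "rim h k L R \<subseteq> (pt h ` grid (k * L) :: (real ^ 'd) set)"
    by (auto simp: rim_def)
  show "0 \<le> R" by fact
  fix b and x y :: "real ^ 'd"
  assume b: "b \<in> grid k" and x: "x \<in> pt h ` block L b" and nb: "x \<notin> rim h k L R"
    and y: "y \<in> pt h ` grid (k * L)" and d: "dist x y \<le> R"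
  obtain j where j: "x = pt h j" "j \<in> block L b" using x by auto
  obtain j' where j': "y = pt h j'" "j' \<in> grid (k * L)" using y by auto
  have jg: "j \<in> grid (k * L)" using block_subset_grid[OF b assms(2)] j by auto
  let ?w = "margin h R"
  have "j' i div L = b i" for i
  proof -
    have "\<not> (j i mod L < ?w \<or> L \<le> j i mod L + ?w)"
      using nb jg unfolding j(1) rim_def by (auto simp: grid_def)
    moreover have "\<bar>h * real (j i) - h * real (j' i)\<bar> \<le> R"
      using component_dist_le[of x i y] d by (simp add: j j' pt_component)
    then have "h * \<bar>real (j i) - real (j' i)\<bar> \<le> R"
      using assms(1) by (simp add: abs_mult flip: right_diff_distrib)
    then have "\<bar>real (j i) - real (j' i)\<bar> \<le> R / h"
      using assms(1) by (simp add: field_simps)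
    then have "\<bar>real (j i) - real (j' i)\<bar> \<le> real ?w"
      unfolding margin_def using real_nat_ceiling_ge[of "R / h"] by linarith
    then have "j i \<le> j' i + ?w" "j' i \<le> j i + ?w" by linarith+
    ultimately have "j' i div L = j i div L"
      by (intro same_block_nat[of ?w]) auto
    then show ?thesis using j(2) by (simp add: block_def)
  qed
  then show "y \<in> pt h ` block L b" using j' by (auto simp: block_def)
qed simp

text \<open>In each coordinate at most \<open>2 * margin h R\<close> of the \<open>L\<close>
  residues are affected; by \<open>h \<le> R\<close> the rounding in \<open>margin\<close> costs at
  most another factor 2.\<close>

lemma card_rim_le:
  fixes h R :: real
  assumes "0 < h" "h \<le> R" "0 < L" "0 < k"
  shows "real (card (rim h k L R :: (real ^ 'd) set)) \<le>
    4 * CARD('d) * R / (h * real L) * real (k * L) ^ CARD('d)"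
proof -
  let ?w = "margin h R" and ?D = "CARD('d)"
  let ?X = "{m. m < k * L \<and> (m mod L < ?w \<or> L \<le> m mod L + ?w)}"
  have D: "1 \<le> ?D" by (simp add: Suc_le_eq)
  have "card ?X \<le> k * card {r. r < L \<and> (r < ?w \<or> L \<le> r + ?w)}"
    by (rule card_residues_le)
  also have "card {r. r < L \<and> (r < ?w \<or> L \<le> r + ?w)} \<le> card ({..<?w} \<union> {L - ?w..<L})"
    by (rule card_mono) auto
  also have "\<dots> \<le> card {..<?w} + card {L - ?w..<L}"
    by (rule card_Un_le)
  also have "\<dots> \<le> 2 * ?w" by simp
  finally have X: "card ?X \<le> k * (2 * ?w)" by simp
  have "card (rim h k L R :: (real ^ 'd) set) \<le> ?D * (card ?X * (k * L) ^ (?D - 1))"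
    unfolding rim_def card_pt[OF assms(1)] by (rule card_grid_slab) (use D in auto)
  also have "\<dots> \<le> ?D * (k * (2 * ?w) * (k * L) ^ (?D - 1))"
    using X by (intro mult_le_mono) auto
  finally have "real (card (rim h k L R :: (real ^ 'd) set))
    \<le> real (?D * (k * (2 * ?w) * (k * L) ^ (?D - 1)))"
    by (rule of_nat_mono)
  also have "\<dots> = 2 * ?D * real ?w / real L * (real (k * L) * real (k * L) ^ (?D - 1))"
    using assms by (simp add: field_simps)
  also have "real (k * L) * real (k * L) ^ (?D - 1) = real (k * L) ^ ?D"
    using D by (simp flip: power_Suc)
  also have "2 * ?D * real ?w / real L * real (k * L) ^ ?D
    \<le> 2 * ?D * (2 * R / h) / real L * real (k * L) ^ ?D"
  proof -
    have "1 \<le> R / h" using assms by simp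
    then have "real ?w \<le> 2 * R / h"
      unfolding margin_def using of_nat_ceiling[of "R / h"] by linarith
    then show ?thesis
      by (intro mult_right_mono divide_right_mono mult_left_mono) auto
  qed
  finally show ?thesis by (simp add: mult_ac)
qed

lemma blocks_in_grid:
  assumes "b \<in> grid (N div L)" "0 < L"
  shows "block L b \<subseteq> grid N"
proof -
  have "block L b \<subseteq> grid (N div L * L)" by (rule block_subset_grid[OF assms])
  also have "\<dots> \<subseteq> grid N"
    using div_times_less_eq_dividend[of N L] by (auto simp: grid_def intro: less_le_trans)
  finally show ?thesis .
qed

text \<open>In each coordinate fewer than \<open>L\<close> indices miss the complete blocks, out of
  a side of \<open>k * L\<close> for the large cube; hence the fraction
  \<open>1 / k\<close>.\<close>

lemma card_leftover_le:
  assumes "0 < h" "0 < L" "0 < k" "N \<le> k * L"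
  shows "real (card (pt h ` grid N - (\<Union>b\<in>grid (N div L). pt h ` block L b) :: (real ^ 'd) set)) \<le>
    CARD('d) / real k * real (k * L) ^ CARD('d)"
proof -
  let ?D = "CARD('d)" and ?X = "{N div L * L..<N}"
  have D: "1 \<le> ?D" by (simp add: Suc_le_eq)
  have "pt h ` grid N - (\<Union>b\<in>grid (N div L). pt h ` block L b) \<subseteq>
      pt h ` {j \<in> (grid N :: ('d \<Rightarrow> nat) set). \<exists>i. j i \<in> ?X}"
  proof
    fix x :: "real ^ 'd"
    assume x: "x \<in> pt h ` grid N - (\<Union>b\<in>grid (N div L). pt h ` block L b)"
    then obtain j where j: "x = pt h j" "j \<in> grid N" by auto
    have "j \<notin> grid (N div L * L)"
      using x j unfolding grid_blocks[OF assms(2)] by auto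
    then have "\<exists>i. j i \<in> ?X" using j by (auto simp: grid_def not_less)
    then show "x \<in> pt h ` {j \<in> grid N. \<exists>i. j i \<in> ?X}" using j by auto
  qed
  then have "card (pt h ` grid N - (\<Union>b\<in>grid (N div L). pt h ` block L b) :: (real ^ 'd) set) \<le>
      card (pt h ` {j \<in> (grid N :: ('d \<Rightarrow> nat) set). \<exists>i. j i \<in> ?X})"
    by (rule card_mono[rotated])
      (intro finite_imageI, rule finite_subset[OF _ finite_grid[of N]], auto)
  also have "\<dots> \<le> ?D * (card ?X * N ^ (?D - 1))"
    unfolding card_pt[OF assms(1)] by (rule card_grid_slab) (use D in auto)
  also have "\<dots> \<le> ?D * (L * (k * L) ^ (?D - 1))"
  proof (intro mult_le_mono power_mono)
    have "card ?X = N mod L" by (simp add: minus_div_mult_eq_mod)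
    then show "card ?X \<le> L" using assms(2) by (simp add: less_imp_le)
  qed (use assms in auto)
  finally have "real (card (pt h ` grid N
    - (\<Union>b\<in>grid (N div L). pt h ` block L b) :: (real ^ 'd) set))
      \<le> real (?D * (L * (k * L) ^ (?D - 1)))"
    by (rule of_nat_mono)
  also have "\<dots> = ?D / real k * (real (k * L) * real (k * L) ^ (?D - 1))"
    using assms by (simp add: field_simps)
  also have "real (k * L) * real (k * L) ^ (?D - 1) = real (k * L) ^ ?D"
    using D by (simp flip: power_Suc)
  finally show ?thesis .
qed

section \<open>Bounds for the expected truncated functional\<close>

lemma kap_cube_le:
  fixes S :: "(real ^ 'd) set" and l :: real
  assumes "finite S" "0 < r" "r \<le> l" "\<And>u i. u \<in> S \<Longrightarrow> 0 \<le> u $ i \<and> u $ i \<le> l"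
  shows "real (kap r S) \<le> (2 * l * CARD('d) / r) ^ CARD('d)"
proof -
  let ?D = "CARD('d)"
  define f where "f u = (\<lambda>i. \<lfloor>(u $ i - (0 :: real ^ 'd) $ i) * ?D / r\<rfloor>)" for u :: "real ^ 'd"
  have D: "1 \<le> ?D" by (simp add: Suc_le_eq)
  have "kap r S \<le> card (f ` S)"
    by (rule kap_le_card_image[OF assms(1)])
      (auto simp: f_def fun_eq_iff intro!: dist_le_of_same_floor[OF assms(2), of _ 0])
  also have "\<dots> \<le> card {z :: 'd \<Rightarrow> int. \<forall>i. z i \<in> {0..\<lfloor>l * ?D / r\<rfloor>}}"
  proof (rule card_mono)
    show "f ` S \<subseteq> {z. \<forall>i. z i \<in> {0..\<lfloor>l * ?D / r\<rfloor>}}"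
      using assms by (auto simp: f_def intro!: floor_mono divide_right_mono mult_right_mono)
  next
    show "finite {z :: 'd \<Rightarrow> int. \<forall>i. z i \<in> {0..\<lfloor>l * ?D / r\<rfloor>}}"
      by (rule finite_Collect_grid) simp
  qed
  also have "\<dots> = nat (\<lfloor>l * ?D / r\<rfloor> + 1) ^ ?D"
    unfolding card_Collect_grid by simp
  finally have "real (kap r S) \<le> real (nat (\<lfloor>l * ?D / r\<rfloor> + 1)) ^ ?D"
    by (metis of_nat_mono of_nat_power)
  also have "\<dots> \<le> (2 * l * ?D / r) ^ ?D"
  proof (rule power_mono)
    have "r * 1 \<le> l * ?D"
      using assms D by (intro mult_mono) auto
    then have "1 \<le> l * ?D / r" using assms(2) by (simp add: field_simps)
    then show "real (nat (\<lfloor>l * ?D / r\<rfloor> + 1)) \<le> 2 * l * ?D / r"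
      by linarith
  qed simp
  finally show ?thesis .
qed

text \<open>Scales up to 1 contribute at most the number of points. Beyond 1, packing bounds
  \<open>kap r S\<close> by a multiple of \<open>(l / r) ^ CARD('d)\<close>; in dimension at least 2
  this is dominated by \<open>1 / r\<^sup>2\<close>, whose integral is at most 1.\<close>

lemma HH_cube_le:
  fixes S :: "(real ^ 'd) set" and l :: real
  assumes "finite S" "1 \<le> R" "R \<le> l" "\<And>u i. u \<in> S \<Longrightarrow> 0 \<le> u $ i \<and> u $ i \<le> l" "2 \<le> CARD('d)"
  shows "HH R S \<le> real (card S) + (2 * real CARD('d)) ^ CARD('d) * l ^ CARD('d)"
proof -
  let ?D = "CARD('d)"
  have "HH R S = integral {0..1} (\<lambda>r. real (kap r S)) + integral {1..R} (\<lambda>r. real (kap r S))"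
    unfolding HH_def using assms(2) kap_integrable[OF assms(1)]
    by (intro Henstock_Kurzweil_Integration.integral_combine[symmetric]) auto
  moreover have "integral {0..1} (\<lambda>r. real (kap r S)) \<le> real (card S) * 1"
    by (rule integral_between(2)[OF kap_integrable[OF assms(1)], of 1 0])
      (auto simp: kap_le_card[OF assms(1)])
  moreover have "integral {1..R} (\<lambda>r. real (kap r S)) \<le> (2 * l * ?D) ^ ?D"
  proof -
    have der: "((\<lambda>r::real. (2 * l * ?D) ^ ?D * (1 / r\<^sup>2)) has_integral
        (2 * l * ?D) ^ ?D * (- (1 / R) - - (1 / 1))) {1..R}"
    proof (intro has_integral_mult_right fundamental_theorem_of_calculus assms(2))
      fix r :: real assume "r \<in> {1..R}"
      then show "((\<lambda>r. - (1 / r)) has_vector_derivative 1 / r\<^sup>2) (at r within {1..R})"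
        unfolding has_real_derivative_iff_has_vector_derivative[symmetric]
        by (auto intro!: derivative_eq_intros simp: power2_eq_square)
    qed
    have "integral {1..R} (\<lambda>r. real (kap r S)) \<le> (2 * l * ?D) ^ ?D * (- (1 / R) - - (1 / 1))"
    proof (rule has_integral_le[OF integrable_integral[OF kap_integrable[OF assms(1)]] der])
      fix r :: real assume r: "r \<in> {1..R}"
      have "real (kap r S) \<le> (2 * l * ?D / r) ^ ?D"
        by (rule kap_cube_le) (use assms r in auto)
      also have "\<dots> = (2 * l * ?D) ^ ?D * (1 / r ^ ?D)" by (simp add: power_divide)
      also have "\<dots> \<le> (2 * l * ?D) ^ ?D * (1 / r\<^sup>2)"
      proof (intro mult_left_mono divide_left_mono)
        show "r\<^sup>2 \<le> r ^ ?D" using r assms(5) by (intro power_increasing) auto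
        show "0 \<le> (2 * l * ?D) ^ ?D" using assms by simp
      qed (use r in auto)
      finally show "real (kap r S) \<le> (2 * l * ?D) ^ ?D * (1 / r\<^sup>2)" .
    qed
    also have "\<dots> \<le> (2 * l * ?D) ^ ?D * 1"
      using assms by (intro mult_left_mono) auto
    finally show ?thesis by simp
  qed
  ultimately show ?thesis
    by (simp add: power_mult_distrib mult_ac)
qed

lemma pt_grid_bounds: "u \<in> pt h ` grid N \<Longrightarrow> 0 < h \<Longrightarrow> 0 \<le> u $ i \<and> u $ i \<le> h * real N"
  by (auto simp: pt_component grid_def less_imp_le)

lemma Bexp_HH_le:
  assumes h: "0 < h" "0 < L" and R: "1 \<le> R" "R \<le> h * real L" and D: "2 \<le> CARD('d)"
    and p: "0 \<le> p" "p \<le> 1"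
  shows "Bexp (pt h ` grid L :: (real ^ 'd) set) p (HH R) \<le>
    p * real L ^ CARD('d) + (2 * real CARD('d)) ^ CARD('d) * (h * real L) ^ CARD('d)"
proof -
  let ?Q = "pt h ` grid L :: (real ^ 'd) set"
  have fin: "finite ?Q" using finite_grid by auto
  have "Bexp ?Q p (HH R) \<le> Bexp ?Q p (\<lambda>S. real (card S) + (2 * real CARD('d)) ^ CARD('d)
    * (h * real L) ^ CARD('d))"
  proof (rule Bexp_mono)
    fix S assume S: "S \<subseteq> ?Q"
    show "HH R S \<le> real (card S) + (2 * real CARD('d)) ^ CARD('d) * (h * real L) ^ CARD('d)"
      by (rule HH_cube_le) (use S R D fin finite_subset pt_grid_bounds[of _ h L] h in blast)+
  qed (use p in auto)
  then show ?thesis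
    by (simp add: Bexp_add Bexp_const fin Bexp_card card_pt[OF h(1)] card_grid)
qed

lemma Bexp_singleton:
  assumes "finite B" "x \<in> B"
  shows "Bexp B p (\<lambda>T. of_bool (T = {x})) = p * (1 - p) ^ (card B - 1)"
proof -
  have "Bexp B p (\<lambda>T. of_bool (T = {x})) =
      (\<Sum>S\<in>Pow B. if S = {x} then p ^ card {x} * (1 - p) ^ card (B - {x}) else 0)"
    unfolding Bexp_def by (rule sum.cong) auto
  also have "\<dots> = p ^ card {x} * (1 - p) ^ card (B - {x})"
    using assms by (subst sum.delta) auto
  finally show ?thesis using assms by simp
qed

lemma card_grid_ball_le:
  assumes "0 < h" "h \<le> \<rho>"
  shows "real (card (pt h ` grid L \<inter> cball (pt h j) \<rho> :: (real ^ 'd) set)) \<le> (3 * \<rho> / h) ^ CARD('d)"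
proof -
  let ?m = "nat \<lfloor>\<rho> / h\<rfloor>"
  have "pt h ` grid L \<inter> cball (pt h j) \<rho> \<subseteq> pt h ` {j' :: 'd \<Rightarrow> nat. \<forall>i. j' i \<in> {j i - ?m..j i + ?m}}"
  proof
    fix x :: "real ^ 'd" assume "x \<in> pt h ` grid L \<inter> cball (pt h j) \<rho>"
    then obtain j' where j': "x = pt h j'" "dist (pt h j) x \<le> \<rho>" by auto
    have "j' i \<in> {j i - ?m..j i + ?m}" for i
    proof -
      have "\<bar>h * real (j i) - h * real (j' i)\<bar> \<le> \<rho>"
        using component_dist_le[of "pt h j" i x] j' by (simp add: pt_component)
      then have "h * \<bar>real (j i) - real (j' i)\<bar> \<le> \<rho>"
        using assms(1) by (simp add: abs_mult flip: right_diff_distrib)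
      then have "\<bar>real_of_int (int (j i) - int (j' i))\<bar> \<le> \<rho> / h"
        using assms(1) by (simp add: field_simps)
      then have "\<bar>int (j i) - int (j' i)\<bar> \<le> \<lfloor>\<rho> / h\<rfloor>"
        by (simp add: le_floor_iff)
      then show ?thesis by auto
    qed
    then show "x \<in> pt h ` {j' :: 'd \<Rightarrow> nat. \<forall>i. j' i \<in> {j i - ?m..j i + ?m}}" using j' by auto
  qed
  then have "card (pt h ` grid L \<inter> cball (pt h j) \<rho> :: (real ^ 'd) set) \<le>
      card (pt h ` {j' :: 'd \<Rightarrow> nat. \<forall>i. j' i \<in> {j i - ?m..j i + ?m}})"
    by (rule card_mono[rotated]) (intro finite_imageI finite_Collect_grid, simp)
  also have "\<dots> = (\<Prod>i\<in>UNIV. card {j i - ?m..j i + ?m})"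
    unfolding card_pt[OF assms(1)] card_Collect_grid ..
  also have "\<dots> \<le> (\<Prod>i\<in>(UNIV :: 'd set). 2 * ?m + 1)"
    by (rule prod_mono) auto
  finally have "real (card (pt h ` grid L \<inter> cball (pt h j) \<rho> :: (real ^ 'd) set))
    \<le> real ((2 * ?m + 1) ^ CARD('d))"
    by (intro of_nat_mono) simp
  also have "\<dots> = real (2 * ?m + 1) ^ CARD('d)" by simp
  also have "\<dots> \<le> (3 * \<rho> / h) ^ CARD('d)"
  proof (rule power_mono)
    have "1 \<le> \<rho> / h" using assms by simp
    then show "real (2 * ?m + 1) \<le> 3 * \<rho> / h" by linarith
  qed simp
  finally show ?thesis .
qed

text \<open>A point without other points within \<open>\<rho>\<close> is a component at every scale
  up to \<open>\<rho>\<close>. By Bernoulli's inequality and \<open>small\<close>, each lattice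
  point is present and so isolated with probability at least \<open>p / 2\<close>.\<close>

lemma Bexp_HH_ge:
  assumes h: "0 < h" "h \<le> \<rho>" and \<rho>: "\<rho> \<le> R" and p: "0 \<le> p" "p \<le> 1"
    and small: "p * (3 * \<rho> / h) ^ CARD('d) \<le> 1 / 2"
  shows "\<rho> * p * real L ^ CARD('d) / 2 \<le> Bexp (pt h ` grid L :: (real ^ 'd) set) p (HH R)"
proof -
  let ?Q = "pt h ` grid L :: (real ^ 'd) set"
  have fin: "finite ?Q" using finite_grid by auto
  have \<rho>0: "0 < \<rho>" using h by simp
  have HHge: "\<rho> * real (card {x \<in> S. S \<inter> cball x \<rho> \<subseteq> {x}}) \<le> HH R S" if S: "S \<subseteq> ?Q" for S
  proof -
    have fS: "finite S" using S fin finite_subset by auto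
    have "HH R S = integral {0..\<rho>} (\<lambda>r. real (kap r S)) + integral {\<rho>..R} (\<lambda>r. real (kap r S))"
      unfolding HH_def using \<rho>0 \<rho> kap_integrable[OF fS]
      by (intro Henstock_Kurzweil_Integration.integral_combine[symmetric]) auto
    moreover have "0 \<le> integral {\<rho>..R} (\<lambda>r. real (kap r S))"
      by (rule integral_nonneg[OF kap_integrable[OF fS]]) simp
    moreover have "real (kap \<rho> S) * \<rho> \<le> integral {0..\<rho>} (\<lambda>r. real (kap r S))"
      by (rule integral_between(1)[OF kap_integrable[OF fS], of \<rho> _ "real (card S)"])
        (use \<rho>0 kap_antimono[OF fS] kap_le_card[OF fS] in auto)
    moreover have "\<rho> * real (card {x \<in> S. S \<inter> cball x \<rho> \<subseteq> {x}}) \<le> \<rho> * real (kap \<rho> S)"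
      using kap_ge_isolated[OF fS, of \<rho>] \<rho>0 by (intro mult_left_mono) auto
    ultimately show ?thesis by (simp add: mult.commute)
  qed
  have iso: "p / 2 \<le> Bexp ?Q p (\<lambda>S. of_bool (x \<in> S \<and> S \<inter> cball x \<rho> \<subseteq> {x}))" if x: "x \<in> ?Q" for x
  proof -
    let ?B = "?Q \<inter> cball x \<rho>"
    have xB: "x \<in> ?B" using x \<rho>0 by simp
    have "Bexp ?Q p (\<lambda>S. of_bool (x \<in> S \<and> S \<inter> cball x \<rho> \<subseteq> {x}))
      = Bexp ?Q p (\<lambda>S. of_bool (S \<inter> ?B = {x}))"
      by (intro Bexp_cong arg_cong[where f = of_bool]) (use xB in auto)
    also have "\<dots> = Bexp ?B p (\<lambda>T. of_bool (T = {x}))"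
      by (rule Bexp_restrict[OF fin, of _ p "\<lambda>T. of_bool (T = {x})"]) auto
    also have "\<dots> = p * (1 - p) ^ (card ?B - 1)"
      by (rule Bexp_singleton) (use fin xB in auto)
    also have "\<dots> \<ge> p * (1 / 2)"
    proof (rule mult_left_mono)
      obtain j where j: "x = pt h j" using x by auto
      have "real (card ?B - 1) \<le> (3 * \<rho> / h) ^ CARD('d)"
        using card_grid_ball_le[OF h, of L j] unfolding j by linarith
      then have "real (card ?B - 1) * p \<le> 1 / 2"
        using small mult_left_mono[OF _ p(1)] by (metis mult.commute order_trans)
      moreover have "1 + real (card ?B - 1) * (- p) \<le> (1 + (- p)) ^ (card ?B - 1)"
        by (rule Bernoulli_inequality) (use p in auto)
      ultimately show "1 / 2 \<le> (1 - p) ^ (card ?B - 1)" by simp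
    qed (use p in auto)
    finally show ?thesis by simp
  qed
  have "\<rho> * p * real L ^ CARD('d) / 2 = \<rho> * (\<Sum>x\<in>?Q. p / 2)"
    by (simp add: card_pt[OF h(1)] card_grid)
  also have "\<dots> \<le> \<rho> * (\<Sum>x\<in>?Q. Bexp ?Q p (\<lambda>S. of_bool (x \<in> S \<and> S \<inter> cball x \<rho> \<subseteq> {x})))"
    using \<rho>0 iso by (intro mult_left_mono sum_mono) auto
  also have "\<dots> = Bexp ?Q p (\<lambda>S. \<rho> * (\<Sum>x\<in>?Q. of_bool (x \<in> S \<and> S \<inter> cball x \<rho> \<subseteq> {x})))"
    by (simp only: Bexp_cmult Bexp_sum)
  also have "\<dots> \<le> Bexp ?Q p (HH R)"
  proof (rule Bexp_mono)
    fix S assume S: "S \<subseteq> ?Q"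
    have "?Q \<inter> {x. x \<in> S \<and> S \<inter> cball x \<rho> \<subseteq> {x}} = {x \<in> S. S \<inter> cball x \<rho> \<subseteq> {x}}" using S by auto
    then have "(\<Sum>x\<in>?Q. of_bool (x \<in> S \<and> S \<inter> cball x \<rho> \<subseteq> {x}))
      = real (card {x \<in> S. S \<inter> cball x \<rho> \<subseteq> {x}})"
      using fin by (simp add: sum.If_cases of_bool_def)
    then show "\<rho> * (\<Sum>x\<in>?Q. of_bool (x \<in> S \<and> S \<inter> cball x \<rho> \<subseteq> {x})) \<le> HH R S"
      using HHge[OF S] by simp
  qed (use p in auto)
  finally show ?thesis .
qed

section \<open>Long edges\<close>

text \<open>The last cube in each direction is pushed back into the grid, so all cubes have the same
  number of points. They may overlap, which is harmless for a union bound.\<close>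

definition cube :: "nat \<Rightarrow> nat \<Rightarrow> ('d::finite \<Rightarrow> nat) \<Rightarrow> ('d \<Rightarrow> nat) set" where
  "cube N w q = {j. \<forall>i. j i \<in> {min (q i * w) (N - w)..<min (q i * w) (N - w) + w}}"

definition has_hole :: "real \<Rightarrow> nat \<Rightarrow> nat \<Rightarrow> (real ^ 'd) set \<Rightarrow> bool" where
  "has_hole h N w S \<longleftrightarrow> (\<exists>q\<in>grid (N div w + 1). S \<inter> pt h ` cube N w q = {})"

lemma card_cube: "card (cube N w q :: ('d::finite \<Rightarrow> nat) set) = w ^ CARD('d)"
  unfolding cube_def card_Collect_grid by simp

lemma cube_subset_grid: "w \<le> N \<Longrightarrow> cube N w q \<subseteq> grid N"
proof
  fix j assume w: "w \<le> N" and j: "j \<in> cube N w q"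
  have "j i < N" for i
  proof -
    have "j i < min (q i * w) (N - w) + w" using j by (auto simp: cube_def)
    then show ?thesis using w by linarith
  qed
  then show "j \<in> grid N" by (simp add: grid_def)
qed

lemma Bexp_empty_prob:
  assumes "finite B"
  shows "Bexp B p (\<lambda>T. of_bool (T = {})) = (1 - p) ^ card B"
proof -
  have "Bexp B p (\<lambda>T. of_bool (T = {})) = (\<Sum>S\<in>Pow B. if S = {} then (1 - p) ^ card B else 0)"
    unfolding Bexp_def by (rule sum.cong) auto
  then show ?thesis using assms by (simp add: sum.delta)
qed

lemma Bexp_has_hole_le:
  assumes "0 < h" "w \<le> N" "0 \<le> p" "p \<le> 1"
  shows "Bexp (pt h ` grid N :: (real ^ 'd) set) p (\<lambda>S. of_bool (has_hole h N w S))
    \<le> real (N div w + 1) ^ CARD('d) * exp (- (p * real w ^ CARD('d)))"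
proof -
  let ?A = "pt h ` grid N :: (real ^ 'd) set" and ?q = "grid (N div w + 1) :: ('d \<Rightarrow> nat) set"
  have fin: "finite ?A" "finite ?q" using finite_grid by auto
  have one: "Bexp ?A p (\<lambda>S. of_bool (S \<inter> pt h ` cube N w q = {})) \<le> exp (- (p * real w ^ CARD('d)))"
    for q
  proof -
    have sub: "pt h ` cube N w q \<subseteq> ?A" using cube_subset_grid[OF assms(2)] by blast
    have fc: "finite (pt h ` cube N w q :: (real ^ 'd) set)" using sub fin finite_subset by blast
    have "Bexp ?A p (\<lambda>S. of_bool (S \<inter> pt h ` cube N w q = {})) = (1 - p) ^ (w ^ CARD('d))"
      using Bexp_restrict[OF fin(1) sub, of p "\<lambda>T. of_bool (T = {})"]
      by (simp add: Bexp_empty_prob[OF fc] card_pt[OF assms(1)] card_cube)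
    also have "\<dots> \<le> exp (- p) ^ (w ^ CARD('d))"
      using exp_ge_add_one_self[of "- p"] assms by (intro power_mono) auto
    also have "\<dots> = exp (- (p * real w ^ CARD('d)))"
      by (simp add: mult.commute flip: exp_of_nat_mult)
    finally show ?thesis .
  qed
  have "Bexp ?A p (\<lambda>S. of_bool (has_hole h N w S))
    \<le> Bexp ?A p (\<lambda>S. \<Sum>q\<in>?q. of_bool (S \<inter> pt h ` cube N w q = {}))"
  proof (rule Bexp_mono)
    fix S :: "(real ^ 'd) set"
    show "of_bool (has_hole h N w S) \<le> (\<Sum>q\<in>?q. of_bool (S \<inter> pt h ` cube N w q = {}) :: real)"
    proof (cases "has_hole h N w S")
      case True
      then obtain q where q: "q \<in> ?q" "S \<inter> pt h ` cube N w q = {}" by (auto simp: has_hole_def)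
      have "(of_bool (S \<inter> pt h ` cube N w q = {}) :: real)
        \<le> (\<Sum>q\<in>?q. of_bool (S \<inter> pt h ` cube N w q = {}))"
        by (rule member_le_sum[OF q(1) _ fin(2)]) simp
      then show ?thesis using q by simp
    next
      case False
      then show ?thesis by (simp add: sum_nonneg)
    qed
  qed (use assms in auto)
  also have "\<dots> = (\<Sum>q\<in>?q. Bexp ?A p (\<lambda>S. of_bool (S \<inter> pt h ` cube N w q = {})))"
    by (rule Bexp_sum)
  also have "\<dots> \<le> (\<Sum>q\<in>?q. exp (- (p * real w ^ CARD('d))))"
    by (intro sum_mono one)
  also have "\<dots> = real (N div w + 1) ^ CARD('d) * exp (- (p * real w ^ CARD('d)))"
    by (simp add: card_grid)
  finally show ?thesis .
qed

text \<open>Every position of the box rounds down to an index in some cube, which contains a point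
  of \<open>S\<close> at distance at most \<open>CARD('d) * (h * w)\<close>. So \<open>S\<close> is
  \<open>R / 3\<close>-dense in a convex set.\<close>

lemma kap_eq_1_of_no_hole:
  fixes S :: "(real ^ 'd) set"
  assumes h: "0 < h" and w: "0 < w" "w \<le> N" "CARD('d) * (h * real w) \<le> R / 3"
    and S: "S \<subseteq> pt h ` grid N" "\<not> has_hole h N w S"
  shows "kap R S = 1" "S \<noteq> {}"
proof -
  let ?W = "cbox 0 (\<chi> i. h * real (N - 1)) :: (real ^ 'd) set"
  have fin: "finite S" using S(1) finite_grid finite_subset by blast
  have q0: "(\<lambda>_. 0) \<in> (grid (N div w + 1) :: ('d \<Rightarrow> nat) set)" by (simp add: grid_def)
  with S(2) show ne: "S \<noteq> {}" by (auto simp: has_hole_def)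
  have R: "0 < R"
  proof -
    have "0 < CARD('d) * (h * real w)" using h w by simp
    then show ?thesis using w(3) by linarith
  qed
  show "kap R S = 1"
  proof (rule kap_eq_1_of_dense[OF fin ne, of ?W])
    show "S \<subseteq> ?W"
    proof
      fix u assume "u \<in> S"
      then obtain j where j: "u = pt h j" "j \<in> grid N" using S(1) by auto
      have "j i \<le> N - 1" for i
        using j(2) by (auto simp: grid_def Suc_le_eq dest: spec[of _ i])
      then have "real (j i) \<le> real (N - 1)" for i by (rule of_nat_mono)
      then show "u \<in> ?W" using h j by (simp add: mem_box_cart pt_component)
    qed
  next
    fix y assume y: "y \<in> ?W"
    define idx where "idx i = nat \<lfloor>y $ i / h\<rfloor>" for i
    have yi: "0 \<le> y $ i" "y $ i / h \<le> real (N - 1)" for i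
      using y h by (auto simp: mem_box_cart field_simps)
    have idx: "real (idx i) \<le> y $ i / h" "y $ i / h < real (idx i) + 1" for i
      using yi(1)[of i] h by (auto simp: idx_def)
    have idxN: "idx i < N" for i
    proof -
      have "real (idx i) \<le> real (N - 1)" using idx(1)[of i] yi(2)[of i] by linarith
      then show ?thesis using w by simp
    qed
    define q where "q i = idx i div w" for i
    have "q \<in> grid (N div w + 1)"
      using idxN by (auto simp: grid_def q_def less_Suc_eq_le intro: div_le_mono less_imp_le)
    then obtain j where j: "pt h j \<in> S" "j \<in> cube N w q"
      using S(2) by (auto simp: has_hole_def)
    have "\<bar>y $ i - pt h j $ i\<bar> \<le> h * real w" for i
    proof -
      let ?b = "min (q i * w) (N - w)"
      have jb: "?b \<le> j i" "j i < ?b + w" using j(2) by (auto simp: cube_def)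
      have "q i * w \<le> idx i" "idx i < q i * w + w"
        using w(1) by (auto simp: q_def) (metis add.commute dividend_less_div_times)
      then have ib: "?b \<le> idx i" "idx i < ?b + w"
        using idxN[of i] w(2) by auto
      have "real (j i) + 1 \<le> real ?b + real w" "real ?b \<le> real (j i)"
        "real (idx i) + 1 \<le> real ?b + real w" "real ?b \<le> real (idx i)"
        using jb ib by (simp_all del: of_nat_min flip: of_nat_add of_nat_Suc)
      then have "\<bar>y $ i / h - real (j i)\<bar> \<le> real w"
        using idx[of i] by linarith
      moreover have "y $ i - pt h j $ i = h * (y $ i / h - real (j i))"
        using h by (simp add: pt_component field_simps)
      ultimately show ?thesis using h by (simp add: abs_mult)
    qed
    then have "dist y (pt h j) \<le> CARD('d) * (h * real w)" by (rule dist_le_l1)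
    then show "\<exists>v\<in>S. dist y v \<le> R / 3" using j(1) w(3) by force
  qed (use R in \<open>auto intro: convex_box\<close>)
qed

text \<open>Without a hole the graph at scale \<open>R\<close> is connected and the integral formula
  is exact. With a hole a crude polynomial bound is enough, holes being exponentially
  unlikely.\<close>

lemma mst_tail:
  fixes S :: "(real ^ 'd) set" and l :: real
  assumes h: "0 < h" and w: "0 < w" "w \<le> N" "CARD('d) * (h * real w) \<le> R / 3"
    and S: "S \<subseteq> pt h ` grid N" and l: "h * real N \<le> l" "R \<le> l" "1 \<le> R"
  shows "\<bar>mst_length S - (HH R S - R)\<bar>
    \<le> (2 * CARD('d) * l) ^ (CARD('d) + 1) * of_bool (has_hole h N w S)"
proof (cases "has_hole h N w S")
  case False
  have fin: "finite S" using S finite_grid finite_subset by blast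
  show ?thesis
    using mst_length_eq_integral[OF fin kap_eq_1_of_no_hole(2)[OF h w S False] _
        kap_eq_1_of_no_hole(1)[OF h w S False]] l False
    by (simp add: HH_def)
next
  case True
  let ?D = "CARD('d)"
  have D: "1 \<le> ?D" by (simp add: Suc_le_eq)
  have fin: "finite S" using S finite_grid finite_subset by blast
  have l1: "1 \<le> l" using l by linarith
  have bd: "0 \<le> u $ i \<and> u $ i \<le> l" if "u \<in> S" for u i
    using pt_grid_bounds[of u h N i] S that h l by force
  have one: "1 \<le> 2 * ?D * l"
  proof -
    have "1 \<le> 2 * real ?D" using D by linarith
    then show ?thesis using mult_mono[of 1 "2 * real ?D" 1 l] l1 by linarith
  qed
  show ?thesis
  proof (cases "S = {}")
    \<comment> \<open>For the empty set both functionals vanish and the difference is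
      \<open>R\<close>.\<close>
    case True
    have "1 \<le> 2 * real ?D" using D by linarith
    then have "l \<le> 2 * ?D * l" using mult_right_mono[of 1 "2 * real ?D" l] l1 by linarith
    also have "\<dots> \<le> (2 * ?D * l) ^ (?D + 1)"
      using self_le_power[OF one, of "?D + 1"] by simp
    finally have "R \<le> (2 * ?D * l) ^ (?D + 1)" using l by linarith
    then show ?thesis using True \<open>has_hole h N w S\<close> l by simp
  next
    case False
    \<comment> \<open>At this scale any two points of \<open>S\<close> are adjacent, so the integral
      formula holds with \<open>R'\<close> in place of \<open>R\<close>.\<close>
    define R' where "R' = R + ?D * l"
    have R': "R \<le> R'" using l1 by (simp add: R'_def)
    have "kap R' S = 1"
    proof -
      have "dist u v \<le> R'" if "u \<in> S" "v \<in> S" for u v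
      proof -
        have "\<bar>u $ i - v $ i\<bar> \<le> l" for i using bd[OF that(1), of i] bd[OF that(2), of i] by auto
        then have "dist u v \<le> ?D * l" by (rule dist_le_l1)
        then show ?thesis using l by (simp add: R'_def)
      qed
      then have "kap R' S \<le> card ((\<lambda>_. ()) ` S)"
        by (intro kap_le_card_image[OF fin])
      also have "\<dots> \<le> card {()}" by (rule card_mono) auto
      also have "\<dots> = 1" by simp
      finally show ?thesis
        using ncomp_pos[OF fin False, of "geo R' S"] by (simp add: kap_def)
    qed
    then have "mst_length S = integral {0..R'} (\<lambda>r. real (kap r S)) - R'"
      using l R' by (intro mst_length_eq_integral fin False) auto
    also have "integral {0..R'} (\<lambda>r. real (kap r S))
      = HH R S + integral {R..R'} (\<lambda>r. real (kap r S))"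
      unfolding HH_def using l R' kap_integrable[OF fin]
      by (intro Henstock_Kurzweil_Integration.integral_combine[symmetric]) auto
    finally have eq: "mst_length S - (HH R S - R) = integral {R..R'} (\<lambda>r. real (kap r S))
      - (R' - R)"
      by simp
    have "integral {R..R'} (\<lambda>r. 1) \<le> integral {R..R'} (\<lambda>r. real (kap r S))"
    proof (rule integral_le[OF integrable_const_ivl kap_integrable[OF fin]])
      show "1 \<le> real (kap r S)" for r using ncomp_pos[OF fin False, of "geo r S"] by (simp add:
        kap_def)
    qed
    then have low: "0 \<le> mst_length S - (HH R S - R)" using eq R' by simp
    have "real (kap R S) \<le> (2 * l * ?D / R) ^ ?D"
      by (rule kap_cube_le[OF fin]) (use l bd in auto)
    also have "\<dots> \<le> (2 * ?D * l) ^ ?D"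
    proof (rule power_mono)
      have "2 * l * ?D / R \<le> 2 * l * ?D / 1" using l l1 by (intro divide_left_mono) auto
      then show "2 * l * ?D / R \<le> 2 * ?D * l" by (simp add: mult_ac)
    qed (use l l1 in auto)
    finally have kR: "real (kap R S) \<le> (2 * ?D * l) ^ ?D" .
    have "integral {R..R'} (\<lambda>r. real (kap r S)) \<le> integral {R..R'} (\<lambda>r. (2 * ?D * l) ^ ?D)"
    proof (rule integral_le[OF kap_integrable[OF fin] integrable_const_ivl])
      fix r assume "r \<in> {R..R'}"
      then have "real (kap r S) \<le> real (kap R S)" using kap_antimono[OF fin, of R r] by simp
      then show "real (kap r S) \<le> (2 * ?D * l) ^ ?D" using kR by linarith
    qed
    also have "\<dots> = (2 * ?D * l) ^ ?D * (?D * l)"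
      using R' by (simp add: R'_def mult.commute)
    also have "\<dots> \<le> (2 * ?D * l) ^ ?D * (2 * ?D * l)"
      using l1 D by (intro mult_left_mono) auto
    finally have "mst_length S - (HH R S - R) \<le> (2 * ?D * l) ^ (?D + 1)"
      using eq R' by (simp add: mult.commute)
    then show ?thesis using low True by simp
  qed
qed

section \<open>Moments of the block functionals\<close>

lemma HH_bounds:
  assumes "finite S" "0 \<le> R"
  shows "0 \<le> HH R S" "HH R S \<le> R * real (card S)"
  using integral_between[OF kap_integrable[OF assms(1)] assms(2), of 0 "real (card S)"]
    kap_le_card[OF assms(1)] by (auto simp: HH_def mult.commute)

text \<open>From \<open>0 \<le> HH R S\<close> and \<open>HH R S \<le> R * card S\<close>.
  Cancellation within a block is ignored; the large number of blocks compensates for this.\<close>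

lemma HH_central_moments:
  fixes Q :: "'a::metric_space set"
  assumes Q: "finite Q" "0 \<le> R" and p: "0 \<le> p" "p \<le> 1"
  defines "\<mu> \<equiv> p * real (card Q)"
  assumes \<mu>: "1 \<le> \<mu>"
  shows "Bexp Q p (\<lambda>S. (HH R S - Bexp Q p (HH R))\<^sup>2) \<le> 5 * R\<^sup>2 * \<mu>\<^sup>2"
    and "Bexp Q p (\<lambda>S. \<bar>HH R S - Bexp Q p (HH R)\<bar> ^ 3) \<le> 15 * R ^ 3 * \<mu> ^ 3"
proof -
  have fS: "finite S" if "S \<subseteq> Q" for S using that Q finite_subset by auto
  have "0 \<le> Bexp Q p (HH R)"
    by (rule Bexp_nonneg) (simp_all add: HH_bounds fS Q p)
  moreover have "Bexp Q p (HH R) \<le> Bexp Q p (\<lambda>S. R * real (card S))"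
    by (rule Bexp_mono) (simp_all add: HH_bounds fS Q p)
  ultimately have E: "0 \<le> Bexp Q p (HH R)" "Bexp Q p (HH R) \<le> R * \<mu>"
    by (auto simp: Bexp_cmult Bexp_card[OF Q(1)] \<mu>_def)
  have pt: "\<bar>HH R S - Bexp Q p (HH R)\<bar> \<le> R * (real (card S) + \<mu>)" if "S \<subseteq> Q" for S
  proof -
    have "0 \<le> R * real (card S)" "0 \<le> R * \<mu>" using Q \<mu> by auto
    then show ?thesis
      unfolding distrib_left using HH_bounds[OF fS[OF that] Q(2)] E by linarith
  qed
  note mom = Bexp_card_moments[OF Q(1) p, folded \<mu>_def]
  have m1: "Bexp Q p (\<lambda>S. real (card S)) = \<mu>" by (simp add: Bexp_card[OF Q(1)] \<mu>_def)
  have \<mu>2: "\<mu> \<le> \<mu>\<^sup>2" "\<mu>\<^sup>2 \<le> \<mu> ^ 3" "\<mu> \<le> \<mu> ^ 3"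
    using power_increasing[of 1 2 \<mu>] power_increasing[of 2 3 \<mu>] power_increasing[of 1 3 \<mu>] \<mu> by auto
  have "Bexp Q p (\<lambda>S. (HH R S - Bexp Q p (HH R))\<^sup>2) \<le>
      Bexp Q p (\<lambda>S. R\<^sup>2 * (real (card S) ^ 2 + 2 * \<mu> * real (card S) + \<mu>\<^sup>2))"
  proof (rule Bexp_mono)
    fix S assume "S \<subseteq> Q"
    then have "(HH R S - Bexp Q p (HH R))\<^sup>2 \<le> (R * (real (card S) + \<mu>))\<^sup>2"
      using power_mono[OF pt abs_ge_zero, of S 2] by simp
    also have "\<dots> = R\<^sup>2 * (real (card S) ^ 2 + 2 * \<mu> * real (card S) + \<mu>\<^sup>2)"
      by (simp add: power2_eq_square algebra_simps)
    finally show "(HH R S - Bexp Q p (HH R))\<^sup>2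
      \<le> R\<^sup>2 * (real (card S) ^ 2 + 2 * \<mu> * real (card S) + \<mu>\<^sup>2)" .
  qed (use p in auto)
  also have "\<dots> = R\<^sup>2 * (Bexp Q p (\<lambda>S. real (card S) ^ 2) + 2 * \<mu> * \<mu> + \<mu>\<^sup>2)"
    by (simp only: Bexp_cmult Bexp_add Bexp_const[OF Q(1)] m1)
  also have "\<dots> \<le> R\<^sup>2 * (5 * \<mu>\<^sup>2)"
  proof (rule mult_left_mono)
    have "2 * \<mu> * \<mu> = 2 * \<mu>\<^sup>2" by (simp add: power2_eq_square)
    then show "Bexp Q p (\<lambda>S. real (card S) ^ 2) + 2 * \<mu> * \<mu> + \<mu>\<^sup>2 \<le> 5 * \<mu>\<^sup>2"
      using mom(1) \<mu>2 by linarith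
  qed simp
  finally show "Bexp Q p (\<lambda>S. (HH R S - Bexp Q p (HH R))\<^sup>2) \<le> 5 * R\<^sup>2 * \<mu>\<^sup>2" by simp
  have "Bexp Q p (\<lambda>S. \<bar>HH R S - Bexp Q p (HH R)\<bar> ^ 3) \<le>
      Bexp Q p (\<lambda>S. R ^ 3 * (real (card S) ^ 3 + 3 * \<mu> * real (card S) ^ 2 + 3 * \<mu>\<^sup>2 * real (card S)
        + \<mu> ^ 3))"
  proof (rule Bexp_mono)
    fix S assume "S \<subseteq> Q"
    then have "\<bar>HH R S - Bexp Q p (HH R)\<bar> ^ 3 \<le> (R * (real (card S) + \<mu>)) ^ 3"
      by (intro power_mono pt) auto
    also have "\<dots> = R ^ 3 * (real (card S) ^ 3 + 3 * \<mu> * real (card S) ^ 2 + 3 * \<mu>\<^sup>2 * real (card S)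
      + \<mu> ^ 3)"
      by (simp add: power2_eq_square power3_eq_cube algebra_simps)
    finally show "\<bar>HH R S - Bexp Q p (HH R)\<bar> ^ 3 \<le>
      R ^ 3 * (real (card S) ^ 3 + 3 * \<mu> * real (card S) ^ 2 + 3 * \<mu>\<^sup>2 * real (card S) + \<mu> ^ 3)" .
  qed (use p in auto)
  also have "\<dots> = R ^ 3 * (Bexp Q p (\<lambda>S. real (card S) ^ 3)
    + 3 * \<mu> * Bexp Q p (\<lambda>S. real (card S) ^ 2)
      + 3 * \<mu>\<^sup>2 * \<mu> + \<mu> ^ 3)"
    by (simp only: Bexp_cmult Bexp_add Bexp_const[OF Q(1)] m1)
  also have "\<dots> \<le> R ^ 3 * (15 * \<mu> ^ 3)"
  proof (rule mult_left_mono)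
    have "3 * \<mu> * Bexp Q p (\<lambda>S. real (card S) ^ 2) \<le> 3 * \<mu> * (\<mu>\<^sup>2 + \<mu>)"
      using mom(1) \<mu> by (intro mult_left_mono) auto
    also have "\<dots> = 3 * \<mu> ^ 3 + 3 * \<mu>\<^sup>2" by (simp add: power2_eq_square power3_eq_cube algebra_simps)
    finally have a: "3 * \<mu> * Bexp Q p (\<lambda>S. real (card S) ^ 2) \<le> 3 * \<mu> ^ 3 + 3 * \<mu>\<^sup>2" .
    have "3 * \<mu>\<^sup>2 * \<mu> = 3 * \<mu> ^ 3" by (simp add: power2_eq_square power3_eq_cube)
    then show "Bexp Q p (\<lambda>S. real (card S) ^ 3) + 3 * \<mu> * Bexp Q p (\<lambda>S. real (card S) ^ 2)
      + 3 * \<mu>\<^sup>2 * \<mu> + \<mu> ^ 3 \<le> 15 * \<mu> ^ 3"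
      using mom(2) a \<mu>2 by linarith
  qed (use Q in auto)
  finally show "Bexp Q p (\<lambda>S. \<bar>HH R S - Bexp Q p (HH R)\<bar> ^ 3) \<le> 15 * R ^ 3 * \<mu> ^ 3" by simp
qed

section \<open>Choice of the intensity\<close>

text \<open>\<open>bet D ^ D\<close> is the ratio of the intensities between which \<open>good_parameter\<close> selects one.\<close>

definition bet :: "nat \<Rightarrow> real" where
  "bet D = 12 * (2 + (2 * real D) ^ D)"

definition slope :: "nat \<Rightarrow> real" where
  "slope D = 1 / (2 * (bet D ^ D - 1))"

lemma bet_ge: "12 \<le> bet D"
  by (simp add: bet_def)

lemma bet_pow_ge: "1 \<le> D \<Longrightarrow> 12 \<le> bet D ^ D"
  using self_le_power[of "bet D" D] bet_ge[of D] by simp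

lemma slope_pos: "1 \<le> D \<Longrightarrow> 0 < slope D"
  using bet_pow_ge[of D] by (simp add: slope_def)

text \<open>At density \<open>h ^ D\<close>, one expected point per unit volume, the block mean is
  at most \<open>1 + (2 * D) ^ D\<close> per unit volume; at the upper density the isolated points
  alone give \<open>bet D / 12\<close>. The constants in \<open>bet\<close> make the difference 1,
  and \<open>slope\<close> is half the resulting average derivative per lattice point.\<close>

lemma lattice_good_parameter:
  fixes h R :: real and k L :: nat
  defines "V \<equiv> pt h ` grid (k * L) :: (real ^ 'd) set"
    and "Qb \<equiv> \<lambda>b. pt h ` block L b :: (real ^ 'd) set"
    and "Q0 \<equiv> pt h ` grid L :: (real ^ 'd) set"
    and "D \<equiv> CARD('d)"
    and "P \<equiv> pack TYPE('d) * R"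
  defines "G \<equiv> \<lambda>S. HH R (S \<inter> V) - (\<Sum>b\<in>grid k. HH R (S \<inter> Qb b))"
  assumes D: "2 \<le> CARD('d)" and h: "0 < h" "h \<le> 1 / (6 * bet D)" "bet D ^ D * h ^ D \<le> 1 / 2"
    and R: "1 \<le> R" "R \<le> h * real L" and k: "0 < k" "0 < L"
  shows "\<exists>p. h ^ D \<le> p \<and> p \<le> bet D ^ D * h ^ D \<and>
    slope D * real (card Q0) \<le> (\<Sum>x\<in>Q0. Bexp Q0 p (DD x (HH R))) \<and>
    (\<Sum>x\<in>V. Bexp V p (DD x G)) \<le> 2 * P * (32 * real D * P * R / (h * real L) * real (card V)) / slope
      D"
proof -
  interpret bs: block_system V "grid k" Qb "rim h k L R" R P
    unfolding V_def Qb_def P_def by (rule lattice_block_system) (use h k R in auto)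
  have Geq: "bs.GA V (grid k) = G" by (auto simp: bs.GA_def G_def)
  let ?B = "bet D ^ D" and ?p0 = "h ^ D"
  have b: "12 \<le> bet D" by (rule bet_ge)
  have D1: "1 \<le> D" using D by (simp add: D_def)
  have B: "12 \<le> ?B" by (rule bet_pow_ge[OF D1])
  have p0: "0 < ?p0" using h by simp
  have cardV: "real (card V) = real (k * L) ^ D"
    by (simp add: V_def card_pt[OF h(1)] card_grid D_def)
  have cardQ: "real (card Q0) = real L ^ D"
    by (simp add: Q0_def card_pt[OF h(1)] card_grid D_def)
  have fin: "finite Q0" unfolding Q0_def by (intro finite_imageI finite_grid)
  have cardJ: "real (card (grid k :: ('d \<Rightarrow> nat) set)) = real k ^ D"
    by (simp add: card_grid D_def)
  have EBB: "Bexp V p bs.BB = real k ^ D * Bexp Q0 p (HH R)" for p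
  proof -
    have "Bexp V p bs.BB = (\<Sum>b\<in>grid k. Bexp V p (\<lambda>S. HH R (S \<inter> Qb b)))"
      unfolding bs.BB_def by (rule Bexp_sum)
    also have "\<dots> = (\<Sum>b\<in>(grid k :: ('d \<Rightarrow> nat) set). Bexp Q0 p (HH R))"
    proof (rule sum.cong)
      fix b :: "'d \<Rightarrow> nat" assume "b \<in> grid k"
      then have "Bexp V p (\<lambda>S. HH R (S \<inter> Qb b)) = Bexp (Qb b) p (HH R)"
        using bs.Q_subset by (intro Bexp_restrict bs.finV) auto
      also have "\<dots> = Bexp Q0 p (HH R)"
        unfolding Qb_def Q0_def using Bexp_HH_block[OF k(2), of h b p "\<lambda>z. z" R] by simp
      finally show "Bexp V p (\<lambda>S. HH R (S \<inter> Qb b)) = Bexp Q0 p (HH R)" .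
    qed simp
    finally show ?thesis by (simp add: cardJ)
  qed
  let ?l = "h * real L"
  have up: "Bexp Q0 ?p0 (HH R) \<le> (1 + (2 * real D) ^ D) * ?l ^ D"
  proof -
    have "?p0 \<le> ?B * ?p0" using B p0 by simp
    then have "?p0 \<le> 1" using h by linarith
    then have "Bexp Q0 ?p0 (HH R) \<le> ?p0 * real L ^ CARD('d) + (2 * real CARD('d)) ^ CARD('d)
      * ?l ^ CARD('d)"
      unfolding Q0_def using h k R D by (intro Bexp_HH_le) auto
    then show ?thesis by (simp add: D_def power_mult_distrib algebra_simps)
  qed
  have low: "bet D * ?l ^ D / 12 \<le> Bexp Q0 (?B * ?p0) (HH R)"
  proof -
    \<comment> \<open>Of the order of the typical spacing at the upper density: a cube of side
      \<open>3 * \<rho>\<close> contains \<open>(1 / 2) ^ D\<close> points on average.\<close>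
    let ?\<rho> = "1 / (6 * bet D)"
    have "?B * ?p0 * (3 * ?\<rho> / h) ^ CARD('d) = (1 / 2) ^ D"
    proof -
      have "bet D * h * (3 * ?\<rho> / h) = 1 / 2" using b h by (simp add: field_simps)
      then have "(bet D * h * (3 * ?\<rho> / h)) ^ D = (1 / 2) ^ D" by (rule arg_cong)
      then show ?thesis by (simp only: power_mult_distrib D_def)
    qed
    also have "\<dots> \<le> 1 / 2" using power_decreasing[of 1 D "1 / 2 :: real"] D1 by simp
    finally have sm: "?B * ?p0 * (3 * ?\<rho> / h) ^ CARD('d) \<le> 1 / 2" .
    have "?\<rho> \<le> 1" using b by simp
    then have rR: "?\<rho> \<le> R" using R by linarith
    have "?\<rho> * (?B * ?p0) * real L ^ CARD('d) / 2 \<le> Bexp Q0 (?B * ?p0) (HH R)"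
      unfolding Q0_def using h B p0 by (intro Bexp_HH_ge sm rR) auto
    moreover have "bet D * ?l ^ D / 12 \<le> ?\<rho> * (?B * ?p0) * real L ^ CARD('d) / 2"
    proof -
      obtain m where m: "D = Suc m" "1 \<le> m" using D by (cases D) (auto simp: D_def)
      \<comment> \<open>Density times spacing scales like \<open>bet D ^ (D - 1)\<close>; for
        \<open>D \<ge> 2\<close> this is at least \<open>bet D\<close>.\<close>
      have "bet D \<le> bet D ^ m" using self_le_power[of "bet D" m] m b by simp
      then have "bet D * ?l ^ D / 12 \<le> bet D ^ m * ?l ^ D / 12"
        using h by (intro divide_right_mono mult_right_mono) auto
      also have "bet D ^ m * ?l ^ D / 12 = ?\<rho> * (?B * ?p0) * real L ^ CARD('d) / 2"
      proof -
        have "?B = bet D * bet D ^ m" using m by simp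
        then have "?\<rho> * (?B * ?p0) = bet D ^ m * ?p0 / 6" using b by (simp add: field_simps)
        then show ?thesis
          unfolding D_def[symmetric] power_mult_distrib by (simp only:) simp
      qed
      finally show ?thesis .
    qed
    ultimately show ?thesis by linarith
  qed
  have incr: "Bexp V (?B * ?p0) bs.BB - Bexp V ?p0 bs.BB \<ge> 2 * slope D * (?B - 1) * ?p0
    * real (card V)"
  proof -
    have "?l ^ D \<le> bet D * ?l ^ D / 12 - (1 + (2 * real D) ^ D) * ?l ^ D"
      by (simp add: bet_def algebra_simps)
    then have "?l ^ D \<le> Bexp Q0 (?B * ?p0) (HH R) - Bexp Q0 ?p0 (HH R)" using up low by linarith
    then have "real k ^ D * ?l ^ D \<le> real k ^ D * (Bexp Q0 (?B * ?p0) (HH R) - Bexp Q0 ?p0 (HH R))"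
      by (rule mult_left_mono) simp
    moreover have "2 * slope D * (?B - 1) = 1" using B by (simp add: slope_def)
    ultimately show ?thesis
      unfolding EBB cardV by (simp add: power_mult_distrib right_diff_distrib mult_ac)
  qed
  \<comment> \<open>\<open>8 * P\<close> times the bound of \<open>card_rim_le\<close>, the
    smallness that \<open>good_parameter\<close> asks for.\<close>
  let ?e = "32 * real D * P * R / ?l * real (card V)"
  have P0: "0 < P" using pack_ge_1[where 'd='d] R by (simp add: P_def)
  have Vpos: "0 < real (card V)" using k by (simp add: cardV)
  have e: "0 < ?e" using P0 R h k Vpos D1 by simp
  have "8 * P * real (card (rim h k L R :: (real ^ 'd) set))
    \<le> 8 * P * (4 * real D * R / ?l * real (card V))"
  proof (rule mult_left_mono)
    have "h \<le> R" using h b R by (smt (verit) divide_le_eq_1)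
    then show "real (card (rim h k L R :: (real ^ 'd) set)) \<le> 4 * real D * R / ?l * real (card V)"
      unfolding cardV D_def using card_rim_le[where h = h and R = R and L = L and k = k and 'd = 'd]
        h k by simp
  qed (use P0 in auto)
  then have e_bd: "8 * P * real (card (rim h k L R :: (real ^ 'd) set)) \<le> ?e" by (simp add: mult_ac)
  obtain p where p: "?p0 \<le> p" "p \<le> ?B * ?p0"
    "slope D * real (card V) \<le> (\<Sum>x\<in>V. Bexp V p (DD x bs.BB))"
    "(\<Sum>x\<in>V. Bexp V p (DD x (bs.GA V (grid k)))) \<le> 2 * P * ?e / slope D"
    using bs.good_parameter[OF p0 _ _ slope_pos[OF D1] e e_bd _ incr] B h(3) Vpos by fastforce
  \<comment> \<open>Differentiating the identity \<open>EBB\<close> transfers the derivative bound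
    from the sum over blocks to a single block.\<close>
  have "(\<Sum>x\<in>V. Bexp V p (DD x bs.BB)) = real k ^ D * (\<Sum>x\<in>Q0. Bexp Q0 p (DD x (HH R)))"
  proof (rule DERIV_unique)
    show "((\<lambda>p. Bexp V p bs.BB) has_real_derivative (\<Sum>x\<in>V. Bexp V p (DD x bs.BB))) (at p)"
      by (rule Bexp_has_derivative[OF bs.finV])
    show "((\<lambda>p. Bexp V p bs.BB) has_real_derivative real k ^ D * (\<Sum>x\<in>Q0. Bexp Q0 p (DD x (HH R))))
      (at p)"
      unfolding EBB by (intro DERIV_cmult Bexp_has_derivative fin)
  qed
  then have "real k ^ D * (slope D * real (card Q0))
    \<le> real k ^ D * (\<Sum>x\<in>Q0. Bexp Q0 p (DD x (HH R)))"
    using p(3) unfolding cardV cardQ by (simp add: power_mult_distrib mult_ac)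
  then have "slope D * real (card Q0) \<le> (\<Sum>x\<in>Q0. Bexp Q0 p (DD x (HH R)))"
    by (rule mult_left_le_imp_le) (use k in simp)
  then show ?thesis
    using p unfolding Geq by blast
qed

text \<open>The Cauchy-Schwarz inequality turns the bound on the total expected cost into one on the
  sum of squares in the first chaos.\<close>

lemma Bvar_block_ge:
  assumes "finite Q" "0 < card Q" "0 \<le> p" "p \<le> 1 / 2" "0 \<le> c"
    and "c * real (card Q) \<le> (\<Sum>x\<in>Q. Bexp Q p (DD x f))"
  shows "p * c\<^sup>2 * real (card Q) / 2 \<le> Bvar Q p f"
proof -
  let ?s = "\<Sum>x\<in>Q. Bexp Q p (DD x f)"
  have "(c * real (card Q))\<^sup>2 \<le> ?s\<^sup>2" using assms by (intro power_mono) auto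
  also have "?s\<^sup>2 \<le> (\<Sum>x\<in>Q. (Bexp Q p (DD x f))\<^sup>2) * real (card Q)"
    using Cauchy_Schwarz_ineq_sum[of "\<lambda>x. Bexp Q p (DD x f)" "\<lambda>_. 1" Q] by simp
  finally have "c\<^sup>2 * real (card Q) * real (card Q) \<le> (\<Sum>x\<in>Q. (Bexp Q p (DD x f))\<^sup>2) * real (card Q)"
    by (simp add: power2_eq_square mult_ac)
  then have 1: "c\<^sup>2 * real (card Q) \<le> (\<Sum>x\<in>Q. (Bexp Q p (DD x f))\<^sup>2)"
    by (rule mult_right_le_imp_le) (use assms in simp)
  have "p * (1 / 2) * (c\<^sup>2 * real (card Q)) \<le> p * (1 - p) * (\<Sum>x\<in>Q. (Bexp Q p (DD x f))\<^sup>2)"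
    using 1 assms by (intro mult_mono mult_left_mono) auto
  also have "\<dots> \<le> Bvar Q p f"
    by (rule Bvar_ge_first_chaos) (use assms in auto)
  finally show ?thesis by simp
qed

section \<open>The central limit theorem on the lattice\<close>

text \<open>
  \<open>K1\<close> governs the variance of the gap between the truncated functional and its block sum, \<open>K2\<close> the
  second moment of the truncation error, \<open>K4\<close> and \<open>K5\<close> the third absolute moments and the squared
  variances of the blocks; \<open>s0\<close> bounds the standard deviation per square root of the volume from below.
\<close>

definition K1 :: "nat \<Rightarrow> real \<Rightarrow> real" where
  "K1 D P = bet D ^ D * P\<^sup>2 * real D * (64 * P / slope D + 32)"

definition K2 :: "nat \<Rightarrow> real" where
  "K2 D = (2 * real D) ^ (2 * D + 2) * (12 * real D) ^ D * (6 * real D) ^ (128 * (3 * D + 2))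
    * fact (128 * (3 * D + 2))"

definition K3 :: "nat \<Rightarrow> real \<Rightarrow> real" where
  "K3 D P = 2 * (K1 D P + K2 D)"

definition s0 :: "nat \<Rightarrow> real" where
  "s0 D = sqrt ((slope D)\<^sup>2 / 2 / (8 * bet D) ^ D) / 2"

definition K4 :: "nat \<Rightarrow> real" where
  "K4 D = 15 * (bet D ^ D) ^ 3 * 4 ^ D / s0 D ^ 3"

definition K5 :: "nat \<Rightarrow> real" where
  "K5 D = 25 * (bet D ^ D) ^ 4 * 8 ^ D / s0 D ^ 4"

definition CC :: "nat \<Rightarrow> real \<Rightarrow> real" where
  "CC D P = 1 + K3 D P / (s0 D)\<^sup>2 + K4 D + K5 D"

lemma s0_pos: "1 \<le> D \<Longrightarrow> 0 < s0 D"
  using slope_pos[of D] bet_ge[of D] by (simp add: s0_def)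

lemma s0_sq: "1 \<le> D \<Longrightarrow> (2 * s0 D)\<^sup>2 = (slope D)\<^sup>2 / 2 / (8 * bet D) ^ D"
  using bet_ge[of D] by (simp add: s0_def)

lemma K_nonneg:
  assumes "1 \<le> D" "0 \<le> P"
  shows "0 \<le> K1 D P" "0 \<le> K2 D" "0 \<le> K3 D P" "0 \<le> K4 D" "0 \<le> K5 D"
proof -
  show 1: "0 \<le> K1 D P"
    using assms slope_pos[of D] bet_ge[of D] unfolding K1_def
    by (intro mult_nonneg_nonneg add_nonneg_nonneg divide_nonneg_pos) auto
  show 2: "0 \<le> K2 D" by (simp add: K2_def)
  show "0 \<le> K3 D P" using 1 2 by (simp add: K3_def)
  show "0 \<le> K4 D" "0 \<le> K5 D"
    using s0_pos[OF assms(1)] bet_ge[of D] by (simp_all add: K4_def K5_def)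
qed

lemma grid_mono: "M \<le> N \<Longrightarrow> grid M \<subseteq> grid N"
  by (auto simp: grid_def intro: less_le_trans)

lemma power_le_fact_exp:
  fixes y :: real
  assumes "0 \<le> y"
  shows "y ^ m \<le> fact m * exp y"
proof -
  have s: "(\<lambda>n. y ^ n /\<^sub>R fact n) sums exp y" by (rule exp_converges)
  have "(\<Sum>n\<in>{m}. y ^ n /\<^sub>R fact n) \<le> exp y"
    unfolding sums_unique[OF s] by (rule sum_le_suminf[OF sums_summable[OF s]]) (use assms in auto)
  then show ?thesis by (simp add: field_simps)
qed

lemma cancel_common:
  fixes Y :: real
  shows "Y \<noteq> 0 \<Longrightarrow> (u * X * b / (a * (Y * Y'))) * (Y * (e * Z)) = (u * b * e / a) * (X * Z / Y')"
  by simp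

text \<open>
  With \<open>x\<close> as the truncation scale, the volume-normalised side of the large cube \<open>V\<close> is \<open>x ^ 128\<close>, the
  blocks have side about \<open>x ^ 8\<close>, and \<open>y\<close> is the square root of the volume of \<open>V\<close>. The smaller cube
  \<open>A\<close> is the window: its side depends on the value of \<open>p\<close> that is selected on \<open>V\<close>.
\<close>

locale lattice_setup =
  fixes x h p y E0 s2 \<mu> \<sigma> :: real and k L N D :: nat
    and V Q0 A :: "(real ^ 'd) set" and Q :: "('d \<Rightarrow> nat) \<Rightarrow> (real ^ 'd) set"
      and I :: "('d \<Rightarrow> nat) set"
    and T F SY :: "(real ^ 'd) set \<Rightarrow> real"
  assumes D_def: "D = CARD('d)"
    and V_def: "V = pt h ` grid (k * L)" and Q_def: "\<And>b. Q b = pt h ` block L b"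
    and Q0_def: "Q0 = pt h ` grid L" and A_def: "A = pt h ` grid N" and I_def: "I = grid (N div L)"
    and y_def: "y = x ^ (64 * D)"
    and T_def: "\<And>S. T S = mst_length (S \<inter> A) - (HH x (S \<inter> A) - x)"
    and F_def: "\<And>S. F S = mst_length (S \<inter> A)"
    and SY_def: "\<And>S. SY S = (\<Sum>b\<in>I. HH x (S \<inter> Q b))"
    and E0_def: "E0 = Bexp Q0 p (HH x)" and s2_def: "s2 = Bvar Q0 p (HH x)"
    and \<mu>_def: "\<mu> = p * real (card Q0)" and \<sigma>_def: "\<sigma> = sqrt (Bvar V p F)"
    and D2: "2 \<le> D"
    and h: "0 < h" "h \<le> 1 / (6 * bet D)" "bet D ^ D * h ^ D \<le> 1 / 2"
    and k: "0 < k" and L: "0 < L"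
    and nu: "h * (real k * real L) = x ^ 128"
    and l: "x ^ 8 \<le> h * real L" "h * real L \<le> 2 * x ^ 8"
    and x: "1 \<le> x" "6 * real D \<le> x" "16 * bet D \<le> x" "4 * CC D (pack TYPE('d)) \<le> x"
    and N: "real k * real L \<le> 4 * bet D * real N" "N \<le> k * L"
    and p: "h ^ D \<le> p" "p \<le> bet D ^ D * h ^ D"
    and slope: "slope D * real (card Q0) \<le> (\<Sum>v\<in>Q0. Bexp Q0 p (DD v (HH x)))"
    and small_gap: "(\<Sum>v\<in>V. Bexp V p (DD v (\<lambda>S. HH x (S \<inter> V) - (\<Sum>b\<in>grid k. HH x (S \<inter> Q b)))))
      \<le> 2 * (pack TYPE('d) * x) * (32 * real D * (pack TYPE('d) * x) * x / (h * real L) * real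
        (card V)) / slope D"
begin

lemma D1: "1 \<le> D" "1 \<le> real D" using D2 by auto

lemma P1: "1 \<le> pack TYPE('d)" by (rule pack_ge_1)

lemma B12: "12 \<le> bet D" "12 \<le> bet D ^ D"
  using bet_ge bet_pow_ge D1 by auto

lemma p01: "0 \<le> p" "p \<le> 1" "p \<le> 1 / 2" "0 < p"
  using p h zero_less_power[OF h(1), of D] by linarith+

lemma finV: "finite V" unfolding V_def by (intro finite_imageI finite_grid)
lemma finQ0: "finite Q0" unfolding Q0_def by (intro finite_imageI finite_grid)
lemma finI: "finite I" unfolding I_def by (rule finite_grid)

lemma cardV: "real (card V) = real (k * L) ^ D"
  by (simp add: V_def card_pt[OF h(1)] card_grid D_def)

lemma cardQ0: "real (card Q0) = real L ^ D"
  by (simp add: Q0_def card_pt[OF h(1)] card_grid D_def)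

lemma AV: "A \<subseteq> V"
  unfolding A_def V_def by (intro image_mono grid_mono N(2))

lemma IJ: "I \<subseteq> grid k"
proof -
  have "N div L \<le> k" using N(2) L by (metis div_le_mono div_mult_self_is_m)
  then show ?thesis unfolding I_def by (rule grid_mono)
qed

lemma QA: "b \<in> I \<Longrightarrow> Q b \<subseteq> A"
  using blocks_in_grid[OF _ L] by (auto simp: I_def Q_def A_def)

lemma QV: "b \<in> I \<Longrightarrow> Q b \<subseteq> V"
  using QA AV by blast

lemma Q_eq: "Q = (\<lambda>b. pt h ` block L b)"
  by (rule ext) (rule Q_def)

lemma disjQ: "disjoint_family_on Q I"
  unfolding Q_eq by (rule disjoint_blocks[OF h(1)])


lemma y_pos: "0 < y" using x by (simp add: y_def)

lemma y_sq: "y\<^sup>2 = (x ^ 128) ^ D"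
  by (simp add: y_def flip: power_mult)

lemma pV: "p * real (card V) \<le> bet D ^ D * y\<^sup>2"
proof -
  have "p * real (card V) \<le> (bet D ^ D * h ^ D) * real (card V)"
    using p by (intro mult_right_mono) auto
  also have "\<dots> = bet D ^ D * (h * (real k * real L)) ^ D"
    unfolding cardV by (simp add: power_mult_distrib)
  finally show ?thesis unfolding nu y_sq .
qed

lemma kl: "real k * (h * real L) = x ^ 128"
  using nu by (simp add: mult_ac)

lemma l1: "1 \<le> h * real L"
  using l(1) one_le_power[OF x(1), of 8] by linarith

lemma k_ge: "x ^ 120 \<le> 2 * real k"
proof -
  have "x ^ 120 * x ^ 8 = x ^ 128" by (simp flip: power_add)
  also have "\<dots> = real k * (h * real L)" by (rule kl[symmetric])
  also have "\<dots> \<le> real k * (2 * x ^ 8)" using l by (intro mult_left_mono) auto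
  finally have "x ^ 120 * x ^ 8 \<le> (2 * real k) * x ^ 8" by simp
  then show ?thesis by (rule mult_right_le_imp_le) (use x in simp)
qed

lemma x_ratio: "x / (h * real L) \<le> 1 / x ^ 7"
proof -
  have "x * x ^ 7 \<le> h * real L" using l(1) by (simp flip: power_Suc)
  then show ?thesis using l1 x by (simp add: field_simps)
qed

text \<open>Relative to \<open>y\<^sup>2\<close>, the interior costs contribute the square of
  \<open>C1\<close>, of order \<open>x ^ 2\<close>, times \<open>C1 * x / (h * L)\<close>, of order
  \<open>x ^ 2 / x ^ 8\<close>. This gives \<open>1 / x ^ 4\<close> and explains the block side
  \<open>x ^ 8\<close>; rim and incomplete blocks contribute less.\<close>

lemma Bvar_GA_bound:
  "Bvar V p (\<lambda>S. HH x (S \<inter> A) - (\<Sum>b\<in>I. HH x (S \<inter> Q b))) \<le> K1 D (pack TYPE('d)) * y\<^sup>2 / x ^ 4"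
proof -
  let ?P = "pack TYPE('d) * x" and ?v = "real (card V)" and ?r = "x / (h * real L)"
    and ?s = "slope D"
  interpret bs: block_system V "grid k" Q "rim h k L x" x ?P
    unfolding V_def Q_eq by (rule lattice_block_system) (use h k L x in auto)
  have GA_eq: "bs.GA B J = (\<lambda>S. HH x (S \<inter> B) - (\<Sum>b\<in>J. HH x (S \<inter> Q b)))" for B J
    by (rule ext) (rule bs.GA_def)
  have P: "0 \<le> ?P" using P1 x by simp
  have s: "0 < ?s" by (rule slope_pos[OF D1(1)])
  have v: "0 \<le> ?v" by simp
  have r: "0 \<le> ?r" "?r \<le> 1 / x ^ 7" using x h x_ratio by auto
  have hx: "h \<le> x" using h(2) B12(1) x(1) by (smt (verit) divide_le_eq_1)
  have rim: "real (card (rim h k L x :: (real ^ 'd) set)) \<le> 4 * real D * ?r * ?v"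
    unfolding cardV using card_rim_le[where h = h and R = x and L = L and k = k and 'd = 'd] h k L
      hx by (simp add: D_def)
  have left: "real (card (A - (\<Union>b\<in>I. Q b))) \<le> real D / real k * ?v"
    unfolding cardV A_def I_def Q_def D_def by (rule card_leftover_le) (use h k L N in auto)
  have gap: "(\<Sum>v\<in>V. Bexp V p (DD v (bs.GA V (grid k)))) \<le> 64 * real D * ?P\<^sup>2 * ?r * ?v / ?s"
  proof -
    have "(\<Sum>v\<in>V. Bexp V p (DD v (bs.GA V (grid k)))) \<le>
        2 * ?P * (32 * real D * ?P * x / (h * real L) * ?v) / ?s"
      using small_gap unfolding GA_eq .
    also have "\<dots> = 64 * real D * ?P\<^sup>2 * ?r * ?v / ?s" by (simp add: power2_eq_square)
    finally show ?thesis .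
  qed
  have int: "(\<Sum>v\<in>V - rim h k L x. Bexp V p (DD v (bs.GA V (grid k)))) \<le>
      64 * real D * ?P\<^sup>2 * ?r * ?v / ?s + 2 * ?P * (4 * real D * ?r * ?v)"
  proof -
    have "2 * ?P * real (card (rim h k L x :: (real ^ 'd) set)) \<le> 2 * ?P * (4 * real D * ?r * ?v)"
      using rim P by (intro mult_left_mono) auto
    then show ?thesis using bs.sum_interior_le(1)[OF p01(1,2)] gap by linarith
  qed
  have "Bvar V p (bs.GA A I) \<le> p * (?P * (\<Sum>v\<in>V - rim h k L x. Bexp V p (DD v (bs.GA V (grid k))))
    + (2 * ?P)\<^sup>2 * (real (card (rim h k L x :: (real ^ 'd) set)) + real (card (A - (\<Union>b\<in>I. Q b)))))"
    by (rule bs.Bvar_GA_le[OF p01(1,2) IJ AV QA])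
  also have "\<dots> \<le> p * (?P * (64 * real D * ?P\<^sup>2 * ?r * ?v / ?s + 2 * ?P * (4 * real D * ?r * ?v))
    + (2 * ?P)\<^sup>2 * (4 * real D * ?r * ?v + real D / real k * ?v))"
    using p01 P int rim left by (intro mult_left_mono add_mono) auto
  also have "\<dots> = (p * ?v) * (?P\<^sup>2 * (real D * (64 * (?P * ?r) / ?s + 24 * ?r + 4 * (1 / real k))))"
    using s k by (simp add: power2_eq_square field_simps)
  also have "\<dots> \<le> (bet D ^ D * y\<^sup>2)
    * ((pack TYPE('d))\<^sup>2 * x\<^sup>2 * (real D * ((64 * pack TYPE('d) / ?s + 32) / x ^ 6)))"
  proof (rule mult_mono[OF pV])
    have "?P * ?r \<le> ?P * (1 / x ^ 7)" using P r by (intro mult_left_mono) auto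
    also have "\<dots> = pack TYPE('d) / x ^ 6" using x by (simp add: field_simps eval_nat_numeral)
    finally have a: "64 * (?P * ?r) / ?s \<le> 64 * (pack TYPE('d) / x ^ 6) / ?s"
      using s by (intro divide_right_mono mult_left_mono) auto
    have b: "?r \<le> 1 / x ^ 6"
    proof -
      have "1 / x ^ 7 \<le> 1 / x ^ 6" using x by (intro divide_left_mono power_increasing) auto
      then show ?thesis using r(2) by linarith
    qed
    have c: "1 / real k \<le> 2 / x ^ 6"
    proof -
      have "x ^ 6 \<le> x ^ 120" using x by (intro power_increasing) auto
      then have "x ^ 6 \<le> 2 * real k" using k_ge by linarith
      then show ?thesis using k x by (simp add: field_simps)
    qed
    have "64 * (?P * ?r) / ?s + 24 * ?r + 4 * (1 / real k) \<le>
        64 * (pack TYPE('d) / x ^ 6) / ?s + 24 * (1 / x ^ 6) + 4 * (2 / x ^ 6)"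
      using a b c by (intro add_mono mult_left_mono) auto
    also have "\<dots> = (64 * pack TYPE('d) / ?s + 32) / x ^ 6"
      by (simp add: field_simps add_divide_distrib)
    finally have "real D * (64 * (?P * ?r) / ?s + 24 * ?r + 4 * (1 / real k)) \<le>
        real D * ((64 * pack TYPE('d) / ?s + 32) / x ^ 6)" by (intro mult_left_mono) auto
    then show "?P\<^sup>2 * (real D * (64 * (?P * ?r) / ?s + 24 * ?r + 4 * (1 / real k))) \<le>
        (pack TYPE('d))\<^sup>2 * x\<^sup>2 * (real D * ((64 * pack TYPE('d) / ?s + 32) / x ^ 6))"
      unfolding power_mult_distrib by (rule mult_left_mono) simp
    show "0 \<le> ?P\<^sup>2 * (real D * (64 * (?P * ?r) / ?s + 24 * ?r + 4 * (1 / real k)))"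
      using P1 x(1) l1 s k
      by (intro mult_nonneg_nonneg add_nonneg_nonneg divide_nonneg_pos) auto
    show "0 \<le> bet D ^ D * y\<^sup>2" using B12 by (intro mult_nonneg_nonneg) auto
  qed
  also have "\<dots> = K1 D (pack TYPE('d)) * y\<^sup>2 / x ^ 4"
  proof -
    have "x\<^sup>2 / x ^ 6 = 1 / x ^ 4" using x by (simp add: field_simps eval_nat_numeral)
    moreover have "(bet D ^ D * y\<^sup>2)
      * ((pack TYPE('d))\<^sup>2 * x\<^sup>2 * (real D * ((64 * pack TYPE('d) / ?s + 32) / x ^ 6))) =
        K1 D (pack TYPE('d)) * y\<^sup>2 * (x\<^sup>2 / x ^ 6)"
      by (simp add: K1_def mult_ac)
    ultimately show ?thesis by simp
  qed
  finally show ?thesis unfolding GA_eq .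
qed


text \<open>The probability of a hole decays like \<open>exp (- (x / (6 * D)))\<close> up to a power
  of \<open>x\<close>, and the square of the crude bound in \<open>mst_tail\<close> is also a power
  of \<open>x\<close>; the product is bounded uniformly in \<open>x\<close> and the mesh.\<close>

lemma tail_second_moment: "Bexp V p (\<lambda>S. (T S)\<^sup>2) \<le> K2 D"
proof -
  \<comment> \<open>The largest width for which the absence of holes forces connectedness at scale
    \<open>x\<close>.\<close>
  define w where "w = nat \<lfloor>x / (3 * real D * h)\<rfloor>"
  let ?\<nu> = "x ^ 128"
  have D0: "0 < real D" using D1 by simp
  have h1: "h \<le> 1" using h(2) B12(1) by (smt (verit) divide_le_eq_1)
  have big: "1 \<le> x / (3 * real D * h)"
  proof -
    have "3 * real D * h \<le> 3 * real D * 1" using h1 by (intro mult_left_mono) auto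
    then have "3 * real D * h \<le> x" using x(2) D0 by linarith
    then show ?thesis using h(1) D0 by simp
  qed
  have wle: "real w \<le> x / (3 * real D * h)" using big by (simp add: w_def)
  have w0: "0 < w" using big by (simp add: w_def)
  have wge: "x / (6 * real D) \<le> h * real w"
  proof -
    have "z \<le> 2 * real (nat \<lfloor>z\<rfloor>)" if "1 \<le> z" for z :: real
    proof -
      have "1 \<le> \<lfloor>z\<rfloor>" using that by simp
      then show ?thesis by linarith
    qed
    from this[OF big] have "x / (3 * real D * h) \<le> 2 * real w" unfolding w_def .
    then have "h * (x / (3 * real D * h)) \<le> h * (2 * real w)" using h by (intro mult_left_mono) auto
    then show ?thesis using h D0 by (simp add: field_simps)
  qed
  have Nge: "?\<nu> \<le> 4 * bet D * (h * real N)"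
  proof -
    have "h * (real k * real L) \<le> h * (4 * bet D * real N)" using N h by (intro mult_left_mono) auto
    then show ?thesis unfolding nu by (simp add: mult_ac)
  qed
  have x\<nu>: "x \<le> ?\<nu>" using self_le_power[OF x(1), of 128] by simp
  have wN: "w \<le> N"
  proof -
    have "h * real w \<le> h * (x / (3 * real D * h))" using wle h by (intro mult_left_mono) auto
    also have "\<dots> = x / (3 * real D)" using h by simp
    also have "\<dots> \<le> x / 1" using D1 x by (intro divide_left_mono) auto
    finally have "4 * bet D * (h * real w) \<le> 4 * bet D * x" using B12 by (intro mult_left_mono) auto
    also have "\<dots> \<le> x * x" using x(3) x(1) B12 by (intro mult_right_mono) auto
    also have "\<dots> \<le> ?\<nu>" using power_increasing[of 2 128 x] x(1) by (simp add: power2_eq_square)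
    finally have "4 * bet D * (h * real w) \<le> 4 * bet D * (h * real N)" using Nge by linarith
    then show ?thesis using B12 h by simp
  qed
  have wR: "D * (h * real w) \<le> x / 3"
  proof -
    have "D * (h * real w) \<le> D * (h * (x / (3 * real D * h)))" using wle h
      by (intro mult_left_mono) auto
    then show ?thesis using h D0 by simp
  qed
  have hN: "h * real N \<le> ?\<nu>"
  proof -
    have "real N \<le> real k * real L" using N(2) by (metis of_nat_mono of_nat_mult)
    then show ?thesis unfolding nu[symmetric] using h by (intro mult_left_mono) auto
  qed
  let ?M = "(2 * real D * ?\<nu>) ^ (D + 1)"
  have "Bexp V p (\<lambda>S. (T S)\<^sup>2) \<le> Bexp V p (\<lambda>S. ?M\<^sup>2 * of_bool (has_hole h N w (S \<inter> A)))"
  proof (rule Bexp_mono)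
    fix S assume "S \<subseteq> V"
    have "\<bar>T S\<bar> \<le> (2 * D * ?\<nu>) ^ (D + 1) * of_bool (has_hole h N w (S \<inter> A))"
      unfolding T_def D_def
      by (rule mst_tail[OF h(1) w0 wN wR[unfolded D_def] _ hN x\<nu> x(1)]) (auto simp: A_def)
    then have "\<bar>T S\<bar>\<^sup>2 \<le> (?M * of_bool (has_hole h N w (S \<inter> A)))\<^sup>2"
      by (intro power_mono) auto
    then show "(T S)\<^sup>2 \<le> ?M\<^sup>2 * of_bool (has_hole h N w (S \<inter> A))"
      by (cases "has_hole h N w (S \<inter> A)") auto
  qed (use p01 in auto)
  also have "\<dots> = ?M\<^sup>2 * Bexp A p (\<lambda>S. of_bool (has_hole h N w S))"
    unfolding Bexp_cmult using Bexp_restrict[OF finV AV, of p "\<lambda>S. of_bool (has_hole h N w S)"] by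
      simp
  also have "\<dots> \<le> ?M\<^sup>2 * (real (N div w + 1) ^ D * exp (- (p * real w ^ D)))"
    unfolding A_def D_def by (intro mult_left_mono Bexp_has_hole_le[OF h(1) wN p01(1,2)]) auto
  also have "\<dots> \<le> ?M\<^sup>2 * ((12 * real D * ?\<nu>) ^ D * exp (- (x / (6 * real D))))"
  proof (intro mult_left_mono mult_mono power_mono)
    show "real (N div w + 1) \<le> 12 * real D * ?\<nu>"
    proof -
      have "real (N div w) \<le> real N / real w" by (rule of_nat_div_le_of_nat)
      also have "\<dots> = (h * real N) / (h * real w)" using h by simp
      also have "\<dots> \<le> ?\<nu> / (x / (6 * real D))"
        using hN wge h D0 x by (intro frac_le) auto
      also have "\<dots> \<le> 6 * real D * ?\<nu>"
      proof -
        have "?\<nu> / (x / (6 * real D)) = 6 * real D * ?\<nu> / x" by simp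
        also have "\<dots> \<le> 6 * real D * ?\<nu> / 1" using x by (intro divide_left_mono) auto
        finally show ?thesis by simp
      qed
      finally have "real (N div w) \<le> 6 * real D * ?\<nu>" .
      moreover have "1 * 1 \<le> real D * ?\<nu>" using D1(2) x\<nu> x(1) by (intro mult_mono) auto
      ultimately show ?thesis by simp
    qed
    \<comment> \<open>A cube of width \<open>w\<close> contains \<open>p * w ^ D\<close> points on
      average, by \<open>h ^ D \<le> p\<close> at least its volume
      \<open>(h * w) ^ D\<close>.\<close>
    show "exp (- (p * real w ^ D)) \<le> exp (- (x / (6 * real D)))"
    proof -
      have a: "1 \<le> x / (6 * real D)" using x(2) D0 by simp
      have "x / (6 * real D) \<le> (x / (6 * real D)) ^ D"
        by (rule self_le_power[OF a]) (use D1 in simp)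
      also have "\<dots> \<le> (h * real w) ^ D"
        using wge a by (intro power_mono) auto
      also have "\<dots> = h ^ D * real w ^ D" by (rule power_mult_distrib)
      also have "\<dots> \<le> p * real w ^ D" using p by (intro mult_right_mono) auto
      finally show ?thesis by simp
    qed
  qed auto
  also have "\<dots> = (2 * real D) ^ (2 * D + 2) * (12 * real D) ^ D
    * (x ^ (128 * (3 * D + 2)) * exp (- (x / (6 * real D))))"
  proof -
    have e1: "?M\<^sup>2 = (2 * real D) ^ (2 * D + 2) * x ^ (128 * (2 * D + 2))"
    proof -
      have "?M\<^sup>2 = (2 * real D * ?\<nu>) ^ (2 * D + 2)"
        unfolding power_mult[symmetric] by (simp add: algebra_simps)
      also have "\<dots> = (2 * real D) ^ (2 * D + 2) * ?\<nu> ^ (2 * D + 2)" by (rule power_mult_distrib)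
      finally show ?thesis by (simp only: power_mult)
    qed
    have e2: "(12 * real D * ?\<nu>) ^ D = (12 * real D) ^ D * x ^ (128 * D)"
      by (simp add: power_mult_distrib flip: power_mult)
    have e3: "x ^ (128 * (2 * D + 2)) * x ^ (128 * D) = x ^ (128 * (3 * D + 2))"
      by (simp add: add.commute flip: power_add)
    show ?thesis unfolding e1 e2 e3[symmetric] by (simp only: mult_ac)
  qed
  also have "\<dots> \<le> (2 * real D) ^ (2 * D + 2) * (12 * real D) ^ D *
      ((6 * real D) ^ (128 * (3 * D + 2)) * fact (128 * (3 * D + 2)))"
  proof (rule mult_left_mono)
    let ?m = "128 * (3 * D + 2)" and ?z = "x / (6 * real D)"
    have "x = 6 * real D * ?z" using D0 by simp
    then have "x ^ ?m = (6 * real D * ?z) ^ ?m" by (rule arg_cong)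
    also have "\<dots> = (6 * real D) ^ ?m * ?z ^ ?m" by (rule power_mult_distrib)
    also have "\<dots> \<le> (6 * real D) ^ ?m * (fact ?m * exp ?z)"
      using x by (intro mult_left_mono power_le_fact_exp) auto
    finally have "x ^ ?m * exp (- ?z) \<le> (6 * real D) ^ ?m * (fact ?m * exp ?z) * exp (- ?z)"
      by (rule mult_right_mono) simp
    also have "\<dots> = (6 * real D) ^ ?m * fact ?m * (exp ?z * exp (- ?z))" by (simp only: mult_ac)
    also have "exp ?z * exp (- ?z) = 1" by (simp flip: exp_add)
    finally show "x ^ ?m * exp (- ?z) \<le> (6 * real D) ^ ?m * fact ?m" by simp
  qed simp
  finally show ?thesis unfolding K2_def by (simp only: mult.assoc)
qed


lemma Bvar_F_SY: "Bvar V p (\<lambda>S. SY S - F S) \<le> K3 D (pack TYPE('d)) * y\<^sup>2 / x ^ 4"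
proof -
  let ?GA = "\<lambda>S. HH x (S \<inter> A) - (\<Sum>b\<in>I. HH x (S \<inter> Q b))"
  have "(\<lambda>S. SY S - F S) = (\<lambda>S. (- 1) * (?GA S + T S + (- x)))"
    by (auto simp: F_def T_def SY_def)
  then have "Bvar V p (\<lambda>S. SY S - F S) = Bvar V p (\<lambda>S. ?GA S + T S)"
    using Bvar_cmult[of V p "- 1" "\<lambda>S. ?GA S + T S + (- x)"]
      Bvar_add_const[OF finV, of p "\<lambda>S. ?GA S + T S" "- x"] by simp
  also have "\<dots> \<le> 2 * Bvar V p ?GA + 2 * Bvar V p T"
    by (rule Bvar_add_le[OF finV p01(1,2)])
  also have "\<dots> \<le> 2 * (K1 D (pack TYPE('d)) * y\<^sup>2 / x ^ 4) + 2 * (K2 D * y\<^sup>2 / x ^ 4)"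
  proof (intro add_mono mult_left_mono Bvar_GA_bound)
    have "Bvar V p T \<le> K2 D * 1"
      using Bvar_le_square[OF finV p01(1,2), of T] tail_second_moment by linarith
    also have "\<dots> \<le> K2 D * (y\<^sup>2 / x ^ 4)"
    proof (rule mult_left_mono)
      have "x ^ 4 \<le> x ^ (128 * D)" using D1 x by (intro power_increasing) auto
      also have "\<dots> = y\<^sup>2" unfolding y_sq by (simp flip: power_mult)
      finally show "1 \<le> y\<^sup>2 / x ^ 4" using x by simp
    qed (use K_nonneg(2)[OF D1(1)] P1 in force)
    finally show "Bvar V p T \<le> K2 D * y\<^sup>2 / x ^ 4" by simp
  qed auto
  finally show ?thesis by (simp add: K3_def add_divide_distrib algebra_simps)
qed


section \<open>Block moments and the total variance\<close>

lemma mu: "(h * real L) ^ D \<le> \<mu>" "\<mu> \<le> bet D ^ D * (h * real L) ^ D" "1 \<le> \<mu>"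
proof -
  have "h ^ D * real L ^ D \<le> p * real L ^ D" using p by (intro mult_right_mono) auto
  then show 1: "(h * real L) ^ D \<le> \<mu>" by (simp add: \<mu>_def cardQ0 power_mult_distrib)
  have "p * real L ^ D \<le> bet D ^ D * h ^ D * real L ^ D" using p by (intro mult_right_mono) auto
  then show "\<mu> \<le> bet D ^ D * (h * real L) ^ D" by (simp add: \<mu>_def cardQ0 power_mult_distrib)
  show "1 \<le> \<mu>" using 1 one_le_power[OF l1, of D] by linarith
qed

lemma block_moments:
  assumes "b \<in> I"
  shows "Bexp (Q b) p (\<lambda>S. HH x S - E0) = 0" "Bexp (Q b) p (\<lambda>S. (HH x S - E0)\<^sup>2) = s2"
    "Bexp (Q b) p (\<lambda>S. \<bar>HH x S - E0\<bar> ^ 3) \<le> 15 * x ^ 3 * \<mu> ^ 3"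
proof -
  have tr: "Bexp (Q b) p (\<lambda>S. \<phi> (HH x S)) = Bexp Q0 p (\<lambda>S. \<phi> (HH x S))" for \<phi>
    unfolding Q_def Q0_def by (rule Bexp_HH_block[OF L])
  show "Bexp (Q b) p (\<lambda>S. HH x S - E0) = 0"
    using tr[of "\<lambda>z. z - E0"] unfolding Bexp_diff Bexp_const[OF finQ0] by (simp add: E0_def)
  show "Bexp (Q b) p (\<lambda>S. (HH x S - E0)\<^sup>2) = s2"
    unfolding tr[of "\<lambda>z. (z - E0)\<^sup>2"] by (simp add: s2_def Bvar_def E0_def)
  show "Bexp (Q b) p (\<lambda>S. \<bar>HH x S - E0\<bar> ^ 3) \<le> 15 * x ^ 3 * \<mu> ^ 3"
    using tr[of "\<lambda>z. \<bar>z - E0\<bar> ^ 3"] HH_central_moments(2)[OF finQ0 _ p01(1,2), of x] x mu(3)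
    unfolding E0_def \<mu>_def by simp
qed

lemma s2_bounds: "(h * real L) ^ D * (slope D)\<^sup>2 / 2 \<le> s2" "0 \<le> s2" "s2 \<le> 5 * x\<^sup>2 * \<mu>\<^sup>2"
proof -
  have "\<mu> * ((slope D)\<^sup>2 / 2) \<le> s2"
    using Bvar_block_ge[OF finQ0 _ p01(1,3), of "slope D" "HH x"] slope slope_pos[OF D1(1)] cardQ0 L
    by (simp add: s2_def \<mu>_def Q0_def mult_ac)
  moreover have "(h * real L) ^ D * ((slope D)\<^sup>2 / 2) \<le> \<mu> * ((slope D)\<^sup>2 / 2)"
    using mu(1) by (intro mult_right_mono) auto
  ultimately show "(h * real L) ^ D * (slope D)\<^sup>2 / 2 \<le> s2" by simp
  show "0 \<le> s2" unfolding s2_def by (rule Bvar_nonneg[OF p01(1,2)])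
  show "s2 \<le> 5 * x\<^sup>2 * \<mu>\<^sup>2"
    unfolding s2_def Bvar_def \<mu>_def
    by (rule HH_central_moments(1)[OF finQ0 _ p01(1,2)]) (use x mu(3) \<mu>_def in auto)
qed

lemma finQ: "b \<in> I \<Longrightarrow> finite (Q b)"
  using finite_subset[OF QV finV] .

lemma cardI: "real (card I) = real (N div L) ^ D"
  by (simp add: I_def card_grid D_def)

lemma Bvar_SY: "Bexp V p SY = real (card I) * E0" "Bvar V p SY = real (card I) * s2"
proof -
  let ?U = "\<lambda>S. \<Sum>b\<in>I. (HH x (S \<inter> Q b) - E0)"
  note bm = Bexp_block_sum[OF finI finQ disjQ p01(1,2) block_moments(1,2)]
  have red: "Bexp V p (\<lambda>S. \<phi> (?U S)) = Bexp (\<Union>b\<in>I. Q b) p (\<lambda>S. \<phi> (?U S))" for \<phi> :: "real \<Rightarrow> real"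
    by (rule Bexp_block_sum_restrict[OF finV QV])
  have 1: "Bexp V p ?U = 0" "Bexp V p (\<lambda>S. (?U S)\<^sup>2) = real (card I) * s2"
    using bm red[of "\<lambda>z. z"] red[of "\<lambda>z. z\<^sup>2"] by simp_all
  have SY: "SY = (\<lambda>S. ?U S + real (card I) * E0)"
    by (auto simp: SY_def sum_subtractf)
  show "Bexp V p SY = real (card I) * E0"
    unfolding SY Bexp_add Bexp_const[OF finV] 1 by simp
  show "Bvar V p SY = real (card I) * s2"
    unfolding SY Bvar_add_const[OF finV] Bvar_eq[OF finV] 1 by simp
qed

text \<open>The window has at least \<open>1 / (4 * bet D)\<close> of the side of \<open>V\<close>,
  and rounding to complete blocks at most halves the number per side. Each of these blocks has
  variance at least \<open>(slope D)\<^sup>2 / 2\<close> times its volume.\<close>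

lemma Bvar_SY_ge: "(2 * s0 D * y)\<^sup>2 \<le> Bvar V p SY"
proof -
  have "real k / (8 * bet D) \<le> real (N div L)"
  proof -
    have b: "0 < bet D" using B12 by simp
    have "real N / real L < real (N div L) + 1"
      using floor_divide_of_nat_eq[of N L, where 'a = real] by linarith
    moreover have "real k / (4 * bet D) \<le> real N / real L"
      using N(1) L b by (simp add: field_simps)
    moreover have "1 \<le> real k / (8 * bet D)"
    proof -
      have "16 * bet D \<le> x ^ 120" using x(3) self_le_power[OF x(1), of 120] by simp
      then have "8 * bet D \<le> real k" using k_ge by linarith
      then show ?thesis using b by simp
    qed
    moreover have "real k / (4 * bet D) = 2 * (real k / (8 * bet D))" by simp
    ultimately show ?thesis by linarith
  qed
  then have "(real k / (8 * bet D)) ^ D \<le> real (card I)"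
    unfolding cardI using B12 by (intro power_mono) auto
  then have "(real k / (8 * bet D)) ^ D * ((h * real L) ^ D * (slope D)\<^sup>2 / 2) \<le> real (card I) * s2"
    using s2_bounds(1) h(1) by (intro mult_mono) auto
  moreover have "(real k / (8 * bet D)) ^ D * ((h * real L) ^ D * (slope D)\<^sup>2 / 2)
    = (2 * s0 D * y)\<^sup>2"
  proof -
    have "(2 * s0 D * y)\<^sup>2 = ((slope D)\<^sup>2 / 2 / (8 * bet D) ^ D) * (real k * (h * real L)) ^ D"
      unfolding power_mult_distrib[of "2 * s0 D" y] s0_sq[OF D1(1)] y_sq kl ..
    also have "(real k * (h * real L)) ^ D = real k ^ D * (h * real L) ^ D"
      by (rule power_mult_distrib)
    finally show ?thesis by (simp add: power_divide mult_ac)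
  qed
  ultimately show ?thesis using Bvar_SY by simp
qed

lemma CC_bounds: "1 \<le> CC D (pack TYPE('d))" "K3 D (pack TYPE('d)) / (s0 D)\<^sup>2 \<le> CC D (pack TYPE('d))"
  "K4 D \<le> CC D (pack TYPE('d))" "K5 D \<le> CC D (pack TYPE('d))"
proof -
  have "0 \<le> K3 D (pack TYPE('d)) / (s0 D)\<^sup>2" "0 \<le> K4 D" "0 \<le> K5 D"
    using K_nonneg[OF D1(1), of "pack TYPE('d)"] P1 by auto
  then show "1 \<le> CC D (pack TYPE('d))" "K3 D (pack TYPE('d)) / (s0 D)\<^sup>2 \<le> CC D (pack TYPE('d))"
    "K4 D \<le> CC D (pack TYPE('d))" "K5 D \<le> CC D (pack TYPE('d))"
    unfolding CC_def by linarith+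
qed


lemma gap_sd: "Bvar V p (\<lambda>S. SY S - F S) \<le> (s0 D * y)\<^sup>2 * (CC D (pack TYPE('d)) / x ^ 4)"
proof -
  have "K3 D (pack TYPE('d)) * y\<^sup>2 / x ^ 4
    = (s0 D * y)\<^sup>2 * (K3 D (pack TYPE('d)) / (s0 D)\<^sup>2 / x ^ 4)"
    using s0_pos[OF D1(1)] by (simp add: power_mult_distrib)
  also have "\<dots> \<le> (s0 D * y)\<^sup>2 * (CC D (pack TYPE('d)) / x ^ 4)"
    using CC_bounds(2) x by (intro mult_left_mono divide_right_mono) auto
  finally show ?thesis using Bvar_F_SY by linarith
qed

text \<open>Of the lower bound \<open>2 * s0 D * y\<close> for the standard deviation of the block
  sum, the gap takes away at most one half.\<close>

lemma sigma_ge: "s0 D * y \<le> \<sigma>" "0 < \<sigma>"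
proof -
  have sy: "0 < s0 D * y" using s0_pos[OF D1(1)] y_pos by simp
  have "CC D (pack TYPE('d)) \<le> x ^ 4"
    using x(4) CC_bounds(1) self_le_power[OF x(1), of 4] by linarith
  then have "(s0 D * y)\<^sup>2 * (CC D (pack TYPE('d)) / x ^ 4) \<le> (s0 D * y)\<^sup>2 * 1"
    using x by (intro mult_left_mono) auto
  then have "Bvar V p (\<lambda>S. SY S - F S) \<le> (s0 D * y)\<^sup>2" using gap_sd by linarith
  then have 1: "sqrt (Bvar V p (\<lambda>S. SY S - F S)) \<le> s0 D * y"
    using sy by (intro real_le_lsqrt) (auto intro: Bvar_nonneg p01)
  have "2 * (s0 D * y) \<le> sqrt (Bvar V p SY)"
    using Bvar_SY_ge by (intro real_le_rsqrt) (simp add: mult.assoc)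
  also have "\<dots> \<le> \<sigma> + sqrt (Bvar V p (\<lambda>S. SY S - F S))"
    using sd_triangle[OF p01(1,2), of V F "\<lambda>S. SY S - F S"] by (simp add: \<sigma>_def)
  finally show "s0 D * y \<le> \<sigma>" using 1 by linarith
  then show "0 < \<sigma>" using sy by linarith
qed

text \<open>One factor combines with the number of blocks to at most the volume
  \<open>y\<^sup>2\<close>; the other \<open>m\<close> are block volumes, each at most
  \<open>(2 * x ^ 8) ^ D\<close>.\<close>

lemma block_count_bound: "real (card I) * ((h * real L) ^ D) ^ (m + 1)
  \<le> y\<^sup>2 * ((2 ^ m) ^ D * x ^ (8 * m * D))"
proof -
  have "real (N div L) \<le> real k"
  proof -
    have "N div L \<le> k" using N(2) L by (metis div_le_mono div_mult_self_is_m)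
    then show ?thesis by simp
  qed
  then have "real (card I) \<le> real k ^ D" unfolding cardI by (intro power_mono) auto
  then have "real (card I) * ((h * real L) ^ D) ^ (m + 1)
    \<le> real k ^ D * ((h * real L) ^ D) ^ (m + 1)"
    using h by (intro mult_right_mono) auto
  also have "\<dots> = (real k * (h * real L)) ^ D * (h * real L) ^ (m * D)"
    by (simp add: power_mult_distrib mult_ac flip: power_mult)
  also have "\<dots> \<le> (real k * (h * real L)) ^ D * (2 * x ^ 8) ^ (m * D)"
    using l h by (intro mult_left_mono power_mono) auto
  also have "(2 * x ^ 8) ^ (m * D) = (2 ^ m) ^ D * x ^ (8 * m * D)"
    by (simp add: power_mult_distrib mult.assoc flip: power_mult)
  finally show ?thesis unfolding kl y_sq .
qed

lemma x_power_y: "a + 9 \<le> 64 * D * b \<Longrightarrow> x ^ a / y ^ b \<le> 1 / x ^ 9"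
proof -
  assume "a + 9 \<le> 64 * D * b"
  then have "x ^ (a + 9) \<le> x ^ (64 * D * b)" using x by (intro power_increasing) auto
  also have "\<dots> = y ^ b" by (simp add: y_def flip: power_mult)
  finally have "x ^ a * x ^ 9 \<le> y ^ b" by (simp only: power_add)
  then show ?thesis using y_pos x by (simp add: field_simps)
qed

text \<open>An application of \<open>clt_perturbed_block_sum\<close> with
  \<open>\<epsilon> = CC / x\<close>. As \<open>CC\<close> is at least 1, it may be raised to the
  powers required there; \<open>4 * CC \<le> x\<close> gives
  \<open>\<epsilon> \<le> 1 / 4\<close>.\<close>

lemma normal_approximation:
  "\<bar>Bexp V p (\<lambda>S. of_bool ((F S - Bexp V p F) / \<sigma> \<le> t)) - Phi t\<bar> \<le> 10 * (CC D (pack TYPE('d)) / x)"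
proof (rule clt_perturbed_block_sum[where V = V and I = I and Q = Q
      and Y = "\<lambda>_ S. (1 / \<sigma>) * (HH x S - E0)" and q = "\<lambda>_. (1 / \<sigma>)\<^sup>2 * s2"])
  let ?C = "CC D (pack TYPE('d))" and ?sy = "s0 D * y"
  have sy: "0 < ?sy" using s0_pos[OF D1(1)] y_pos by simp
  note C = CC_bounds
  show "finite V" "0 \<le> p" "p \<le> 1" "finite I" "disjoint_family_on Q I" using finV p01 finI disjQ
    by auto
  show "Q i \<subseteq> V" if "i \<in> I" for i using QV[OF that] .
  show "Bexp (Q i) p (\<lambda>S. (1 / \<sigma>) * (HH x S - E0)) = 0" if "i \<in> I" for i
    unfolding Bexp_cmult block_moments(1)[OF that] by simp
  show "Bexp (Q i) p (\<lambda>S. ((1 / \<sigma>) * (HH x S - E0))\<^sup>2) = (1 / \<sigma>)\<^sup>2 * s2" if "i \<in> I" for i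
    unfolding power_mult_distrib Bexp_cmult block_moments(2)[OF that] ..
  have W: "(\<lambda>S. (F S - Bexp V p F) / \<sigma>) = (\<lambda>S. (1 / \<sigma>) * (F S - Bexp V p F))" by auto
  show "Bexp V p (\<lambda>S. (F S - Bexp V p F) / \<sigma>) = 0"
    unfolding W Bexp_cmult Bexp_diff Bexp_const[OF finV] by simp
  have var: "Bvar V p F = \<sigma>\<^sup>2" unfolding \<sigma>_def real_sqrt_pow2[OF Bvar_nonneg[OF p01(1,2)]] ..
  have "Bexp V p (\<lambda>S. ((1 / \<sigma>) * (F S - Bexp V p F))\<^sup>2) = (1 / \<sigma>)\<^sup>2 * Bvar V p F"
    unfolding power_mult_distrib Bexp_cmult Bvar_def ..
  then show "Bexp V p (\<lambda>S. ((F S - Bexp V p F) / \<sigma>)\<^sup>2) = 1"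
    unfolding fun_cong[OF W] var using sigma_ge(2) by (simp add: power_divide)
  show "0 < ?C / x" "?C / x \<le> 1 / 4" using C(1) x by (auto simp: field_simps)
  have pw: "?C \<le> ?C ^ n" if "0 < n" for n using self_le_power[OF C(1) that] .
  show "Bexp V p (\<lambda>S. ((\<Sum>i\<in>I. (1 / \<sigma>) * (HH x (S \<inter> Q i) - E0)) - (F S - Bexp V p F) / \<sigma>)\<^sup>2)
    \<le> (?C / x) ^ 4"
  proof -
    have "(\<Sum>i\<in>I. (1 / \<sigma>) * (HH x (S \<inter> Q i) - E0)) - (F S - Bexp V p F) / \<sigma> =
        (1 / \<sigma>) * ((SY S - F S) - Bexp V p (\<lambda>S. SY S - F S))" for S
      unfolding Bexp_diff Bvar_SY(1) sum_distrib_left[symmetric] sum_subtractf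
      by (simp add: SY_def right_diff_distrib diff_divide_distrib)
    then have "Bexp V p (\<lambda>S. ((\<Sum>i\<in>I. (1 / \<sigma>) * (HH x (S \<inter> Q i) - E0)) - (F S - Bexp V p F) / \<sigma>)\<^sup>2) =
        (1 / \<sigma>)\<^sup>2 * Bvar V p (\<lambda>S. SY S - F S)"
      by (simp only: power_mult_distrib Bexp_cmult Bvar_def)
    also have "\<dots> \<le> (1 / ?sy)\<^sup>2 * (?sy\<^sup>2 * (?C / x ^ 4))"
      using sigma_ge sy gap_sd by (intro mult_mono power_mono divide_left_mono)
        (auto intro: Bvar_nonneg p01)
    also have "\<dots> = ?C / x ^ 4"
      using s0_pos[OF D1(1)] y_pos by (simp add: power_divide)
    also have "\<dots> \<le> ?C ^ 4 / x ^ 4" using pw[of 4] x by (intro divide_right_mono) auto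
    finally show ?thesis by (simp add: power_divide)
  qed
  have mu3: "\<mu> ^ n \<le> (bet D ^ D) ^ n * ((h * real L) ^ D) ^ n" for n
    using power_mono[OF mu(2), of n] mu(3) by (simp add: power_mult_distrib)
  show "(\<Sum>i\<in>I. Bexp (Q i) p (\<lambda>S. \<bar>(1 / \<sigma>) * (HH x S - E0)\<bar> ^ 3)) \<le> (?C / x) ^ 9"
  proof -
    have "Bexp (Q i) p (\<lambda>S. \<bar>(1 / \<sigma>) * (HH x S - E0)\<bar> ^ 3) \<le> (1 / ?sy) ^ 3 * (15 * x ^ 3 * \<mu> ^ 3)"
      if "i \<in> I" for i
    proof -
      have "Bexp (Q i) p (\<lambda>S. \<bar>(1 / \<sigma>) * (HH x S - E0)\<bar> ^ 3) =
          \<bar>1 / \<sigma>\<bar> ^ 3 * Bexp (Q i) p (\<lambda>S. \<bar>HH x S - E0\<bar> ^ 3)"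
        unfolding abs_mult power_mult_distrib Bexp_cmult ..
      also have "\<dots> \<le> (1 / ?sy) ^ 3 * (15 * x ^ 3 * \<mu> ^ 3)"
        using sigma_ge sy block_moments(3)[OF that]
        by (intro mult_mono power_mono) (auto intro!: Bexp_nonneg p01 simp: frac_le)
      finally show ?thesis .
    qed
    then have "(\<Sum>i\<in>I. Bexp (Q i) p (\<lambda>S. \<bar>(1 / \<sigma>) * (HH x S - E0)\<bar> ^ 3)) \<le>
        (\<Sum>i\<in>I. (1 / ?sy) ^ 3 * (15 * x ^ 3 * \<mu> ^ 3))"
      by (rule sum_mono)
    also have "\<dots> = (15 * x ^ 3 / ?sy ^ 3) * (real (card I) * \<mu> ^ 3)"
      by (simp add: power_divide)
    also have "\<dots> \<le> (15 * x ^ 3 / ?sy ^ 3)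
      * (real (card I) * ((bet D ^ D) ^ 3 * ((h * real L) ^ D) ^ 3))"
      using x sy mu3[of 3] by (intro mult_left_mono) auto
    also have "\<dots> = (15 * x ^ 3 * (bet D ^ D) ^ 3 / ?sy ^ 3)
      * (real (card I) * ((h * real L) ^ D) ^ (2 + 1))"
      by simp
    also have "\<dots> \<le> (15 * x ^ 3 * (bet D ^ D) ^ 3 / ?sy ^ 3)
      * (y\<^sup>2 * ((2 ^ 2) ^ D * x ^ (8 * 2 * D)))"
      using x sy B12 by (intro mult_left_mono block_count_bound) auto
    \<comment> \<open>Three powers of \<open>x\<close> come from the truncation scale and
      \<open>16 * D\<close> from two surplus block volumes; \<open>y = x ^ (64 * D)\<close>
      outweighs them by at least \<open>x ^ 9\<close>.\<close>
    also have "\<dots> = K4 D * (x ^ (3 + 16 * D) / y ^ 1)"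
    proof -
      have e: "?sy ^ 3 = s0 D ^ 3 * (y\<^sup>2 * y ^ 1)" "(2 ^ 2) ^ D = (4 :: real) ^ D"
        "8 * 2 * D = 16 * D"
        by (simp_all add: power_mult_distrib power2_eq_square power3_eq_cube)
      show ?thesis
        unfolding e K4_def power_add by (rule cancel_common) (use y_pos in simp)
    qed
    also have "\<dots> \<le> K4 D * (1 / x ^ 9)"
      using D1 K_nonneg(4)[OF D1(1), of 1] by (intro mult_left_mono x_power_y) auto
    also have "\<dots> \<le> ?C ^ 9 * (1 / x ^ 9)"
      using C(3) pw[of 9] x by (intro mult_right_mono) auto
    finally show ?thesis by (simp add: power_divide)
  qed
  show "(\<Sum>i\<in>I. ((1 / \<sigma>)\<^sup>2 * s2)\<^sup>2) \<le> (?C / x) ^ 9"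
  proof -
    have "(1 / \<sigma>)\<^sup>2 * s2 \<le> (1 / ?sy)\<^sup>2 * (5 * x\<^sup>2 * \<mu>\<^sup>2)"
      using sigma_ge sy s2_bounds by (intro mult_mono power_mono) (auto simp: frac_le)
    then have "((1 / \<sigma>)\<^sup>2 * s2)\<^sup>2 \<le> ((1 / ?sy)\<^sup>2 * (5 * x\<^sup>2 * \<mu>\<^sup>2))\<^sup>2"
      using s2_bounds by (intro power_mono) auto
    also have "\<dots> = (25 * x ^ 4 / ?sy ^ 4) * \<mu> ^ 4"
      by (simp add: power_divide power_mult_distrib flip: power_mult)
    finally have "(\<Sum>i\<in>I. ((1 / \<sigma>)\<^sup>2 * s2)\<^sup>2) \<le> (\<Sum>i\<in>I. (25 * x ^ 4 / ?sy ^ 4) * \<mu> ^ 4)"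
      by (intro sum_mono)
    also have "\<dots> = (25 * x ^ 4 / ?sy ^ 4) * (real (card I) * \<mu> ^ 4)"
      by simp
    also have "\<dots> \<le> (25 * x ^ 4 / ?sy ^ 4)
      * (real (card I) * ((bet D ^ D) ^ 4 * ((h * real L) ^ D) ^ 4))"
      using x sy mu3[of 4] by (intro mult_left_mono) auto
    also have "\<dots> = (25 * x ^ 4 * (bet D ^ D) ^ 4 / ?sy ^ 4)
      * (real (card I) * ((h * real L) ^ D) ^ (3 + 1))"
      by simp
    also have "\<dots> \<le> (25 * x ^ 4 * (bet D ^ D) ^ 4 / ?sy ^ 4)
      * (y\<^sup>2 * ((2 ^ 3) ^ D * x ^ (8 * 3 * D)))"
      using x sy B12 by (intro mult_left_mono block_count_bound) auto
    also have "\<dots> = K5 D * (x ^ (4 + 24 * D) / y ^ 2)"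
    proof -
      have e: "?sy ^ 4 = s0 D ^ 4 * (y\<^sup>2 * y\<^sup>2)" "(2 ^ 3) ^ D = (8 :: real) ^ D"
        "8 * 3 * D = 24 * D"
        by (simp_all add: power_mult_distrib flip: power_add)
      show ?thesis
        unfolding e K5_def power_add by (rule cancel_common) (use y_pos in simp)
    qed
    also have "\<dots> \<le> K5 D * (1 / x ^ 9)"
      using D1 K_nonneg(5)[OF D1(1), of 1] by (intro mult_left_mono x_power_y) auto
    also have "\<dots> \<le> ?C ^ 9 * (1 / x ^ 9)"
      using C(4) pw[of 9] x by (intro mult_right_mono) auto
    finally show ?thesis by (simp add: power_divide)
  qed
qed

lemma conclusion:
  shows "(s0 D)\<^sup>2 \<le> Bvar A p mst_length"
    and "\<bar>Bexp A p (\<lambda>S. of_bool ((mst_length S - Bexp A p mst_length) / sqrt (Bvar A p mst_length)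
      \<le> t)) - Phi t\<bar>
      \<le> 10 * CC D (pack TYPE('d)) / x"
proof -
  have red: "Bexp V p (\<lambda>S. \<phi> (F S)) = Bexp A p (\<lambda>S. \<phi> (mst_length S))" for \<phi>
    unfolding F_def by (rule Bexp_restrict[OF finV AV, of p "\<lambda>S. \<phi> (mst_length S)"])
  have E: "Bexp V p F = Bexp A p mst_length" using red[of "\<lambda>z. z"] by simp
  have Vr: "Bvar V p F = Bvar A p mst_length"
    unfolding Bvar_def E using red[of "\<lambda>z. (z - Bexp A p mst_length)\<^sup>2"] by simp
  have "1 \<le> y" unfolding y_def by (rule one_le_power[OF x(1)])
  then have "s0 D * 1 \<le> s0 D * y" using s0_pos[OF D1(1)] by (intro mult_left_mono) auto
  then have "s0 D \<le> \<sigma>" using sigma_ge(1) by linarith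
  then have "(s0 D)\<^sup>2 \<le> \<sigma>\<^sup>2" using s0_pos[OF D1(1)] by (intro power_mono) auto
  then show "(s0 D)\<^sup>2 \<le> Bvar A p mst_length"
    using Bvar_nonneg[OF p01(1,2), of V F] by (simp add: \<sigma>_def Vr)
  show "\<bar>Bexp A p (\<lambda>S. of_bool ((mst_length S - Bexp A p mst_length) / sqrt (Bvar A p mst_length)
    \<le> t)) - Phi t\<bar>
      \<le> 10 * CC D (pack TYPE('d)) / x"
    using normal_approximation[of t]
      red[of "\<lambda>z. of_bool ((z - Bexp A p mst_length) / sqrt (Bvar A p mst_length) \<le> t)"]
    unfolding \<sigma>_def E Vr by simp
qed

end

definition x_min :: "nat \<Rightarrow> real \<Rightarrow> real" where
  "x_min D P = max (max 1 (6 * real D)) (max (16 * bet D) (4 * CC D P))"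

definition mst_cdf :: "'a::metric_space set \<Rightarrow> real \<Rightarrow> real \<Rightarrow> real" where
  "mst_cdf A p t = Bexp A p (\<lambda>S. of_bool
    ((mst_length S - Bexp A p mst_length) / sqrt (Bvar A p mst_length) \<le> t))"

text \<open>\<open>L\<close> is free: it refines the mesh \<open>h\<close> without changing the
  normalised sizes of blocks and cube. The density is chosen before \<open>N\<close>, so a single
  \<open>p\<close> serves every admissible window.\<close>

lemma lattice_clt:
  fixes x :: real and L :: nat
  defines "D \<equiv> CARD('d::finite)" and "k \<equiv> nat \<lfloor>x ^ 120\<rfloor>"
  defines "h \<equiv> x ^ 128 / (real k * real L)"
  assumes D: "2 \<le> CARD('d)" and x: "x_min D (pack TYPE('d)) \<le> x"
    and L: "0 < L" "6 * bet D * x ^ 128 \<le> real k * real L"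
  shows "\<exists>p. h ^ D \<le> p \<and> p \<le> bet D ^ D * h ^ D \<and> p \<le> 1 / 2 \<and>
    (\<forall>N. real k * real L \<le> 4 * bet D * real N \<and> N \<le> k * L \<longrightarrow>
      (s0 D)\<^sup>2 \<le> Bvar (pt h ` grid N :: (real ^ 'd) set) p mst_length \<and>
      (\<forall>t. \<bar>mst_cdf (pt h ` grid N :: (real ^ 'd) set) p t - Phi t\<bar> \<le> 10 * CC D (pack TYPE('d)) /
        x))"
proof -
  have x1: "1 \<le> x" "6 * real D \<le> x" "16 * bet D \<le> x" "4 * CC D (pack TYPE('d)) \<le> x"
    using x by (simp_all add: x_min_def)
  have b: "12 \<le> bet D" by (rule bet_ge)
  have x120: "1 \<le> x ^ 120" by (rule one_le_power[OF x1(1)])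
  have kle: "real k \<le> x ^ 120" unfolding k_def using x120 by simp
  have kge: "x ^ 120 \<le> 2 * real k"
  proof -
    have "1 \<le> \<lfloor>x ^ 120\<rfloor>" using x120 by simp
    then show ?thesis unfolding k_def by linarith
  qed
  have k: "0 < k" using kge x120 by (cases k) auto
  have kL: "0 < real k * real L" using k L by simp
  have h0: "0 < h" unfolding h_def using x1(1) kL by (intro divide_pos_pos) auto
  have nu: "h * (real k * real L) = x ^ 128" using k L(1) by (simp add: h_def)
  have hle: "h \<le> 1 / (6 * bet D)"
    unfolding h_def using L(2) kL b by (simp add: field_simps)
  have bh: "bet D ^ D * h ^ D \<le> 1 / 2"
  proof -
    have "bet D * h \<le> 1 / 6" using hle b by (simp add: field_simps)
    moreover have "0 \<le> bet D * h" using b h0 by simp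
    ultimately have "(bet D * h) ^ D \<le> (1 / 6) ^ D" by (intro power_mono) auto
    also have "\<dots> \<le> 1 / 6" using power_decreasing[of 1 D "1 / 6 :: real"] D by (simp add: D_def)
    finally show ?thesis by (simp add: power_mult_distrib)
  qed
  have hL: "real k * (h * real L) = x ^ 128" using nu by (simp add: mult_ac)
  have l1: "x ^ 8 \<le> h * real L"
  proof -
    have "x ^ 120 * x ^ 8 = real k * (h * real L)" unfolding hL by (simp flip: power_add)
    also have "\<dots> \<le> x ^ 120 * (h * real L)" using kle h0 by (intro mult_right_mono) auto
    finally show ?thesis by (rule mult_left_le_imp_le) (use x120 in linarith)
  qed
  have l2: "h * real L \<le> 2 * x ^ 8"
  proof -
    have "x ^ 120 * (h * real L) \<le> 2 * real k * (h * real L)" using kge h0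
      by (intro mult_right_mono) auto
    also have "\<dots> = 2 * (real k * (h * real L))" by simp
    also have "\<dots> = x ^ 120 * (2 * x ^ 8)"
    proof -
      have "x ^ 128 = x ^ 120 * x ^ 8" by (simp flip: power_add)
      then show ?thesis unfolding hL by simp
    qed
    finally show ?thesis by (rule mult_left_le_imp_le) (use x120 in linarith)
  qed
  have R: "x \<le> h * real L" using self_le_power[OF x1(1), of 8] l1 by simp
  obtain p where p: "h ^ D \<le> p" "p \<le> bet D ^ D * h ^ D"
    "slope D * real (card (pt h ` grid L :: (real ^ 'd) set)) \<le>
      (\<Sum>v\<in>pt h ` grid L. Bexp (pt h ` grid L :: (real ^ 'd) set) p (DD v (HH x)))"
    "(\<Sum>v\<in>pt h ` grid (k * L). Bexp (pt h ` grid (k * L) :: (real ^ 'd) set) p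
        (DD v (\<lambda>S. HH x (S \<inter> pt h ` grid (k * L)) - (\<Sum>b\<in>grid k. HH x (S \<inter> pt h ` block L b)))))
      \<le> 2 * (pack TYPE('d) * x) * (32 * real D * (pack TYPE('d) * x) * x / (h * real L)
          * real (card (pt h ` grid (k * L) :: (real ^ 'd) set))) / slope D"
    using lattice_good_parameter[OF D h0 hle[unfolded D_def] bh[unfolded D_def] x1(1) R k L(1)]
    unfolding D_def by blast
  let ?V = "pt h ` grid (k * L) :: (real ^ 'd) set" and ?Q0 = "pt h ` grid L :: (real ^ 'd) set"
  let ?A = "\<lambda>N. pt h ` grid N :: (real ^ 'd) set"
  have "lattice_setup x h p (x ^ (64 * D)) (Bexp ?Q0 p (HH x)) (Bvar ?Q0 p (HH x))
      (p * real (card ?Q0)) (sqrt (Bvar ?V p (\<lambda>S. mst_length (S \<inter> ?A N))))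
      k L N D ?V ?Q0 (?A N) (\<lambda>b. pt h ` block L b) (grid (N div L))
      (\<lambda>S. mst_length (S \<inter> ?A N) - (HH x (S \<inter> ?A N) - x))
      (\<lambda>S. mst_length (S \<inter> ?A N)) (\<lambda>S. \<Sum>b\<in>grid (N div L). HH x (S \<inter> pt h ` block L b))"
    if "real k * real L \<le> 4 * bet D * real N" "N \<le> k * L" for N
    unfolding lattice_setup_def
    using D h0 hle bh k L(1) nu l1 l2 x1 that p by (simp add: D_def)
  from lattice_setup.conclusion[OF this, folded mst_cdf_def] show ?thesis
    using p(1,2) bh by (intro exI[of _ p]) auto
qed

section \<open>Perturbation of minimal spanning trees\<close>

text \<open>The image of an optimal graph is a competitor. Counting its edges by
  \<open>2 ^ card V\<close> suffices because \<open>V\<close> is fixed while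
  \<open>\<epsilon>\<close> tends to 0; the factor \<open>c\<close> covers dilations.\<close>

lemma mst_length_image_le:
  fixes V :: "'a::metric_space set" and f :: "'a \<Rightarrow> 'b::metric_space"
  assumes V: "finite V" and inj: "inj_on f V" and c: "0 \<le> c" "0 \<le> \<epsilon>"
    and d: "\<And>u v. u \<in> V \<Longrightarrow> v \<in> V \<Longrightarrow> dist (f u) (f v) \<le> c * dist u v + \<epsilon>"
  shows "mst_length (f ` V) \<le> c * mst_length V + \<epsilon> * 2 ^ card V"
proof -
  obtain E where E: "connected_graph V E" "mst_length V = (\<Sum>e\<in>E. diameter e)"
    using mst_length_attained(1)[OF V] by blast
  have EV: "E \<subseteq> pairs V" using E(1) by (simp add: connected_graph_iff)
  have EP: "E \<subseteq> Pow V" using EV by (auto simp: pairs_def)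
  have finE: "finite E" using EP V finite_subset by blast
  have injE: "inj_on (image f) E"
    by (rule inj_on_subset[OF inj_on_image_Pow[OF inj] EP])
  have reach: "(f u, f v) \<in> (adj (image f ` E))\<^sup>*" if "(u, v) \<in> (adj E)\<^sup>*" for u v
    using that
  proof (induction rule: rtrancl_induct)
    case (step y z)
    then have "f ` {y, z} \<in> image f ` E" by (intro imageI) (simp add: adj_def)
    then have "(f y, f z) \<in> adj (image f ` E)" by (simp add: adj_def)
    with step.IH show ?case by (rule rtrancl_into_rtrancl)
  qed simp
  have "image f ` E \<subseteq> pairs (f ` V)"
  proof
    fix e assume "e \<in> image f ` E"
    then obtain u v where "e = f ` {u, v}" "u \<in> V" "v \<in> V" "u \<noteq> v"
      using EV by (auto simp: pairs_def)
    then have "e = {f u, f v}" "f u \<in> f ` V" "f v \<in> f ` V" "f u \<noteq> f v"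
      using inj by (auto simp: inj_on_eq_iff)
    then show "e \<in> pairs (f ` V)" unfolding pairs_def by blast
  qed
  moreover have "\<forall>u\<in>f ` V. \<forall>v\<in>f ` V. (u, v) \<in> (adj (image f ` E))\<^sup>*"
    using E(1) reach by (auto simp: connected_graph_iff)
  ultimately have "connected_graph (f ` V) (image f ` E)"
    by (simp add: connected_graph_iff)
  then have "mst_length (f ` V) \<le> (\<Sum>e\<in>image f ` E. diameter e)"
    by (rule mst_length_attained(2)[rotated]) (use V in simp)
  also have "\<dots> = (\<Sum>e\<in>E. diameter (f ` e))"
    using sum.reindex[OF injE, of diameter] by simp
  also have "\<dots> \<le> (\<Sum>e\<in>E. c * diameter e + \<epsilon>)"
  proof (rule sum_mono)
    fix e assume "e \<in> E"
    then obtain u v where uv: "e = {u, v}" "u \<in> V" "v \<in> V" using EV by (auto simp: pairs_def)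
    then show "diameter (f ` e) \<le> c * diameter e + \<epsilon>"
      using d[OF uv(2,3)] by (simp add: diameter_edge)
  qed
  also have "\<dots> = c * mst_length V + \<epsilon> * real (card E)"
    by (simp add: sum.distrib E(2) sum_distrib_left mult.commute)
  also have "\<dots> \<le> c * mst_length V + \<epsilon> * 2 ^ card V"
  proof -
    have "card E \<le> card (Pow V)" by (rule card_mono) (use EP V in auto)
    then have "real (card E) \<le> real (2 ^ card V)" unfolding card_Pow[OF V] by (rule of_nat_mono)
    then show ?thesis using c by (intro add_left_mono mult_left_mono) auto
  qed
  finally show ?thesis .
qed

lemma mst_length_perturb:
  fixes V :: "'a::metric_space set" and f :: "'a \<Rightarrow> 'b::metric_space"
  assumes V: "finite V" and inj: "inj_on f V" and c: "0 \<le> \<epsilon>"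
    and d: "\<And>u v. u \<in> V \<Longrightarrow> v \<in> V \<Longrightarrow> \<bar>dist (f u) (f v) - dist u v\<bar> \<le> \<epsilon>"
  shows "\<bar>mst_length (f ` V) - mst_length V\<bar> \<le> \<epsilon> * 2 ^ card V"
proof -
  have 1: "mst_length (f ` V) \<le> 1 * mst_length V + \<epsilon> * 2 ^ card V"
    by (rule mst_length_image_le[OF V inj]) (use c d in \<open>auto simp: abs_le_iff\<close>, force)
  let ?g = "the_inv_into V f"
  have g: "?g (f u) = u" if "u \<in> V" for u using inj that by (rule the_inv_into_f_f)
  have im: "?g ` f ` V = V" using g by (simp add: image_image cong: image_cong)
  have "mst_length (?g ` f ` V) \<le> 1 * mst_length (f ` V) + \<epsilon> * 2 ^ card (f ` V)"
  proof (rule mst_length_image_le)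
    show "inj_on ?g (f ` V)" using inj by (rule inj_on_the_inv_into)
    fix u v assume "u \<in> f ` V" "v \<in> f ` V"
    then obtain u' v' where uv: "u = f u'" "v = f v'" "u' \<in> V" "v' \<in> V" by blast
    show "dist (?g u) (?g v) \<le> 1 * dist u v + \<epsilon>"
      using d[OF uv(3,4)] g[OF uv(3)] g[OF uv(4)] unfolding uv(1,2) by (simp add: abs_le_iff)
  qed (use V c in auto)
  then have 2: "mst_length V \<le> mst_length (f ` V) + \<epsilon> * 2 ^ card V"
    unfolding im card_image[OF inj] by simp
  from 1 2 show ?thesis by (simp add: abs_le_iff)
qed

lemma mst_length_pt_scale:
  assumes "finite J" "0 < a" "0 < h"
  shows "mst_length (pt a ` J :: (real ^ 'd) set)
    = (a / h) * mst_length (pt h ` J :: (real ^ 'd) set)"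
proof -
  have le: "mst_length (pt a ` J :: (real ^ 'd) set)
    \<le> (a / h) * mst_length (pt h ` J :: (real ^ 'd) set)"
    if ah: "0 < a" "0 < h" for a h
  proof -
    let ?f = "\<lambda>v :: real ^ 'd. (a / h) *\<^sub>R v"
    have im: "pt a ` J = ?f ` (pt h ` J)"
      unfolding image_image using ah by (intro image_cong) (auto simp: pt_def vec_eq_iff)
    have "mst_length (?f ` (pt h ` J)) \<le> (a / h) * mst_length (pt h ` J :: (real ^ 'd) set)
      + 0 * 2 ^ card (pt h ` J :: (real ^ 'd) set)"
    proof (rule mst_length_image_le)
      show "inj_on ?f (pt h ` J)" using ah by (auto simp: inj_on_def)
      fix u v :: "real ^ 'd"
      have "?f u - ?f v = (a / h) *\<^sub>R (u - v)" by (simp add: scaleR_diff_right)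
      then have "dist (?f u) (?f v) = (a / h) * dist u v"
        using ah by (simp only: dist_norm norm_scaleR abs_of_pos divide_pos_pos)
      then show "dist (?f u) (?f v) \<le> (a / h) * dist u v + 0" by simp
    qed (use assms ah in auto)
    then show ?thesis unfolding im by simp
  qed
  have "(a / h) * mst_length (pt h ` J :: (real ^ 'd) set)
    \<le> (a / h) * ((h / a) * mst_length (pt a ` J :: (real ^ 'd) set))"
    using le[OF assms(3,2)] assms by (intro mult_left_mono) auto
  also have "\<dots> = mst_length (pt a ` J :: (real ^ 'd) set)" using assms by simp
  finally show ?thesis using le[OF assms(2,3)] by (intro antisym)
qed

lemma mst_length_bounds:
  fixes V :: "'a::metric_space set"
  assumes V: "finite V" and R: "0 \<le> R" "\<And>u v. u \<in> V \<Longrightarrow> v \<in> V \<Longrightarrow> dist u v \<le> R"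
  shows "0 \<le> mst_length V" "mst_length V \<le> R * real (card V)"
proof -
  obtain E where E: "connected_graph V E" "mst_length V = (\<Sum>e\<in>E. diameter e)"
    using mst_length_attained(1)[OF V] by blast
  then show "0 \<le> mst_length V"
    using diameter_pair_nonneg[of _ V] by (auto simp: connected_graph_iff intro!: sum_nonneg)
  show "mst_length V \<le> R * real (card V)"
  proof (cases "V = {}")
    case False
    have "kap R V \<le> card ((\<lambda>_. ()) ` V)"
      by (rule kap_le_card_image[OF V]) (use R in auto)
    also have "\<dots> \<le> card {()}" by (rule card_mono) auto
    finally have "kap R V = 1"
      using ncomp_pos[OF V False, of "geo R V"] by (simp add: kap_def)
    from mst_length_eq_integral[OF V False R(1) this] show ?thesis
      using HH_bounds(2)[OF V R(1)] R(1) by (simp add: HH_def)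
  qed simp
qed

section \<open>Discretisation\<close>

text \<open>Half-open, so that each point with all coordinates at least \<open>c\<close> lies in
  exactly one cell. Natural indices suffice because \<open>c\<close> will be the lower coordinate of
  the window.\<close>

definition cell :: "real \<Rightarrow> real \<Rightarrow> ('d::finite \<Rightarrow> nat) \<Rightarrow> (real ^ 'd) set" where
  "cell c a j = {y. \<forall>i. c + a * real (j i) \<le> y $ i \<and> y $ i < c + a * (real (j i) + 1)}"

definition cell_index :: "real \<Rightarrow> real \<Rightarrow> real ^ 'd \<Rightarrow> ('d \<Rightarrow> nat)" where
  "cell_index c a y = (\<lambda>i. nat \<lfloor>(y $ i - c) / a\<rfloor>)"

lemma mem_cell_iff:
  assumes "0 < a" "\<And>i. c \<le> y $ i"
  shows "y \<in> cell c a j \<longleftrightarrow> j = cell_index c a y"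
proof -
  have "c + a * real (j i) \<le> y $ i \<and> y $ i < c + a * (real (j i) + 1) \<longleftrightarrow> j i = nat \<lfloor>(y $ i - c) / a\<rfloor>"
    for i
  proof -
    have q: "0 \<le> (y $ i - c) / a" using assms by simp
    have "c + a * real (j i) \<le> y $ i \<and> y $ i < c + a * (real (j i) + 1) \<longleftrightarrow>
        real (j i) \<le> (y $ i - c) / a \<and> (y $ i - c) / a < real (j i) + 1"
      using assms(1) by (auto simp: field_simps)
    also have "\<dots> \<longleftrightarrow> int (j i) = \<lfloor>(y $ i - c) / a\<rfloor>"
      by (metis floor_eq_iff of_int_of_nat_eq)
    also have "\<dots> \<longleftrightarrow> j i = nat \<lfloor>(y $ i - c) / a\<rfloor>" using q by auto
    finally show ?thesis .
  qed
  then show ?thesis by (auto simp: cell_def cell_index_def fun_eq_iff)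
qed

lemma occupied_cells:
  assumes "0 < a" "\<And>y i. y \<in> V \<Longrightarrow> c \<le> y $ i" "cell_index c a ` V \<subseteq> G"
  shows "{j \<in> G. V \<inter> cell c a j \<noteq> {}} = cell_index c a ` V"
  using assms(2,3) mem_cell_iff[OF assms(1)] by blast

lemma pt_cell_index:
  assumes "0 < a" "c \<le> y $ i"
  shows "\<bar>pt a (cell_index c a y) $ i - (y $ i - c)\<bar> \<le> a"
proof -
  have q: "0 \<le> (y $ i - c) / a" using assms by simp
  then have "\<bar>real (nat \<lfloor>(y $ i - c) / a\<rfloor>) - (y $ i - c) / a\<bar> \<le> 1" by linarith
  then have "a * \<bar>real (nat \<lfloor>(y $ i - c) / a\<rfloor>) - (y $ i - c) / a\<bar> \<le> a * 1"
    using assms by (intro mult_left_mono) auto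
  moreover have "a * ((y $ i - c) / a) = y $ i - c" using assms(1) by simp
  then have "a * (real (nat \<lfloor>(y $ i - c) / a\<rfloor>) - (y $ i - c) / a) =
      pt a (cell_index c a y) $ i - (y $ i - c)"
    unfolding right_diff_distrib by (simp add: pt_component cell_index_def)
  ultimately show ?thesis
    using assms(1) by (metis abs_mult abs_of_pos mult.right_neutral)
qed

lemma dist_pt_cell_index:
  fixes u v :: "real ^ 'd" and a c :: real
  assumes "0 < a" "\<And>i. c \<le> u $ i" "\<And>i. c \<le> v $ i"
  shows "\<bar>dist (pt a (cell_index c a u)) (pt a (cell_index c a v)) - dist u v\<bar> \<le> 2 * CARD('d) * a"
proof -
  let ?c = "(\<chi> i. c) :: real ^ 'd"
  have "dist (pt a (cell_index c a y)) (y - ?c) \<le> CARD('d) * a" if "\<And>i. c \<le> y $ i"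
    for y :: "real ^ 'd"
    by (rule dist_le_l1) (use pt_cell_index[of a c y] assms(1) that in simp)
  from this[of u] this[of v] have 1: "dist (pt a (cell_index c a u)) (u - ?c) \<le> CARD('d) * a"
    "dist (pt a (cell_index c a v)) (v - ?c) \<le> CARD('d) * a" using assms by auto
  have "\<bar>dist (pt a (cell_index c a u)) (pt a (cell_index c a v)) - dist (u - ?c) (v - ?c)\<bar> \<le>
      dist (pt a (cell_index c a u)) (u - ?c) + dist (pt a (cell_index c a v)) (v - ?c)"
    using dist_triangle2[of "pt a (cell_index c a u)" "pt a (cell_index c a v)" "u - ?c"]
      dist_triangle[of "pt a (cell_index c a u)" "pt a (cell_index c a v)" "u - ?c"]
      dist_triangle[of "u - ?c" "pt a (cell_index c a v)" "v - ?c"]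
      dist_triangle[of "u - ?c" "v - ?c" "pt a (cell_index c a u)"]
      dist_triangle[of "pt a (cell_index c a u)" "v - ?c" "pt a (cell_index c a v)"]
    by (simp add: dist_commute abs_le_iff)
  moreover have "dist (u - ?c) (v - ?c) = dist u v" by (simp add: dist_norm)
  ultimately show ?thesis using 1 by simp
qed

text \<open>Once the mesh is small compared with the least distance in \<open>V\<close>, the map to
  cell corners is injective and changes distances by a multiple of \<open>a m\<close>; the shift by
  \<open>c\<close> is an isometry.\<close>

lemma mst_discretisation_tendsto:
  fixes V :: "(real ^ 'd) set" and a :: "nat \<Rightarrow> real"
  assumes V: "finite V" "\<And>y i. y \<in> V \<Longrightarrow> c \<le> y $ i"
    and a: "a \<longlonglongrightarrow> 0" "\<And>m. 0 < a m"
    and T: "eventually (\<lambda>m. T m = cell_index c (a m) ` V) sequentially"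
  shows "(\<lambda>m. mst_length (pt (a m) ` T m :: (real ^ 'd) set)) \<longlonglongrightarrow> mst_length V"
proof -
  have "finite ((\<lambda>(u, v). dist u v) ` (V \<times> V) - {0})" using V by auto
  then obtain \<delta> where \<delta>: "0 < \<delta>" "\<And>u v. u \<in> V \<Longrightarrow> v \<in> V \<Longrightarrow> u \<noteq> v \<Longrightarrow> \<delta> \<le> dist u v"
  proof -
    assume fin: "finite ((\<lambda>(u, v). dist u v) ` (V \<times> V) - {0})"
      and that: "\<And>\<delta>. 0 < \<delta> \<Longrightarrow> (\<And>u v. u \<in> V \<Longrightarrow> v \<in> V \<Longrightarrow> u \<noteq> v \<Longrightarrow> \<delta> \<le> dist u v) \<Longrightarrow> thesis"
    \<comment> \<open>The element 1 covers sets with at most one point, which have no positive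
      distances.\<close>
    let ?X = "insert 1 ((\<lambda>(u, v). dist u v) ` (V \<times> V) - {0})"
    have "Min ?X \<in> ?X" by (rule Min_in) (use fin in auto)
    then have "0 < Min ?X" by (auto simp: zero_less_dist_iff split: prod.splits)
    moreover have "Min ?X \<le> dist u v" if "u \<in> V" "v \<in> V" "u \<noteq> v" for u v
      by (rule Min_le) (use fin that in \<open>auto intro!: rev_image_eqI[of "(u, v)"]\<close>)
    ultimately show thesis by (rule that)
  qed
  have lim: "(\<lambda>m. 2 * CARD('d) * a m) \<longlonglongrightarrow> 0"
    using tendsto_mult_right_zero[OF a(1)] by simp
  then have small: "eventually (\<lambda>m. 2 * CARD('d) * a m < \<delta>) sequentially"
    using \<delta>(1) by (rule order_tendstoD(2))
  have "eventually (\<lambda>m. norm (mst_length (pt (a m) ` T m :: (real ^ 'd) set) - mst_length V) \<le>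
      2 * CARD('d) * a m * 2 ^ card V) sequentially"
    using T small
  proof eventually_elim
    case (elim m)
    let ?f = "\<lambda>y. pt (a m) (cell_index c (a m) y) :: real ^ 'd"
    have d: "\<bar>dist (?f u) (?f v) - dist u v\<bar> \<le> 2 * CARD('d) * a m" if "u \<in> V" "v \<in> V" for u v
      by (rule dist_pt_cell_index[OF a(2)]) (use V(2) that in auto)
    have "inj_on ?f V"
    proof (rule inj_onI, rule ccontr)
      fix u v assume uv: "u \<in> V" "v \<in> V" "?f u = ?f v" "u \<noteq> v"
      then show False using d[OF uv(1,2)] \<delta>(2)[OF uv(1,2,4)] elim(2) by simp
    qed
    from mst_length_perturb[OF V(1) this _ d] have
      "\<bar>mst_length (?f ` V) - mst_length V\<bar> \<le> 2 * CARD('d) * a m * 2 ^ card V"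
      using a(2)[of m] by simp
    then show ?case by (simp add: elim(1) image_image)
  qed
  moreover have "(\<lambda>m. 2 * CARD('d) * a m * 2 ^ card V) \<longlonglongrightarrow> 0"
    using tendsto_mult_left_zero[OF lim] by simp
  ultimately have "(\<lambda>m. mst_length (pt (a m) ` T m :: (real ^ 'd) set) - mst_length V) \<longlonglongrightarrow> 0"
    by (rule Lim_null_comparison)
  then show ?thesis by (simp add: LIM_zero_iff)
qed

section \<open>Windows and cells as Borel sets\<close>

lemma mem_window:
  assumes "n \<ge> 1"
  shows "y \<in> window n \<longleftrightarrow> (\<forall>i. - (real n / 2) \<le> y $ i \<and> y $ i \<le> real n / 2)"
proof
  assume "y \<in> window n"
  then obtain z where "y = real n *\<^sub>R z" "z \<in> unit_hypercube"
    unfolding window_def by blast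
  then have z: "y = real n *\<^sub>R z" "\<And>i. - (1 / 2) \<le> z $ i" "\<And>i. z $ i \<le> 1 / 2"
    by (simp_all add: unit_hypercube_def mem_box_cart)
  have "real n * (- (1 / 2)) \<le> real n * z $ i \<and> real n * z $ i \<le> real n * (1 / 2)" for i
    using z(2,3)[of i] by (intro conjI mult_left_mono) auto
  then show "\<forall>i. - (real n / 2) \<le> y $ i \<and> y $ i \<le> real n / 2"
    by (simp add: z(1))
next
  assume y: "\<forall>i. - (real n / 2) \<le> y $ i \<and> y $ i \<le> real n / 2"
  have "y = real n *\<^sub>R ((1 / real n) *\<^sub>R y)" using assms by simp
  moreover have "(1 / real n) *\<^sub>R y \<in> unit_hypercube"
    using y assms by (auto simp: unit_hypercube_def mem_box_cart field_simps)
  ultimately show "y \<in> window n" unfolding window_def by (rule image_eqI)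
qed

lemma window_eq_cbox:
  assumes "n \<ge> 1"
  shows "window n = cbox (\<chi> i. - (real n / 2)) (\<chi> i. real n / 2)"
  by (rule set_eqI) (simp add: mem_window[OF assms] mem_box_cart)

lemma window_borel: "n \<ge> 1 \<Longrightarrow> window n \<in> sets borel" "n \<ge> 1 \<Longrightarrow> bounded (window n)"
  by (simp_all add: window_eq_cbox)

lemma cell_borel: "cell c a j \<in> sets borel"
proof -
  have eq: "cell c a j = (\<Inter>i\<in>UNIV. {y. c + a * real (j i) \<le> y $ i} \<inter> {y. y $ i
    < c + a * (real (j i) + 1)})"
    by (auto simp: cell_def)
  show ?thesis
    unfolding eq
    by (intro sets.finite_INT sets.Int borel_closed borel_open closed_Collect_le open_Collect_less
        continuous_intros) auto
qed

lemma cell_sandwich: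
  "box (\<chi> i. c + a * real (j i)) (\<chi> i. c + a * (real (j i) + 1)) \<subseteq> cell c a j"
  "cell c a j \<subseteq> cbox (\<chi> i. c + a * real (j i)) (\<chi> i. c + a * (real (j i) + 1))"
  by (auto simp: cell_def mem_box_cart less_imp_le)

lemma cell_bounded: "bounded (cell c a j)"
  using bounded_subset[OF bounded_cbox cell_sandwich(2)] .

lemma measure_cell:
  fixes j :: "'d::finite \<Rightarrow> nat"
  assumes "0 < a"
  shows "measure lborel (cell c a j) = a ^ CARD('d)"
proof -
  let ?l = "(\<chi> i. c + a * real (j i)) :: real ^ 'd"
    and ?u = "(\<chi> i. c + a * (real (j i) + 1)) :: real ^ 'd"
  have le: "\<forall>i. ?l $ i \<le> ?u $ i" using assms by simp
  then have ne: "cbox ?l ?u \<noteq> {}" by (simp add: interval_ne_empty_cart)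
  have c: "measure lborel (cbox ?l ?u) = a ^ CARD('d)"
    unfolding content_cbox_cart[OF ne] by (simp add: algebra_simps)
  have "\<forall>b\<in>Basis. ?l \<bullet> b \<le> ?u \<bullet> b"
    using ne by (auto simp: box_ne_empty)
  then have b: "measure lborel (box ?l ?u) = a ^ CARD('d)"
    using c by (simp add: measure_lborel_box_eq measure_lborel_cbox_eq)
  have m: "cell c a j \<in> fmeasurable lborel"
    by (rule fmeasurableI2[OF fmeasurable_cbox cell_sandwich(2)]) (simp add: cell_borel)
  have "measure lborel (box ?l ?u) \<le> measure lborel (cell c a j)"
    by (rule measure_mono_fmeasurable[OF cell_sandwich(1) _ m]) simp
  moreover have "measure lborel (cell c a j) \<le> measure lborel (cbox ?l ?u)"
    by (rule measure_mono_fmeasurable[OF cell_sandwich(2)]) (auto simp: cell_borel)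
  ultimately show ?thesis using b c by simp
qed

lemma disjoint_cells:
  assumes "0 < a" "j \<noteq> j'"
  shows "cell c a j \<inter> cell c a j' = {}"
proof (rule ccontr)
  assume "cell c a j \<inter> cell c a j' \<noteq> {}"
  then obtain y where y: "y \<in> cell c a j" "y \<in> cell c a j'" by blast
  have "c \<le> y $ i" for i
  proof -
    have "c + a * real (j i) \<le> y $ i" using y(1) by (simp add: cell_def)
    moreover have "0 \<le> a * real (j i)" using assms(1) by simp
    ultimately show ?thesis by linarith
  qed
  from mem_cell_iff[OF assms(1) this] y assms(2) show False by simp
qed

section \<open>Occupied cells of a Poisson process\<close>

context homogeneous_poisson_process
begin

lemma occupied_measurable:
  assumes "A \<in> sets borel" "bounded A"
  shows "{\<omega> \<in> space M. P \<omega> \<inter> A \<noteq> {}} \<in> sets M"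
proof -
  have "{\<omega> \<in> space M. P \<omega> \<inter> A \<noteq> {}} = (\<lambda>\<omega>. card (P \<omega> \<inter> A)) -` (- {0}) \<inter> space M"
    using locally_finite[OF _ assms(2)] by (auto simp: card_eq_0_iff)
  then show ?thesis
    using measurable_sets[OF count_measurable[OF assms], of "- {0}"] by simp
qed

lemma occupation_event:
  fixes B :: "'j \<Rightarrow> 'a set"
  assumes "finite J" "\<And>j. j \<in> J \<Longrightarrow> B j \<in> sets borel \<and> bounded (B j)" "S \<subseteq> J"
  shows "{\<omega> \<in> space M. {j \<in> J. P \<omega> \<inter> B j \<noteq> {}} = S} \<in> sets M"
proof -
  have eq: "{\<omega> \<in> space M. {j \<in> J. P \<omega> \<inter> B j \<noteq> {}} = S} =
      {\<omega> \<in> space M. \<forall>j\<in>J. (P \<omega> \<inter> B j \<noteq> {}) = (j \<in> S)}"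
    using assms(3) by auto
  have "{\<omega> \<in> space M. (P \<omega> \<inter> B j \<noteq> {}) = (j \<in> S)} \<in> sets M" if "j \<in> J" for j
  proof -
    have occ: "{\<omega> \<in> space M. P \<omega> \<inter> B j \<noteq> {}} \<in> sets M"
      using occupied_measurable assms(2)[OF that] by blast
    show ?thesis
    proof (cases "j \<in> S")
      case False
      then have "{\<omega> \<in> space M. (P \<omega> \<inter> B j \<noteq> {}) = (j \<in> S)}
        = space M - {\<omega> \<in> space M. P \<omega> \<inter> B j \<noteq> {}}"
        by auto
      then show ?thesis using occ by auto
    qed (use occ in simp)
  qed
  then show ?thesis
    unfolding eq using assms(1) by (rule sets.sets_Collect_finite_All)
qed

lemma occupation_sum:
  fixes B :: "'j \<Rightarrow> 'a set" and g :: "'j set \<Rightarrow> real"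
  assumes "finite J" "\<omega> \<in> space M"
  shows "g {j \<in> J. P \<omega> \<inter> B j \<noteq> {}} =
    (\<Sum>S\<in>Pow J. g S * indicator {\<omega> \<in> space M. {j \<in> J. P \<omega> \<inter> B j \<noteq> {}} = S} \<omega>)"
proof -
  let ?T = "\<lambda>\<omega>. {j \<in> J. P \<omega> \<inter> B j \<noteq> {}}"
  have "(\<Sum>S\<in>Pow J. g S * indicator {\<omega> \<in> space M. ?T \<omega> = S} \<omega>)
    = (\<Sum>S\<in>Pow J. if S = ?T \<omega> then g S else 0)"
    using assms(2) by (intro sum.cong) (auto simp: indicator_def)
  then show ?thesis using assms(1) by (simp add: sum.delta)
qed

lemma occupation_measurable:
  fixes B :: "'j \<Rightarrow> 'a set" and g :: "'j set \<Rightarrow> real"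
  assumes "finite J" "\<And>j. j \<in> J \<Longrightarrow> B j \<in> sets borel \<and> bounded (B j)"
  shows "(\<lambda>\<omega>. g {j \<in> J. P \<omega> \<inter> B j \<noteq> {}}) \<in> borel_measurable M"
proof -
  have "(\<lambda>\<omega>. \<Sum>S\<in>Pow J. g S * indicator {\<omega> \<in> space M. {j \<in> J. P \<omega> \<inter> B j \<noteq> {}} = S} \<omega>) \<in>
    borel_measurable M"
    using occupation_event[OF assms]
    by (intro borel_measurable_sum borel_measurable_times borel_measurable_indicator) auto
  then show ?thesis
    by (subst measurable_cong[OF occupation_sum[OF assms(1)]]) auto
qed

text \<open>Counts in disjoint sets are independent and each set is empty with probability
  \<open>1 - p\<close>, so the occupied indices form a Bernoulli(\<open>p\<close>) random subset of
  \<open>J\<close>. This links the Poisson process to \<open>Bexp\<close>.\<close>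

lemma occupation_law:
  fixes B :: "'j \<Rightarrow> 'a set"
  assumes "finite J" "\<And>j. j \<in> J \<Longrightarrow> B j \<in> sets borel \<and> bounded (B j)" "disjoint_family_on B J"
    and vol: "\<And>j. j \<in> J \<Longrightarrow> exp (- (lam * measure lborel (B j))) = 1 - p"
    and S: "S \<subseteq> J"
  shows "prob {\<omega> \<in> space M. {j \<in> J. P \<omega> \<inter> B j \<noteq> {}} = S} = p ^ card S * (1 - p) ^ card (J - S)"
proof -
  have occ: "{\<omega> \<in> space M. P \<omega> \<inter> B j \<noteq> {}} \<in> sets M" if "j \<in> J" for j
    using occupied_measurable assms(2)[OF that] by blast
  have eq: "{\<omega> \<in> space M. {j \<in> J. P \<omega> \<inter> B j \<noteq> {}} = S} =
      {\<omega> \<in> space M. \<forall>j\<in>J. (P \<omega> \<inter> B j \<noteq> {}) = (j \<in> S)}"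
    using S by auto
  \<comment> \<open>The enumeration is needed because \<open>counts_indep\<close> speaks of families
    indexed by an initial segment of the naturals.\<close>
  obtain e where e: "bij_betw e {..<card J} J"
    using ex_bij_betw_nat_finite[OF assms(1)] by (auto simp: atLeast0LessThan)
  have eJ: "e i \<in> J" if "i < card J" for i using e that by (auto simp: bij_betw_def)
  have ind: "indep_vars (\<lambda>_. count_space UNIV) (\<lambda>i \<omega>. card (P \<omega> \<inter> B (e i))) {..<card J}"
  proof (rule counts_indep)
    show "B (e i) \<in> sets borel \<and> bounded (B (e i))" if "i < card J" for i
      using assms(2)[OF eJ[OF that]] .
    show "disjoint_family_on (\<lambda>i. B (e i)) {..<card J}"
      using assms(3) e by (auto simp: disjoint_family_on_def bij_betw_def inj_on_def) blast
  qed
  let ?A = "\<lambda>i. if e i \<in> S then - {0} else {0} :: nat set"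
  let ?X = "\<lambda>i \<omega>. card (P \<omega> \<inter> B (e i))"
  have X: "?X i -` ?A i \<inter> space M = {\<omega> \<in> space M. (P \<omega> \<inter> B (e i) \<noteq> {}) = (e i \<in> S)}" if "i < card J"
    for i
    using locally_finite[of _ "B (e i)"] assms(2)[OF eJ[OF that]] by (auto simp: card_eq_0_iff)
  have pr: "prob (?X i -` ?A i \<inter> space M) = (if e i \<in> S then p else 1 - p)" if i: "i < card J" for i
  proof -
    have b: "B (e i) \<in> sets borel" "bounded (B (e i))" using assms(2)[OF eJ[OF i]] by auto
    have z: "prob {\<omega> \<in> space M. P \<omega> \<inter> B (e i) = {}} = 1 - p"
    proof -
      have "{\<omega> \<in> space M. P \<omega> \<inter> B (e i) = {}} = {\<omega> \<in> space M. card (P \<omega> \<inter> B (e i)) = 0}"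
        using locally_finite[OF _ b(2)] by (auto simp: card_eq_0_iff)
      then show ?thesis
        using count_poisson[OF b, of 0] vol[OF eJ[OF i]] by simp
    qed
    show ?thesis
    proof (cases "e i \<in> S")
      case False
      then show ?thesis using z unfolding X[OF i] by simp
    next
      case True
      have "prob (space M - {\<omega> \<in> space M. P \<omega> \<inter> B (e i) \<noteq> {}})
        = 1 - prob {\<omega> \<in> space M. P \<omega> \<inter> B (e i) \<noteq> {}}"
        by (rule prob_compl[OF occ[OF eJ[OF i]]])
      moreover have "space M - {\<omega> \<in> space M. P \<omega> \<inter> B (e i) \<noteq> {}}
        = {\<omega> \<in> space M. P \<omega> \<inter> B (e i) = {}}" by auto
      ultimately show ?thesis using z True unfolding X[OF i] by simp
    qed
  qed
  show "prob {\<omega> \<in> space M. {j \<in> J. P \<omega> \<inter> B j \<noteq> {}} = S} = p ^ card S * (1 - p) ^ card (J - S)"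
  proof (cases "J = {}")
    case True
    then show ?thesis using S by (simp add: prob_space)
  next
    case False
    have ne: "{..<card J} \<noteq> {}" using False assms(1) by (simp add: lessThan_empty_iff card_eq_0_iff)
    have "{\<omega> \<in> space M. {j \<in> J. P \<omega> \<inter> B j \<noteq> {}} = S} = (\<Inter>i\<in>{..<card J}. ?X i -` ?A i \<inter> space M)"
    proof -
      have im: "e ` {..<card J} = J" using e by (simp add: bij_betw_def)
      have "(\<forall>j\<in>J. Z j) \<longleftrightarrow> (\<forall>i<card J. Z (e i))" for Z
      proof
        assume Z: "\<forall>i<card J. Z (e i)"
        show "\<forall>j\<in>J. Z j"
        proof
          fix j assume "j \<in> J"
          then have "j \<in> e ` {..<card J}" by (simp only: im)
          then show "Z j" using Z by auto
        qed
      qed (use eJ in blast)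
      then show ?thesis unfolding eq using ne X by auto
    qed
    then have "prob {\<omega> \<in> space M. {j \<in> J. P \<omega> \<inter> B j \<noteq> {}} = S}
      = (\<Prod>i<card J. prob (?X i -` ?A i \<inter> space M))"
      using indep_varsD[OF ind ne, of ?A] by simp
    also have "\<dots> = (\<Prod>i<card J. if e i \<in> S then p else 1 - p)"
      by (rule prod.cong) (simp_all add: pr)
    also have "\<dots> = (\<Prod>j\<in>J. if j \<in> S then p else 1 - p)"
      by (rule prod.reindex_bij_betw[OF e])
    also have "\<dots> = p ^ card S * (1 - p) ^ card (J - S)"
    proof -
      have "J \<inter> S = S" "J \<inter> - S = J - S" using S by auto
      then show ?thesis using assms(1) by (simp add: prod.If_cases)
    qed
    finally show ?thesis .
  qed
qed

lemma occupation_expectation: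
  fixes B :: "'j \<Rightarrow> 'a set" and g :: "'j set \<Rightarrow> real"
  assumes "finite J" "\<And>j. j \<in> J \<Longrightarrow> B j \<in> sets borel \<and> bounded (B j)" "disjoint_family_on B J"
    and "\<And>j. j \<in> J \<Longrightarrow> exp (- (lam * measure lborel (B j))) = 1 - p"
  shows "expectation (\<lambda>\<omega>. g {j \<in> J. P \<omega> \<inter> B j \<noteq> {}}) = Bexp J p g"
proof -
  let ?T = "\<lambda>\<omega>. {j \<in> J. P \<omega> \<inter> B j \<noteq> {}}"
  let ?E = "\<lambda>S. {\<omega> \<in> space M. ?T \<omega> = S}"
  note ev = occupation_event[OF assms(1,2)]
  have "expectation (\<lambda>\<omega>. g (?T \<omega>)) = expectation (\<lambda>\<omega>. \<Sum>S\<in>Pow J. g S * indicator (?E S) \<omega>)"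
    by (rule Bochner_Integration.integral_cong) (use occupation_sum[OF assms(1)] in auto)
  also have "\<dots> = (\<Sum>S\<in>Pow J. expectation (\<lambda>\<omega>. g S * indicator (?E S) \<omega>))"
    by (rule Bochner_Integration.integral_sum)
      (use ev in \<open>auto intro!: integrable_mult_right integrable_real_indicator simp: less_top[symmetric]\<close>)
  also have "\<dots> = (\<Sum>S\<in>Pow J. g S * prob (?E S))"
    by (intro sum.cong) (auto simp: ev)
  also have "\<dots> = Bexp J p g"
    unfolding Bexp_def by (intro sum.cong) (auto simp: occupation_law[OF assms])
  finally show "expectation (\<lambda>\<omega>. g (?T \<omega>)) = Bexp J p g" .
qed

text \<open>The number of points will dominate the tree lengths, so its second moment justifies the
  convergence of their means and variances.\<close>

lemma count_square_integrable:
  assumes A: "A \<in> sets borel" "bounded A" and lam: "0 \<le> lam"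
  shows "integrable M (\<lambda>\<omega>. (real (card (P \<omega> \<inter> A)))\<^sup>2)"
proof -
  let ?X = "\<lambda>\<omega>. card (P \<omega> \<inter> A)" and ?E = "\<lambda>k. {\<omega> \<in> space M. card (P \<omega> \<inter> A) = k}"
  define r where "r = lam * measure lborel A"
  have r0: "0 \<le> r" using lam by (simp add: r_def)
  have meas: "?X \<in> measurable M (count_space UNIV)" by (rule count_measurable[OF A])
  have E: "?E k \<in> sets M" for k
    using measurable_sets[OF meas, of "{k}"] by (simp add: vimage_def Int_def conj_commute)
  have m: "(\<lambda>\<omega>. (real (?X \<omega>))\<^sup>2) \<in> borel_measurable M"
    using meas by measurable
  have "(\<integral>\<^sup>+\<omega>. ennreal ((real (?X \<omega>))\<^sup>2) \<partial>M)
    = (\<integral>\<^sup>+\<omega>. (\<Sum>k. ennreal ((real k)\<^sup>2) * indicator (?E k) \<omega>) \<partial>M)"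
  proof (rule nn_integral_cong)
    fix \<omega> assume w: "\<omega> \<in> space M"
    have "(\<lambda>k. ennreal ((real k)\<^sup>2) * indicator (?E k) \<omega>)
      = (\<lambda>k. if k = ?X \<omega> then ennreal ((real k)\<^sup>2) else 0)"
      using w by (auto simp: fun_eq_iff indicator_def)
    then show "ennreal ((real (?X \<omega>))\<^sup>2) = (\<Sum>k. ennreal ((real k)\<^sup>2) * indicator (?E k) \<omega>)"
      by (simp add: sums_unique[OF sums_single, symmetric])
  qed
  also have "\<dots> = (\<Sum>k. \<integral>\<^sup>+\<omega>. ennreal ((real k)\<^sup>2) * indicator (?E k) \<omega> \<partial>M)"
    by (rule nn_integral_suminf) (use E in measurable)
  also have "\<dots> = (\<Sum>k. ennreal ((real k)\<^sup>2 * (r ^ k / fact k * exp (- r))))"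
  proof (rule suminf_cong)
    fix k
    have "(\<integral>\<^sup>+\<omega>. ennreal ((real k)\<^sup>2) * indicator (?E k) \<omega> \<partial>M)
      = ennreal ((real k)\<^sup>2) * emeasure M (?E k)"
      by (rule nn_integral_cmult_indicator[OF E])
    also have "\<dots> = ennreal ((real k)\<^sup>2 * (r ^ k / fact k * exp (- r)))"
      unfolding emeasure_eq_measure count_poisson[OF A] r_def[symmetric]
      by (subst ennreal_mult) (use r0 in auto)
    finally show "(\<integral>\<^sup>+\<omega>. ennreal ((real k)\<^sup>2) * indicator (?E k) \<omega> \<partial>M)
      = ennreal ((real k)\<^sup>2 * (r ^ k / fact k * exp (- r)))" .
  qed
  also have "\<dots> < \<infinity>"
  proof -
    have "summable (\<lambda>k. 2 * exp (- r) * (inverse (fact k) * (exp 1 * r) ^ k))"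
      by (intro summable_mult summable_exp)
    then have "summable (\<lambda>k. (real k)\<^sup>2 * (r ^ k / fact k * exp (- r)))"
    proof (rule summable_comparison_test'[where N = 0])
      fix k :: nat
      have "(real k)\<^sup>2 \<le> 2 * exp (real k)"
        using exp_lower_Taylor_quadratic[of "real k"] by simp
      moreover have "exp (real k) = exp 1 ^ k" by (simp flip: exp_of_nat_mult)
      ultimately have "(real k)\<^sup>2 * (r ^ k / fact k * exp (- r))
        \<le> 2 * exp 1 ^ k * (r ^ k / fact k * exp (- r))"
        using r0 by (intro mult_right_mono) auto
      also have "\<dots> = 2 * exp (- r) * (inverse (fact k) * (exp 1 * r) ^ k)"
        by (simp add: power_mult_distrib field_simps)
      finally show "norm ((real k)\<^sup>2 * (r ^ k / fact k * exp (- r)))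
        \<le> 2 * exp (- r) * (inverse (fact k) * (exp 1 * r) ^ k)"
        using r0 by simp
    qed
    then have "(\<Sum>k. ennreal ((real k)\<^sup>2 * (r ^ k / fact k * exp (- r)))) \<noteq> top"
      by (rule ennreal_suminf_neq_top) (use r0 in auto)
    then show ?thesis by (simp add: less_top)
  qed
  finally show ?thesis
    by (intro integrableI_bounded m) simp
qed

lemma null_set_empty:
  assumes "A \<in> sets borel" "bounded A" "measure lborel A = 0"
  shows "AE \<omega> in M. P \<omega> \<inter> A = {}"
proof -
  have "prob {\<omega> \<in> space M. card (P \<omega> \<inter> A) = 0} = 1"
    unfolding count_poisson[OF assms(1,2)] assms(3) by simp
  then have "AE \<omega> in M. \<omega> \<in> {\<omega> \<in> space M. card (P \<omega> \<inter> A) = 0}" by (rule AE_prob_1)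
  then show ?thesis
    by eventually_elim (use locally_finite[OF _ assms(2)] in \<open>auto simp: card_eq_0_iff\<close>)
qed

end

section \<open>Passage to the continuum\<close>

lemma frac_bounded:
  assumes "0 \<le> z" "z \<le> real N - 1"
  shows "nat \<lfloor>z\<rfloor> < N"
  using assms by linarith

text \<open>Only counts are assumed measurable. The length is a pointwise limit of functions of the
  set of occupied cells, and each of these depends on finitely many counts.\<close>

lemma (in homogeneous_poisson_process) mst_window_measurable:
  fixes Q :: "'w \<Rightarrow> (real ^ 'd) set"
  assumes "homogeneous_poisson_process M lam Q" and n: "n \<ge> 1"
  shows "(\<lambda>\<omega>. mst_length (Q \<omega> \<inter> window n)) \<in> borel_measurable M"
proof -
  interpret Q: homogeneous_poisson_process M lam Q by fact
  let ?a = "\<lambda>m. real n / real (Suc m)" and ?c = "- (real n / 2)"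
  \<comment> \<open>A coordinate equal to \<open>n / 2\<close> has index \<open>m + 1\<close>, hence
    \<open>m + 2\<close> indices. The outermost cells stick out and are cut with the window
    below.\<close>
  let ?J = "\<lambda>m. grid (m + 2) :: ('d \<Rightarrow> nat) set"
  let ?T = "\<lambda>m \<omega>. {j \<in> ?J m. Q \<omega> \<inter> (window n \<inter> cell ?c (?a m) j) \<noteq> {}}"
  show ?thesis
  proof (rule borel_measurable_LIMSEQ_real)
    show "(\<lambda>\<omega>. mst_length (pt (?a m) ` ?T m \<omega> :: (real ^ 'd) set)) \<in> borel_measurable M" for m
      by (rule Q.occupation_measurable[OF finite_grid])
        (auto simp: window_borel[OF n] cell_borel intro: bounded_subset[OF window_borel(2)[OF n]])
    fix \<omega> assume w: "\<omega> \<in> space M"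
    let ?V = "Q \<omega> \<inter> window n"
    show "(\<lambda>m. mst_length (pt (?a m) ` ?T m \<omega> :: (real ^ 'd) set)) \<longlonglongrightarrow> mst_length ?V"
    proof (rule mst_discretisation_tendsto)
      show "finite ?V" by (rule Q.locally_finite[OF w window_borel(2)[OF n]])
      show low: "?c \<le> y $ i" if "y \<in> ?V" for y i using that by (simp add: mem_window[OF n])
      show "?a \<longlonglongrightarrow> 0" using LIMSEQ_Suc[OF lim_const_over_n[of "real n"]] by simp
      show a0: "0 < ?a m" for m using n by simp
      show "\<forall>\<^sub>F m in sequentially. ?T m \<omega> = cell_index ?c (?a m) ` ?V"
      proof (rule always_eventually, rule allI)
        fix m
        have "?T m \<omega> = {j \<in> ?J m. ?V \<inter> cell ?c (?a m) j \<noteq> {}}" by auto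
        also have "\<dots> = cell_index ?c (?a m) ` ?V"
        proof (rule occupied_cells[OF a0 low])
          show "cell_index ?c (?a m) ` ?V \<subseteq> ?J m"
          proof
            fix j assume "j \<in> cell_index ?c (?a m) ` ?V"
            then obtain y where y: "y \<in> ?V" "j = cell_index ?c (?a m) y" by auto
            have "j i < m + 2" for i
            proof -
              have "(y $ i - ?c) / ?a m \<le> real n / ?a m"
                using y(1) a0[of m] by (intro divide_right_mono)
                  (auto simp: mem_window[OF n] dest: spec[of _ i])
              also have "\<dots> = real (m + 2) - 1" using n by simp
              finally show ?thesis
                unfolding y(2) cell_index_def using low[OF y(1), of i] a0[of m]
                  by (intro frac_bounded) auto
            qed
            then show "j \<in> ?J m" by (simp add: grid_def)
          qed
        qed
        finally show "?T m \<omega> = cell_index ?c (?a m) ` ?V" .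
      qed
    qed
  qed
qed

text \<open>The upper faces of the window are null sets. Points on them would be missed at every
  mesh by half-open cells that lie inside the window.\<close>

lemma AE_window_interior:
  fixes Q :: "'w \<Rightarrow> (real ^ 'd) set"
  assumes "homogeneous_poisson_process M lam Q" and n: "n \<ge> 1"
  shows "AE \<omega> in M. \<forall>y\<in>Q \<omega> \<inter> window n. \<forall>i. y $ i < real n / 2"
proof -
  interpret Q: homogeneous_poisson_process M lam Q by fact
  let ?F = "\<lambda>i. cbox (\<chi> j. if j = i then real n / 2 else - (real n / 2)) (\<chi> j. real n / 2) ::
    (real ^ 'd) set"
  have "AE \<omega> in M. Q \<omega> \<inter> ?F i = {}" for i
  proof (rule Q.null_set_empty)
    have ne: "?F i \<noteq> {}" by (auto simp: interval_ne_empty_cart)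
    show "measure lborel (?F i) = 0"
      unfolding content_cbox_cart[OF ne] by (rule prod_zero) (auto intro: bexI[of _ i])
  qed auto
  then have "AE \<omega> in M. \<forall>i\<in>UNIV. Q \<omega> \<inter> ?F i = {}"
    by (intro AE_finite_allI) auto
  then show ?thesis
  proof eventually_elim
    case (elim \<omega>)
    show ?case
    proof (intro ballI allI)
      fix y i assume y: "y \<in> Q \<omega> \<inter> window n"
      then have b: "\<And>j. - (real n / 2) \<le> y $ j \<and> y $ j \<le> real n / 2" by (simp add: mem_window[OF n])
      show "y $ i < real n / 2"
      proof (rule ccontr)
        assume "\<not> y $ i < real n / 2"
        with b[of i] have "y $ i = real n / 2" by linarith
        then have "y \<in> ?F i" using b by (auto simp: mem_box_cart)
        then show False using elim y by blast
      qed
    qed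
  qed
qed

section \<open>Limits of distribution functions and the choice of the mesh\<close>

definition ramp :: "real \<Rightarrow> real \<Rightarrow> real \<Rightarrow> real" where
  "ramp t \<delta> w = max 0 (min 1 ((t + \<delta> - w) / \<delta>))"

lemma ramp_bounds:
  assumes "0 < \<delta>"
  shows "of_bool (w \<le> t) \<le> ramp t \<delta> w" "ramp t \<delta> w \<le> of_bool (w \<le> t + \<delta>)" "0 \<le> ramp t \<delta> w"
    "ramp t \<delta> w \<le> 1"
proof -
  show "of_bool (w \<le> t) \<le> ramp t \<delta> w"
  proof (cases "w \<le> t")
    case True
    then have "1 \<le> (t + \<delta> - w) / \<delta>" using assms by (simp add: field_simps)
    then show ?thesis by (simp add: ramp_def)
  qed (simp add: ramp_def)
  show "ramp t \<delta> w \<le> of_bool (w \<le> t + \<delta>)"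
  proof (cases "w \<le> t + \<delta>")
    case False
    then have "(t + \<delta> - w) / \<delta> \<le> 0" using assms by (simp add: field_simps)
    then show ?thesis using False by (simp add: ramp_def)
  qed (simp add: ramp_def)
qed (simp_all add: ramp_def)

text \<open>Almost sure convergence passes to expectations of continuous ramps, which lie between
  indicators with thresholds \<open>\<delta>\<close> apart; the Lipschitz continuity of
  \<open>Phi\<close> then allows \<open>\<delta>\<close> to tend to 0.\<close>

lemma (in prob_space) cdf_bound_limit:
  fixes W :: "'a \<Rightarrow> real" and Wm :: "nat \<Rightarrow> 'a \<Rightarrow> real"
  assumes [measurable]: "W \<in> borel_measurable M" "\<And>m. Wm m \<in> borel_measurable M"
    and lim: "AE \<omega> in M. (\<lambda>m. Wm m \<omega>) \<longlonglongrightarrow> W \<omega>"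
    and b: "\<And>m t. \<bar>expectation (\<lambda>\<omega>. of_bool (Wm m \<omega> \<le> t)) - Phi t\<bar> \<le> b"
  shows "\<bar>expectation (\<lambda>\<omega>. of_bool (W \<omega> \<le> t)) - Phi t\<bar> \<le> b"
proof -
  have int: "integrable M (\<lambda>\<omega>. f \<omega> :: real)" if "f \<in> borel_measurable M" "\<And>\<omega>. 0 \<le> f \<omega> \<and> f \<omega> \<le> 1"
    for f
    using that by (intro integrable_const_bound[of _ 1]) auto
  have [measurable]: "ramp t \<delta> \<in> borel_measurable borel" for t \<delta>
    unfolding ramp_def by measurable
  have conv: "(\<lambda>m. expectation (\<lambda>\<omega>. ramp t \<delta> (Wm m \<omega>))) \<longlonglongrightarrow> expectation (\<lambda>\<omega>. ramp t \<delta> (W \<omega>))"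
    if "0 < \<delta>" for t \<delta>
  proof (rule integral_dominated_convergence[where w = "\<lambda>_. 1"])
    show "AE \<omega> in M. (\<lambda>m. ramp t \<delta> (Wm m \<omega>)) \<longlonglongrightarrow> ramp t \<delta> (W \<omega>)"
      using lim by eventually_elim (unfold ramp_def, intro tendsto_intros, use that in auto)
    show "AE \<omega> in M. norm (ramp t \<delta> (Wm m \<omega>)) \<le> 1" for m
      using ramp_bounds[OF that] by (intro AE_I2) auto
  qed auto
  have up: "expectation (\<lambda>\<omega>. of_bool (W \<omega> \<le> t)) \<le> Phi t + b + \<delta>" if d: "0 < \<delta>" for \<delta>
  proof -
    have "expectation (\<lambda>\<omega>. of_bool (W \<omega> \<le> t)) \<le> expectation (\<lambda>\<omega>. ramp t \<delta> (W \<omega>))"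
      using ramp_bounds[OF d] by (intro integral_mono int) auto
    also have "\<dots> \<le> Phi (t + \<delta>) + b"
    proof (rule LIMSEQ_le_const2[OF conv[OF d]], intro exI[of _ 0] allI impI)
      fix m
      have "expectation (\<lambda>\<omega>. ramp t \<delta> (Wm m \<omega>)) \<le> expectation (\<lambda>\<omega>. of_bool (Wm m \<omega> \<le> t + \<delta>))"
        using ramp_bounds[OF d] by (intro integral_mono int) auto
      also have "\<dots> \<le> Phi (t + \<delta>) + b" using b[of m "t + \<delta>"] by (simp add: abs_le_iff)
      finally show "expectation (\<lambda>\<omega>. ramp t \<delta> (Wm m \<omega>)) \<le> Phi (t + \<delta>) + b" .
    qed
    finally show ?thesis using Phi_lipschitz[of t "t + \<delta>"] d by simp
  qed
  have low: "Phi t - b - \<delta> \<le> expectation (\<lambda>\<omega>. of_bool (W \<omega> \<le> t))" if d: "0 < \<delta>" for \<delta>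
  proof -
    have "Phi (t - \<delta>) - b \<le> expectation (\<lambda>\<omega>. ramp (t - \<delta>) \<delta> (W \<omega>))"
    proof (rule LIMSEQ_le_const[OF conv[OF d]], intro exI[of _ 0] allI impI)
      fix m
      have "Phi (t - \<delta>) - b \<le> expectation (\<lambda>\<omega>. of_bool (Wm m \<omega> \<le> t - \<delta>))"
        using b[of m "t - \<delta>"] by (simp add: abs_le_iff)
      also have "\<dots> \<le> expectation (\<lambda>\<omega>. ramp (t - \<delta>) \<delta> (Wm m \<omega>))"
        using ramp_bounds[OF d] by (intro integral_mono int) auto
      finally show "Phi (t - \<delta>) - b \<le> expectation (\<lambda>\<omega>. ramp (t - \<delta>) \<delta> (Wm m \<omega>))" .
    qed
    also have "\<dots> \<le> expectation (\<lambda>\<omega>. of_bool (W \<omega> \<le> t))"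
      using ramp_bounds[OF d, where t = "t - \<delta>"] by (intro integral_mono int) auto
    finally show ?thesis using Phi_lipschitz[of "t - \<delta>" t] d by simp
  qed
  have "expectation (\<lambda>\<omega>. of_bool (W \<omega> \<le> t)) \<le> Phi t + b"
    by (rule field_le_epsilon) (use up in auto)
  moreover have "Phi t - b \<le> expectation (\<lambda>\<omega>. of_bool (W \<omega> \<le> t))"
    by (rule field_le_epsilon) (use low in \<open>force simp: algebra_simps\<close>)
  ultimately show ?thesis by (simp add: abs_le_iff)
qed

text \<open>A cell of side \<open>a\<close> is occupied with probability exactly \<open>p\<close> at
  intensity \<open>lam\<close>. Since \<open>- ln (1 - p)\<close> lies between \<open>p\<close> and
  \<open>2 * p\<close>, the normalised side \<open>a * root D lam\<close> is comparable with
  \<open>h\<close>.\<close>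

lemma mesh_bounds:
  fixes h p lam :: real and D :: nat
  assumes D: "1 \<le> D" and h: "0 < h" and lam: "0 < lam" and b: "1 \<le> b"
    and p: "h ^ D \<le> p" "p \<le> b ^ D * h ^ D" "p \<le> 1 / 2"
  defines "a \<equiv> root D (- ln (1 - p) / lam)"
  shows "0 < a" "exp (- (lam * a ^ D)) = 1 - p" "h \<le> a * root D lam" "a * root D lam \<le> 2 * b * h"
proof -
  have p0: "0 < p" using p(1) h zero_less_power[OF h, of D] by linarith
  have l1: "p \<le> - ln (1 - p)"
    using ln_add_one_self_le_self2[of "- p"] p(3) by simp
  have l2: "- ln (1 - p) \<le> 2 * p"
  proof -
    have "1 / (1 - p) \<le> 1 + 2 * p" using p0 p(3) by (simp add: field_simps)
    then have "ln (1 / (1 - p)) \<le> ln (1 + 2 * p)" using p(3) by (intro ln_mono) auto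
    also have "\<dots> \<le> 2 * p" using p0 by (intro ln_add_one_self_le_self) auto
    finally show ?thesis using p(3) by (simp add: ln_div)
  qed
  have pos: "0 < - ln (1 - p) / lam" using l1 p0 lam by (intro divide_pos_pos) auto
  show a0: "0 < a" unfolding a_def using pos D by (simp add: real_root_gt_zero)
  have aD: "lam * a ^ D = - ln (1 - p)"
    unfolding a_def using pos D lam by (simp add: real_root_pow_pos2)
  show "exp (- (lam * a ^ D)) = 1 - p" unfolding aD using p(3) by simp
  have r: "a * root D lam = root D (- ln (1 - p))"
    unfolding a_def using lam by (simp flip: real_root_mult)
  have "root D (h ^ D) \<le> root D (- ln (1 - p))" using D p(1) l1 by (intro real_root_le_mono) auto
  then show "h \<le> a * root D lam" unfolding r using h D by (simp add: real_root_power_cancel)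
  have "- ln (1 - p) \<le> (2 * b * h) ^ D"
  proof -
    have "2 * p \<le> 2 ^ D * (b ^ D * h ^ D)"
      using p(2) p0 self_le_power[of 2 D] D by (intro mult_mono) auto
    then show ?thesis using l2 by (simp add: power_mult_distrib)
  qed
  then have "root D (- ln (1 - p)) \<le> root D ((2 * b * h) ^ D)" using D
    by (intro real_root_le_mono) auto
  then show "a * root D lam \<le> 2 * b * h" unfolding r using h b D
    by (simp add: real_root_power_cancel)
qed

text \<open>For every \<open>m\<close> the lattice result brings its own density, and the cell side
  \<open>a m\<close> adapts the mesh to it. The discretised length then has the law of the lattice
  functional times \<open>a m / h m\<close>, a factor that standardisation removes; finally
  \<open>m\<close> tends to infinity.\<close>

lemma mst_window_clt:
  fixes M :: "'w measure" and P :: "'w \<Rightarrow> (real ^ 'd) set"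
  assumes poisson: "homogeneous_poisson_process M lam P" and lam: "0 < lam" and dim: "2 \<le> CARD('d)"
    and n: "n \<ge> 1" and xn: "x ^ 128 = real n * root CARD('d) lam"
    and x: "x_min CARD('d) (pack TYPE('d)) \<le> x"
  defines "F \<equiv> \<lambda>\<omega>. mst_length (P \<omega> \<inter> window n)"
  shows "\<bar>prob_space.expectation M (\<lambda>\<omega>. of_bool ((F \<omega> - prob_space.expectation M F) /
      sqrt (prob_space.variance M F) \<le> t)) - Phi t\<bar> \<le> 10 * CC CARD('d) (pack TYPE('d)) / x"
proof -
  interpret homogeneous_poisson_process M lam P by fact
  let ?D = "CARD('d)" and ?c = "- (real n / 2)"
  define \<kappa> where "\<kappa> = 10 * CC CARD('d) (pack TYPE('d)) / x"
  define r where "r = root ?D lam"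
  define k where "k = nat \<lfloor>x ^ 120\<rfloor>"
  have D1: "1 \<le> ?D" using dim by simp
  have b: "12 \<le> bet ?D" by (rule bet_ge)
  have r0: "0 < r" unfolding r_def using lam by (simp add: real_root_gt_zero)
  have x1: "1 \<le> x" using x by (simp add: x_min_def)
  have k: "0 < k"
  proof -
    have "1 \<le> x ^ 120" by (rule one_le_power[OF x1])
    then show ?thesis by (simp add: k_def)
  qed
  obtain L0 where L0: "6 * bet ?D * x ^ 128 \<le> real L0"
    using real_arch_simple by blast
  define L where "L m = L0 + m + 1" for m
  define h where "h m = x ^ 128 / (real k * real (L m))" for m
  have L_pos: "0 < L m" for m by (simp add: L_def)
  have kL_big: "6 * bet ?D * x ^ 128 \<le> real k * real (L m)" for m
  proof -
    have "real L0 \<le> 1 * real (L m)" by (simp add: L_def)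
    also have "\<dots> \<le> real k * real (L m)" using k by (intro mult_right_mono) auto
    finally show ?thesis using L0 by linarith
  qed
  have kL_pos: "0 < real k * real (L m)" for m using k L_pos by simp
  have h0: "0 < h m" for m unfolding h_def using kL_pos x1 by (intro divide_pos_pos) auto
  have "\<exists>p. h m ^ ?D \<le> p \<and> p \<le> bet ?D ^ ?D * h m ^ ?D \<and> p \<le> 1 / 2 \<and>
    (\<forall>N. real k * real (L m) \<le> 4 * bet ?D * real N \<and> N \<le> k * L m \<longrightarrow>
      (s0 ?D)\<^sup>2 \<le> Bvar (pt (h m) ` grid N :: (real ^ 'd) set) p mst_length \<and>
      (\<forall>t. \<bar>mst_cdf (pt (h m) ` grid N :: (real ^ 'd) set) p t - Phi t\<bar> \<le> \<kappa>))" for m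
    unfolding h_def k_def \<kappa>_def
    by (rule lattice_clt[OF dim x L_pos]) (use kL_big[unfolded k_def] in auto)
  then obtain p where p: "\<And>m. h m ^ ?D \<le> p m" "\<And>m. p m \<le> bet ?D ^ ?D * h m ^ ?D" "\<And>m. p m \<le> 1 / 2"
    and lat: "\<And>m N. real k * real (L m) \<le> 4 * bet ?D * real N \<Longrightarrow> N \<le> k * L m \<Longrightarrow>
      (s0 ?D)\<^sup>2 \<le> Bvar (pt (h m) ` grid N :: (real ^ 'd) set) (p m) mst_length \<and>
      (\<forall>t. \<bar>mst_cdf (pt (h m) ` grid N :: (real ^ 'd) set) (p m) t - Phi t\<bar> \<le> \<kappa>)"
    by metis
  define a where "a m = root ?D (- ln (1 - p m) / lam)" for m
  have b1: "1 \<le> bet ?D" using b by simp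
  note mesh = mesh_bounds[OF D1 h0 lam b1 p, folded a_def r_def]
  have a0: "0 < a m" for m by (rule mesh(1))
  \<comment> \<open>Rounded down, so that all cells used lie inside the window.\<close>
  define N where "N m = nat \<lfloor>real n / a m\<rfloor>" for m
  have nu: "real n * r = h m * (real k * real (L m))" for m
    using xn k L_pos[of m] by (simp add: h_def r_def)
  \<comment> \<open>Admissibility of the window: counted in cells, it is at most the large cube and
    at least a fixed fraction of it, by the two-sided comparison of \<open>a m\<close> with
    \<open>h m\<close>.\<close>
  have na_up: "real n / a m \<le> real k * real (L m)" for m
  proof -
    have "real n * h m \<le> real n * (a m * r)" using mesh(3)[of m] by (intro mult_left_mono) auto
    also have "\<dots> = h m * ((real k * real (L m)) * a m)" using nu[of m] by (simp add: mult_ac)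
    finally have "h m * real n \<le> h m * ((real k * real (L m)) * a m)" by (simp add: mult_ac)
    then have "real n \<le> (real k * real (L m)) * a m" using h0[of m] by simp
    then show ?thesis using a0[of m] by (simp add: field_simps)
  qed
  have na_low: "real k * real (L m) \<le> 2 * bet ?D * (real n / a m)" for m
  proof -
    have "h m * ((real k * real (L m)) * a m) = real n * (a m * r)" using nu[of m]
      by (simp add: mult_ac)
    also have "\<dots> \<le> real n * (2 * bet ?D * h m)" using mesh(4)[of m] by (intro mult_left_mono) auto
    finally have "h m * ((real k * real (L m)) * a m) \<le> h m * (2 * bet ?D * real n)"
      by (simp add: mult_ac)
    then have "(real k * real (L m)) * a m \<le> 2 * bet ?D * real n" using h0[of m] by simp
    then show ?thesis using a0[of m] by (simp add: field_simps)
  qed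
  have Nle: "real (N m) \<le> real n / a m" for m using a0[of m] by (simp add: N_def)
  have N1: "N m \<le> k * L m" for m
  proof -
    have "real (N m) \<le> real (k * L m)" using Nle[of m] na_up[of m] by simp
    then show ?thesis by (simp only: of_nat_le_iff)
  qed
  have N2: "real k * real (L m) \<le> 4 * bet ?D * real (N m)" for m
  proof -
    have "real n / a m \<le> real (N m) + 1" unfolding N_def by linarith
    then have "2 * bet ?D * (real n / a m) \<le> 2 * bet ?D * (real (N m) + 1)" using b
      by (intro mult_left_mono) auto
    moreover have "4 * bet ?D \<le> real k * real (L m)"
    proof -
      have "4 * bet ?D \<le> 6 * bet ?D * x ^ 128"
        using b one_le_power[OF x1, of 128] mult_mono[of "4 * bet ?D" "6 * bet ?D" 1
          "x ^ 128"] by simp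
      then show ?thesis using kL_big[of m] by linarith
    qed
    ultimately show ?thesis using na_low[of m] by (simp add: algebra_simps)
  qed
  define A where "A m = (pt (h m) ` grid (N m) :: (real ^ 'd) set)" for m
  have varA: "(s0 ?D)\<^sup>2 \<le> Bvar (A m) (p m) mst_length" for m
    using lat[OF N2 N1] by (simp add: A_def)
  have cdfA: "\<bar>mst_cdf (A m) (p m) t - Phi t\<bar> \<le> \<kappa>" for m t
    using lat[OF N2 N1] by (simp add: A_def)
  have a_lim: "a \<longlonglongrightarrow> 0"
  proof (rule tendsto_sandwich[of "\<lambda>_. 0" _ _ "\<lambda>m. 2 * bet ?D / r * h m"])
    show "\<forall>\<^sub>F m in sequentially. a m \<le> 2 * bet ?D / r * h m"
      using mesh(4) r0 by (intro always_eventually allI) (simp add: field_simps)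
    have "(\<lambda>m. x ^ 128 / real k * (1 / real (L0 + 1 + m))) \<longlonglongrightarrow> 0"
      by (intro tendsto_mult_right_zero LIMSEQ_ignore_initial_segment lim_1_over_n)
        (use LIMSEQ_ignore_initial_segment[OF lim_1_over_n, of "L0 + 1"] in \<open>simp add: add.commute\<close>)
    then have "h \<longlonglongrightarrow> 0" by (simp add: h_def[abs_def] L_def add_ac)
    then show "(\<lambda>m. 2 * bet ?D / r * h m) \<longlonglongrightarrow> 0" by (rule tendsto_mult_right_zero)
  qed (use a0 less_imp_le in \<open>auto intro!: always_eventually\<close>)
  let ?C = "\<lambda>m j. cell ?c (a m) j :: (real ^ 'd) set"
  define T where "T m \<omega> = {j \<in> grid (N m). P \<omega> \<inter> ?C m j \<noteq> {}}" for m \<omega>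
  define Fm where "Fm m \<omega> = mst_length (pt (a m) ` T m \<omega> :: (real ^ 'd) set)" for m \<omega>
  have cells: "?C m j \<in> sets borel \<and> bounded (?C m j)" for m j
    using cell_borel cell_bounded by blast
  have vol: "exp (- (lam * measure lborel (?C m j))) = 1 - p m" for m and j :: "'d \<Rightarrow> nat"
    unfolding measure_cell[OF a0] by (rule mesh(2))
  have disj: "disjoint_family_on (?C m) J" for m and J :: "('d \<Rightarrow> nat) set"
    unfolding disjoint_family_on_def by (intro ballI impI disjoint_cells a0)
  have Fm_meas [measurable]: "Fm m \<in> borel_measurable M" for m
    unfolding Fm_def T_def by (rule occupation_measurable[OF finite_grid cells])
  have F_meas [measurable]: "F \<in> borel_measurable M"
    unfolding F_def by (rule mst_window_measurable[OF poisson n])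
  have Fm_exp: "expectation (\<lambda>\<omega>. \<phi> (Fm m \<omega>)) = Bexp (A m) (p m) (\<lambda>S. \<phi> (a m / h m * mst_length S))"
    for \<phi> :: "real \<Rightarrow> real" and m
  proof -
    have "expectation (\<lambda>\<omega>. \<phi> (Fm m \<omega>))
      = Bexp (grid (N m)) (p m) (\<lambda>J. \<phi> (mst_length (pt (a m) ` J :: (real ^ 'd) set)))"
      unfolding Fm_def T_def by (rule occupation_expectation[OF finite_grid cells disj vol])
    also have "\<dots> = Bexp (grid (N m)) (p m)
      (\<lambda>J. \<phi> (a m / h m * mst_length (pt (h m) ` J :: (real ^ 'd) set)))"
    proof (rule Bexp_cong)
      fix J :: "('d \<Rightarrow> nat) set" assume "J \<subseteq> grid (N m)"
      then have "finite J" using finite_grid finite_subset by blast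
      then show "\<phi> (mst_length (pt (a m) ` J :: (real ^ 'd) set))
        = \<phi> (a m / h m * mst_length (pt (h m) ` J :: (real ^ 'd) set))"
        using mst_length_pt_scale[OF _ a0 h0, of J m m] by simp
    qed
    also have "\<dots> = Bexp (A m) (p m) (\<lambda>S. \<phi> (a m / h m * mst_length S))"
      unfolding A_def by (rule Bexp_image[OF inj_on_pt[OF h0], symmetric])
    finally show ?thesis .
  qed
  have cell_window: "y \<in> window n" if "y \<in> ?C m j" "j \<in> grid (N m)" for y m j
  proof -
    have "?c \<le> y $ i \<and> y $ i \<le> real n / 2" for i
    proof -
      have y: "?c + a m * real (j i) \<le> y $ i" "y $ i < ?c + a m * (real (j i) + 1)"
        using that(1) by (simp_all add: cell_def)
      have "real (j i) + 1 \<le> real (N m)" using that(2)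
        by (auto simp: grid_def Suc_le_eq dest: spec[of _ i])
      then have "a m * (real (j i) + 1) \<le> a m * (real n / a m)"
        using Nle[of m] a0[of m] by (intro mult_left_mono) auto
      also have "\<dots> = real n" using a0[of m] by simp
      finally have "a m * (real (j i) + 1) \<le> real n" .
      moreover have "0 \<le> a m * real (j i)" using a0[of m] by simp
      ultimately show ?thesis using y by simp
    qed
    then show ?thesis by (simp add: mem_window[OF n])
  qed
  have T_window: "T m \<omega> = {j \<in> grid (N m). (P \<omega> \<inter> window n) \<inter> ?C m j \<noteq> {}}" for m \<omega>
    unfolding T_def using cell_window by blast
  have conv: "AE \<omega> in M. (\<lambda>m. Fm m \<omega>) \<longlonglongrightarrow> F \<omega>"
    using AE_window_interior[OF poisson n] AE_space
  proof eventually_elim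
    case (elim \<omega>)
    let ?V = "P \<omega> \<inter> window n"
    have fin: "finite ?V" by (rule locally_finite[OF elim(2) window_borel(2)[OF n]])
    have low: "?c \<le> y $ i" if "y \<in> ?V" for y i using that by (simp add: mem_window[OF n])
    show ?case
      unfolding Fm_def F_def
    proof (rule mst_discretisation_tendsto[OF fin low a_lim a0])
      have "\<forall>\<^sub>F m in sequentially. a m < real n / 2 - y $ i" if "y \<in> ?V" for y i
        using elim(1) that by (intro order_tendstoD(2)[OF a_lim]) auto
      then have "\<forall>\<^sub>F m in sequentially. \<forall>y\<in>?V. \<forall>i\<in>UNIV. a m < real n / 2 - y $ i"
        by (intro eventually_ball_finite fin finite ballI) auto
      then show "\<forall>\<^sub>F m in sequentially. T m \<omega> = cell_index ?c (a m) ` ?V"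
      proof eventually_elim
        case (elim m)
        show ?case
          unfolding T_window
        proof (rule occupied_cells[OF a0 low])
          show "cell_index ?c (a m) ` ?V \<subseteq> grid (N m)"
          proof
            fix j assume "j \<in> cell_index ?c (a m) ` ?V"
            then obtain y where y: "y \<in> ?V" "j = cell_index ?c (a m) y" by auto
            have "j i < N m" for i
            proof -
              have "y $ i - ?c + a m \<le> real n" using elim y(1)
                by (auto dest!: bspec[of _ _ y] simp: less_imp_le dest: spec[of _ i])
              then have "(y $ i - ?c + a m) / a m \<le> real n / a m"
                using a0[of m] by (intro divide_right_mono) auto
              then have "(y $ i - ?c) / a m + 1 \<le> real n / a m"
                using a0[of m] by (simp add: add_divide_distrib)
              moreover have "0 \<le> (y $ i - ?c) / a m" using low[OF y(1), of i] a0[of m] by simp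
              ultimately show ?thesis unfolding y(2) cell_index_def N_def by linarith
            qed
            then show "j \<in> grid (N m)" by (simp add: grid_def)
          qed
        qed
      qed
    qed
  qed
  \<comment> \<open>A minimal spanning tree of points at mutual distances at most \<open>?K\<close>
    has length at most \<open>?K\<close> times their number. So \<open>?K * X\<close> dominates all
    discretised lengths at once.\<close>
  define X where "X \<omega> = real (card (P \<omega> \<inter> window n))" for \<omega>
  let ?K = "real ?D * real n"
  have X2: "integrable M (\<lambda>\<omega>. (X \<omega>)\<^sup>2)"
    unfolding X_def by (rule count_square_integrable[OF window_borel[OF n]]) (use lam in simp)
  have X_meas [measurable]: "X \<in> borel_measurable M"
    unfolding X_def using count_measurable[OF window_borel[OF n]] by measurable
  have X1: "integrable M X"
  proof (rule Bochner_Integration.integrable_bound[OF Bochner_Integration.integrable_add[OF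
    integrable_const[of 1] X2]])
    show "AE \<omega> in M. norm (X \<omega>) \<le> norm (1 + (X \<omega>)\<^sup>2)"
    proof (rule AE_I2)
      fix \<omega>
      have "0 \<le> (X \<omega> - 1)\<^sup>2 + (X \<omega>)\<^sup>2 + 1" by simp
      moreover have "0 \<le> X \<omega>" by (simp add: X_def)
      ultimately show "norm (X \<omega>) \<le> norm (1 + (X \<omega>)\<^sup>2)"
        unfolding power2_diff by simp
    qed
  qed simp
  have Fm_dom: "0 \<le> Fm m \<omega> \<and> Fm m \<omega> \<le> ?K * X \<omega>" if w: "\<omega> \<in> space M" for m \<omega>
  proof -
    let ?W = "pt (a m) ` T m \<omega> :: (real ^ 'd) set" and ?V = "P \<omega> \<inter> window n"
    have fin: "finite ?V" by (rule locally_finite[OF w window_borel(2)[OF n]])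
    have low: "?c \<le> y $ i" if "y \<in> ?V" for y i using that by (simp add: mem_window[OF n])
    have "T m \<omega> \<subseteq> cell_index ?c (a m) ` ?V"
    proof
      fix j assume "j \<in> T m \<omega>"
      then obtain y where y: "y \<in> ?V" "y \<in> ?C m j" unfolding T_window by auto
      then have "j = cell_index ?c (a m) y" using mem_cell_iff[OF a0 low[OF y(1)]] by simp
      then show "j \<in> cell_index ?c (a m) ` ?V" using y(1) by blast
    qed
    then have "card (T m \<omega>) \<le> card (cell_index ?c (a m) ` ?V)" using fin by (intro card_mono) auto
    also have "\<dots> \<le> card ?V" by (rule card_image_le[OF fin])
    finally have cT: "card (T m \<omega>) \<le> card ?V" .
    have fT: "finite (T m \<omega>)" unfolding T_def by (rule finite_subset[OF _ finite_grid[of "N m"]])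
      auto
    have bd: "0 \<le> u $ i \<and> u $ i \<le> real n" if "u \<in> ?W" for u i
    proof -
      have "u \<in> pt (a m) ` grid (N m)" using that by (auto simp: T_def)
      from pt_grid_bounds[OF this a0] have "0 \<le> u $ i \<and> u $ i \<le> a m * real (N m)" .
      moreover have "a m * real (N m) \<le> a m * (real n / a m)" using Nle[of m] a0[of m]
        by (intro mult_left_mono) auto
      ultimately show ?thesis using a0[of m] by simp
    qed
    have dist: "dist u v \<le> ?K" if "u \<in> ?W" "v \<in> ?W" for u v
    proof (rule dist_le_l1)
      show "\<bar>u $ i - v $ i\<bar> \<le> real n" for i using bd[OF that(1), of i] bd[OF that(2), of i] by auto
    qed
    have "card ?W \<le> card ?V" using card_image_le[OF fT, of "pt (a m) :: _ \<Rightarrow> real ^ 'd"] cT by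
      linarith
    then have KX: "?K * real (card ?W) \<le> ?K * X \<omega>" unfolding X_def by (intro mult_left_mono) auto
    have fW: "finite ?W" and K0: "0 \<le> ?K" using fT by auto
    show ?thesis
      unfolding Fm_def using mst_length_bounds[OF fW K0 dist] KX by (meson order_trans)
  qed
  have F_dom: "AE \<omega> in M. 0 \<le> F \<omega> \<and> F \<omega> \<le> ?K * X \<omega>"
    using conv AE_space
  proof eventually_elim
    case (elim \<omega>)
    then show ?case
      using LIMSEQ_le_const[OF elim(1), of 0] LIMSEQ_le_const2[OF elim(1), of "?K * X \<omega>"] Fm_dom[OF
        elim(2)] by blast
  qed
  have X1': "integrable M (\<lambda>\<omega>. ?K * X \<omega>)" using X1 by simp
  have X2': "integrable M (\<lambda>\<omega>. (?K * X \<omega>)\<^sup>2)" using X2 by (simp add: power_mult_distrib)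
  have sq: "norm (z\<^sup>2) \<le> y\<^sup>2" if "0 \<le> z \<and> z \<le> y" for z y :: real using that
    by (simp add: power_mono)
  have F1: "integrable M F"
    by (rule Bochner_Integration.integrable_bound[OF X1' F_meas])
      (use F_dom in eventually_elim, auto)
  have F2: "integrable M (\<lambda>\<omega>. (F \<omega>)\<^sup>2)"
    by (rule Bochner_Integration.integrable_bound[OF X2'])
      (simp, use F_dom in eventually_elim, auto intro: power_mono)
  have lim1: "(\<lambda>m. expectation (Fm m)) \<longlonglongrightarrow> expectation F"
    by (rule integral_dominated_convergence[OF F_meas Fm_meas X1' conv])
      (use Fm_dom in \<open>auto intro!: AE_I2\<close>)
  have lim2: "(\<lambda>m. expectation (\<lambda>\<omega>. (Fm m \<omega>)\<^sup>2)) \<longlonglongrightarrow> expectation (\<lambda>\<omega>. (F \<omega>)\<^sup>2)"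
  proof (rule integral_dominated_convergence[OF _ _ X2'])
    show "AE \<omega> in M. (\<lambda>m. (Fm m \<omega>)\<^sup>2) \<longlonglongrightarrow> (F \<omega>)\<^sup>2"
      using conv by eventually_elim (rule tendsto_power)
    show "AE \<omega> in M. norm ((Fm m \<omega>)\<^sup>2) \<le> (?K * X \<omega>)\<^sup>2" for m
      by (rule AE_I2) (rule sq[OF Fm_dom])
  qed simp_all
  define E where "E m = expectation (Fm m)" for m
  define W where "W m = expectation (\<lambda>\<omega>. (Fm m \<omega>)\<^sup>2) - (E m)\<^sup>2" for m
  have finA: "finite (A m)" for m unfolding A_def by (intro finite_imageI finite_grid)
  let ?B = "\<lambda>m. Bvar (A m) (p m) mst_length" and ?e = "\<lambda>m. Bexp (A m) (p m) mst_length"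
    and ?q = "\<lambda>m. a m / h m"
  have q0: "0 < ?q m" for m using a0 h0 by simp
  have E_eq: "E m = ?q m * ?e m" for m
    unfolding E_def using Fm_exp[of "\<lambda>z. z" m] by (simp only: Bexp_cmult)
  have W_eq: "W m = (?q m)\<^sup>2 * ?B m" for m
  proof -
    have "expectation (\<lambda>\<omega>. (Fm m \<omega>)\<^sup>2) = (?q m)\<^sup>2 * Bexp (A m) (p m) (\<lambda>S. (mst_length S)\<^sup>2)"
      unfolding Fm_exp[of "\<lambda>z. z\<^sup>2" m] power_mult_distrib Bexp_cmult ..
    then show ?thesis
      unfolding W_def E_eq Bvar_eq[OF finA]
        by (simp add: power_mult_distrib power_divide right_diff_distrib)
  qed
  have B0: "0 < ?B m" for m using varA[of m] s0_pos[OF D1] by (meson less_le_trans zero_less_power)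
  have cdfm: "\<bar>expectation (\<lambda>\<omega>. of_bool ((Fm m \<omega> - E m) / sqrt (W m) \<le> t)) - Phi t\<bar> \<le> \<kappa>" for m t
  proof -
    have sW: "sqrt (W m) = ?q m * sqrt (?B m)" unfolding W_eq using a0[of m] h0[of m]
      by (simp add: real_sqrt_mult)
    have norm: "(?q m * z - E m) / sqrt (W m) = (z - ?e m) / sqrt (?B m)" for z
      unfolding E_eq sW right_diff_distrib[symmetric] using a0[of m] h0[of m] by simp
    have "expectation (\<lambda>\<omega>. of_bool ((Fm m \<omega> - E m) / sqrt (W m) \<le> t)) = mst_cdf (A m) (p m) t"
      unfolding Fm_exp[of "\<lambda>z. of_bool ((z - E m) / sqrt (W m) \<le> t)" m] norm mst_cdf_def ..
    then show ?thesis using cdfA by simp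
  qed
  have vF: "variance F = expectation (\<lambda>\<omega>. (F \<omega>)\<^sup>2) - (expectation F)\<^sup>2"
    by (rule variance_eq[OF F1 F2])
  have limW: "W \<longlonglongrightarrow> variance F"
    unfolding vF W_def E_def by (intro tendsto_intros lim1 lim2)
  \<comment> \<open>The lattice bound survives the limit because \<open>a m / h m\<close> is at
    least \<open>1 / r\<close>. Positivity of the limit variance is what makes the standardised
    variables converge.\<close>
  have "(s0 ?D / r)\<^sup>2 \<le> variance F"
  proof (rule LIMSEQ_le_const[OF limW], intro exI[of _ 0] allI impI)
    fix m
    have "1 / r \<le> ?q m" using mesh(3)[of m] r0 h0[of m] by (simp add: field_simps)
    then have "(1 / r)\<^sup>2 * (s0 ?D)\<^sup>2 \<le> (?q m)\<^sup>2 * ?B m"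
      using r0 varA[of m] by (intro mult_mono power_mono) auto
    then show "(s0 ?D / r)\<^sup>2 \<le> W m" unfolding W_eq by (simp add: power_divide)
  qed
  then have vpos: "0 < variance F" using s0_pos[OF D1] r0
    by (meson divide_pos_pos less_le_trans zero_less_power)
  show ?thesis
    unfolding \<kappa>_def[symmetric]
  proof (rule cdf_bound_limit)
    show "AE \<omega> in M. (\<lambda>m. (Fm m \<omega> - E m) / sqrt (W m)) \<longlonglongrightarrow> (F \<omega> - expectation F) / sqrt (variance F)"
      using conv
    proof eventually_elim
      case (elim \<omega>)
      show ?case
        using lim1 limW vpos elim by (intro tendsto_intros) (auto simp: E_def[abs_def])
    qed
  qed (use cdfm in auto)
qed

theorem theorem4p4:
  fixes M :: "'w measure" and lam :: real
    and P :: "'w \<Rightarrow> (real ^ 'd) set"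
    and F :: "nat \<Rightarrow> 'w \<Rightarrow> real"
  assumes dim: "CARD('d) \<ge> 2"
    and intensity: "lam > 0"
    and poisson: "homogeneous_poisson_process M lam P"
    and F_def: "\<And>n \<omega>. F n \<omega> = mst_length (P \<omega> \<inter> window n)"
  shows "\<exists>C0 D1 D2 :: real. C0 > 0 \<and> 0 < D1 \<and> D1 < 1 \<and> D2 > 0 \<and>
    (\<forall>n\<ge>1.
      let dK = kolmogorov_distance
                 (distr M borel (\<lambda>\<omega>. (F n \<omega> - prob_space.expectation M (F n)) /
                                       sqrt (prob_space.variance M (F n))))
                 std_normal_distribution
      in (CARD('d) = 2 \<longrightarrow> dK \<le> C0 * real n powr (- D1)) \<and>
         (CARD('d) \<ge> 3 \<and> n \<ge> 2 \<longrightarrow> dK \<le> C0 * ln (real n) powr (- D2)))"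
proof -
  interpret homogeneous_poisson_process M lam P by fact
  let ?D = "CARD('d)"
  define r where "r = root ?D lam"
  define xm where "xm = x_min ?D (pack TYPE('d))"
  \<comment> \<open>The maximum with \<open>xm\<close> makes the bound trivial for
    \<open>x < xm\<close>, where \<open>C / x\<close> exceeds 1.\<close>
  define C where "C = max xm (10 * CC ?D (pack TYPE('d)))"
  define C0 where "C0 = C / r powr (1 / 128)"
  have r0: "0 < r" unfolding r_def using intensity by (simp add: real_root_gt_zero)
  have xm1: "1 \<le> xm" by (simp add: xm_def x_min_def)
  have C1: "1 \<le> C" using xm1 by (simp add: C_def)
  have C0: "0 < C0" unfolding C0_def using C1 r0 by (intro divide_pos_pos) auto
  define dK where "dK n = kolmogorov_distance
                 (distr M borel (\<lambda>\<omega>. (F n \<omega> - expectation (F n)) / sqrt (variance (F n))))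
                 std_normal_distribution" for n
  have main: "dK n \<le> C0 * real n powr (- (1 / 128))" if n: "n \<ge> 1" for n
  proof -
    have Feq: "F n = (\<lambda>\<omega>. mst_length (P \<omega> \<inter> window n))" using F_def by auto
    have F_meas [measurable]: "F n \<in> borel_measurable M"
      unfolding Feq by (rule mst_window_measurable[OF poisson n])
    define W where "W \<omega> = (F n \<omega> - expectation (F n)) / sqrt (variance (F n))" for \<omega>
    have W_meas [measurable]: "W \<in> borel_measurable M" unfolding W_def by measurable
    \<comment> \<open>\<open>x ^ 128\<close> is the side of the window in the units in which the
      intensity is 1.\<close>
    define x where "x = (real n * r) powr (1 / 128)"
    have x0: "0 < x" using n r0 by (simp add: x_def)
    have x128: "x ^ 128 = real n * r"
    proof -
      have "x ^ 128 = x powr real 128" using x0 by (simp add: powr_realpow)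
      also have "\<dots> = real n * r" unfolding x_def powr_powr using n r0 by simp
      finally show ?thesis .
    qed
    have cdfW: "cdf (distr M borel W) t = expectation (\<lambda>\<omega>. of_bool (W \<omega> \<le> t))" for t
    proof -
      have "cdf (distr M borel W) t = prob {\<omega> \<in> space M. W \<omega> \<le> t}"
        unfolding cdf_def by (subst measure_distr) (auto intro!: arg_cong[where f = prob])
      also have "\<dots> = expectation (\<lambda>\<omega>. indicator {\<omega> \<in> space M. W \<omega> \<le> t} \<omega>)" by simp
      also have "\<dots> = expectation (\<lambda>\<omega>. of_bool (W \<omega> \<le> t))"
        by (rule Bochner_Integration.integral_cong) (auto simp: indicator_def)
      finally show ?thesis .
    qed
    have "\<bar>cdf (distr M borel W) t - Phi t\<bar> \<le> C / x" for t
    proof (cases "xm \<le> x")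
      case True
      have "\<bar>cdf (distr M borel W) t - Phi t\<bar> \<le> 10 * CC ?D (pack TYPE('d)) / x"
        unfolding cdfW W_def Feq
        by (rule mst_window_clt[OF poisson intensity dim n])
          (use x128 True in \<open>simp_all add: r_def xm_def\<close>)
      also have "\<dots> \<le> C / x" using x0 by (intro divide_right_mono) (auto simp: C_def)
      finally show ?thesis .
    next
      case False
      interpret W: real_distribution "distr M borel W" by (rule real_distribution_distr) simp
      have "\<bar>cdf (distr M borel W) t - Phi t\<bar> \<le> 1"
        using W.cdf_nonneg[of t] W.cdf_bounded_prob[of t] Phi_nonneg[of t] Phi_le_1[of t]
          by linarith
      also have "1 \<le> C / x" using False x0 by (simp add: C_def)
      finally show ?thesis .
    qed
    then have "dK n \<le> C / x"
      unfolding dK_def kolmogorov_distance_def W_def[symmetric] Phi_def[symmetric]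
      by (intro cSUP_least) (auto simp: Phi_def)
    also have "C / x = C0 * real n powr (- (1 / 128))"
      unfolding x_def C0_def using n r0 by (simp add: powr_mult powr_minus field_simps)
    finally show ?thesis .
  qed
  show ?thesis
  proof (rule exI[of _ C0], rule exI[of _ "1 / 128"], rule exI[of _ "1 / 128"], intro conjI allI
    impI)
    fix n :: nat assume n: "n \<ge> 1"
    have "dK n \<le> C0 * ln (real n) powr (- (1 / 128))" if "2 \<le> n"
    proof -
      have l: "0 < ln (real n)" "ln (real n) \<le> real n"
        using that ln_le_minus_one[of "real n"] by auto
      have "real n powr (- (1 / 128)) \<le> ln (real n) powr (- (1 / 128))"
        using l by (intro powr_mono2') auto
      then have "C0 * real n powr (- (1 / 128)) \<le> C0 * ln (real n) powr (- (1 / 128))"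
        using C0 by (intro mult_left_mono) auto
      then show ?thesis using main[OF n] by linarith
    qed
    then show "let dK = kolmogorov_distance
                 (distr M borel (\<lambda>\<omega>. (F n \<omega> - prob_space.expectation M (F n)) /
                                       sqrt (prob_space.variance M (F n))))
                 std_normal_distribution
      in (CARD('d) = 2 \<longrightarrow> dK \<le> C0 * real n powr (- (1 / 128))) \<and>
         (CARD('d) \<ge> 3 \<and> n \<ge> 2 \<longrightarrow> dK \<le> C0 * ln (real n) powr (- (1 / 128)))"
      unfolding dK_def[symmetric] Let_def using main[OF n] by blast
  qed (use C0 in auto)
qed

end
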